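(* Let $\mu\ge 0$ be real, $\beta>0$, $N\ge1$ an integer, and let $u$ be a function on $\mathbb R$ with $u\cdot(1+x^2)^{\mu/2}\in L^2(\mathbb R)$. Set $\omega=|x|^{2\mu}$, $M=\frac{\sqrt N}{2\sqrt3\,\beta}$ and $B=\frac{\sqrt N\,\beta}{2\sqrt3}$. Then there is a constant $C_\mu$ depending only on $\mu$ (not on $u,\beta,N$) such that $$\bigl\|u-\widehat\Pi_N^{(\mu,\beta)} u\bigr\|_\omega \le C_\mu\Bigl( \bigl\|u \cdot \mathbb{I}_{\{|x|>M\}}\bigr\|_\omega +B^{-\mu+\frac{1}{2}} \bigl\| \mathcal{F}[u](B \,\cdot) \bigr\|_{H^{\mu}(\mathbb{R}\setminus [-1,1])} +e^{-\frac{N}{24}}\bigl(\|u\|_\omega+\|u\| \, M^\mu\bigr)\Bigr),$$ where $\|\mathcal{F}[u](B\,\cdot)\|_{H^{\mu}(\mathbb{R}\setminus[-1,1])}$ is the Sobolev $H^\mu$ norm, on the set $\mathbb R\setminus[-1,1]$, of the function $\xi\mapsto\mathcal F[u](B\xi)$.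
   Context: $P_N$ is the space of polynomials of degree at most $N$; $\|f\|_w=(\int |f|^2w)^{1/2}$ for a weight $w$, and $\|f\|$ is the unweighted $L^2(\mathbb R)$ norm. $\mathbb I_A$ is the indicator function of $A$. The Fourier transform is $\mathcal F[f](\xi)=\frac{1}{\sqrt{2\pi}}\int_{\mathbb R}e^{-i\xi x}f(x)\,dx$. $H^\mu$ denotes the (possibly fractional-order) Sobolev space. For $\mu>-\tfrac12$, $\beta>0$, $\widehat{\Pi}_N^{(\mu,\beta)}$ is the orthogonal projection of $L^2_{|x|^{2\mu}}(\mathbb R)$ (inner product $\int_{\mathbb R} f\bar g|x|^{2\mu}dx$) onto $\widehat P_N^{\beta,H}=\{e^{-\beta^2x^2/2}p(x):p\in P_N\}$, which is the span of the first $N+1$ scaled generalized Hermite functions $\widehat H_n^{(\mu)}(\beta x)$, $0\le n\le N$. *)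

theory Defs
  imports "HOL-Analysis.Analysis" "HOL-Computational_Algebra.Polynomial"
begin

definition enn_sqrt :: "ennreal \<Rightarrow> ennreal" where
  "enn_sqrt a = (if a = \<infinity> then \<infinity> else ennreal (sqrt (enn2real a)))"

(* the weight |x|^(2 mu)  (with the convention |x|^0 = 1 also at x = 0) *)
definition wt :: "real \<Rightarrow> real \<Rightarrow> real" where
  "wt mu x = (if mu = 0 then 1 else \<bar>x\<bar> powr (2 * mu))"

definition wnorm :: "(real \<Rightarrow> real) \<Rightarrow> (real \<Rightarrow> complex) \<Rightarrow> ennreal" where
  "wnorm w f = enn_sqrt (\<integral>\<^sup>+ x. ennreal ((cmod (f x))\<^sup>2 * w x) \<partial>lborel)"

definition l2norm :: "(real \<Rightarrow> complex) \<Rightarrow> ennreal" where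
  "l2norm f = wnorm (\<lambda>_. 1) f"

definition gauss_poly_space :: "real \<Rightarrow> nat \<Rightarrow> (real \<Rightarrow> complex) set" where
  "gauss_poly_space beta N =
     {(\<lambda>x. of_real (exp (- (beta\<^sup>2 * x\<^sup>2) / 2)) * poly p (of_real x)) | p :: complex poly. degree p \<le> N}"

definition is_hproj :: "real \<Rightarrow> real \<Rightarrow> nat \<Rightarrow> (real \<Rightarrow> complex) \<Rightarrow> (real \<Rightarrow> complex) \<Rightarrow> bool" where
  "is_hproj mu beta N u v \<longleftrightarrow>
     v \<in> gauss_poly_space beta N \<and>
     (\<forall>q \<in> gauss_poly_space beta N.
        integrable lborel (\<lambda>x. (u x - v x) * cnj (q x) * of_real (wt mu x)) \<and>
        (\<integral>x. (u x - v x) * cnj (q x) * of_real (wt mu x) \<partial>lborel) = 0)"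

definition hproj :: "real \<Rightarrow> real \<Rightarrow> nat \<Rightarrow> (real \<Rightarrow> complex) \<Rightarrow> (real \<Rightarrow> complex)" where
  "hproj mu beta N u = (THE v. is_hproj mu beta N u v)"

(* g is the (Plancherel) Fourier transform F[u] of u \<in> L^2(R), with the normalisation
   F[u](\<xi>) = (2\<pi>)^(-1/2) \<integral> e^{-i \<xi> x} u(x) dx:  g is the L^2-limit of the truncated integrals *)
definition fourier_L2 :: "(real \<Rightarrow> complex) \<Rightarrow> (real \<Rightarrow> complex) \<Rightarrow> bool" where
  "fourier_L2 u g \<longleftrightarrow> g \<in> borel_measurable lborel \<and>
     ((\<lambda>R::real. \<integral>\<^sup>+ \<xi>. ennreal ((cmod (g \<xi> -
          of_real (1 / sqrt (2 * pi)) *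
          (\<integral>x. indicator {-R..R} x *\<^sub>R (exp (- \<i> * of_real (\<xi> * x)) * u x) \<partial>lborel)))\<^sup>2) \<partial>lborel)
       \<longlongrightarrow> 0) at_top"

definition test_fun :: "real set \<Rightarrow> (real \<Rightarrow> real) \<Rightarrow> bool" where
  "test_fun \<Omega> \<phi> \<longleftrightarrow>
     (\<forall>k x. ((deriv ^^ k) \<phi> has_real_derivative (deriv ^^ Suc k) \<phi> x) (at x)) \<and>
     compact (closure {x. \<phi> x \<noteq> 0}) \<and> closure {x. \<phi> x \<noteq> 0} \<subseteq> \<Omega>"

definition weak_deriv :: "real set \<Rightarrow> nat \<Rightarrow> (real \<Rightarrow> complex) \<Rightarrow> (real \<Rightarrow> complex) \<Rightarrow> bool" where
  "weak_deriv \<Omega> k f h \<longleftrightarrow> h \<in> borel_measurable lborel \<and>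
     (\<forall>\<phi>. test_fun \<Omega> \<phi> \<longrightarrow>
        set_integrable lborel \<Omega> (\<lambda>x. f x * of_real ((deriv ^^ k) \<phi> x)) \<and>
        set_integrable lborel \<Omega> (\<lambda>x. h x * of_real (\<phi> x)) \<and>
        (LINT x:\<Omega>|lborel. f x * of_real ((deriv ^^ k) \<phi> x)) =
          (-1) ^ k * (LINT x:\<Omega>|lborel. h x * of_real (\<phi> x)))"

(* squared Sobolev(-Slobodeckij) norm of H^mu(\<Omega>), mu = m + \<sigma>, m integer, 0 \<le> \<sigma> < 1:
   \<Sum>_{k\<le>m} ||f^(k)||^2_{L^2(\<Omega>)} + \<integral>\<integral>_{\<Omega>\<times>\<Omega>} |f^(m)(x)-f^(m)(y)|^2/|x-y|^{1+2\<sigma>}  (last term only if \<sigma> > 0);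
   equal to \<infinity> if f \<notin> H^mu(\<Omega>) *)
definition sobolev_sq :: "real \<Rightarrow> real set \<Rightarrow> (real \<Rightarrow> complex) \<Rightarrow> ennreal" where
  "sobolev_sq mu \<Omega> f =
     (let m = nat \<lfloor>mu\<rfloor>; \<sigma> = mu - real m in
      INF h \<in> {h :: nat \<Rightarrow> real \<Rightarrow> complex.
                 f \<in> borel_measurable lborel \<and> h 0 = f \<and> (\<forall>k \<in> {1..m}. weak_deriv \<Omega> k f (h k))}.
        (\<Sum>k\<le>m. \<integral>\<^sup>+ x \<in> \<Omega>. ennreal ((cmod (h k x))\<^sup>2) \<partial>lborel) +
        (if \<sigma> > 0 then
           (\<integral>\<^sup>+ x \<in> \<Omega>. (\<integral>\<^sup>+ y \<in> \<Omega>.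
               ennreal ((cmod (h m x - h m y))\<^sup>2 / \<bar>x - y\<bar> powr (1 + 2 * \<sigma>)) \<partial>lborel) \<partial>lborel)
         else 0))"

definition sobolev_norm :: "real \<Rightarrow> real set \<Rightarrow> (real \<Rightarrow> complex) \<Rightarrow> ennreal" where
  "sobolev_norm mu \<Omega> f = enn_sqrt (sobolev_sq mu \<Omega> f)"

end

(* The projection is the best approximation in the weighted norm, so it suffices to exhibit one
   function exp(-beta^2 x^2/2) p(x) with deg p <= N that satisfies the bound.  Split u = U + l, where
   l is the part with frequencies in [-9B/8, 9B/8], obtained with a smooth cutoff of F[u].

   High frequencies: F[U] is the cut-off transform, so the norm of |x|^mu U is controlled by the
   H^mu norm of F[u](B .) outside [-1,1].  To see this, convolve F[U] with the m-th derivative of a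
   mollifier, i.e. multiply U by its transform; the weak derivatives move to F[u] by Leibniz' rule, the
   fractional part of mu is reached by integrating over translations (Plancherel), and the mollifier is
   removed by Fatou's lemma.

   Low frequencies: multiply l by c = (normal density of variance beta^(-2)) * indicator of [-2M,2M].
   On [-M,M] this changes l by a factor 1 + O(exp(-N/24)).  The product c l is a superposition of
   coherent states exp(i b x - beta^2 (x-a)^2/2) with |a| <= 2M and |b| <= 9B/8; writing these as
   exp(-beta^2 x^2/2) exp(-beta^2 a^2/2) exp((beta^2 a + i b) x) and truncating the last exponential
   series at degree N gives the approximant, and on this phase-space rectangle the error is
   smaller than exp(-N/24) by an exponential factor. *)

theory Submission
  imports Defs "HOL-Probability.Probability"
begin

subsection \<open>Square integrals\<close>

text \<open>All estimates are kept as \<open>ennreal\<close> square integrals, where infinite values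
  are harmless and constants depending on \<open>mu\<close> cost nothing; hence the weak triangle
  inequality with factor 2, and a square root only at the very end. Plancherel and Parseval on L^1
  \<inter> L^2 take the place of Fourier inversion: they give u - ift F and ft u - F the same norm,
  which compares u with the inverse transform of the cut-off data. The obstacle is that the Sobolev
  norm sees F[u](B .) only outside [-1,1]. The cutoff therefore vanishes on a neighbourhood of
  [-1,1], so that all derivatives fall where information exists; the price is a band slightly wider
  than B. The rate has its source in \<beta>^2 M^2 / 2 = N/24: a point of [-M,M] lies at distance at
  least M from the complement of [-2M,2M]. On the rectangle of coherent states \<beta>^2 (2M)^2 =
  N/3 and (9B/8)^2 / \<beta>^2 = (81/64) N/12; this leaves just enough room in the Taylor remainder
  for exp(-N/24) and a spare exp(-N/400) that pays for powers of N.\<close>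

definition N2 :: "(real \<Rightarrow> complex) \<Rightarrow> ennreal" where
  "N2 f = (\<integral>\<^sup>+ x. ennreal ((cmod (f x))\<^sup>2) \<partial>lborel)"

lemma cmod_add_sq: "(cmod (a + b))\<^sup>2 \<le> 2 * (cmod a)\<^sup>2 + 2 * (cmod b)\<^sup>2"
proof -
  have "(cmod (a + b))\<^sup>2 \<le> (cmod a + cmod b)\<^sup>2"
    by (intro power_mono norm_triangle_ineq) auto
  also have "\<dots> \<le> 2 * (cmod a)\<^sup>2 + 2 * (cmod b)\<^sup>2"
    using zero_le_power2[of "cmod a - cmod b"] by (simp add: power2_sum power2_diff)
  finally show ?thesis .
qed

lemma N2_mono: "(\<And>x. cmod (f x) \<le> cmod (g x)) \<Longrightarrow> N2 f \<le> N2 g"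
  unfolding N2_def by (intro nn_integral_mono ennreal_leI power_mono) auto

lemma N2_add:
  assumes [measurable]: "f \<in> borel_measurable borel" "g \<in> borel_measurable borel"
  shows "N2 (\<lambda>x. f x + g x) \<le> 2 * N2 f + 2 * N2 g"
proof -
  have "N2 (\<lambda>x. f x + g x) \<le> (\<integral>\<^sup>+ x. 2 * ennreal ((cmod (f x))\<^sup>2) + 2 * ennreal ((cmod (g x))\<^sup>2) \<partial>lborel)"
    unfolding N2_def
  proof (intro nn_integral_mono)
    fix x
    have "ennreal ((cmod (f x + g x))\<^sup>2) \<le> ennreal (2 * (cmod (f x))\<^sup>2 + 2 * (cmod (g x))\<^sup>2)"
      by (intro ennreal_leI cmod_add_sq)
    also have "\<dots> = 2 * ennreal ((cmod (f x))\<^sup>2) + 2 * ennreal ((cmod (g x))\<^sup>2)"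
      by (simp add: ennreal_plus ennreal_mult)
    finally show "ennreal ((cmod (f x + g x))\<^sup>2) \<le> 2 * ennreal ((cmod (f x))\<^sup>2) + 2 * ennreal ((cmod (g x))\<^sup>2)" .
  qed
  also have "\<dots> = 2 * N2 f + 2 * N2 g"
    unfolding N2_def by (subst nn_integral_add) (auto simp: nn_integral_cmult)
  finally show ?thesis .
qed

lemma N2_uminus: "N2 (\<lambda>x. - f x) = N2 f"
  by (simp add: N2_def)

lemma N2_minus_commute: "N2 (\<lambda>x. f x - g x) = N2 (\<lambda>x. g x - f x)"
  by (simp add: N2_def norm_minus_commute)

lemma N2_diff:
  assumes [measurable]: "f \<in> borel_measurable borel" "g \<in> borel_measurable borel"
  shows "N2 (\<lambda>x. f x - g x) \<le> 2 * N2 f + 2 * N2 g"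
  using N2_add[of f "\<lambda>x. - g x"] by (simp add: N2_uminus)

lemma N2_triangle:
  assumes [measurable]: "f \<in> borel_measurable borel" "g \<in> borel_measurable borel" "h \<in> borel_measurable borel"
  shows "N2 (\<lambda>x. f x - h x) \<le> 2 * N2 (\<lambda>x. f x - g x) + 2 * N2 (\<lambda>x. g x - h x)"
  using N2_add[of "\<lambda>x. f x - g x" "\<lambda>x. g x - h x"] by simp

lemma N2_cmult:
  assumes [measurable]: "f \<in> borel_measurable borel"
  shows "N2 (\<lambda>x. c * f x) = ennreal ((cmod c)\<^sup>2) * N2 f"
  unfolding N2_def by (simp add: norm_mult power_mult_distrib ennreal_mult nn_integral_cmult)

lemma N2_affine:
  assumes [measurable]: "f \<in> borel_measurable borel" and "c \<noteq> 0"
  shows "N2 f = ennreal \<bar>c\<bar> * N2 (\<lambda>x. f (t + c * x))"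
  unfolding N2_def by (rule nn_integral_real_affine) (use assms in auto)

lemma N2_shift:
  assumes [measurable]: "f \<in> borel_measurable borel"
  shows "N2 (\<lambda>x. f (x + t)) = N2 f"
  using N2_affine[OF assms, of 1 t] by (simp add: add.commute)

text \<open>Iterating \<open>N2_add\<close> doubles the constant at each step. The crude power of 2
  is affordable because the sums in question have floor mu + 1 terms.\<close>

lemma N2_sum:
  assumes [measurable]: "\<And>i. f i \<in> borel_measurable borel"
  shows "N2 (\<lambda>x. \<Sum>i\<le>(n::nat). f i x) \<le> 2 ^ Suc n * (\<Sum>i\<le>n. N2 (f i))"
proof (induction n)
  case 0
  have "N2 (f 0) \<le> 2 * N2 (f 0)" by (metis mult_2 add_increasing2 order_refl zero_le)
  then show ?case by simp
next
  case (Suc n)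
  have "N2 (\<lambda>x. \<Sum>i\<le>Suc n. f i x) \<le> 2 * N2 (\<lambda>x. \<Sum>i\<le>n. f i x) + 2 * N2 (f (Suc n))"
    using N2_add[of "\<lambda>x. \<Sum>i\<le>n. f i x" "f (Suc n)"] by simp
  also have "\<dots> \<le> 2 * (2 ^ Suc n * (\<Sum>i\<le>n. N2 (f i))) + 2 ^ Suc (Suc n) * N2 (f (Suc n))"
  proof (intro add_mono mult_left_mono mult_right_mono Suc)
    have "ennreal (2 ^ 1) \<le> ennreal (2 ^ Suc (Suc n))"
      by (intro ennreal_leI power_increasing) auto
    then show "(2::ennreal) \<le> 2 ^ Suc (Suc n)"
      by (simp only: ennreal_power[symmetric] ennreal_numeral power_one_right zero_le_numeral)
  qed auto
  also have "\<dots> = 2 ^ Suc (Suc n) * (\<Sum>i\<le>Suc n. N2 (f i))"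
    by (simp add: distrib_left mult.assoc)
  finally show ?case .
qed

text \<open>Dominated convergence. The factor 2 in the bound is the one that comes with the
  approximation of measurable functions by simple functions; truncations satisfy it
  trivially.\<close>

lemma N2_tendsto_0:
  assumes [measurable]: "\<And>n. s n \<in> borel_measurable borel" "f \<in> borel_measurable borel"
    and lim: "\<And>x. (\<lambda>n. s n x) \<longlonglongrightarrow> f x" and bd: "\<And>n x. cmod (s n x) \<le> 2 * cmod (f x)"
    and fin: "N2 f < \<infinity>"
  shows "(\<lambda>n. N2 (\<lambda>x. s n x - f x)) \<longlonglongrightarrow> 0"
proof -
  have "(\<lambda>n. \<integral>\<^sup>+ x. ennreal ((cmod (s n x - f x))\<^sup>2) \<partial>lborel) \<longlonglongrightarrow> (\<integral>\<^sup>+ (x::real). 0 \<partial>lborel)"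
  proof (rule nn_integral_dominated_convergence[where w="\<lambda>x. 9 * ennreal ((cmod (f x))\<^sup>2)"])
    show "AE x in lborel. ennreal ((cmod (s j x - f x))\<^sup>2) \<le> 9 * ennreal ((cmod (f x))\<^sup>2)" for j
    proof (intro AE_I2)
      fix x
      have "cmod (s j x - f x) \<le> 3 * cmod (f x)"
        using norm_triangle_ineq4[of "s j x" "f x"] bd[of j x] by linarith
      then have "(cmod (s j x - f x))\<^sup>2 \<le> (3 * cmod (f x))\<^sup>2" by (intro power_mono) auto
      then have "ennreal ((cmod (s j x - f x))\<^sup>2) \<le> ennreal (9 * (cmod (f x))\<^sup>2)"
        by (intro ennreal_leI) (simp add: power_mult_distrib)
      then show "ennreal ((cmod (s j x - f x))\<^sup>2) \<le> 9 * ennreal ((cmod (f x))\<^sup>2)"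
        by (simp add: ennreal_mult)
    qed
    show "(\<integral>\<^sup>+ x. 9 * ennreal ((cmod (f x))\<^sup>2) \<partial>lborel) < \<infinity>"
      using fin by (simp add: nn_integral_cmult N2_def ennreal_mult_less_top)
    show "AE x in lborel. (\<lambda>i. ennreal ((cmod (s i x - f x))\<^sup>2)) \<longlonglongrightarrow> 0"
    proof (intro AE_I2)
      fix x
      have "(\<lambda>n. (cmod (s n x - f x))\<^sup>2) \<longlonglongrightarrow> (cmod (f x - f x))\<^sup>2"
        by (intro tendsto_intros lim)
      then have "(\<lambda>n. ennreal ((cmod (s n x - f x))\<^sup>2)) \<longlonglongrightarrow> ennreal 0"
        by (intro tendsto_ennrealI) simp
      then show "(\<lambda>i. ennreal ((cmod (s i x - f x))\<^sup>2)) \<longlonglongrightarrow> 0" by simp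
    qed
  qed auto
  then show ?thesis unfolding N2_def by simp
qed

lemma indicator_scale_tendsto: "(\<lambda>n. indicator {- real n..real n} x *\<^sub>R (f::complex)) \<longlonglongrightarrow> f"
proof -
  obtain n0 :: nat where n0: "\<bar>x\<bar> \<le> real n0" using real_arch_simple by blast
  show ?thesis
  proof (rule tendsto_eventually, rule eventually_sequentiallyI[of n0])
    fix n assume "n0 \<le> n"
    then have "x \<in> {- real n..real n}" using n0 by auto
    then show "indicator {- real n..real n} x *\<^sub>R f = f" by simp
  qed
qed

lemma N2_truncate_tendsto_0:
  assumes [measurable]: "f \<in> borel_measurable borel" and fin: "N2 f < \<infinity>"
  shows "(\<lambda>n. N2 (\<lambda>x. indicator {- real n..real n} x *\<^sub>R f x - f x)) \<longlonglongrightarrow> 0"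
proof (rule N2_tendsto_0)
  fix n x show "cmod (indicator {- real n..real n} x *\<^sub>R f x) \<le> 2 * cmod (f x)"
    by (auto simp: indicator_def)
qed (use fin in \<open>auto intro: indicator_scale_tendsto\<close>)

subsection \<open>Continuity of translations\<close>

definition trans_cont :: "(real \<Rightarrow> complex) \<Rightarrow> bool" where
  "trans_cont f \<longleftrightarrow> f \<in> borel_measurable borel \<and>
     (\<forall>e>0. \<exists>d>0. \<forall>h. \<bar>h\<bar> < d \<longrightarrow> N2 (\<lambda>x. f (x + h) - f x) \<le> ennreal e)"

lemma trans_cont_measurable: "trans_cont f \<Longrightarrow> f \<in> borel_measurable borel"
  by (simp add: trans_cont_def)

lemma trans_cont_add:
  assumes f: "trans_cont f" and g: "trans_cont g"
  shows "trans_cont (\<lambda>x. f x + g x)"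
  unfolding trans_cont_def
proof (intro conjI allI impI)
  have [measurable]: "f \<in> borel_measurable borel" "g \<in> borel_measurable borel"
    using f g by (auto dest: trans_cont_measurable)
  show "(\<lambda>x. f x + g x) \<in> borel_measurable borel" by measurable
  fix e :: real assume "e > 0"
  then have e: "e / 4 > 0" by simp
  obtain d1 where d1: "d1 > 0" "\<And>h. \<bar>h\<bar> < d1 \<Longrightarrow> N2 (\<lambda>x. f (x + h) - f x) \<le> ennreal (e/4)"
    using f e unfolding trans_cont_def by blast
  obtain d2 where d2: "d2 > 0" "\<And>h. \<bar>h\<bar> < d2 \<Longrightarrow> N2 (\<lambda>x. g (x + h) - g x) \<le> ennreal (e/4)"
    using g e unfolding trans_cont_def by blast
  show "\<exists>d>0. \<forall>h. \<bar>h\<bar> < d \<longrightarrow> N2 (\<lambda>x. f (x + h) + g (x + h) - (f x + g x)) \<le> ennreal e"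
  proof (intro exI[of _ "min d1 d2"] conjI allI impI)
    fix h assume h: "\<bar>h\<bar> < min d1 d2"
    have "N2 (\<lambda>x. f (x + h) + g (x + h) - (f x + g x)) = N2 (\<lambda>x. (f (x + h) - f x) + (g (x + h) - g x))"
      by (simp add: algebra_simps)
    also have "\<dots> \<le> 2 * N2 (\<lambda>x. f (x + h) - f x) + 2 * N2 (\<lambda>x. g (x + h) - g x)"
      by (rule N2_add) auto
    also have "\<dots> \<le> 2 * ennreal (e/4) + 2 * ennreal (e/4)"
      using d1(2)[of h] d2(2)[of h] h by (intro add_mono mult_left_mono) auto
    also have "\<dots> = ennreal e"
      using e by (simp add: ennreal_mult[symmetric] ennreal_plus[symmetric] flip: ennreal_numeral)
    finally show "N2 (\<lambda>x. f (x + h) + g (x + h) - (f x + g x)) \<le> ennreal e" .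
  qed (use d1 d2 in auto)
qed

lemma trans_cont_cmult:
  assumes f: "trans_cont f"
  shows "trans_cont (\<lambda>x. c * f x)"
  unfolding trans_cont_def
proof (intro conjI allI impI)
  have [measurable]: "f \<in> borel_measurable borel"
    using f by (auto dest: trans_cont_measurable)
  show "(\<lambda>x. c * f x) \<in> borel_measurable borel" by measurable
  fix e :: real assume e: "e > 0"
  define b where "b = (cmod c)\<^sup>2 + 1"
  have b: "b > 0" by (simp add: b_def add_nonneg_pos)
  then obtain d where d: "d > 0" "\<And>h. \<bar>h\<bar> < d \<Longrightarrow> N2 (\<lambda>x. f (x + h) - f x) \<le> ennreal (e/b)"
    using f e unfolding trans_cont_def by (meson divide_pos_pos)
  show "\<exists>d>0. \<forall>h. \<bar>h\<bar> < d \<longrightarrow> N2 (\<lambda>x. c * f (x + h) - c * f x) \<le> ennreal e"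
  proof (intro exI[of _ d] conjI allI impI)
    fix h assume h: "\<bar>h\<bar> < d"
    have "N2 (\<lambda>x. c * f (x + h) - c * f x) = ennreal ((cmod c)\<^sup>2) * N2 (\<lambda>x. f (x + h) - f x)"
      by (subst N2_cmult[symmetric]) (auto simp: algebra_simps)
    also have "\<dots> \<le> ennreal b * ennreal (e/b)"
      using d(2)[of h] h by (intro mult_mono ennreal_leI) (auto simp: b_def)
    also have "\<dots> = ennreal e" using b e by (simp add: ennreal_mult[symmetric])
    finally show "N2 (\<lambda>x. c * f (x + h) - c * f x) \<le> ennreal e" .
  qed (use d in auto)
qed

lemma trans_cont_sum:
  assumes "finite A" "\<And>i. i \<in> A \<Longrightarrow> trans_cont (f i)"
  shows "trans_cont (\<lambda>x. \<Sum>i\<in>A. f i x)"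
  using assms
proof (induction A rule: finite_induct)
  case empty
  show ?case by (auto simp: trans_cont_def N2_def intro: exI[of _ 1])
qed (auto intro: trans_cont_add)

text \<open>f(. + h) - f is split at g(. + h) and at g, and the two outer terms have equal norm by
  translation invariance. With squares, 2 + 2 (2 + 2) = 10 copies of e/16 stay below e.\<close>

lemma trans_cont_limit:
  assumes f[measurable]: "f \<in> borel_measurable borel"
    and ap: "\<And>e. e > 0 \<Longrightarrow> \<exists>g. trans_cont g \<and> N2 (\<lambda>x. g x - f x) \<le> ennreal e"
  shows "trans_cont f"
  unfolding trans_cont_def
proof (intro conjI allI impI f)
  fix e :: real assume "e > 0"
  then have e: "e / 16 > 0" by simp
  obtain g where g: "trans_cont g" and fg: "N2 (\<lambda>x. g x - f x) \<le> ennreal (e/16)" using ap[OF e] by blast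
  have [measurable]: "g \<in> borel_measurable borel"
    using g by (auto dest: trans_cont_measurable)
  obtain d where d: "d > 0" "\<And>h. \<bar>h\<bar> < d \<Longrightarrow> N2 (\<lambda>x. g (x + h) - g x) \<le> ennreal (e/16)"
    using g e unfolding trans_cont_def by blast
  show "\<exists>d>0. \<forall>h. \<bar>h\<bar> < d \<longrightarrow> N2 (\<lambda>x. f (x + h) - f x) \<le> ennreal e"
  proof (intro exI[of _ d] conjI allI impI)
    fix h assume h: "\<bar>h\<bar> < d"
    have 1: "N2 (\<lambda>x. g (x + h) - f x) \<le> 2 * N2 (\<lambda>x. g (x + h) - g x) + 2 * N2 (\<lambda>x. g x - f x)"
      by (rule N2_triangle) auto
    have 2: "N2 (\<lambda>x. f (x + h) - g (x + h)) \<le> ennreal (e/16)"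
      using N2_shift[of "\<lambda>x. f x - g x" h] fg by (simp add: N2_minus_commute[of f g])
    have "N2 (\<lambda>x. f (x + h) - f x) \<le> 2 * N2 (\<lambda>x. f (x + h) - g (x + h)) + 2 * N2 (\<lambda>x. g (x + h) - f x)"
      by (rule N2_triangle) auto
    also have "\<dots> \<le> 2 * ennreal (e/16) + 2 * (2 * ennreal (e/16) + 2 * ennreal (e/16))"
      by (intro add_mono mult_left_mono order_trans[OF 1] 2 d(2) h fg) auto
    also have "\<dots> = ennreal (2 * (e/16) + 2 * (2 * (e/16) + 2 * (e/16)))"
      using e by (simp only: ennreal_mult ennreal_plus ennreal_numeral zero_le_numeral add_nonneg_nonneg mult_nonneg_nonneg less_imp_le)
    also have "\<dots> \<le> ennreal e" using e by (intro ennreal_leI) simp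
    finally show "N2 (\<lambda>x. f (x + h) - f x) \<le> ennreal e" .
  qed (use d in auto)
qed

text \<open>Outer regularity: an open U around K with U - K small contains K + h for all small h, by
  compactness. Hence K and its translate differ only inside U - K and a translate of U - K.\<close>

lemma trans_cont_compact:
  assumes K: "compact (K::real set)"
  shows "trans_cont (\<lambda>x. indicator K x)"
  unfolding trans_cont_def
proof (intro conjI allI impI)
  have [measurable]: "K \<in> sets borel" using K by (simp add: compact_imp_closed)
  show "(\<lambda>x. indicator K x :: complex) \<in> borel_measurable borel" by measurable
  fix e :: real assume "e > 0"
  then have e: "e / 2 > 0" by simp
  obtain U where U: "open U" "K \<subseteq> U" "emeasure lebesgue (U - K) < ennreal (e/2)"
    by (rule sets_lebesgue_outer_open[OF _ e, of K]) (auto intro!: compact_imp_closed K)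
  have [measurable]: "U \<in> sets borel" using U by simp
  have UK: "emeasure lborel (U - K) < ennreal (e/2)"
    using U(3) by (simp add: emeasure_completion)
  obtain d where d: "d > 0" "(\<Union>x\<in>K. ball x d) \<subseteq> U"
    using compact_subset_open_imp_ball_epsilon_subset[OF K U(1,2)] by blast
  have KU: "x + h \<in> U" if "x \<in> K" "\<bar>h\<bar> < d" for x h
  proof -
    have "x + h \<in> (\<Union>x\<in>K. ball x d)" using that by (auto simp: dist_real_def intro!: bexI[of _ x])
    then show ?thesis using d(2) by blast
  qed
  have meas: "(\<integral>\<^sup>+ x. indicator (U - K) (x + t) \<partial>lborel) \<le> ennreal (e/2)" for t
  proof -
    have "(\<integral>\<^sup>+ x. indicator (U - K) (x + t) \<partial>lborel) = (\<integral>\<^sup>+ x. indicator (U - K) x \<partial>lborel)"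
      using nn_integral_real_affine[of "\<lambda>x. indicator (U - K) x" 1 t] by (simp add: add.commute)
    then show ?thesis using UK by simp
  qed
  show "\<exists>d>0. \<forall>h. \<bar>h\<bar> < d \<longrightarrow> N2 (\<lambda>x. indicator K (x + h) - indicator K x) \<le> ennreal e"
  proof (intro exI[of _ d] conjI allI impI d)
    fix h assume h: "\<bar>h\<bar> < d"
    have "N2 (\<lambda>x. indicator K (x + h) - indicator K x) \<le>
       (\<integral>\<^sup>+ x. indicator (U - K) (x + h) + indicator (U - K) (x + 0) \<partial>lborel)"
      unfolding N2_def
    proof (intro nn_integral_mono)
      fix x
      have "x + h \<in> K \<Longrightarrow> x \<in> U" using KU[of "x+h" "-h"] h by simp
      moreover have "x \<in> K \<Longrightarrow> x + h \<in> U" using KU[of x h] h by simp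
      ultimately show "ennreal ((cmod (indicator K (x + h) - indicator K x))\<^sup>2)
        \<le> indicator (U - K) (x + h) + indicator (U - K) (x + 0)"
        by (auto simp: indicator_def)
    qed
    also have "\<dots> = (\<integral>\<^sup>+ x. indicator (U - K) (x + h) \<partial>lborel) + (\<integral>\<^sup>+ x. indicator (U - K) (x + 0) \<partial>lborel)"
      by (intro nn_integral_add) auto
    also have "\<dots> \<le> ennreal (e/2) + ennreal (e/2)" by (intro add_mono meas)
    also have "\<dots> = ennreal e" using e by (simp flip: ennreal_plus)
    finally show "N2 (\<lambda>x. indicator K (x + h) - indicator K x) \<le> ennreal e" .
  qed
qed

lemma trans_cont_bounded_set:
  assumes A[measurable]: "A \<in> sets borel" and bA: "bounded (A::real set)"
  shows "trans_cont (\<lambda>x. indicator A x)"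
proof (rule trans_cont_limit)
  fix e :: real assume e: "e > 0"
  obtain T where T: "closed T" "T \<subseteq> A" "emeasure lebesgue (A - T) < ennreal e"
    by (rule sets_lebesgue_inner_closed[OF _ e, of A]) (auto simp: A)
  have [measurable]: "T \<in> sets borel" using T by simp
  have "compact T" using T bA by (meson bounded_subset compact_eq_bounded_closed)
  moreover have "N2 (\<lambda>x. indicator T x - indicator A x) \<le> (\<integral>\<^sup>+ x. indicator (A - T) x \<partial>lborel)"
    unfolding N2_def using T(2) by (intro nn_integral_mono) (auto simp: indicator_def)
  moreover have "\<dots> \<le> ennreal e" using T(3) by (simp add: emeasure_completion)
  ultimately show "\<exists>g. trans_cont g \<and> N2 (\<lambda>x. g x - indicator A x) \<le> ennreal e"
    using trans_cont_compact by (meson order_trans)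
qed auto

lemma ennreal_LIMSEQ_0_D: "X \<longlonglongrightarrow> (0::ennreal) \<Longrightarrow> e > 0 \<Longrightarrow> \<exists>n. X n \<le> ennreal e"
  using order_tendstoD(2)[of X 0 sequentially "ennreal e"]
  by (auto simp: eventually_sequentially intro: less_imp_le)

text \<open>Simple functions reduce the claim to level sets. The bound by
  \<open>2 * dist (f x) 0\<close> forces the approximants to vanish wherever f does, so their
  nonzero level sets are bounded.\<close>

lemma trans_cont_bounded_support:
  assumes [measurable]: "f \<in> borel_measurable borel" and fin: "N2 f < \<infinity>"
    and supp: "\<And>x. \<bar>x\<bar> > R \<Longrightarrow> f x = 0"
  shows "trans_cont f"
proof -
  obtain s where s: "\<And>i. simple_function borel (s i)" "\<And>x. (\<lambda>i. s i x) \<longlonglongrightarrow> f x"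
     "\<And>i x. dist (s i x) 0 \<le> 2 * dist (f x) 0"
    using borel_measurable_implies_sequence_metric[of f borel 0] by auto
  have sm[measurable]: "s i \<in> borel_measurable borel" for i
    using s(1) by (rule borel_measurable_simple_function)
  have lim: "(\<lambda>n. N2 (\<lambda>x. s n x - f x)) \<longlonglongrightarrow> 0"
    using s by (intro N2_tendsto_0 fin) auto
  have tc: "trans_cont (s n)" for n
  proof -
    have fr: "finite (range (s n))" using s(1)[of n] by (auto simp: simple_function_def)
    have *: "s n x = (\<Sum>y\<in>range (s n) - {0}. y * indicator (s n -` {y}) x)" for x
    proof -
      have "(\<Sum>y\<in>range (s n) - {0}. y * indicator (s n -` {y}) x) = (\<Sum>y\<in>range (s n). y * indicator (s n -` {y}) x)"
        by (rule sum.mono_neutral_left) (use fr in auto)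
      also have "\<dots> = (\<Sum>y\<in>range (s n). if s n x = y then y else 0)"
        by (intro sum.cong) (auto simp: indicator_def)
      also have "\<dots> = s n x" using fr by (subst sum.delta') auto
      finally show ?thesis by simp
    qed
    have "trans_cont (\<lambda>x. \<Sum>y\<in>range (s n) - {0}. y * indicator (s n -` {y}) x)"
    proof (intro trans_cont_sum trans_cont_cmult trans_cont_bounded_set)
      fix y assume y: "y \<in> range (s n) - {0}"
      show "s n -` {y} \<in> sets borel" using measurable_sets[OF sm, of "{y}" n] by simp
      have "s n -` {y} \<subseteq> {-R..R}"
      proof
        fix x assume "x \<in> s n -` {y}"
        then have "f x \<noteq> 0" using s(3)[of n x] y by auto
        then show "x \<in> {-R..R}" using supp[of x] by (cases "\<bar>x\<bar> > R") auto
      qed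
      then show "bounded (s n -` {y})" using bounded_subset bounded_closed_interval by blast
    qed (use fr in auto)
    then show ?thesis using * by (metis (no_types, lifting) ext)
  qed
  show ?thesis
  proof (rule trans_cont_limit)
    fix e :: real assume "e > 0"
    then show "\<exists>g. trans_cont g \<and> N2 (\<lambda>x. g x - f x) \<le> ennreal e"
      using ennreal_LIMSEQ_0_D[OF lim] tc by blast
  qed auto
qed

lemma trans_cont_L2:
  assumes [measurable]: "f \<in> borel_measurable borel" and fin: "N2 f < \<infinity>"
  shows "trans_cont f"
proof (rule trans_cont_limit)
  fix e :: real assume "e > 0"
  then obtain n where n: "N2 (\<lambda>x. indicator {- real n..real n} x *\<^sub>R f x - f x) \<le> ennreal e"
    using ennreal_LIMSEQ_0_D[OF N2_truncate_tendsto_0[OF assms]] by blast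
  have "trans_cont (\<lambda>x. indicator {- real n..real n} x *\<^sub>R f x)"
  proof (rule trans_cont_bounded_support[where R="real n"])
    have "N2 (\<lambda>x. indicator {- real n..real n} x *\<^sub>R f x) \<le> N2 f"
      by (intro N2_mono) (auto simp: indicator_def)
    then show "N2 (\<lambda>x. indicator {- real n..real n} x *\<^sub>R f x) < \<infinity>" using fin by (rule le_less_trans)
  qed (auto simp: indicator_def)
  then show "\<exists>g. trans_cont g \<and> N2 (\<lambda>x. g x - f x) \<le> ennreal e" using n by blast
qed auto

subsection \<open>Plancherel and Parseval\<close>

lemma borel_measurable_cnj[measurable (raw)]:
  "f \<in> borel_measurable M \<Longrightarrow> (\<lambda>x. cnj (f x)) \<in> borel_measurable M"
  by (rule measurable_compose[of f]) (auto intro!: borel_measurable_continuous_onI continuous_intros)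

lemma borel_measurable_fst_snd[measurable]:
  "(fst :: 'a::topological_space \<times> 'b::topological_space \<Rightarrow> 'a) \<in> borel_measurable borel"
  "(snd :: 'a::topological_space \<times> 'b::topological_space \<Rightarrow> 'b) \<in> borel_measurable borel"
  by (auto intro!: borel_measurable_continuous_onI continuous_intros)

text \<open>Tonelli, in the product form that justifies most interchanges of integrals
  below.\<close>

lemma integrable_pair_bound:
  fixes f :: "_ \<Rightarrow> complex" and a :: "_ \<Rightarrow> real" and b :: "_ \<Rightarrow> real"
  assumes [measurable]: "f \<in> borel_measurable (lborel \<Otimes>\<^sub>M lborel)"
    and a: "integrable lborel a" and b: "integrable lborel b"
    and bd: "\<And>x y. cmod (f (x, y)) \<le> a x * b y"
  shows "integrable (lborel \<Otimes>\<^sub>M lborel) f"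
proof (rule integrableI_bounded)
  have [measurable]: "a \<in> borel_measurable lborel" "b \<in> borel_measurable lborel" using a b by auto
  have "(\<integral>\<^sup>+ z. ennreal (cmod (f z)) \<partial>(lborel \<Otimes>\<^sub>M lborel)) = (\<integral>\<^sup>+ x. \<integral>\<^sup>+ y. ennreal (cmod (f (x, y))) \<partial>lborel \<partial>lborel)"
    by (subst lborel.nn_integral_fst[symmetric]) auto
  also have "\<dots> \<le> (\<integral>\<^sup>+ x. \<integral>\<^sup>+ y. ennreal \<bar>a x\<bar> * ennreal \<bar>b y\<bar> \<partial>lborel \<partial>lborel)"
  proof (intro nn_integral_mono)
    fix x y
    have "cmod (f (x, y)) \<le> \<bar>a x\<bar> * \<bar>b y\<bar>" using bd[of x y] by (metis abs_ge_self abs_mult order_trans)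
    then show "ennreal (cmod (f (x, y))) \<le> ennreal \<bar>a x\<bar> * ennreal \<bar>b y\<bar>"
      by (simp add: ennreal_mult[symmetric] ennreal_leI)
  qed
  also have "\<dots> = (\<integral>\<^sup>+ x. ennreal \<bar>a x\<bar> \<partial>lborel) * (\<integral>\<^sup>+ y. ennreal \<bar>b y\<bar> \<partial>lborel)"
    by (simp add: nn_integral_cmult nn_integral_multc)
  also have "\<dots> < \<infinity>"
    using a b by (auto simp: integrable_iff_bounded ennreal_mult_less_top)
  finally show "(\<integral>\<^sup>+ z. ennreal (cmod (f z)) \<partial>(lborel \<Otimes>\<^sub>M lborel)) < \<infinity>" .
qed auto

section \<open>The space L^1 \<inter> L^2 and its inner product\<close>

definition L12 :: "(real \<Rightarrow> complex) \<Rightarrow> bool" where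
  "L12 f \<longleftrightarrow> integrable lborel f \<and> N2 f < \<infinity>"

lemma L12_measurable: "L12 f \<Longrightarrow> f \<in> borel_measurable borel"
  by (auto simp: L12_def)

lemma N2_finite_integrable:
  assumes [measurable]: "f \<in> borel_measurable borel" and "N2 f < \<infinity>"
  shows "integrable lborel (\<lambda>x. (cmod (f x))\<^sup>2)"
  using assms by (intro integrableI_bounded) (auto simp: N2_def)

lemma N2_eq_integral:
  assumes "f \<in> borel_measurable borel" "N2 f < \<infinity>"
  shows "N2 f = ennreal (\<integral>x. (cmod (f x))\<^sup>2 \<partial>lborel)"
  unfolding N2_def by (intro nn_integral_eq_integral N2_finite_integrable assms) auto

lemma integrable_mult_cnj_of_squares:
  fixes f g :: "'a \<Rightarrow> complex"
  assumes [measurable]: "f \<in> borel_measurable M" "g \<in> borel_measurable M"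
    and "integrable M (\<lambda>x. (cmod (f x))\<^sup>2)" "integrable M (\<lambda>x. (cmod (g x))\<^sup>2)"
  shows "integrable M (\<lambda>x. f x * cnj (g x))"
proof (rule Bochner_Integration.integrable_bound)
  show "integrable M (\<lambda>x. (cmod (f x))\<^sup>2 + (cmod (g x))\<^sup>2)"
    using assms by (intro Bochner_Integration.integrable_add)
  show "AE x in M. norm (f x * cnj (g x)) \<le> norm ((cmod (f x))\<^sup>2 + (cmod (g x))\<^sup>2)"
  proof (intro AE_I2)
    fix x
    have "2 * cmod (f x) * cmod (g x) \<le> (cmod (f x))\<^sup>2 + (cmod (g x))\<^sup>2"
      by (rule sum_squares_bound)
    moreover have "0 \<le> cmod (f x) * cmod (g x)" by simp
    ultimately have "cmod (f x) * cmod (g x) \<le> (cmod (f x))\<^sup>2 + (cmod (g x))\<^sup>2"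
      by linarith
    then show "norm (f x * cnj (g x)) \<le> norm ((cmod (f x))\<^sup>2 + (cmod (g x))\<^sup>2)"
      by (simp add: norm_mult)
  qed
qed measurable

lemma integrable_mult_cnj:
  assumes "f \<in> borel_measurable borel" "g \<in> borel_measurable borel" "N2 f < \<infinity>" "N2 g < \<infinity>"
  shows "integrable lborel (\<lambda>x. f x * cnj (g x))"
  using assms by (intro integrable_mult_cnj_of_squares N2_finite_integrable) auto

lemma cmod_diff_sq: "(cmod (a - b))\<^sup>2 = (cmod a)\<^sup>2 + (cmod b)\<^sup>2 - 2 * Re (a * cnj b)"
  by (simp only: cmod_power2 minus_complex.simps complex_cnj times_complex.simps cnj.simps)
     (simp add: power2_eq_square algebra_simps)

text \<open>Polarisation: the norm of a difference is reduced to two norms and one inner product, so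
  that Plancherel and Parseval can be fed in separately.\<close>

lemma N2_diff_eq:
  assumes [measurable]: "f \<in> borel_measurable borel" "g \<in> borel_measurable borel"
    and fin: "N2 f < \<infinity>" "N2 g < \<infinity>"
  shows "N2 (\<lambda>x. f x - g x) = ennreal ((\<integral>x. (cmod (f x))\<^sup>2 \<partial>lborel) + (\<integral>x. (cmod (g x))\<^sup>2 \<partial>lborel)
     - 2 * Re (\<integral>x. f x * cnj (g x) \<partial>lborel))"
proof -
  have i1: "integrable lborel (\<lambda>x. (cmod (f x))\<^sup>2)" "integrable lborel (\<lambda>x. (cmod (g x))\<^sup>2)"
    using fin by (auto intro: N2_finite_integrable)
  have i2: "integrable lborel (\<lambda>x. f x * cnj (g x))" by (intro integrable_mult_cnj fin) auto
  have i3: "integrable lborel (\<lambda>x. Re (f x * cnj (g x)))" using i2 by (rule integrable_Re)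
  have "N2 (\<lambda>x. f x - g x) = (\<integral>\<^sup>+x. ennreal ((cmod (f x))\<^sup>2 + (cmod (g x))\<^sup>2 - 2 * Re (f x * cnj (g x))) \<partial>lborel)"
    unfolding N2_def cmod_diff_sq ..
  also have "\<dots> = ennreal (\<integral>x. ((cmod (f x))\<^sup>2 + (cmod (g x))\<^sup>2 - 2 * Re (f x * cnj (g x))) \<partial>lborel)"
    using i1 i3 by (intro nn_integral_eq_integral AE_I2 Bochner_Integration.integrable_diff Bochner_Integration.integrable_add integrable_mult_right)
      (simp_all only: cmod_diff_sq[symmetric] zero_le_power2)
  also have "(\<integral>x. ((cmod (f x))\<^sup>2 + (cmod (g x))\<^sup>2 - 2 * Re (f x * cnj (g x))) \<partial>lborel)
    = (\<integral>x. (cmod (f x))\<^sup>2 \<partial>lborel) + (\<integral>x. (cmod (g x))\<^sup>2 \<partial>lborel) - 2 * (\<integral>x. Re (f x * cnj (g x)) \<partial>lborel)"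
    using i1 i3 by (simp del: times_complex.sel)
  also have "(\<integral>x. Re (f x * cnj (g x)) \<partial>lborel) = Re (\<integral>x. f x * cnj (g x) \<partial>lborel)"
    using i2 by (rule integral_Re)
  finally show ?thesis .
qed

text \<open>The Bochner integral of a non-integrable function is 0 by convention, so
  \<open>ft f\<close> is the Fourier transform only for integrable f; other square-integrable
  functions are reached through their truncations.\<close>

definition ft :: "(real \<Rightarrow> complex) \<Rightarrow> real \<Rightarrow> complex" where
  "ft f \<xi> = of_real (1 / sqrt (2 * pi)) * (\<integral>x. exp (- \<i> * of_real (\<xi> * x)) * f x \<partial>lborel)"

definition ift :: "(real \<Rightarrow> complex) \<Rightarrow> real \<Rightarrow> complex" where
  "ift f x = ft f (- x)"

lemma ft_measurable[measurable]:
  assumes [measurable]: "f \<in> borel_measurable borel"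
  shows "ft f \<in> borel_measurable borel"
  unfolding ft_def by measurable

lemma ift_measurable[measurable]:
  assumes [measurable]: "f \<in> borel_measurable borel"
  shows "ift f \<in> borel_measurable borel"
  unfolding ift_def by measurable

lemma norm_iexp[simp]: "cmod (exp (- (\<i> * of_real t))) = 1" "cmod (exp (\<i> * of_real t)) = 1"
  by (auto simp: norm_exp_eq_Re)

lemma integrable_iexp_mult:
  assumes "integrable lborel f"
  shows "integrable lborel (\<lambda>x. exp (- \<i> * of_real (\<xi> * x)) * f x)"
proof (rule Bochner_Integration.integrable_bound[OF assms])
  have [measurable]: "f \<in> borel_measurable borel" using assms by auto
  show "(\<lambda>x. exp (- \<i> * of_real (\<xi> * x)) * f x) \<in> borel_measurable lborel" by measurable
  show "AE x in lborel. cmod (exp (- \<i> * of_real (\<xi> * x)) * f x) \<le> cmod (f x)"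
    by (simp add: norm_mult del: of_real_mult)
qed

section \<open>Plancherel by Gaussian damping\<close>

lemma gaussian_ft:
  assumes n: "n > 0"
  shows "(\<integral>\<xi>. exp (- \<i> * of_real (\<xi> * d)) * of_real (exp (- (\<xi> / n)\<^sup>2 / 2)) \<partial>lborel)
       = of_real (2 * pi * normal_density y (1 / n) (y + d))"
proof -
  \<comment> \<open>The characteristic function of the standard normal law; the scale n is then
    restored by the substitution \<xi> = n x.\<close>
  have c: "(CLINT x|lborel. of_real (std_normal_density x) * iexp (- (n * d) * x)) = of_real (exp (- (n*d)\<^sup>2 / 2))"
  proof -
    have "char std_normal_distribution (- (n * d)) = of_real (exp (- (n*d)\<^sup>2 / 2))"
      using char_std_normal_distribution by simp
    then show ?thesis
      unfolding char_def by (subst (asm) integral_density) (auto simp: scaleR_conv_of_real)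
  qed
  have "(\<integral>\<xi>. exp (- \<i> * of_real (\<xi> * d)) * of_real (exp (- (\<xi> / n)\<^sup>2 / 2)) \<partial>lborel)
     = n *\<^sub>R (\<integral>x. exp (- \<i> * of_real ((n * x) * d)) * of_real (exp (- ((n * x) / n)\<^sup>2 / 2)) \<partial>lborel)"
    using lborel_integral_real_affine[of n "\<lambda>\<xi>. exp (- \<i> * of_real (\<xi> * d)) * of_real (exp (- (\<xi> / n)\<^sup>2 / 2))" 0] n
    by simp
  also have "(\<integral>x. exp (- \<i> * of_real ((n * x) * d)) * of_real (exp (- ((n * x) / n)\<^sup>2 / 2)) \<partial>lborel)
     = (\<integral>x. of_real (sqrt (2 * pi)) * (of_real (std_normal_density x) * iexp (- (n * d) * x)) \<partial>lborel)"
    using n by (intro Bochner_Integration.integral_cong) (auto simp: std_normal_density_def algebra_simps)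
  also have "\<dots> = of_real (sqrt (2 * pi)) * of_real (exp (- (n*d)\<^sup>2 / 2))"
    by (subst integral_mult_right_zero) (simp only: c)
  also have "n *\<^sub>R (\<dots> :: complex) = of_real (n * sqrt (2 * pi) * exp (- (n*d)\<^sup>2 / 2))"
    by (simp add: scaleR_conv_of_real)
  also have "n * sqrt (2 * pi) * exp (- (n*d)\<^sup>2 / 2) = 2 * pi * normal_density y (1 / n) (y + d)"
  proof -
    have "sqrt (2 * pi * (1 / n)\<^sup>2) = sqrt (2 * pi) / n" using n by (simp add: real_sqrt_mult real_sqrt_divide power_one_over)
    then have "2 * pi * normal_density y (1 / n) (y + d) = (2 * pi / sqrt (2 * pi)) * n * exp (- (n*d)\<^sup>2 / 2)"
      using n unfolding normal_density_def by (simp add: power_divide power_mult_distrib)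
    also have "2 * pi / sqrt (2 * pi) = sqrt (2 * pi)" by (rule real_div_sqrt) simp
    finally show ?thesis by simp
  qed
  finally show ?thesis .
qed

text \<open>An exact identity for every n: the damped integral of |ft u|^2 is the double integral of
  u(x) cnj(u(y)) against a normal kernel of width 1/n, and polarisation rewrites this as the squared
  norm of u minus half an average of translation differences. The limit n \<rightarrow> \<infinity>
  then rests on continuity of translations alone.\<close>

lemma plancherel_regularized:
  assumes u: "L12 u" and n: "n > 0"
  shows "(\<integral>\<^sup>+ \<xi>. ennreal ((cmod (ft u \<xi>))\<^sup>2 * exp (- (\<xi> / n)\<^sup>2 / 2)) \<partial>lborel)
     + (\<integral>\<^sup>+ t. ennreal (std_normal_density t) * N2 (\<lambda>x. u (x + t / n) - u x) \<partial>lborel) / 2 = N2 u"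
proof -
  have [measurable]: "u \<in> borel_measurable borel" using u by (rule L12_measurable)
  have ui: "integrable lborel u" and uf: "N2 u < \<infinity>" using u by (auto simp: L12_def)
  have u2: "integrable lborel (\<lambda>x. (cmod (u x))\<^sup>2)" by (intro N2_finite_integrable uf) auto
  define E where "E = (\<lambda>\<xi>. exp (- (\<xi> / n)\<^sup>2 / 2))"
  define k where "k = (\<lambda>p. normal_density (snd p) (1 / n) (fst p))"
  define w where "w = (\<lambda>p. u (fst p) * cnj (u (snd p)))"
  have [measurable]: "E \<in> borel_measurable borel" "w \<in> borel_measurable borel" unfolding E_def w_def by measurable
  have [measurable]: "k \<in> borel_measurable borel" unfolding k_def normal_density_def by measurable
  have sq: "sqrt (2 * pi * (1 / n)\<^sup>2) = sqrt (2 * pi) / n" using n by (simp add: real_sqrt_mult real_sqrt_divide power_one_over)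
  have k_swap: "k (x, y) = normal_density x (1 / n) y" for x y
    by (simp add: k_def normal_density_def power2_commute)
  have k0: "k p \<ge> 0" for p by (simp add: k_def)
  have kint: "(\<integral>\<^sup>+ x. ennreal (normal_density y (1 / n) x) \<partial>lborel) = 1" for y
    using n by (subst nn_integral_eq_integral) auto
  have Ei: "integrable lborel E"
  proof -
    have "integrable lborel (\<lambda>x. sqrt (2 * pi) * n * normal_density 0 n x)" using n by simp
    also have "(\<lambda>x. sqrt (2 * pi) * n * normal_density 0 n x) = E"
      using n by (auto simp: E_def normal_density_def real_sqrt_mult power_divide)
    finally show ?thesis .
  qed
  have wi: "integrable (lborel \<Otimes>\<^sub>M lborel) w"
    by (rule integrable_pair_bound[where a="\<lambda>x. cmod (u x)" and b="\<lambda>x. cmod (u x)"])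
       (use ui in \<open>auto simp: w_def norm_mult\<close>)
  have wi': "integrable lborel w" using wi by (simp add: lborel_prod)
  \<comment> \<open>The squared modulus of an integral is an integral over the plane, with phase
    \<xi> (x - y).\<close>
  have ft2: "of_real ((cmod (ft u \<xi>))\<^sup>2) = (1 / (2 * pi)) *\<^sub>R (\<integral>p. exp (- \<i> * of_real (\<xi> * (fst p - snd p))) * w p \<partial>lborel)" for \<xi>
  proof -
    define a where "a = (\<integral>x. exp (- \<i> * of_real (\<xi> * x)) * u x \<partial>lborel)"
    have ca: "cnj a = (\<integral>y. exp (\<i> * of_real (\<xi> * y)) * cnj (u y) \<partial>lborel)"
    proof -
      have "cnj a = (\<integral>x. cnj (exp (- \<i> * of_real (\<xi> * x)) * u x) \<partial>lborel)"
        unfolding a_def by (rule Bochner_Integration.integral_cnj[symmetric])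
      also have "\<dots> = (\<integral>y. exp (\<i> * of_real (\<xi> * y)) * cnj (u y) \<partial>lborel)"
        by (intro Bochner_Integration.integral_cong refl) (simp add: exp_cnj)
      finally show ?thesis .
    qed
    have ai: "integrable lborel (\<lambda>x. exp (- \<i> * of_real (\<xi> * x)) * u x)" by (rule integrable_iexp_mult[OF ui])
    define F where "F = (\<lambda>x y. exp (- \<i> * of_real (\<xi> * (x - y))) * w (x, y))"
    have Fi: "integrable (lborel \<Otimes>\<^sub>M lborel) (case_prod F)"
      by (rule integrable_pair_bound[where a="\<lambda>x. cmod (u x)" and b="\<lambda>x. cmod (u x)"])
         (use ui in \<open>auto simp: w_def F_def norm_mult simp del: of_real_mult of_real_diff\<close>)
    have "(\<integral>p. exp (- \<i> * of_real (\<xi> * (fst p - snd p))) * w p \<partial>lborel) = (\<integral>p. case_prod F p \<partial>(lborel \<Otimes>\<^sub>M lborel))"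
      by (simp add: lborel_prod F_def split_beta')
    also have "\<dots> = (\<integral>x. \<integral>y. F x y \<partial>lborel \<partial>lborel)"
      using lborel_pair.integral_fst'[OF Fi] by simp
    also have "\<dots> = (\<integral>x. (exp (- \<i> * of_real (\<xi> * x)) * u x) * cnj a \<partial>lborel)"
    proof (intro Bochner_Integration.integral_cong refl)
      fix x
      have "(\<integral>y. F x y \<partial>lborel) = (\<integral>y. (exp (- \<i> * of_real (\<xi> * x)) * u x) * (exp (\<i> * of_real (\<xi> * y)) * cnj (u y)) \<partial>lborel)"
        unfolding F_def w_def
        by (intro Bochner_Integration.integral_cong refl) (simp add: ring_distribs exp_diff exp_minus field_simps)
      then show "(\<integral>y. F x y \<partial>lborel) = (exp (- \<i> * of_real (\<xi> * x)) * u x) * cnj a" by (simp add: ca)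
    qed
    also have "\<dots> = a * cnj a" by (simp add: a_def)
    finally have 1: "(\<integral>p. exp (- \<i> * of_real (\<xi> * (fst p - snd p))) * w p \<partial>lborel) = of_real ((cmod a)\<^sup>2)"
      by (simp only: complex_norm_square)
    have "(cmod (ft u \<xi>))\<^sup>2 = 1 / (2 * pi) * (cmod a)\<^sup>2"
      unfolding ft_def a_def[symmetric] by (simp add: norm_mult norm_divide power_mult_distrib power_divide)
    then show ?thesis unfolding 1 by (simp add: scaleR_conv_of_real)
  qed
  \<comment> \<open>The Gaussian factor \<open>E\<close> supplies the integrability in \<xi> that
    Fubini requires.\<close>
  define G where "G = (\<lambda>(p::real\<times>real) \<xi>. exp (- \<i> * of_real (\<xi> * (fst p - snd p))) * w p * of_real (E \<xi>))"
  have Gi: "integrable (lborel \<Otimes>\<^sub>M lborel) (case_prod G)"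
  proof (rule integrable_pair_bound[where a="\<lambda>p. cmod (w p)" and b=E])
    have "case_prod G = (\<lambda>z. exp (- \<i> * of_real (snd z * (fst (fst z) - snd (fst z)))) * w (fst z) * of_real (E (snd z)))"
      by (auto simp: G_def)
    also have "\<dots> \<in> borel_measurable borel" by measurable
    finally show "case_prod G \<in> borel_measurable (lborel \<Otimes>\<^sub>M lborel)" by (simp add: lborel_prod)
  qed (use wi' Ei in \<open>auto simp: G_def norm_mult E_def simp del: of_real_mult of_real_diff\<close>)
  have "complex_of_real (\<integral>\<xi>. (cmod (ft u \<xi>))\<^sup>2 * E \<xi> \<partial>lborel) = (\<integral>\<xi>. of_real ((cmod (ft u \<xi>))\<^sup>2) * of_real (E \<xi>) \<partial>lborel)"
    by (subst integral_complex_of_real[symmetric]) simp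
  also have "\<dots> = (\<integral>\<xi>. (1 / (2 * pi)) *\<^sub>R (\<integral>p. G p \<xi> \<partial>lborel) \<partial>lborel)"
    unfolding ft2 G_def by (simp add: scaleR_conv_of_real)
  also have "\<dots> = (1 / (2 * pi)) *\<^sub>R (\<integral>\<xi>. (\<integral>p. G p \<xi> \<partial>lborel) \<partial>lborel)" by simp
  also have "(\<integral>\<xi>. (\<integral>p. G p \<xi> \<partial>lborel) \<partial>lborel) = (\<integral>p. (\<integral>\<xi>. G p \<xi> \<partial>lborel) \<partial>lborel)"
    by (rule lborel_pair.Fubini_integral[OF Gi])
  also have "\<dots> = (\<integral>p. (2 * pi) *\<^sub>R (w p * of_real (k p)) \<partial>lborel)"
  proof (intro Bochner_Integration.integral_cong refl)
    fix p :: "real \<times> real"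
    have "(\<integral>\<xi>. G p \<xi> \<partial>lborel) = w p * (\<integral>\<xi>. exp (- \<i> * of_real (\<xi> * (fst p - snd p))) * of_real (E \<xi>) \<partial>lborel)"
      unfolding G_def by (subst integral_mult_right_zero[symmetric]) (simp add: mult_ac)
    also have "\<dots> = w p * of_real (2 * pi * k p)"
      unfolding E_def by (subst gaussian_ft[OF n, of _ "snd p"]) (simp add: k_def)
    finally show "(\<integral>\<xi>. G p \<xi> \<partial>lborel) = (2 * pi) *\<^sub>R (w p * of_real (k p))"
      by (simp add: scaleR_conv_of_real)
  qed
  also have "(1 / (2 * pi)) *\<^sub>R \<dots> = (\<integral>p. w p * of_real (k p) \<partial>lborel)" by simp
  finally have main: "(\<integral>\<xi>. (cmod (ft u \<xi>))\<^sup>2 * E \<xi> \<partial>lborel) = Re (\<integral>p. w p * of_real (k p) \<partial>lborel)"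
    by (metis Re_complex_of_real)
  define r where "r = (\<integral>x. (cmod (u x))\<^sup>2 \<partial>lborel)"
  have N2u: "N2 u = ennreal r" unfolding r_def by (intro N2_eq_integral uf) auto
  have r0: "r \<ge> 0" by (simp add: r_def)
  \<comment> \<open>The normal kernel integrates to 1 in the other variable, so both pure squares
    have integral r.\<close>
  have J1: "(\<integral>\<^sup>+ p. ennreal ((cmod (u (fst p)))\<^sup>2 * k p) \<partial>lborel) = ennreal r"
  proof -
    have "(\<integral>\<^sup>+ p. ennreal ((cmod (u (fst p)))\<^sup>2 * k p) \<partial>lborel) = (\<integral>\<^sup>+ x. \<integral>\<^sup>+ y. ennreal ((cmod (u x))\<^sup>2 * k (x, y)) \<partial>lborel \<partial>lborel)"
      by (subst lborel_prod[symmetric], subst lborel.nn_integral_fst[symmetric]) (auto simp: lborel_prod)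
    also have "\<dots> = (\<integral>\<^sup>+ x. ennreal ((cmod (u x))\<^sup>2) \<partial>lborel)"
      by (simp add: k_swap ennreal_mult nn_integral_cmult kint)
    finally show ?thesis using N2u by (simp add: N2_def)
  qed
  have J2: "(\<integral>\<^sup>+ p. ennreal ((cmod (u (snd p)))\<^sup>2 * k p) \<partial>lborel) = ennreal r"
  proof -
    have "(\<integral>\<^sup>+ p. ennreal ((cmod (u (snd p)))\<^sup>2 * k p) \<partial>lborel) = (\<integral>\<^sup>+ y. \<integral>\<^sup>+ x. ennreal ((cmod (u y))\<^sup>2 * k (x, y)) \<partial>lborel \<partial>lborel)"
      by (subst lborel_prod[symmetric], subst lborel_pair.nn_integral_snd[symmetric]) (auto simp: lborel_prod)
    also have "\<dots> = (\<integral>\<^sup>+ x. ennreal ((cmod (u x))\<^sup>2) \<partial>lborel)"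
      by (simp add: k_def ennreal_mult nn_integral_cmult kint)
    finally show ?thesis using N2u by (simp add: N2_def)
  qed
  have I1: "integrable lborel (\<lambda>p. (cmod (u (fst p)))\<^sup>2 * k p)"
    by (rule integrableI_bounded) (use J1 k0 in \<open>auto simp: abs_mult\<close>)
  have I2: "integrable lborel (\<lambda>p. (cmod (u (snd p)))\<^sup>2 * k p)"
    by (rule integrableI_bounded) (use J2 k0 in \<open>auto simp: abs_mult\<close>)
  have R1: "(\<integral>p. (cmod (u (fst p)))\<^sup>2 * k p \<partial>lborel) = r"
    using J1 r0 k0 by (intro integral_eq_nn_integral[THEN trans]) (auto intro!: borel_measurable_times)
  have R2: "(\<integral>p. (cmod (u (snd p)))\<^sup>2 * k p \<partial>lborel) = r"
    using J2 r0 k0 by (intro integral_eq_nn_integral[THEN trans]) (auto intro!: borel_measurable_times)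
  define D where "D = (\<lambda>p. (cmod (u (fst p) - u (snd p)))\<^sup>2 * k p)"
  have [measurable]: "D \<in> borel_measurable borel" unfolding D_def by measurable
  have D0: "D p \<ge> 0" for p by (simp add: D_def k0)
  have DI: "integrable lborel D"
  proof (rule Bochner_Integration.integrable_bound)
    show "integrable lborel (\<lambda>p. 2 * ((cmod (u (fst p)))\<^sup>2 * k p) + 2 * ((cmod (u (snd p)))\<^sup>2 * k p))"
      using I1 I2 by (intro Bochner_Integration.integrable_add integrable_mult_right)
    show "AE p in lborel. norm (D p) \<le> norm (2 * ((cmod (u (fst p)))\<^sup>2 * k p) + 2 * ((cmod (u (snd p)))\<^sup>2 * k p))"
    proof (intro AE_I2)
      fix p
      have "(cmod (u (fst p) - u (snd p)))\<^sup>2 \<le> 2 * (cmod (u (fst p)))\<^sup>2 + 2 * (cmod (u (snd p)))\<^sup>2"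
        using cmod_add_sq[of "u (fst p)" "- u (snd p)"] by simp
      then have "D p \<le> (2 * (cmod (u (fst p)))\<^sup>2 + 2 * (cmod (u (snd p)))\<^sup>2) * k p"
        unfolding D_def by (intro mult_right_mono k0)
      then show "norm (D p) \<le> norm (2 * ((cmod (u (fst p)))\<^sup>2 * k p) + 2 * ((cmod (u (snd p)))\<^sup>2 * k p))"
        using D0[of p] k0[of p] by (simp add: algebra_simps)
    qed
  qed auto
  have wk: "integrable lborel (\<lambda>p. w p * of_real (k p))"
  proof (rule Bochner_Integration.integrable_bound)
    show "integrable lborel (\<lambda>p. ((cmod (u (fst p)))\<^sup>2 * k p) + ((cmod (u (snd p)))\<^sup>2 * k p))"
      using I1 I2 by (intro Bochner_Integration.integrable_add)
    show "AE p in lborel. norm (w p * of_real (k p)) \<le> norm (((cmod (u (fst p)))\<^sup>2 * k p) + ((cmod (u (snd p)))\<^sup>2 * k p))"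
    proof (intro AE_I2)
      fix p
      have "2 * cmod (u (fst p)) * cmod (u (snd p)) \<le> (cmod (u (fst p)))\<^sup>2 + (cmod (u (snd p)))\<^sup>2"
        by (rule sum_squares_bound)
      moreover have "0 \<le> cmod (u (fst p)) * cmod (u (snd p))" by simp
      ultimately have "cmod (u (fst p)) * cmod (u (snd p)) \<le> (cmod (u (fst p)))\<^sup>2 + (cmod (u (snd p)))\<^sup>2"
        by linarith
      then have "cmod (u (fst p)) * cmod (u (snd p)) * k p \<le> ((cmod (u (fst p)))\<^sup>2 + (cmod (u (snd p)))\<^sup>2) * k p"
        by (intro mult_right_mono k0)
      then show "norm (w p * of_real (k p)) \<le> norm (((cmod (u (fst p)))\<^sup>2 * k p) + ((cmod (u (snd p)))\<^sup>2 * k p))"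
        using k0[of p] by (simp add: w_def norm_mult algebra_simps)
    qed
  qed auto
  have "Re (\<integral>p. w p * of_real (k p) \<partial>lborel) = (\<integral>p. Re (w p * of_real (k p)) \<partial>lborel)"
    using wk by (rule integral_Re[symmetric])
  \<comment> \<open>Re (u(x) cnj(u(y))) is half of |u(x)|^2 + |u(y)|^2 - |u(x) - u(y)|^2.\<close>
  also have "\<dots> = (\<integral>p. ((cmod (u (fst p)))\<^sup>2 * k p + (cmod (u (snd p)))\<^sup>2 * k p - D p) / 2 \<partial>lborel)"
    by (intro Bochner_Integration.integral_cong refl)
       (simp add: D_def cmod_diff_sq w_def field_simps)
  also have "\<dots> = (r + r - (\<integral>p. D p \<partial>lborel)) / 2"
    using I1 I2 DI R1 R2 by simp
  finally have main2: "(\<integral>\<xi>. (cmod (ft u \<xi>))\<^sup>2 * E \<xi> \<partial>lborel) = r - (\<integral>p. D p \<partial>lborel) / 2"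
    using main by simp
  have bnd: "(cmod (ft u \<xi>))\<^sup>2 \<le> (\<integral>x. cmod (u x) \<partial>lborel)\<^sup>2" for \<xi>
  proof (intro power_mono)
    have "cmod (\<integral>x. exp (- \<i> * of_real (\<xi> * x)) * u x \<partial>lborel) \<le> (\<integral>x. cmod (exp (- \<i> * of_real (\<xi> * x)) * u x) \<partial>lborel)"
      by (rule integral_norm_bound)
    also have "\<dots> = (\<integral>x. cmod (u x) \<partial>lborel)" by (simp add: norm_mult del: of_real_mult)
    finally have 1: "cmod (\<integral>x. exp (- \<i> * of_real (\<xi> * x)) * u x \<partial>lborel) \<le> (\<integral>x. cmod (u x) \<partial>lborel)" .
    have "1 / sqrt (2 * pi) \<le> 1" using pi_gt3 by simp
    then show "cmod (ft u \<xi>) \<le> (\<integral>x. cmod (u x) \<partial>lborel)"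
      using mult_mono[OF _ 1, of "1 / sqrt (2 * pi)" 1] by (simp add: ft_def norm_mult norm_divide del: of_real_mult)
  qed auto
  have Ai: "integrable lborel (\<lambda>\<xi>. (cmod (ft u \<xi>))\<^sup>2 * E \<xi>)"
  proof (rule Bochner_Integration.integrable_bound)
    show "integrable lborel (\<lambda>\<xi>. (\<integral>x. cmod (u x) \<partial>lborel)\<^sup>2 * E \<xi>)" using Ei by simp
    show "AE \<xi> in lborel. norm ((cmod (ft u \<xi>))\<^sup>2 * E \<xi>) \<le> norm ((\<integral>x. cmod (u x) \<partial>lborel)\<^sup>2 * E \<xi>)"
      using bnd by (auto simp: E_def abs_mult intro!: mult_right_mono)
  qed auto
  have A: "(\<integral>\<^sup>+ \<xi>. ennreal ((cmod (ft u \<xi>))\<^sup>2 * E \<xi>) \<partial>lborel) = ennreal (r - (\<integral>p. D p \<partial>lborel) / 2)"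
    using Ai main2 by (subst nn_integral_eq_integral) (auto simp: E_def)
  have A0: "r - (\<integral>p. D p \<partial>lborel) / 2 \<ge> 0"
    unfolding main2[symmetric] by (intro integral_nonneg_AE) (auto simp: E_def)
  have "(\<integral>\<^sup>+ p. ennreal (D p) \<partial>lborel) = (\<integral>\<^sup>+ y. \<integral>\<^sup>+ x. ennreal ((cmod (u x - u y))\<^sup>2 * k (x, y)) \<partial>lborel \<partial>lborel)"
    unfolding D_def
    by (subst lborel_prod[symmetric], subst lborel_pair.nn_integral_snd[symmetric]) (auto simp: lborel_prod)
  \<comment> \<open>Substituting x = y + t/n turns the kernel of width 1/n into the standard normal
    density in t.\<close>
  also have "\<dots> = (\<integral>\<^sup>+ y. \<integral>\<^sup>+ t. ennreal ((cmod (u (y + t / n) - u y))\<^sup>2) * ennreal (std_normal_density t) \<partial>lborel \<partial>lborel)"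
  proof (rule nn_integral_cong)
    fix y
    have "(\<integral>\<^sup>+ x. ennreal ((cmod (u x - u y))\<^sup>2 * k (x, y)) \<partial>lborel) =
      ennreal \<bar>1 / n\<bar> * (\<integral>\<^sup>+ t. ennreal ((cmod (u (y + 1 / n * t) - u y))\<^sup>2 * k (y + 1 / n * t, y)) \<partial>lborel)"
      by (rule nn_integral_real_affine) (use n in auto)
    also have "\<dots> = (\<integral>\<^sup>+ t. ennreal \<bar>1 / n\<bar> * ennreal ((cmod (u (y + 1 / n * t) - u y))\<^sup>2 * k (y + 1 / n * t, y)) \<partial>lborel)"
      by (rule nn_integral_cmult[symmetric]) measurable
    also have "\<dots> = (\<integral>\<^sup>+ t. ennreal ((cmod (u (y + t / n) - u y))\<^sup>2) * ennreal (std_normal_density t) \<partial>lborel)"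
    proof (intro nn_integral_cong)
      fix t
      have "k (y + 1 / n * t, y) = n * std_normal_density t"
        unfolding k_def using n sq by (simp add: normal_density_def power_divide field_simps)
      then show "ennreal \<bar>1 / n\<bar> * ennreal ((cmod (u (y + 1 / n * t) - u y))\<^sup>2 * k (y + 1 / n * t, y))
        = ennreal ((cmod (u (y + t / n) - u y))\<^sup>2) * ennreal (std_normal_density t)"
        using n by (simp add: ennreal_mult[symmetric])
    qed
    finally show "(\<integral>\<^sup>+ x. ennreal ((cmod (u x - u y))\<^sup>2 * k (x, y)) \<partial>lborel) =
      (\<integral>\<^sup>+ t. ennreal ((cmod (u (y + t / n) - u y))\<^sup>2) * ennreal (std_normal_density t) \<partial>lborel)" .
  qed
  also have "\<dots> = (\<integral>\<^sup>+ t. \<integral>\<^sup>+ y. ennreal ((cmod (u (y + t / n) - u y))\<^sup>2) * ennreal (std_normal_density t) \<partial>lborel \<partial>lborel)"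
    by (rule lborel_pair.Fubini') (simp add: split_beta', measurable)
  also have "\<dots> = (\<integral>\<^sup>+ t. ennreal (std_normal_density t) * N2 (\<lambda>x. u (x + t / n) - u x) \<partial>lborel)"
    unfolding N2_def by (rule nn_integral_cong) (subst nn_integral_multc, auto simp: mult.commute)
  finally have DD: "(\<integral>\<^sup>+ t. ennreal (std_normal_density t) * N2 (\<lambda>x. u (x + t / n) - u x) \<partial>lborel) = ennreal (\<integral>p. D p \<partial>lborel)"
    using DI D0 by (subst (asm) nn_integral_eq_integral) auto
  have d0: "(\<integral>p. D p \<partial>lborel) \<ge> 0" by (intro integral_nonneg_AE AE_I2 D0)
  have "ennreal (\<integral>p. D p \<partial>lborel) / 2 = ennreal ((\<integral>p. D p \<partial>lborel) / 2)"
    using d0 by (subst ennreal_numeral[symmetric], subst divide_ennreal) auto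
  then show ?thesis
    unfolding DD N2u A[unfolded E_def] using A0 d0 by (simp flip: ennreal_plus)
qed

lemma nn_integral_std_normal: "(\<integral>\<^sup>+ t. ennreal (std_normal_density t) \<partial>lborel) = 1"
  by (subst nn_integral_eq_integral) auto

text \<open>Dominated convergence in t: each translation difference tends to 0 and never exceeds 4
  times \<open>N2 u\<close>.\<close>

lemma trans_average_tendsto_0:
  assumes [measurable]: "u \<in> borel_measurable borel" and fin: "N2 u < \<infinity>"
  shows "(\<lambda>n. \<integral>\<^sup>+ t. ennreal (std_normal_density t) * N2 (\<lambda>x. u (x + t / real (Suc n)) - u x) \<partial>lborel) \<longlonglongrightarrow> 0"
proof -
  have "(\<lambda>n. \<integral>\<^sup>+ t. ennreal (std_normal_density t) * N2 (\<lambda>x. u (x + t / real (Suc n)) - u x) \<partial>lborel)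
     \<longlonglongrightarrow> (\<integral>\<^sup>+ (t::real). 0 \<partial>lborel)"
  proof (rule nn_integral_dominated_convergence[where w="\<lambda>t. ennreal (std_normal_density t) * (4 * N2 u)"])
    show "(\<lambda>t. ennreal (std_normal_density t) * N2 (\<lambda>x. u (x + t / real (Suc n)) - u x)) \<in> borel_measurable lborel" for n
      unfolding N2_def by measurable
    have "N2 (\<lambda>x. u (x + t) - u x) \<le> 4 * N2 u" for t
    proof -
      have "N2 (\<lambda>x. u (x + t) - u x) \<le> 2 * N2 u + 2 * N2 u"
        using N2_diff[of "\<lambda>x. u (x + t)" u] by (simp add: N2_shift)
      also have "\<dots> = 4 * N2 u" by (simp add: distrib_right[symmetric])
      finally show ?thesis .
    qed
    then show "AE t in lborel. ennreal (std_normal_density t) * N2 (\<lambda>x. u (x + t / real (Suc n)) - u x)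
        \<le> ennreal (std_normal_density t) * (4 * N2 u)" for n
      by (intro AE_I2 mult_left_mono) auto
    have "(\<integral>\<^sup>+ t. ennreal (std_normal_density t) * (4 * N2 u) \<partial>lborel) = 1 * (4 * N2 u)"
      by (subst nn_integral_multc) (auto simp: nn_integral_std_normal)
    also have "\<dots> < \<infinity>" using fin by (simp add: ennreal_mult_less_top)
    finally show "(\<integral>\<^sup>+ t. ennreal (std_normal_density t) * (4 * N2 u) \<partial>lborel) < \<infinity>" .
    show "AE t in lborel. (\<lambda>n. ennreal (std_normal_density t) * N2 (\<lambda>x. u (x + t / real (Suc n)) - u x)) \<longlonglongrightarrow> 0"
    proof (intro AE_I2)
      fix t :: real
      have lim: "(\<lambda>n. N2 (\<lambda>x. u (x + t / real (Suc n)) - u x)) \<longlonglongrightarrow> 0"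
      proof (rule tendsto_zero_ennreal)
        fix e :: real assume "e > 0"
        then have "e / 2 > 0" by simp
        then obtain d where d: "d > 0" "\<And>h. \<bar>h\<bar> < d \<Longrightarrow> N2 (\<lambda>x. u (x + h) - u x) \<le> ennreal (e/2)"
          using trans_cont_L2[OF _ fin] unfolding trans_cont_def by (meson assms(1))
        have "(\<lambda>n. t / real (Suc n)) \<longlonglongrightarrow> 0" by real_asymp
        then have "\<forall>\<^sub>F n in sequentially. \<bar>t / real (Suc n)\<bar> < d"
          using d(1) by (auto simp: tendsto_iff dist_real_def)
        then show "\<forall>\<^sub>F n in sequentially. N2 (\<lambda>x. u (x + t / real (Suc n)) - u x) < ennreal e"
        proof eventually_elim
          case (elim n)
          then have "N2 (\<lambda>x. u (x + t / real (Suc n)) - u x) \<le> ennreal (e/2)" by (rule d(2))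
          also have "\<dots> < ennreal e" using \<open>e > 0\<close> by (intro ennreal_lessI) auto
          finally show ?case .
        qed
      qed
      have "(\<lambda>n. ennreal (std_normal_density t) * N2 (\<lambda>x. u (x + t / real (Suc n)) - u x)) \<longlonglongrightarrow> ennreal (std_normal_density t) * 0"
        by (intro ennreal_tendsto_cmult lim) auto
      then show "(\<lambda>n. ennreal (std_normal_density t) * N2 (\<lambda>x. u (x + t / real (Suc n)) - u x)) \<longlonglongrightarrow> 0" by simp
    qed
  qed auto
  then show ?thesis by simp
qed

lemma plancherel_L12:
  assumes u: "L12 u"
  shows "N2 (ft u) = N2 u"
proof -
  have [measurable]: "u \<in> borel_measurable borel" using u by (rule L12_measurable)
  define A where "A = (\<lambda>n. \<integral>\<^sup>+ \<xi>. ennreal ((cmod (ft u \<xi>))\<^sup>2 * exp (- (\<xi> / real (Suc n))\<^sup>2 / 2)) \<partial>lborel)"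
  define D where "D = (\<lambda>n. \<integral>\<^sup>+ t. ennreal (std_normal_density t) * N2 (\<lambda>x. u (x + t / real (Suc n)) - u x) \<partial>lborel)"
  have eq: "A n + D n / 2 = N2 u" for n
    unfolding A_def D_def by (rule plancherel_regularized[OF u]) simp
  have D: "D \<longlonglongrightarrow> 0" unfolding D_def by (rule trans_average_tendsto_0) (use u in \<open>auto simp: L12_def\<close>)
  \<comment> \<open>The damping increases to 1, so monotone convergence identifies the limit even
    before \<open>N2 (ft u)\<close> is known to be finite.\<close>
  have A: "A \<longlonglongrightarrow> N2 (ft u)"
    unfolding A_def N2_def
  proof (rule nn_integral_LIMSEQ)
    show "incseq (\<lambda>n \<xi>. ennreal ((cmod (ft u \<xi>))\<^sup>2 * exp (- (\<xi> / real (Suc n))\<^sup>2 / 2)))"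
    proof (intro incseq_SucI le_funI ennreal_leI mult_left_mono)
      fix n \<xi>
      have "\<bar>\<xi> / real (Suc (Suc n))\<bar> \<le> \<bar>\<xi> / real (Suc n)\<bar>"
        by (auto simp: abs_divide intro!: divide_left_mono)
      then have "(\<xi> / real (Suc (Suc n)))\<^sup>2 \<le> (\<xi> / real (Suc n))\<^sup>2"
        by (simp only: abs_le_square_iff)
      then show "exp (- (\<xi> / real (Suc n))\<^sup>2 / 2) \<le> exp (- (\<xi> / real (Suc (Suc n)))\<^sup>2 / 2)" by simp
    qed auto
    fix \<xi>
    have "(\<lambda>n. \<xi> / real (Suc n)) \<longlonglongrightarrow> 0" by real_asymp
    then have "(\<lambda>n. exp (- (\<xi> / real (Suc n))\<^sup>2 / 2)) \<longlonglongrightarrow> exp (- 0\<^sup>2 / 2)"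
      by (intro tendsto_intros) auto
    then have "(\<lambda>n. exp (- (\<xi> / real (Suc n))\<^sup>2 / 2)) \<longlonglongrightarrow> 1" by simp
    then have "(\<lambda>n. (cmod (ft u \<xi>))\<^sup>2 * exp (- (\<xi> / real (Suc n))\<^sup>2 / 2)) \<longlonglongrightarrow> (cmod (ft u \<xi>))\<^sup>2 * 1"
      by (intro tendsto_intros)
    then show "(\<lambda>n. ennreal ((cmod (ft u \<xi>))\<^sup>2 * exp (- (\<xi> / real (Suc n))\<^sup>2 / 2))) \<longlonglongrightarrow> ennreal ((cmod (ft u \<xi>))\<^sup>2)"
      by (intro tendsto_ennrealI) simp
  qed measurable
  have D2: "(\<lambda>n. D n / 2) \<longlonglongrightarrow> 0"
    using ennreal_tendsto_cmult[OF _ D, of "inverse 2"]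
    by (simp add: divide_ennreal_def mult.commute less_top[symmetric])
  have "(\<lambda>n. A n + D n / 2) \<longlonglongrightarrow> N2 (ft u) + 0" by (intro tendsto_add A D2)
  then show ?thesis unfolding eq by (simp add: LIMSEQ_const_iff)
qed

lemma L12_ft:
  assumes "L12 u" shows "ft u \<in> borel_measurable borel" "N2 (ft u) < \<infinity>"
  using assms plancherel_L12[OF assms] by (auto simp: L12_def intro!: ft_measurable)

lemma N2_ift:
  assumes "L12 u"
  shows "N2 (ift u) = N2 u"
proof -
  have "N2 (ft u) = ennreal \<bar>-1\<bar> * N2 (\<lambda>x. ft u (0 + (-1) * x))"
    by (rule N2_affine) (use L12_ft[OF assms] in auto)
  then show ?thesis using plancherel_L12[OF assms] by (simp add: ift_def[abs_def])
qed

text \<open>The multiplication formula: both sides are the same absolutely convergent double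
  integral of u(x) cnj(F(\<xi>)) exp(-i \<xi> x), normalised by 1 / sqrt (2 pi).\<close>

lemma parseval_L12:
  assumes u: "L12 u" and F: "L12 F"
  shows "(\<integral>x. u x * cnj (ift F x) \<partial>lborel) = (\<integral>\<xi>. ft u \<xi> * cnj (F \<xi>) \<partial>lborel)"
proof -
  have [measurable]: "u \<in> borel_measurable borel" "F \<in> borel_measurable borel" using u F by (auto dest: L12_measurable)
  define c :: complex where "c = of_real (1 / sqrt (2 * pi))"
  define H where "H = (\<lambda>x \<xi>. c * (exp (- \<i> * of_real (\<xi> * x)) * (u x * cnj (F \<xi>))))"
  have [measurable]: "case_prod H \<in> borel_measurable (lborel \<Otimes>\<^sub>M lborel)"
  proof -
    have "case_prod H = (\<lambda>z. c * (exp (- \<i> * of_real (snd z * fst z)) * (u (fst z) * cnj (F (snd z)))))"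
      by (auto simp: H_def)
    also have "\<dots> \<in> borel_measurable borel" by measurable
    finally show ?thesis by (simp add: lborel_prod)
  qed
  have Hi: "integrable (lborel \<Otimes>\<^sub>M lborel) (case_prod H)"
    by (rule integrable_pair_bound[where a="\<lambda>x. cmod c * cmod (u x)" and b="\<lambda>x. cmod (F x)"])
       (use u F in \<open>auto simp: L12_def H_def norm_mult simp del: of_real_mult\<close>)
  have "(\<integral>x. u x * cnj (ift F x) \<partial>lborel) = (\<integral>x. (\<integral>\<xi>. H x \<xi> \<partial>lborel) \<partial>lborel)"
  proof (intro Bochner_Integration.integral_cong refl)
    fix x
    have "cnj (ift F x) = c * (\<integral>\<xi>. cnj (exp (- \<i> * of_real ((-x) * \<xi>)) * F \<xi>) \<partial>lborel)"
      unfolding ift_def ft_def c_def Bochner_Integration.integral_cnj by simp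
    then have "u x * cnj (ift F x) = (\<integral>\<xi>. u x * (c * cnj (exp (- \<i> * of_real ((-x) * \<xi>)) * F \<xi>)) \<partial>lborel)"
      by simp
    also have "\<dots> = (\<integral>\<xi>. H x \<xi> \<partial>lborel)"
      unfolding H_def by (intro Bochner_Integration.integral_cong refl) (simp add: exp_cnj algebra_simps)
    finally show "u x * cnj (ift F x) = (\<integral>\<xi>. H x \<xi> \<partial>lborel)" .
  qed
  also have "\<dots> = (\<integral>\<xi>. (\<integral>x. H x \<xi> \<partial>lborel) \<partial>lborel)"
    by (rule lborel_pair.Fubini_integral[OF Hi, symmetric])
  also have "\<dots> = (\<integral>\<xi>. ft u \<xi> * cnj (F \<xi>) \<partial>lborel)"
  proof (intro Bochner_Integration.integral_cong refl)
    fix \<xi>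
    have "(\<integral>x. H x \<xi> \<partial>lborel) = (\<integral>x. (c * cnj (F \<xi>)) * (exp (- \<i> * of_real (\<xi> * x)) * u x) \<partial>lborel)"
      unfolding H_def by (intro Bochner_Integration.integral_cong refl) (simp add: algebra_simps)
    also have "\<dots> = ft u \<xi> * cnj (F \<xi>)" unfolding ft_def c_def by simp
    finally show "(\<integral>x. H x \<xi> \<partial>lborel) = ft u \<xi> * cnj (F \<xi>)" .
  qed
  finally show ?thesis .
qed

text \<open>Plays the role of Fourier inversion. After both squares are expanded, the pure terms
  agree by Plancherel and the mixed ones by Parseval.\<close>

lemma N2_inverse_diff:
  assumes u: "L12 u" and F: "L12 F"
  shows "N2 (\<lambda>x. u x - ift F x) = N2 (\<lambda>\<xi>. ft u \<xi> - F \<xi>)"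
proof -
  have m[measurable]: "u \<in> borel_measurable borel" "F \<in> borel_measurable borel" using u F by (auto dest: L12_measurable)
  have fin: "N2 u < \<infinity>" "N2 F < \<infinity>" "N2 (ift F) < \<infinity>" "N2 (ft u) < \<infinity>"
    using u F N2_ift[OF F] plancherel_L12[OF u] by (auto simp: L12_def)
  have a: "(\<integral>x. (cmod (ift F x))\<^sup>2 \<partial>lborel) = (\<integral>x. (cmod (F x))\<^sup>2 \<partial>lborel)"
    using N2_ift[OF F] fin by (subst (asm) (1 2) N2_eq_integral) auto
  have b: "(\<integral>x. (cmod (ft u x))\<^sup>2 \<partial>lborel) = (\<integral>x. (cmod (u x))\<^sup>2 \<partial>lborel)"
    using plancherel_L12[OF u] fin by (subst (asm) (1 2) N2_eq_integral) auto
  show ?thesis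
    using fin by (subst (1 2) N2_diff_eq) (auto simp: parseval_L12[OF u F] a b)
qed

subsection \<open>Convolution with a bounded integrable kernel\<close>

text \<open>Fatou's lemma, in the form that passes a convergent sequence of bounds to a pointwise
  limit.\<close>

lemma nn_integral_le_LIMSEQ:
  assumes [measurable]: "\<And>n. f n \<in> borel_measurable M"
    and lim: "\<And>x. (\<lambda>n. f n x) \<longlonglongrightarrow> g x"
    and le: "\<And>n. (\<integral>\<^sup>+x. f n x \<partial>M) \<le> a n" and a: "a \<longlonglongrightarrow> (b :: ennreal)"
  shows "(\<integral>\<^sup>+x. g x \<partial>M) \<le> b"
proof -
  have "g x = liminf (\<lambda>n. f n x)" for x
    using lim_imp_Liminf[OF _ lim[of x]] by simp
  then have "(\<integral>\<^sup>+x. g x \<partial>M) = (\<integral>\<^sup>+x. liminf (\<lambda>n. f n x) \<partial>M)" by simp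
  also have "\<dots> \<le> liminf (\<lambda>n. \<integral>\<^sup>+x. f n x \<partial>M)" by (rule nn_integral_liminf) auto
  also have "\<dots> \<le> liminf a" by (intro Liminf_mono always_eventually allI le)
  also have "\<dots> = b" using a by (intro lim_imp_Liminf) auto
  finally show ?thesis .
qed

definition conv :: "(real \<Rightarrow> real) \<Rightarrow> (real \<Rightarrow> complex) \<Rightarrow> real \<Rightarrow> complex" where
  "conv K G \<xi> = (\<integral>y. G y * of_real (K (\<xi> - y)) \<partial>lborel)"

text \<open>The transform of K with sign + and without normalisation. These conventions make
  \<open>kt K\<close> exactly the multiplier of \<open>conv K\<close>: convolving a transform with K
  multiplies the function by \<open>kt K\<close>, with no stray constant.\<close>

definition kt :: "(real \<Rightarrow> real) \<Rightarrow> real \<Rightarrow> complex" where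
  "kt K x = (\<integral>s. of_real (K s) * exp (\<i> * of_real (x * s)) \<partial>lborel)"

text \<open>Integrability serves Young's inequality; together with boundedness it puts K in L^2, so
  the convolution with an L^2 function converges at every point.\<close>

definition kernel :: "(real \<Rightarrow> real) \<Rightarrow> bool" where
  "kernel K \<longleftrightarrow> integrable lborel K \<and> (\<exists>c. \<forall>x. \<bar>K x\<bar> \<le> c)"

lemma kernel_measurable: "kernel K \<Longrightarrow> K \<in> borel_measurable borel"
  by (auto simp: kernel_def)

lemma conv_measurable[measurable]:
  assumes [measurable]: "K \<in> borel_measurable borel" "G \<in> borel_measurable borel"
  shows "conv K G \<in> borel_measurable borel"
  unfolding conv_def by measurable

lemma kt_measurable[measurable]:
  assumes [measurable]: "K \<in> borel_measurable borel"
  shows "kt K \<in> borel_measurable borel"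
  unfolding kt_def by measurable

lemma norm_conv_le:
  assumes [measurable]: "K \<in> borel_measurable borel" "G \<in> borel_measurable borel"
  shows "ennreal (cmod (conv K G \<xi>)) \<le> (\<integral>\<^sup>+ y. ennreal (cmod (G y)) * ennreal \<bar>K (\<xi> - y)\<bar> \<partial>lborel)"
proof (cases "integrable lborel (\<lambda>y. G y * of_real (K (\<xi> - y)))")
  case True
  then show ?thesis
    unfolding conv_def using integral_norm_bound_ennreal[OF True]
    by (simp add: norm_mult ennreal_mult)
\<comment> \<open>A divergent convolution integral is 0 by convention, and the bound is then
  trivial.\<close>
qed (simp add: conv_def not_integrable_integral_eq)

lemma nn_integral_reflect:
  assumes [measurable]: "f \<in> borel_measurable borel"
  shows "(\<integral>\<^sup>+ y. f (t - y) \<partial>lborel) = (\<integral>\<^sup>+ (y::real). f y \<partial>lborel)"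
  using nn_integral_real_affine[of f "-1" t] by simp

lemma nn_integral_shift:
  assumes [measurable]: "f \<in> borel_measurable borel"
  shows "(\<integral>\<^sup>+ y. f (y + t) \<partial>lborel) = (\<integral>\<^sup>+ (y::real). f y \<partial>lborel)"
  using nn_integral_real_affine[of f 1 t] by (simp add: add.commute)

lemma nn_integral_kernel_shift:
  assumes [measurable]: "K \<in> borel_measurable borel"
  shows "(\<integral>\<^sup>+ \<xi>. c * ennreal \<bar>K (\<xi> - y)\<bar> \<partial>lborel) = c * (\<integral>\<^sup>+ (s::real). ennreal \<bar>K s\<bar> \<partial>lborel)"
  using nn_integral_shift[of "\<lambda>y. ennreal \<bar>K y\<bar>" "-y"] by (subst nn_integral_cmult) auto

text \<open>Young's inequality, from Cauchy--Schwarz with respect to the measure with density \<open>K\<close>.\<close>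

lemma N2_conv_le:
  assumes [measurable]: "K \<in> borel_measurable borel" "G \<in> borel_measurable borel"
  shows "N2 (conv K G) \<le> (\<integral>\<^sup>+ s. ennreal \<bar>K s\<bar> \<partial>lborel)\<^sup>2 * N2 G"
proof -
  define \<kappa> where "\<kappa> = (\<integral>\<^sup>+ s. ennreal \<bar>K s\<bar> \<partial>lborel)"
  have K1: "(\<integral>\<^sup>+ y. ennreal \<bar>K (\<xi> - y)\<bar> \<partial>lborel) = \<kappa>" for \<xi>
    unfolding \<kappa>_def by (rule nn_integral_reflect) measurable
  have K2: "(\<integral>\<^sup>+ \<xi>. ennreal \<bar>K (\<xi> - y)\<bar> \<partial>lborel) = \<kappa>" for y
    unfolding \<kappa>_def using nn_integral_shift[of "\<lambda>y. ennreal \<bar>K y\<bar>" "-y"] by simp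
  have pt: "ennreal ((cmod (conv K G \<xi>))\<^sup>2) \<le> \<kappa> * (\<integral>\<^sup>+ y. ennreal ((cmod (G y))\<^sup>2) * ennreal \<bar>K (\<xi> - y)\<bar> \<partial>lborel)" for \<xi>
  proof -
    have "ennreal ((cmod (conv K G \<xi>))\<^sup>2) = (ennreal (cmod (conv K G \<xi>)))\<^sup>2" by (simp add: ennreal_power)
    also have "\<dots> \<le> (\<integral>\<^sup>+ y. ennreal (cmod (G y)) * ennreal \<bar>K (\<xi> - y)\<bar> \<partial>lborel)\<^sup>2"
      by (intro power_mono norm_conv_le) auto
    also have "(\<integral>\<^sup>+ y. ennreal (cmod (G y)) * ennreal \<bar>K (\<xi> - y)\<bar> \<partial>lborel)
        = (\<integral>\<^sup>+ y. ennreal (cmod (G y) * sqrt \<bar>K (\<xi> - y)\<bar>) * ennreal (sqrt \<bar>K (\<xi> - y)\<bar>) \<partial>lborel)"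
      by (intro nn_integral_cong) (simp add: ennreal_mult[symmetric])
    also have "\<dots>\<^sup>2 \<le> (\<integral>\<^sup>+ y. (ennreal (cmod (G y) * sqrt \<bar>K (\<xi> - y)\<bar>))\<^sup>2 \<partial>lborel) * (\<integral>\<^sup>+ y. (ennreal (sqrt \<bar>K (\<xi> - y)\<bar>))\<^sup>2 \<partial>lborel)"
      by (rule Cauchy_Schwarz_nn_integral) auto
    also have "\<dots> = (\<integral>\<^sup>+ y. ennreal ((cmod (G y))\<^sup>2) * ennreal \<bar>K (\<xi> - y)\<bar> \<partial>lborel) * \<kappa>"
      unfolding K1[symmetric, of \<xi>] by (simp add: ennreal_power power_mult_distrib ennreal_mult)
    finally show ?thesis by (simp add: mult.commute)
  qed
  have "N2 (conv K G) \<le> (\<integral>\<^sup>+ \<xi>. \<kappa> * (\<integral>\<^sup>+ y. ennreal ((cmod (G y))\<^sup>2) * ennreal \<bar>K (\<xi> - y)\<bar> \<partial>lborel) \<partial>lborel)"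
    unfolding N2_def by (intro nn_integral_mono pt)
  also have "\<dots> = \<kappa> * (\<integral>\<^sup>+ \<xi>. (\<integral>\<^sup>+ y. ennreal ((cmod (G y))\<^sup>2) * ennreal \<bar>K (\<xi> - y)\<bar> \<partial>lborel) \<partial>lborel)"
    by (intro nn_integral_cmult) measurable
  also have "(\<integral>\<^sup>+ \<xi>. (\<integral>\<^sup>+ y. ennreal ((cmod (G y))\<^sup>2) * ennreal \<bar>K (\<xi> - y)\<bar> \<partial>lborel) \<partial>lborel)
    = (\<integral>\<^sup>+ y. (\<integral>\<^sup>+ \<xi>. ennreal ((cmod (G y))\<^sup>2) * ennreal \<bar>K (\<xi> - y)\<bar> \<partial>lborel) \<partial>lborel)"
    by (rule lborel_pair.Fubini') (simp add: split_beta', measurable)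
  also have "\<dots> = (\<integral>\<^sup>+ y. ennreal ((cmod (G y))\<^sup>2) * \<kappa> \<partial>lborel)"
    by (rule nn_integral_cong) (subst nn_integral_cmult, auto simp: K2)
  also have "\<dots> = N2 G * \<kappa>" unfolding N2_def by (rule nn_integral_multc) auto
  finally show ?thesis by (simp add: \<kappa>_def power2_eq_square mult_ac)
qed

lemma kernel_nn_finite: "kernel K \<Longrightarrow> (\<integral>\<^sup>+ s. ennreal \<bar>K s\<bar> \<partial>lborel) < \<infinity>"
  by (auto simp: kernel_def integrable_iff_bounded)

lemma N2_conv_finite:
  assumes K: "kernel K" and "G \<in> borel_measurable borel" "N2 G < \<infinity>"
  shows "N2 (conv K G) < \<infinity>"
  using N2_conv_le[OF kernel_measurable[OF K] assms(2)] kernel_nn_finite[OF K] assms(3)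
  by (auto simp: ennreal_mult_less_top power2_eq_square elim!: le_less_trans)

lemma kernel_N2: 
  assumes K: "kernel K"
  shows "N2 (\<lambda>s. of_real (K s)) < \<infinity>"
proof -
  obtain c where c: "\<And>x. \<bar>K x\<bar> \<le> c" using K by (auto simp: kernel_def)
  have c0: "c \<ge> 0" using c[of 0] by linarith
  have [measurable]: "K \<in> borel_measurable borel" using K by (rule kernel_measurable)
  have "N2 (\<lambda>s. of_real (K s)) \<le> (\<integral>\<^sup>+ s. ennreal c * ennreal \<bar>K s\<bar> \<partial>lborel)"
    unfolding N2_def
  proof (intro nn_integral_mono)
    fix s
    have "\<bar>K s\<bar> * \<bar>K s\<bar> \<le> c * \<bar>K s\<bar>" using c by (intro mult_right_mono) auto
    then show "ennreal ((cmod (of_real (K s)))\<^sup>2) \<le> ennreal c * ennreal \<bar>K s\<bar>"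
      using c0 by (auto simp: ennreal_mult[symmetric] power2_eq_square intro: ennreal_leI)
  qed
  also have "\<dots> = ennreal c * (\<integral>\<^sup>+ s. ennreal \<bar>K s\<bar> \<partial>lborel)" by (rule nn_integral_cmult) auto
  also have "\<dots> < \<infinity>" using kernel_nn_finite[OF K] by (simp add: ennreal_mult_less_top)
  finally show ?thesis .
qed

lemma integrable_conv:
  assumes K: "kernel K" and [measurable]: "G \<in> borel_measurable borel" and fin: "N2 G < \<infinity>"
  shows "integrable lborel (\<lambda>y. G y * of_real (K (\<xi> - y)))"
proof -
  have [measurable]: "K \<in> borel_measurable borel" using K by (rule kernel_measurable)
  have "N2 (\<lambda>s. of_real (K (\<xi> + (-1) * s))) < \<infinity>"
    using kernel_N2[OF K] N2_affine[of "\<lambda>s. of_real (K s)" "-1" \<xi>] by simp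
  then have "integrable lborel (\<lambda>y. G y * cnj (of_real (K (\<xi> + (-1) * y))))"
    by (intro integrable_mult_cnj fin) auto
  then show ?thesis by simp
qed

lemma conv_diff:
  assumes K: "kernel K" and [measurable]: "G \<in> borel_measurable borel" "H \<in> borel_measurable borel"
    and "N2 G < \<infinity>" "N2 H < \<infinity>"
  shows "conv K (\<lambda>y. G y - H y) \<xi> = conv K G \<xi> - conv K H \<xi>"
  unfolding conv_def
  using integrable_conv[OF K, of G \<xi>] integrable_conv[OF K, of H \<xi>] assms
  by (subst Bochner_Integration.integral_diff[symmetric]) (auto simp: algebra_simps)

lemma conv_L12:
  assumes K: "kernel K" and F: "L12 F"
  shows "L12 (conv K F)"
proof -
  have [measurable]: "K \<in> borel_measurable borel" "F \<in> borel_measurable borel"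
    using K F by (auto dest: kernel_measurable L12_measurable)
  have "(\<integral>\<^sup>+ \<xi>. ennreal (cmod (conv K F \<xi>)) \<partial>lborel) \<le> (\<integral>\<^sup>+ \<xi>. (\<integral>\<^sup>+ y. ennreal (cmod (F y)) * ennreal \<bar>K (\<xi> - y)\<bar> \<partial>lborel) \<partial>lborel)"
    by (intro nn_integral_mono norm_conv_le) auto
  also have "\<dots> = (\<integral>\<^sup>+ y. (\<integral>\<^sup>+ \<xi>. ennreal (cmod (F y)) * ennreal \<bar>K (\<xi> - y)\<bar> \<partial>lborel) \<partial>lborel)"
    by (rule lborel_pair.Fubini') (simp add: split_beta', measurable)
  also have "\<dots> = (\<integral>\<^sup>+ y. ennreal (cmod (F y)) * (\<integral>\<^sup>+ s. ennreal \<bar>K s\<bar> \<partial>lborel) \<partial>lborel)"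
    by (simp add: nn_integral_kernel_shift)
  also have "\<dots> = (\<integral>\<^sup>+ y. ennreal (cmod (F y)) \<partial>lborel) * (\<integral>\<^sup>+ s. ennreal \<bar>K s\<bar> \<partial>lborel)"
    by (rule nn_integral_multc) auto
  also have "\<dots> < \<infinity>"
    using F kernel_nn_finite[OF K] by (auto simp: L12_def integrable_iff_bounded ennreal_mult_less_top)
  finally have "integrable lborel (conv K F)" by (intro integrableI_bounded) auto
  then show ?thesis using N2_conv_finite[OF K, of F] F by (auto simp: L12_def)
qed

lemma kt_bound:
  assumes K: "kernel K"
  shows "cmod (kt K x) \<le> (\<integral>s. \<bar>K s\<bar> \<partial>lborel)"
proof -
  have "cmod (kt K x) \<le> (\<integral>s. cmod (of_real (K s) * exp (\<i> * of_real (x * s))) \<partial>lborel)"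
    unfolding kt_def by (rule integral_norm_bound)
  then show ?thesis by (simp add: norm_mult del: of_real_mult)
qed

lemma integrable_kt:
  assumes K: "kernel K"
  shows "integrable lborel (\<lambda>s. of_real (K s) * exp (\<i> * of_real (x * s)))"
proof (rule Bochner_Integration.integrable_bound)
  have [measurable]: "K \<in> borel_measurable borel" using K by (rule kernel_measurable)
  show "integrable lborel K" using K by (simp add: kernel_def)
  show "(\<lambda>s. of_real (K s) * exp (\<i> * of_real (x * s))) \<in> borel_measurable lborel" by measurable
qed (simp add: norm_mult del: of_real_mult)

lemma L12_mult_bounded:
  assumes F: "L12 F" and [measurable]: "k \<in> borel_measurable borel" and k: "\<And>x. cmod (k x) \<le> c"
  shows "L12 (\<lambda>x. k x * F x)"
proof -
  have [measurable]: "F \<in> borel_measurable borel" using F by (rule L12_measurable)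
  have c0: "c \<ge> 0" using k[of 0] norm_ge_zero order_trans by blast
  have le: "cmod (k x * F x) \<le> cmod (of_real c * F x)" for x
    using k[of x] c0 by (auto simp: norm_mult intro!: mult_right_mono)
  have "integrable lborel (\<lambda>x. k x * F x)"
    by (rule Bochner_Integration.integrable_bound[where f="\<lambda>x. of_real c * F x"])
       (use F le in \<open>auto simp: L12_def\<close>)
  moreover have "N2 (\<lambda>x. k x * F x) \<le> N2 (\<lambda>x. of_real c * F x)" by (intro N2_mono le)
  moreover have "N2 (\<lambda>x. of_real c * F x) < \<infinity>"
    using F by (subst N2_cmult) (auto simp: L12_def ennreal_mult_less_top)
  ultimately show ?thesis by (auto simp: L12_def)
qed

lemma integral_reflect_shift:
  fixes f :: "real \<Rightarrow> complex"
  shows "(\<integral>y. f (t - y) \<partial>lborel) = (\<integral>y. f y \<partial>lborel)"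
  using lborel_integral_real_affine[of "-1" f t] by simp

lemma integral_shift:
  fixes f :: "real \<Rightarrow> complex"
  shows "(\<integral>y. f (y + t) \<partial>lborel) = (\<integral>y. f y \<partial>lborel)"
  using lborel_integral_real_affine[of "1" f t] by (simp add: add.commute)

text \<open>Fubini on the integral that defines \<open>kt K\<close>: multiplying a function by exp(i
  x s) translates its transform by s.\<close>

lemma ft_kt_mult:
  assumes K: "kernel K" and u: "L12 u"
  shows "ft (\<lambda>x. kt K x * u x) \<xi> = conv K (ft u) \<xi>"
proof -
  have [measurable]: "K \<in> borel_measurable borel" "u \<in> borel_measurable borel"
    using K u by (auto dest: kernel_measurable L12_measurable)
  define c :: complex where "c = of_real (1 / sqrt (2 * pi))"
  define H where "H = (\<lambda>x s. (exp (- \<i> * of_real ((\<xi> - s) * x)) * u x) * of_real (K s))"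
  have [measurable]: "case_prod H \<in> borel_measurable (lborel \<Otimes>\<^sub>M lborel)"
  proof -
    have "case_prod H = (\<lambda>z. (exp (- \<i> * of_real ((\<xi> - snd z) * fst z)) * u (fst z)) * of_real (K (snd z)))"
      by (auto simp: H_def)
    also have "\<dots> \<in> borel_measurable borel" by measurable
    finally show ?thesis by (simp add: lborel_prod)
  qed
  have Hi: "integrable (lborel \<Otimes>\<^sub>M lborel) (case_prod H)"
    by (rule integrable_pair_bound[where a="\<lambda>x. cmod (u x)" and b="\<lambda>x. \<bar>K x\<bar>"])
       (use u K in \<open>auto simp: L12_def kernel_def H_def norm_mult simp del: of_real_mult of_real_diff\<close>)
  have "ft (\<lambda>x. kt K x * u x) \<xi> = c * (\<integral>x. (\<integral>s. H x s \<partial>lborel) \<partial>lborel)"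
    unfolding ft_def c_def
  proof (intro arg_cong2[where f="(*)"] Bochner_Integration.integral_cong refl)
    fix x
    have "exp (- \<i> * of_real (\<xi> * x)) * (kt K x * u x) = (\<integral>s. (exp (- \<i> * of_real (\<xi> * x)) * u x) * (of_real (K s) * exp (\<i> * of_real (x * s))) \<partial>lborel)"
      unfolding kt_def by simp
    also have "\<dots> = (\<integral>s. H x s \<partial>lborel)"
      unfolding H_def
    proof (intro Bochner_Integration.integral_cong refl)
      fix s
      have "exp (- \<i> * of_real ((\<xi> - s) * x)) = exp (- \<i> * of_real (\<xi> * x)) * exp (\<i> * of_real (x * s))"
        by (simp add: mult_exp_exp algebra_simps)
      then show "(exp (- \<i> * of_real (\<xi> * x)) * u x) * (of_real (K s) * exp (\<i> * of_real (x * s)))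
        = (exp (- \<i> * of_real ((\<xi> - s) * x)) * u x) * of_real (K s)" by (simp only: mult_ac)
    qed
    finally show "exp (- \<i> * of_real (\<xi> * x)) * (kt K x * u x) = (\<integral>s. H x s \<partial>lborel)" .
  qed
  also have "\<dots> = c * (\<integral>s. (\<integral>x. H x s \<partial>lborel) \<partial>lborel)"
    by (subst lborel_pair.Fubini_integral[OF Hi]) rule
  also have "\<dots> = (\<integral>s. c * (\<integral>x. H x s \<partial>lborel) \<partial>lborel)" by simp
  also have "\<dots> = (\<integral>s. ft u (\<xi> - s) * of_real (K (\<xi> - (\<xi> - s))) \<partial>lborel)"
    by (intro Bochner_Integration.integral_cong refl) (simp add: H_def ft_def c_def)
  also have "\<dots> = conv K (ft u) \<xi>"
    unfolding conv_def by (rule integral_reflect_shift)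
  finally show ?thesis .
qed

lemma ift_conv:
  assumes K: "kernel K" and F: "L12 F"
  shows "ift (conv K F) x = kt K x * ift F x"
proof -
  have [measurable]: "K \<in> borel_measurable borel" "F \<in> borel_measurable borel"
    using K F by (auto dest: kernel_measurable L12_measurable)
  define c :: complex where "c = of_real (1 / sqrt (2 * pi))"
  define e where "e = (\<lambda>t. exp (\<i> * of_real (x * t)))"
  have [measurable]: "e \<in> borel_measurable borel" unfolding e_def by measurable
  have e1: "cmod (e t) = 1" for t by (simp add: e_def del: of_real_mult)
  have eadd: "e (a + b) = e a * e b" for a b by (simp add: e_def mult_exp_exp algebra_simps)
  define H where "H = (\<lambda>\<xi> y. e \<xi> * (F y * of_real (K (\<xi> - y))))"
  have Hm[measurable]: "case_prod H \<in> borel_measurable (lborel \<Otimes>\<^sub>M lborel)"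
  proof -
    have "case_prod H = (\<lambda>z. e (fst z) * (F (snd z) * of_real (K (fst z - snd z))))"
      by (auto simp: H_def)
    also have "\<dots> \<in> borel_measurable borel" by measurable
    finally show ?thesis by (simp add: lborel_prod)
  qed
  \<comment> \<open>The variables do not separate here, so \<xi> is integrated first: for each y the
    kernel contributes its L^1 norm.\<close>
  have Hi: "integrable (lborel \<Otimes>\<^sub>M lborel) (case_prod H)"
  proof (rule integrableI_bounded)
    have "(\<integral>\<^sup>+ z. ennreal (norm (case_prod H z)) \<partial>(lborel \<Otimes>\<^sub>M lborel)) = (\<integral>\<^sup>+ y. \<integral>\<^sup>+ \<xi>. ennreal (norm (H \<xi> y)) \<partial>lborel \<partial>lborel)"
      by (subst lborel_pair.nn_integral_snd[symmetric]) auto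
    also have "\<dots> = (\<integral>\<^sup>+ y. \<integral>\<^sup>+ \<xi>. ennreal (cmod (F y)) * ennreal \<bar>K (\<xi> - y)\<bar> \<partial>lborel \<partial>lborel)"
      by (simp add: H_def norm_mult e1 ennreal_mult)
    also have "\<dots> = (\<integral>\<^sup>+ y. ennreal (cmod (F y)) * (\<integral>\<^sup>+ s. ennreal \<bar>K s\<bar> \<partial>lborel) \<partial>lborel)"
      by (simp add: nn_integral_kernel_shift)
    also have "\<dots> = (\<integral>\<^sup>+ y. ennreal (cmod (F y)) \<partial>lborel) * (\<integral>\<^sup>+ s. ennreal \<bar>K s\<bar> \<partial>lborel)"
      by (rule nn_integral_multc) auto
    also have "\<dots> < \<infinity>"
      using F kernel_nn_finite[OF K] by (auto simp: L12_def integrable_iff_bounded ennreal_mult_less_top)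
    finally show "(\<integral>\<^sup>+ z. ennreal (norm (case_prod H z)) \<partial>(lborel \<Otimes>\<^sub>M lborel)) < \<infinity>" .
  qed measurable
  have "ift (conv K F) x = c * (\<integral>\<xi>. (\<integral>y. H \<xi> y \<partial>lborel) \<partial>lborel)"
    unfolding ift_def ft_def c_def H_def conv_def e_def by simp
  also have "\<dots> = c * (\<integral>y. (\<integral>\<xi>. H \<xi> y \<partial>lborel) \<partial>lborel)"
    by (subst lborel_pair.Fubini_integral[OF Hi]) rule
  also have "(\<integral>y. (\<integral>\<xi>. H \<xi> y \<partial>lborel) \<partial>lborel) = (\<integral>y. (e y * F y) * kt K x \<partial>lborel)"
  proof (intro Bochner_Integration.integral_cong refl)
    fix y
    have "(\<integral>\<xi>. H \<xi> y \<partial>lborel) = (\<integral>s. H (s + y) y \<partial>lborel)" by (rule integral_shift[symmetric])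
    also have "\<dots> = (\<integral>s. (e y * F y) * (of_real (K s) * e s) \<partial>lborel)"
      unfolding H_def by (intro Bochner_Integration.integral_cong refl) (simp add: eadd mult_ac)
    also have "\<dots> = (e y * F y) * kt K x" unfolding kt_def e_def by simp
    finally show "(\<integral>\<xi>. H \<xi> y \<partial>lborel) = (e y * F y) * kt K x" .
  qed
  also have "\<dots> = (\<integral>y. e y * F y \<partial>lborel) * kt K x" by simp
  finally show ?thesis by (simp add: ift_def ft_def c_def e_def mult_ac)
qed

subsection \<open>Fourier pairs\<close>

abbreviation trunc :: "nat \<Rightarrow> (real \<Rightarrow> complex) \<Rightarrow> real \<Rightarrow> complex" where
  "trunc n u \<equiv> (\<lambda>x. indicator {- real n..real n} x *\<^sub>R u x)"

text \<open>A relation in place of an operator on L^2: g is any function to which the transforms of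
  the integer truncations of u converge in mean square.\<close>

definition ft_pair :: "(real \<Rightarrow> complex) \<Rightarrow> (real \<Rightarrow> complex) \<Rightarrow> bool" where
  "ft_pair u g \<longleftrightarrow> u \<in> borel_measurable borel \<and> g \<in> borel_measurable borel \<and> N2 u < \<infinity> \<and>
     (\<lambda>n. N2 (\<lambda>\<xi>. ft (trunc n u) \<xi> - g \<xi>)) \<longlonglongrightarrow> 0"

lemma fourier_L2_ft_pair:
  assumes "u \<in> borel_measurable lborel" "N2 u < \<infinity>" and F: "fourier_L2 u g"
  shows "ft_pair u g"
proof -
  have "(\<lambda>n. N2 (\<lambda>\<xi>. g \<xi> - of_real (1 / sqrt (2 * pi)) *
          (\<integral>x. indicator {-real n..real n} x *\<^sub>R (exp (- \<i> * of_real (\<xi> * x)) * u x) \<partial>lborel))) \<longlonglongrightarrow> 0"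
    using F filterlim_compose[OF _ filterlim_real_sequentially] unfolding fourier_L2_def N2_def by blast
  then show ?thesis
    using assms unfolding ft_pair_def fourier_L2_def ft_def
    by (subst N2_minus_commute) simp
qed

lemma L12_trunc:
  assumes [measurable]: "u \<in> borel_measurable borel" and fin: "N2 u < \<infinity>"
  shows "L12 (trunc n u)"
proof -
  have le: "N2 (trunc n u) \<le> N2 u" by (intro N2_mono) (auto simp: indicator_def)
  have "integrable lborel (trunc n u)"
  proof (rule Bochner_Integration.integrable_bound)
    show "integrable lborel (\<lambda>x. indicator {- real n..real n} x + (cmod (u x))\<^sup>2)"
      by (intro Bochner_Integration.integrable_add N2_finite_integrable fin) (auto intro: integrable_real_indicator)
    show "AE x in lborel. norm (trunc n u x) \<le> norm (indicator {- real n..real n} x + (cmod (u x))\<^sup>2)"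
    proof (intro AE_I2)
      fix x
      have "0 \<le> (cmod (u x) - 1)\<^sup>2" by simp
      then have "2 * cmod (u x) \<le> 1 + (cmod (u x))\<^sup>2" by (simp add: power2_diff)
      then have "cmod (u x) \<le> 1 + (cmod (u x))\<^sup>2" using norm_ge_zero[of "u x"] by linarith
      then show "norm (trunc n u x) \<le> norm (indicator {- real n..real n} x + (cmod (u x))\<^sup>2)"
        by (auto simp: indicator_def)
    qed
  qed measurable
  then show ?thesis using le fin by (auto simp: L12_def)
qed

text \<open>The weak triangle inequality loses a factor 2 against Plancherel, which is harmless for
  bounds up to constants.\<close>

lemma ft_pair_N2_le:
  assumes p: "ft_pair u g"
  shows "N2 g \<le> 2 * N2 u"
proof -
  have [measurable]: "u \<in> borel_measurable borel" "g \<in> borel_measurable borel" and fin: "N2 u < \<infinity>"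
    and lim: "(\<lambda>n. N2 (\<lambda>\<xi>. ft (trunc n u) \<xi> - g \<xi>)) \<longlonglongrightarrow> 0"
    using p by (auto simp: ft_pair_def)
  have "N2 g \<le> 2 * N2 u + 2 * N2 (\<lambda>\<xi>. ft (trunc n u) \<xi> - g \<xi>)" for n
  proof -
    have "N2 g = N2 (\<lambda>\<xi>. ft (trunc n u) \<xi> - (ft (trunc n u) \<xi> - g \<xi>))" by simp
    also have "\<dots> \<le> 2 * N2 (ft (trunc n u)) + 2 * N2 (\<lambda>\<xi>. ft (trunc n u) \<xi> - g \<xi>)"
      by (rule N2_diff) measurable
    also have "N2 (ft (trunc n u)) = N2 (trunc n u)" by (rule plancherel_L12[OF L12_trunc]) (use fin in auto)
    also have "\<dots> \<le> N2 u" by (intro N2_mono) (auto simp: indicator_def)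
    finally show ?thesis by (simp add: add_mono mult_left_mono)
  qed
  moreover have "(\<lambda>n. 2 * N2 u + 2 * N2 (\<lambda>\<xi>. ft (trunc n u) \<xi> - g \<xi>)) \<longlonglongrightarrow> 2 * N2 u + 2 * 0"
    by (intro tendsto_add tendsto_const ennreal_tendsto_cmult lim) auto
  ultimately show ?thesis
    by (intro LIMSEQ_le_const[of "\<lambda>n. 2 * N2 u + 2 * N2 (\<lambda>\<xi>. ft (trunc n u) \<xi> - g \<xi>)"]) auto
qed

lemma ft_pair_N2_finite: "ft_pair u g \<Longrightarrow> N2 g < \<infinity>"
  using ft_pair_N2_le[of u g] by (auto simp: ft_pair_def ennreal_mult_less_top elim!: le_less_trans)

text \<open>The bridge between the two sides: a multiplier \<open>kt K\<close> on u is a convolution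
  on g. For a truncation of u this is the exact \<open>N2_inverse_diff\<close>; as the truncation
  grows, Young's inequality controls the right side and Fatou's lemma the left. Taking K to be a
  derivative of a mollifier will produce the weight |x|^m, while all derivatives of g stay
  weak.\<close>

lemma ft_pair_conv:
  assumes p: "ft_pair u g" and F: "L12 F" and K: "kernel K"
  shows "N2 (\<lambda>x. kt K x * (u x - ift F x)) \<le> 2 * N2 (conv K (\<lambda>\<xi>. g \<xi> - F \<xi>))"
proof -
  have [measurable]: "u \<in> borel_measurable borel" "g \<in> borel_measurable borel" and fin: "N2 u < \<infinity>"
    and lim: "(\<lambda>n. N2 (\<lambda>\<xi>. ft (trunc n u) \<xi> - g \<xi>)) \<longlonglongrightarrow> 0"
    using p by (auto simp: ft_pair_def)
  have [measurable]: "K \<in> borel_measurable borel" "F \<in> borel_measurable borel"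
    using K F by (auto dest: kernel_measurable L12_measurable)
  have fg: "N2 g < \<infinity>" using p by (rule ft_pair_N2_finite)
  have fF: "N2 F < \<infinity>" using F by (simp add: L12_def)
  define \<kappa> where "\<kappa> = (\<integral>\<^sup>+ s. ennreal \<bar>K s\<bar> \<partial>lborel)"
  have \<kappa>: "\<kappa> < \<infinity>" unfolding \<kappa>_def by (rule kernel_nn_finite[OF K])
  have L: "L12 (trunc n u)" for n by (rule L12_trunc) (use fin in auto)
  have bd: "N2 (\<lambda>x. kt K x * trunc n u x - kt K x * ift F x)
     \<le> 2 * N2 (conv K (\<lambda>\<xi>. g \<xi> - F \<xi>)) + 2 * (\<kappa>\<^sup>2 * N2 (\<lambda>\<xi>. ft (trunc n u) \<xi> - g \<xi>))" for n
  proof -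
    have ftn: "N2 (ft (trunc n u)) < \<infinity>" using L12_ft[OF L] by auto
    have Lk: "L12 (\<lambda>x. kt K x * trunc n u x)"
      by (rule L12_mult_bounded[OF L _ kt_bound[OF K]]) measurable
    have "N2 (\<lambda>x. kt K x * trunc n u x - kt K x * ift F x) = N2 (\<lambda>x. kt K x * trunc n u x - ift (conv K F) x)"
      by (simp add: ift_conv[OF K F])
    also have "\<dots> = N2 (\<lambda>\<xi>. ft (\<lambda>x. kt K x * trunc n u x) \<xi> - conv K F \<xi>)"
      by (rule N2_inverse_diff[OF Lk conv_L12[OF K F]])
    \<comment> \<open>Insert g: the second convolution is the truncation error and disappears in the
      limit.\<close>
    also have "\<dots> = N2 (\<lambda>\<xi>. conv K (\<lambda>\<xi>. g \<xi> - F \<xi>) \<xi> + conv K (\<lambda>\<xi>. ft (trunc n u) \<xi> - g \<xi>) \<xi>)"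
      by (subst (1 2) conv_diff[OF K]) (use ftn fg fF in \<open>auto simp: ft_kt_mult[OF K L] simp del: mult_scaleR_right\<close>)
    also have "\<dots> \<le> 2 * N2 (conv K (\<lambda>\<xi>. g \<xi> - F \<xi>)) + 2 * N2 (conv K (\<lambda>\<xi>. ft (trunc n u) \<xi> - g \<xi>))"
      by (rule N2_add) measurable
    also have "N2 (conv K (\<lambda>\<xi>. ft (trunc n u) \<xi> - g \<xi>)) \<le> \<kappa>\<^sup>2 * N2 (\<lambda>\<xi>. ft (trunc n u) \<xi> - g \<xi>)"
      unfolding \<kappa>_def by (rule N2_conv_le) measurable
    finally show ?thesis by (simp add: add_mono mult_left_mono)
  qed
  have "(\<lambda>n. 2 * N2 (conv K (\<lambda>\<xi>. g \<xi> - F \<xi>)) + 2 * (\<kappa>\<^sup>2 * N2 (\<lambda>\<xi>. ft (trunc n u) \<xi> - g \<xi>)))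
     \<longlonglongrightarrow> 2 * N2 (conv K (\<lambda>\<xi>. g \<xi> - F \<xi>)) + 2 * (\<kappa>\<^sup>2 * 0)"
    using \<kappa> by (intro tendsto_add tendsto_const ennreal_tendsto_cmult lim) (auto simp: power2_eq_square ennreal_mult_less_top)
  then have l2: "(\<lambda>n. 2 * N2 (conv K (\<lambda>\<xi>. g \<xi> - F \<xi>)) + 2 * (\<kappa>\<^sup>2 * N2 (\<lambda>\<xi>. ft (trunc n u) \<xi> - g \<xi>)))
     \<longlonglongrightarrow> 2 * N2 (conv K (\<lambda>\<xi>. g \<xi> - F \<xi>))" by simp
  show ?thesis
    unfolding N2_def[of "\<lambda>x. kt K x * (u x - ift F x)"]
  proof (rule nn_integral_le_LIMSEQ[OF _ _ bd[unfolded N2_def[of "\<lambda>x. kt K x * trunc _ u x - kt K x * ift F x"]] l2])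
    fix x
    have "(\<lambda>n. (cmod (kt K x * trunc n u x - kt K x * ift F x))\<^sup>2) \<longlonglongrightarrow> (cmod (kt K x * u x - kt K x * ift F x))\<^sup>2"
      by (intro tendsto_intros indicator_scale_tendsto)
    then show "(\<lambda>n. ennreal ((cmod (kt K x * trunc n u x - kt K x * ift F x))\<^sup>2)) \<longlonglongrightarrow> ennreal ((cmod (kt K x * (u x - ift F x)))\<^sup>2)"
      by (intro tendsto_ennrealI) (simp add: algebra_simps)
  qed measurable
qed

subsection \<open>Smooth functions, mollifiers and cutoffs\<close>

definition smooth :: "(real \<Rightarrow> real) \<Rightarrow> bool" where
  "smooth f \<longleftrightarrow> (\<forall>k x. ((deriv ^^ k) f has_real_derivative (deriv ^^ Suc k) f x) (at x))"

text \<open>Coinduction: a set of functions closed under differentiation contains only smooth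
  functions. Each closure property below amounts to exhibiting such a set, so that only first
  derivatives are ever computed.\<close>

lemma smooth_coinduct:
  assumes "f \<in> S" and step: "\<And>g. g \<in> S \<Longrightarrow> \<exists>g'\<in>S. \<forall>x. (g has_real_derivative g' x) (at x)"
  shows "smooth f"
proof -
  have S: "(deriv ^^ k) f \<in> S" for k
  proof (induction k)
    case (Suc k)
    obtain g' where g': "g' \<in> S" "\<forall>x. ((deriv ^^ k) f has_real_derivative g' x) (at x)"
      using step[OF Suc] by blast
    then have "deriv ((deriv ^^ k) f) = g'" by (auto intro: DERIV_imp_deriv)
    then show ?case using g' by simp
  qed (use assms in auto)
  show ?thesis
    unfolding smooth_def
  proof (intro allI)
    fix k x
    obtain g' where g': "\<forall>x. ((deriv ^^ k) f has_real_derivative g' x) (at x)" using step[OF S] by blast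
    then have "deriv ((deriv ^^ k) f) = g'" by (auto intro: DERIV_imp_deriv)
    then show "((deriv ^^ k) f has_real_derivative (deriv ^^ Suc k) f x) (at x)" using g' by simp
  qed
qed

lemma smooth_DERIV: "smooth f \<Longrightarrow> (f has_real_derivative deriv f x) (at x)"
  unfolding smooth_def by (metis funpow_0 funpow.simps(2) o_apply)

lemma smooth_deriv: "smooth f \<Longrightarrow> smooth (deriv f)"
  unfolding smooth_def by (metis funpow_Suc_right o_apply)

lemma smooth_derivs: "smooth f \<Longrightarrow> smooth ((deriv ^^ k) f)"
  by (induction k) (auto intro: smooth_deriv)

lemma smooth_continuous: "smooth f \<Longrightarrow> continuous_on A f"
  by (meson DERIV_continuous_on has_field_derivative_at_within smooth_DERIV)

lemma smooth_measurable: "smooth f \<Longrightarrow> f \<in> borel_measurable borel"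
  by (intro borel_measurable_continuous_onI smooth_continuous)

lemma smooth_antideriv:
  assumes "\<And>x. (P has_real_derivative f x) (at x)" "smooth f"
  shows "smooth P"
proof (rule smooth_coinduct[where S="insert P {f. smooth f}"])
  fix g assume "g \<in> insert P {f. smooth f}"
  then show "\<exists>g'\<in>insert P {f. smooth f}. \<forall>x. (g has_real_derivative g' x) (at x)"
    using assms smooth_DERIV smooth_deriv by (metis insert_iff mem_Collect_eq)
qed auto

lemma smooth_const: "smooth (\<lambda>x. c)"
  by (rule smooth_coinduct[where S="range (\<lambda>c x. c)"]) (auto intro!: bexI[of _ "\<lambda>x. 0"] derivative_eq_intros)

lemma smooth_add:
  assumes "smooth f" "smooth g" shows "smooth (\<lambda>x. f x + g x)"
proof (rule smooth_coinduct[where S="{\<lambda>x. f x + g x | f g. smooth f \<and> smooth g}"])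
  fix h assume "h \<in> {\<lambda>x. f x + g x | f g. smooth f \<and> smooth g}"
  then obtain f g where h: "h = (\<lambda>x. f x + g x)" "smooth f" "smooth g" by blast
  then have "\<forall>x. (h has_real_derivative (deriv f x + deriv g x)) (at x)"
    by (auto intro!: derivative_intros smooth_DERIV)
  moreover have "(\<lambda>x. deriv f x + deriv g x) \<in> {\<lambda>x. f x + g x | f g. smooth f \<and> smooth g}"
    using h smooth_deriv by blast
  ultimately show "\<exists>g'\<in>{\<lambda>x. f x + g x | f g. smooth f \<and> smooth g}. \<forall>x. (h has_real_derivative g' x) (at x)"
    by (intro bexI) auto
qed (use assms in auto)

lemma smooth_affine:
  assumes "smooth f" shows "smooth (\<lambda>x. c * f (a * x + b))"
proof (rule smooth_coinduct[where S="{\<lambda>x. c * f (a * x + b) | c f. smooth f}"])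
  fix h assume "h \<in> {\<lambda>x. c * f (a * x + b) | c f. smooth f}"
  then obtain f c where h: "h = (\<lambda>x. c * f (a * x + b))" "smooth f" by blast
  have "\<forall>x. (h has_real_derivative (c * a) * deriv f (a * x + b)) (at x)"
  proof
    fix x
    have "((\<lambda>x. f (a * x + b)) has_real_derivative deriv f (a * x + b) * a) (at x)"
      by (rule DERIV_chain2[of f]) (auto intro!: derivative_eq_intros smooth_DERIV h)
    then show "(h has_real_derivative (c * a) * deriv f (a * x + b)) (at x)"
      unfolding h by (auto intro!: derivative_eq_intros)
  qed
  moreover have "(\<lambda>x. (c * a) * deriv f (a * x + b)) \<in> {\<lambda>x. c * f (a * x + b) | c f. smooth f}"
    using h(2) smooth_deriv by blast
  ultimately show "\<exists>g'\<in>{\<lambda>x. c * f (a * x + b) | c f. smooth f}. \<forall>x. (h has_real_derivative g' x) (at x)"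
    by (intro bexI) auto
qed (use assms in auto)

lemma smooth_cmult: "smooth f \<Longrightarrow> smooth (\<lambda>x. c * f x)"
  using smooth_affine[of f c 1 0] by simp

lemma smooth_diff: "smooth f \<Longrightarrow> smooth g \<Longrightarrow> smooth (\<lambda>x. f x - g x)"
  using smooth_add[OF _ smooth_cmult[of g "-1"], of f] by simp

text \<open>A single product is not reproduced by the product rule, but sums of products are; this
  is the set for the coinduction.\<close>

inductive_set smooth_products :: "(real \<Rightarrow> real) set" where
  prod: "smooth f \<Longrightarrow> smooth g \<Longrightarrow> (\<lambda>x. f x * g x) \<in> smooth_products"
| add: "f \<in> smooth_products \<Longrightarrow> g \<in> smooth_products \<Longrightarrow> (\<lambda>x. f x + g x) \<in> smooth_products"

lemma smooth_mult:
  assumes "smooth f" "smooth g" shows "smooth (\<lambda>x. f x * g x)"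
proof (rule smooth_coinduct[where S=smooth_products])
  show "(\<lambda>x. f x * g x) \<in> smooth_products" using assms by (rule smooth_products.prod)
  fix h assume "h \<in> smooth_products"
  then show "\<exists>g'\<in>smooth_products. \<forall>x. (h has_real_derivative g' x) (at x)"
  proof induction
    case (prod f g)
    have "\<forall>x. ((\<lambda>x. f x * g x) has_real_derivative (deriv f x * g x + f x * deriv g x)) (at x)"
      using prod by (auto intro!: derivative_eq_intros smooth_DERIV)
    moreover have "(\<lambda>x. deriv f x * g x + f x * deriv g x) \<in> smooth_products"
      using prod by (intro smooth_products.intros smooth_deriv)
    ultimately show ?case by (intro bexI) auto
  next
    case (add f g)
    then obtain f' g' where "f' \<in> smooth_products" "\<forall>x. (f has_real_derivative f' x) (at x)"
      "g' \<in> smooth_products" "\<forall>x. (g has_real_derivative g' x) (at x)" by blast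
    then show ?case
      by (intro bexI[of _ "\<lambda>x. f' x + g' x"]) (auto intro!: derivative_intros smooth_products.add)
  qed
qed

text \<open>On an open set the vanishing of one derivative passes to the next, since a derivative
  depends on values near the point only.\<close>

lemma derivs_zero_open:
  assumes "smooth f" "open U" "\<And>x. x \<in> U \<Longrightarrow> f x = 0" "x \<in> U"
  shows "(deriv ^^ k) f x = 0"
  using assms(4)
proof (induction k arbitrary: x)
  case (Suc k)
  have "((\<lambda>x. 0) has_real_derivative 0) (at x)" by simp
  then have "((deriv ^^ k) f has_real_derivative 0) (at x)"
    by (rule has_field_derivative_transform_within_open[OF _ assms(2) Suc.prems]) (simp add: Suc.IH)
  then show ?case by (simp add: DERIV_imp_deriv)
qed (use assms in auto)

lemma poly_exp_minus_tendsto_0: "((\<lambda>x::real. poly p x * exp (- x)) \<longlongrightarrow> 0) at_top"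
proof -
  have "((\<lambda>x. \<Sum>i\<le>degree p. coeff p i * (x ^ i / exp x)) \<longlongrightarrow> (\<Sum>i\<le>degree p. coeff p i * 0)) at_top"
    by (intro tendsto_sum tendsto_mult tendsto_const tendsto_power_div_exp_0)
  moreover have "(\<Sum>i\<le>degree p. coeff p i * (x ^ i / exp x)) = poly p x * exp (- x)" for x
    by (simp add: poly_altdef sum_distrib_right exp_minus divide_inverse sum_distrib_left mult_ac)
  ultimately show ?thesis by simp
qed

lemma smooth_exp_inverse: "smooth (\<lambda>x. if x > 0 then exp (- (1 / x)) else 0)"
proof (rule smooth_coinduct[where S="range (\<lambda>p x. if x > 0 then poly p (1 / x) * exp (- (1 / x)) else 0)"])
  show "(\<lambda>x::real. if x > 0 then exp (- (1 / x)) else 0) \<in> range (\<lambda>p x. if x > 0 then poly p (1 / x) * exp (- (1 / x)) else 0)"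
    by (rule range_eqI[of _ _ 1]) auto
  fix g :: "real \<Rightarrow> real"
  assume "g \<in> range (\<lambda>p x. if x > 0 then poly p (1 / x) * exp (- (1 / x)) else 0)"
  then obtain p :: "real poly" where g: "g = (\<lambda>x. if x > 0 then poly p (1 / x) * exp (- (1 / x)) else 0)" by blast
  \<comment> \<open>Differentiating p(1/x) exp(-1/x) gives x^(-2) (p - p')(1/x) exp(-1/x), which has
    the same shape.\<close>
  define q where "q = [:0, 0, 1:] * (p - pderiv p)"
  define g' :: "real \<Rightarrow> real" where "g' = (\<lambda>x. if x > 0 then poly q (1 / x) * exp (- (1 / x)) else 0)"
  have "(g has_real_derivative g' x) (at x)" for x
  proof -
    consider "x > 0" | "x < 0" | "x = 0" by linarith
    then show ?thesis
    proof cases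
      case 1
      have "((\<lambda>x. poly p (1 / x) * exp (- (1 / x))) has_real_derivative g' x) (at x)"
        using 1 unfolding g'_def q_def
        by (auto intro!: derivative_eq_intros poly_DERIV[THEN DERIV_chain2] simp: field_simps power2_eq_square)
      then show ?thesis
        unfolding g by (rule has_field_derivative_transform_within_open[where S="{0<..}"]) (use 1 in auto)
    next
      case 2
      have "((\<lambda>x. 0) has_real_derivative g' x) (at x)" using 2 by (auto simp: g'_def)
      then show ?thesis
        unfolding g by (rule has_field_derivative_transform_within_open[where S="{..<0}"]) (use 2 in auto)
    next
      case 3
      have "((\<lambda>h. (g (0 + h) - g 0) / h) \<longlongrightarrow> 0) (at 0)"
      proof (rule filterlim_split_at)
        have "eventually (\<lambda>h. 0 = (g (0 + h) - g 0) / h) (at_left 0)"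
          by (auto simp: eventually_at_filter g)
        then show "((\<lambda>h. (g (0 + h) - g 0) / h) \<longlongrightarrow> 0) (at_left 0)"
          by (rule Lim_transform_eventually[OF tendsto_const])
        \<comment> \<open>Dividing by h multiplies the polynomial in 1/h by its variable, which is
          what \<open>pCons 0 p\<close> encodes; the exponential still wins.\<close>
        have "((\<lambda>h. poly (pCons 0 p) (inverse h) * exp (- inverse h)) \<longlongrightarrow> 0) (at_right 0)"
          by (rule filterlim_compose[OF poly_exp_minus_tendsto_0 filterlim_inverse_at_top_right])
        moreover have "eventually (\<lambda>h. poly (pCons 0 p) (inverse h) * exp (- inverse h) = (g (0 + h) - g 0) / h) (at_right 0)"
          by (auto simp: eventually_at_filter g field_simps)
        ultimately show "((\<lambda>h. (g (0 + h) - g 0) / h) \<longlongrightarrow> 0) (at_right 0)"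
          by (rule Lim_transform_eventually)
      qed
      then show ?thesis using 3 by (simp add: DERIV_def g'_def)
    qed
  qed
  then show "\<exists>g'\<in>range (\<lambda>p x. if x > 0 then poly p (1 / x) * exp (- (1 / x)) else 0). \<forall>x. (g has_real_derivative g' x) (at x)"
    by (intro bexI[of _ g']) (auto simp: g'_def)
qed

lemma bounded_support_kernel:
  assumes c: "continuous_on UNIV (f :: real \<Rightarrow> real)" and z: "\<And>x. \<bar>x\<bar> > R \<Longrightarrow> f x = 0"
  shows "kernel f"
proof -
  have "compact (f ` {-R..R})" by (intro compact_continuous_image continuous_on_subset[OF c]) auto
  then obtain b where b: "\<And>x. x \<in> {-R..R} \<Longrightarrow> \<bar>f x\<bar> \<le> b"
    using compact_imp_bounded by (fastforce simp: bounded_iff)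
  have bd: "\<bar>f x\<bar> \<le> max b 0" for x
    using b[of x] z[of x] by (cases "\<bar>x\<bar> > R") force+
  have "set_integrable lborel {-R..R} f"
    unfolding set_integrable_def by (intro borel_integrable_compact continuous_on_subset[OF c]) auto
  moreover have "(\<lambda>x. indicator {-R..R} x *\<^sub>R f x) = f"
  proof
    fix x show "indicator {-R..R} x *\<^sub>R f x = f x" using z[of x] by (cases "\<bar>x\<bar> > R") (auto simp: indicator_def)
  qed
  ultimately show ?thesis unfolding kernel_def using bd by (auto simp: set_integrable_def)
qed

lemma mollifier_exists:
  obtains \<phi> :: "real \<Rightarrow> real" where "smooth \<phi>" "\<And>x. \<phi> x \<ge> 0" "\<And>x. \<bar>x\<bar> \<ge> 1 \<Longrightarrow> \<phi> x = 0"
    "integrable lborel \<phi>" "(\<integral>x. \<phi> x \<partial>lborel) = 1"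
proof -
  define E :: "real \<Rightarrow> real" where "E = (\<lambda>x. if x > 0 then exp (- (1 / x)) else 0)"
  \<comment> \<open>Positive exactly on (-1,1), where both arguments of E are positive.\<close>
  define \<eta> where "\<eta> = (\<lambda>x. E (1 + x) * E (1 - x))"
  have "smooth E" unfolding E_def by (rule smooth_exp_inverse)
  then have s: "smooth \<eta>"
    unfolding \<eta>_def using smooth_affine[of E 1 1 1] smooth_affine[of E 1 "-1" 1]
    by (intro smooth_mult) (auto simp: add.commute)
  have nn: "\<eta> x \<ge> 0" for x by (auto simp: \<eta>_def E_def)
  have z: "\<bar>x\<bar> \<ge> 1 \<Longrightarrow> \<eta> x = 0" for x by (auto simp: \<eta>_def E_def)
  have pos: "\<bar>x\<bar> < 1 \<Longrightarrow> \<eta> x > 0" for x by (auto simp: \<eta>_def E_def)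
  have "kernel \<eta>" by (rule bounded_support_kernel[where R=1]) (use s z in \<open>auto intro: smooth_continuous\<close>)
  then have i: "integrable lborel \<eta>" by (simp add: kernel_def)
  define c where "c = (\<integral>x. \<eta> x \<partial>lborel)"
  have "c \<noteq> 0"
  proof
    assume "c = 0"
    then have "AE x in lborel. \<eta> x = 0"
      unfolding c_def using integral_nonneg_eq_0_iff_AE[OF i] nn by auto
    then have "AE x in lborel. x \<notin> {-1<..<1::real}" 
    proof eventually_elim
      case (elim x)
      then show ?case using pos[of x] by (auto simp: abs_less_iff)
    qed
    then have "{-1<..<1::real} \<in> null_sets lborel" using AE_iff_null_sets[of "{-1<..<1::real}" lborel] by simp
    then have "emeasure lborel {-1<..<1::real} = 0" by (rule null_setsD1)
    moreover have "emeasure lborel {-1<..<1::real} = ennreal 2" by (subst emeasure_lborel_Ioo) auto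
    ultimately show False by simp
  qed
  moreover have "c \<ge> 0" unfolding c_def by (intro integral_nonneg_AE AE_I2 nn)
  ultimately have c: "c > 0" by simp
  show ?thesis
  proof (rule that[of "\<lambda>x. (1 / c) * \<eta> x"])
    show "smooth (\<lambda>x. (1 / c) * \<eta> x)" by (intro smooth_cmult s)
    show "(\<integral>x. (1 / c) * \<eta> x \<partial>lborel) = 1" using c by (simp add: c_def[symmetric])
  qed (use nn z i c in auto)
qed

lemma nn_integral_FTC_nonneg:
  assumes "\<And>x. (P has_real_derivative \<phi> x) (at x)" "\<And>x. \<phi> x \<ge> 0" "\<phi> \<in> borel_measurable borel" "a \<le> b"
  shows "(\<integral>\<^sup>+ t. ennreal (\<phi> t) * indicator {a..b} t \<partial>lborel) = ennreal (P b - P a)"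
  using assms by (intro nn_integral_FTC_Icc) (auto intro: DERIV_subset has_field_derivative_at_within)

lemma primitive_exists:
  assumes s: "smooth \<phi>" and nn: "\<And>x. \<phi> x \<ge> 0" and z: "\<And>x. \<bar>x\<bar> \<ge> 1 \<Longrightarrow> \<phi> x = 0"
    and i: "integrable lborel \<phi>" and one: "(\<integral>x. \<phi> x \<partial>lborel) = 1"
  obtains P where "\<And>x. (P has_real_derivative \<phi> x) (at x)" "mono P" "\<And>x. x \<le> -1 \<Longrightarrow> P x = 0" "\<And>x. x \<ge> 1 \<Longrightarrow> P x = 1"
proof -
  \<comment> \<open>Starting at -2 makes every x \<ge> -1 an interior point of the interval on which
    the primitive is differentiated.\<close>
  define P where "P = (\<lambda>x. integral {-2..x} \<phi>)"
  have c: "continuous_on A \<phi>" for A using s by (rule smooth_continuous)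
  have P0: "P x = 0" if "x \<le> -1" for x
  proof -
    have "P x = integral {-2..x} (\<lambda>x. 0)" unfolding P_def by (intro Henstock_Kurzweil_Integration.integral_cong z) (use that in auto)
    then show ?thesis by simp
  qed
  have D: "(P has_real_derivative \<phi> x) (at x)" for x
  proof (cases "x < -1")
    case True
    have "((\<lambda>x. 0) has_real_derivative \<phi> x) (at x)" using z[of x] True by simp
    then show ?thesis
      by (rule has_field_derivative_transform_within_open[where S="{..<-1}"]) (use True P0 in auto)
  next
    case False
    have "(P has_real_derivative \<phi> x) (at x within {-2..x+1})"
      unfolding P_def by (rule integral_has_real_derivative[OF c]) (use False in auto)
    moreover have "at x within {-2..x+1} = at x" by (rule at_within_interior) (use False in auto)
    ultimately show ?thesis by simp
  qed
  have m: "mono P"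
  proof (rule monoI)
    fix a b :: real assume "a \<le> b"
    then show "P a \<le> P b" using DERIV_nonneg_imp_nondecreasing[of a b P] D nn by blast
  qed
  have P1: "P x = 1" if "x \<ge> 1" for x
  proof -
    have [measurable]: "\<phi> \<in> borel_measurable borel" using s by (rule smooth_measurable)
    have "(\<integral>\<^sup>+ t. ennreal (\<phi> t) * indicator {-1..x} t \<partial>lborel) = ennreal (P x - P (-1))"
      by (rule nn_integral_FTC_nonneg[OF D nn]) (use that in auto)
    moreover have "(\<integral>\<^sup>+ t. ennreal (\<phi> t) * indicator {-1..x} t \<partial>lborel) = (\<integral>\<^sup>+ t. ennreal (\<phi> t) \<partial>lborel)"
    proof (intro nn_integral_cong)
      fix t show "ennreal (\<phi> t) * indicator {-1..x} t = ennreal (\<phi> t)"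
        using z[of t] that by (cases "\<bar>t\<bar> \<ge> 1") (auto simp: indicator_def)
    qed
    moreover have "(\<integral>\<^sup>+ t. ennreal (\<phi> t) \<partial>lborel) = 1"
      using i nn one by (subst nn_integral_eq_integral) auto
    moreover have "P x \<ge> P (-1)" using monoD[OF m, of "-1" x] that by simp
    ultimately show ?thesis using P0[of "-1"] by (simp add: ennreal_eq_1)
  qed
  show ?thesis by (rule that[of P]) (use D m P0 P1 in auto)
qed

lemma cutoff_exists:
  obtains \<theta> :: "real \<Rightarrow> real" where "smooth \<theta>" "\<And>x. 0 \<le> \<theta> x" "\<And>x. \<theta> x \<le> 1"
    "\<And>x. \<bar>x\<bar> \<le> 17/16 \<Longrightarrow> \<theta> x = 0" "\<And>x. \<bar>x\<bar> \<ge> 9/8 \<Longrightarrow> \<theta> x = 1"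
proof -
  obtain \<phi> where \<phi>: "smooth \<phi>" "\<And>x. \<phi> x \<ge> 0" "\<And>x. \<bar>x\<bar> \<ge> 1 \<Longrightarrow> \<phi> x = 0"
    "integrable lborel \<phi>" "(\<integral>x. \<phi> x \<partial>lborel) = 1" using mollifier_exists by blast
  obtain P where P: "\<And>x. (P has_real_derivative \<phi> x) (at x)" "mono P" "\<And>x. x \<le> -1 \<Longrightarrow> P x = 0" "\<And>x. x \<ge> 1 \<Longrightarrow> P x = 1"
    using primitive_exists[OF \<phi>] by metis
  have P01: "0 \<le> P x" "P x \<le> 1" for x
    using monoD[OF P(2), of "min x (-1)" x] monoD[OF P(2), of x "max x 1"] P(3)[of "min x (-1)"] P(4)[of "max x 1"] by auto
  have sP: "smooth P" by (rule smooth_antideriv[OF P(1) \<phi>(1)])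
  show ?thesis
  \<comment> \<open>The difference of the two values of P is 1 for |32 x| \<le> 34 and 0 for |32 x|
    \<ge> 36, which gives the radii 17/16 and 9/8.\<close>
  proof (rule that[of "\<lambda>x. 1 - (P (32 * x + 35) - P (32 * x + (-35)))"])
    show "smooth (\<lambda>x. 1 - (P (32 * x + 35) - P (32 * x + (-35))))"
      using smooth_affine[OF sP, of 1 32 35] smooth_affine[OF sP, of 1 32 "-35"] by (intro smooth_diff smooth_const) auto
    fix x
    show "0 \<le> 1 - (P (32 * x + 35) - P (32 * x + (-35)))" using P01[of "32 * x + 35"] P01[of "32 * x + (-35)"] by linarith
    show "1 - (P (32 * x + 35) - P (32 * x + (-35))) \<le> 1" using monoD[OF P(2), of "32 * x + (-35)" "32 * x + 35"] by simp
    show "\<bar>x\<bar> \<le> 17/16 \<Longrightarrow> 1 - (P (32 * x + 35) - P (32 * x + (-35))) = 0"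
      by (subst P(4), linarith, subst P(3), linarith) simp
    assume x: "\<bar>x\<bar> \<ge> 9/8"
    show "1 - (P (32 * x + 35) - P (32 * x + (-35))) = 1"
    proof (cases "x \<ge> 0")
      case True
      then show ?thesis using x by (subst (1 2) P(4)) auto
    next
      case False
      then show ?thesis using x by (subst (1 2) P(3)) auto
    qed
  qed
qed

subsection \<open>Test functions\<close>

lemma test_fun_smooth: "test_fun \<Omega> \<phi> \<longleftrightarrow> smooth \<phi> \<and> compact (closure {x. \<phi> x \<noteq> 0}) \<and> closure {x. \<phi> x \<noteq> 0} \<subseteq> \<Omega>"
  by (simp add: test_fun_def smooth_def)

text \<open>A closed set A inside \<Omega> is asked for because the support is a closure: a function
  that merely vanishes outside \<Omega> may have a support that touches the boundary.\<close>

lemma test_funI: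
  assumes "smooth \<phi>" "closed A" "A \<subseteq> \<Omega>" "\<And>x. x \<notin> A \<Longrightarrow> \<phi> x = 0" "\<And>x. \<bar>x\<bar> > R \<Longrightarrow> \<phi> x = 0"
  shows "test_fun \<Omega> \<phi>"
proof -
  have "{x. \<phi> x \<noteq> 0} \<subseteq> A \<inter> {-R..R}"
  proof
    fix x assume "x \<in> {x. \<phi> x \<noteq> 0}"
    then show "x \<in> A \<inter> {-R..R}" using assms(4)[of x] assms(5)[of x] by (cases "\<bar>x\<bar> > R") auto
  qed
  then have c: "closure {x. \<phi> x \<noteq> 0} \<subseteq> A \<inter> {-R..R}" using assms(2) by (intro closure_minimal) auto
  then have "bounded (closure {x. \<phi> x \<noteq> 0})"
    by (rule bounded_subset[OF bounded_closed_interval[of "-R" R] order_trans[OF _ inf_le2]])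
  moreover have "closure {x. \<phi> x \<noteq> 0} \<subseteq> \<Omega>"
    by (rule order_trans[OF c le_infI1[OF assms(3)]])
  ultimately show ?thesis
    unfolding test_fun_smooth compact_eq_bounded_closed by (intro conjI assms(1) closed_closure)
qed

lemma derivs_affine:
  assumes "smooth f"
  shows "(deriv ^^ k) (\<lambda>x. f (a * x + b)) = (\<lambda>x. a ^ k * (deriv ^^ k) f (a * x + b))"
proof (induction k)
  case (Suc k)
  have "((\<lambda>x. a ^ k * (deriv ^^ k) f (a * x + b)) has_real_derivative a ^ Suc k * (deriv ^^ Suc k) f (a * x + b)) (at x)" for x
  proof -
    have "((\<lambda>x. (deriv ^^ k) f (a * x + b)) has_real_derivative (deriv ^^ Suc k) f (a * x + b) * a) (at x)"
      by (rule DERIV_chain2[of "(deriv ^^ k) f"]) (use assms in \<open>auto intro!: derivative_eq_intros simp: smooth_def simp del: funpow.simps\<close>)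
    from DERIV_cmult[OF this, of "a ^ k"] show ?thesis by (simp add: mult_ac)
  qed
  then have "deriv (\<lambda>x. a ^ k * (deriv ^^ k) f (a * x + b)) = (\<lambda>x. a ^ Suc k * (deriv ^^ Suc k) f (a * x + b))"
    by (intro ext DERIV_imp_deriv)
  then show ?case using Suc by simp
qed auto

definition csmooth :: "(real \<Rightarrow> real) \<Rightarrow> bool" where
  "csmooth f \<longleftrightarrow> smooth f \<and> (\<exists>R. \<forall>x. \<bar>x\<bar> > R \<longrightarrow> f x = 0)"

lemma csmooth_smooth: "csmooth f \<Longrightarrow> smooth f"
  by (simp add: csmooth_def)

lemma csmooth_kernel: "csmooth f \<Longrightarrow> kernel f"
  unfolding csmooth_def by (meson bounded_support_kernel smooth_continuous)

lemma csmooth_measurable: "csmooth f \<Longrightarrow> f \<in> borel_measurable borel"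
  by (simp add: csmooth_smooth smooth_measurable)

lemma csmooth_derivs: "csmooth f \<Longrightarrow> csmooth ((deriv ^^ k) f)"
proof -
  assume f: "csmooth f"
  then obtain R where R: "\<And>x. \<bar>x\<bar> > R \<Longrightarrow> f x = 0" by (auto simp: csmooth_def)
  have "(deriv ^^ k) f x = 0" if "\<bar>x\<bar> > R" for x
    by (rule derivs_zero_open[where U="{x. \<bar>x\<bar> > R}"])
       (use f R that in \<open>auto simp: csmooth_def intro!: open_Collect_less continuous_intros\<close>)
  then show ?thesis using f smooth_derivs by (auto simp: csmooth_def)
qed

lemma csmooth_deriv: "csmooth f \<Longrightarrow> csmooth (deriv f)"
  using csmooth_derivs[of f 1] by simp

lemma csmooth_diff: "csmooth f \<Longrightarrow> csmooth g \<Longrightarrow> csmooth (\<lambda>x. f x - g x)"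
  unfolding csmooth_def
proof (elim conjE exE, intro conjI smooth_diff)
  fix R R' assume "\<forall>x. \<bar>x\<bar> > R \<longrightarrow> f x = 0" "\<forall>x. \<bar>x\<bar> > R' \<longrightarrow> g x = 0"
  then show "\<exists>R. \<forall>x. \<bar>x\<bar> > R \<longrightarrow> f x - g x = 0" by (intro exI[of _ "max R R'"]) auto
qed

lemma csmooth_affine:
  assumes f: "csmooth f" and a: "\<bar>a\<bar> = 1"
  shows "csmooth (\<lambda>x. f (a * x + b))"
proof -
  obtain R where R: "\<And>x. \<bar>x\<bar> > R \<Longrightarrow> f x = 0" using f by (auto simp: csmooth_def)
  have "f (a * x + b) = 0" if "\<bar>x\<bar> > R + \<bar>b\<bar>" for x
  proof (rule R)
    have "\<bar>a * x\<bar> = \<bar>x\<bar>" using a by (simp add: abs_mult)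
    then show "\<bar>a * x + b\<bar> > R" using that by linarith
  qed
  then show ?thesis using f smooth_affine[of f 1 a b] by (auto simp: csmooth_def)
qed

subsection \<open>The cutoff in frequency\<close>

text \<open>Vanishing beyond \<open>[-1,1]\<close> turns products with smooth functions into test functions on the complement;
  the outer radius \<open>9/8\<close> is what the error exponent of the Gaussian approximation tolerates.\<close>

definition cutoff :: "real \<Rightarrow> real" where
  "cutoff = (SOME \<theta>. smooth \<theta> \<and> (\<forall>x. 0 \<le> \<theta> x) \<and> (\<forall>x. \<theta> x \<le> 1) \<and> (\<forall>x. \<bar>x\<bar> \<le> 17/16 \<longrightarrow> \<theta> x = 0) \<and> (\<forall>x. \<bar>x\<bar> \<ge> 9/8 \<longrightarrow> \<theta> x = 1))"

lemma cutoff: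
  shows smooth_cutoff: "smooth cutoff" and cutoff_nonneg: "0 \<le> cutoff x" and cutoff_le_1: "cutoff x \<le> 1"
    and cutoff_0: "\<bar>x\<bar> \<le> 17/16 \<Longrightarrow> cutoff x = 0" and cutoff_1: "\<bar>x\<bar> \<ge> 9/8 \<Longrightarrow> cutoff x = 1"
proof -
  have "\<exists>\<theta>. smooth \<theta> \<and> (\<forall>x. 0 \<le> \<theta> x) \<and> (\<forall>x. \<theta> x \<le> 1) \<and> (\<forall>x. \<bar>x\<bar> \<le> 17/16 \<longrightarrow> \<theta> x = 0) \<and> (\<forall>x. \<bar>x\<bar> \<ge> 9/8 \<longrightarrow> \<theta> x = 1)"
    using cutoff_exists by metis
  from someI_ex[OF this]
  show "smooth cutoff" "0 \<le> cutoff x" "cutoff x \<le> 1"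
    "\<bar>x\<bar> \<le> 17/16 \<Longrightarrow> cutoff x = 0" "\<bar>x\<bar> \<ge> 9/8 \<Longrightarrow> cutoff x = 1"
    unfolding cutoff_def[symmetric] by auto
qed

lemma cutoff_measurable[measurable]: "(deriv ^^ j) cutoff \<in> borel_measurable borel" "cutoff \<in> borel_measurable borel"
  by (auto intro!: smooth_measurable smooth_derivs smooth_cutoff)

lemma cutoff_derivs_0: "\<bar>x\<bar> < 17/16 \<Longrightarrow> (deriv ^^ j) cutoff x = 0"
  by (rule derivs_zero_open[where U="{x. \<bar>x\<bar> < 17/16}"])
     (auto intro!: smooth_cutoff cutoff_0 open_Collect_less continuous_intros)

lemma csmooth_1_cutoff: "csmooth (\<lambda>x. 1 - cutoff x)"
  unfolding csmooth_def using cutoff_1 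
  by (intro conjI smooth_diff smooth_const smooth_cutoff exI[of _ "9/8"]) auto

lemma cutoff_derivs_bounded: "\<exists>c\<ge>1. \<forall>x. \<bar>(deriv ^^ j) cutoff x\<bar> \<le> c"
proof (cases j)
  case 0
  then show ?thesis using cutoff_nonneg cutoff_le_1 by (intro exI[of _ 1]) auto
next
  case (Suc i)
  \<comment> \<open>\<open>cutoff\<close> itself is not compactly supported, but from the first
    derivative on it agrees up to sign with 1 - \<open>cutoff\<close>, which is.\<close>
  have "deriv (\<lambda>x. 1 - cutoff x) = (\<lambda>x. - deriv cutoff x)"
    by (intro ext DERIV_imp_deriv) (auto intro!: derivative_eq_intros smooth_DERIV smooth_cutoff)
  moreover have "csmooth ((deriv ^^ i) (deriv (\<lambda>x. 1 - cutoff x)))"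
    by (intro csmooth_derivs csmooth_deriv csmooth_1_cutoff)
  moreover have "(deriv ^^ i) (\<lambda>x. - deriv cutoff x) = (\<lambda>x. - (deriv ^^ i) (deriv cutoff) x)"
  proof (induction i)
    case (Suc i)
    have "deriv (\<lambda>x. - (deriv ^^ i) (deriv cutoff) x) = (\<lambda>x. - deriv ((deriv ^^ i) (deriv cutoff)) x)"
      by (intro ext DERIV_imp_deriv) (auto intro!: derivative_eq_intros smooth_DERIV smooth_derivs smooth_deriv smooth_cutoff)
    then show ?case using Suc by simp
  qed simp
  ultimately have "csmooth (\<lambda>x. - (deriv ^^ i) (deriv cutoff) x)" by simp
  then have "kernel (\<lambda>x. - (deriv ^^ i) (deriv cutoff) x)" by (rule csmooth_kernel)
  then obtain c where "\<And>x. \<bar>(deriv ^^ i) (deriv cutoff) x\<bar> \<le> c" by (auto simp: kernel_def)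
  then have "\<forall>x. \<bar>(deriv ^^ j) cutoff x\<bar> \<le> max 1 c"
    unfolding Suc funpow_Suc_right o_def by (simp add: le_max_iff_disj)
  then show ?thesis by (intro exI[of _ "max 1 c"]) auto
qed

lemma derivs_diff:
  assumes "smooth f" "smooth g"
  shows "(deriv ^^ k) (\<lambda>x. f x - g x) = (\<lambda>x. (deriv ^^ k) f x - (deriv ^^ k) g x)"
proof (induction k)
  case (Suc k)
  have "deriv (\<lambda>x. (deriv ^^ k) f x - (deriv ^^ k) g x) = (\<lambda>x. deriv ((deriv ^^ k) f) x - deriv ((deriv ^^ k) g) x)"
    by (intro ext DERIV_imp_deriv) (auto intro!: derivative_intros smooth_DERIV smooth_derivs assms)
  then show ?case using Suc by simp
qed simp

lemma deriv_mult_smooth: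
  assumes "smooth f" "smooth g"
  shows "deriv (\<lambda>x. f x * g x) = (\<lambda>x. deriv f x * g x + f x * deriv g x)"
  by (intro ext DERIV_imp_deriv) (auto intro!: derivative_eq_intros smooth_DERIV assms)

text \<open>Leibniz' rule in the adjoint form, where all derivatives of \<open>\<phi>\<close> are moved outside.\<close>

lemma adjoint_leibniz:
  "\<exists>a::nat \<Rightarrow> real. (\<forall>\<theta> \<phi> x. smooth \<theta> \<longrightarrow> smooth \<phi> \<longrightarrow>
     \<theta> x * (deriv ^^ m) \<phi> x = (\<Sum>j\<le>m. a j * (deriv ^^ (m - j)) (\<lambda>y. (deriv ^^ j) \<theta> y * \<phi> y) x))"
proof (induction m)
  case 0
  show ?case by (intro exI[of _ "\<lambda>_. 1"]) auto
next
  case (Suc m)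
  then obtain a where a: "\<And>\<theta> \<phi> x. smooth \<theta> \<Longrightarrow> smooth \<phi> \<Longrightarrow>
     \<theta> x * (deriv ^^ m) \<phi> x = (\<Sum>j\<le>m. a j * (deriv ^^ (m - j)) (\<lambda>y. (deriv ^^ j) \<theta> y * \<phi> y) x)" by blast
  \<comment> \<open>Applying the hypothesis to \<phi>' and writing \<theta>^(j) \<phi>' as
    (\<theta>^(j) \<phi>)' - \<theta>^(j+1) \<phi> gives the recursion a'(j) = a(j) - a(j-1), that
    of the signed binomial coefficients.\<close>
  define a' where "a' = (\<lambda>j. (if j \<le> m then a j else 0) - (if j = 0 then 0 else a (j - 1)))"
  have "\<theta> x * (deriv ^^ Suc m) \<phi> x = (\<Sum>j\<le>Suc m. a' j * (deriv ^^ (Suc m - j)) (\<lambda>y. (deriv ^^ j) \<theta> y * \<phi> y) x)"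
    if s: "smooth \<theta>" "smooth \<phi>" for \<theta> \<phi> x
  proof -
    define T where "T = (\<lambda>j. (deriv ^^ (Suc m - j)) (\<lambda>y. (deriv ^^ j) \<theta> y * \<phi> y) x)"
    have "\<theta> x * (deriv ^^ Suc m) \<phi> x = (\<Sum>j\<le>m. a j * (deriv ^^ (m - j)) (\<lambda>y. (deriv ^^ j) \<theta> y * deriv \<phi> y) x)"
      using a[OF s(1) smooth_deriv[OF s(2)], of x] by (simp only: funpow_Suc_right o_apply)
    also have "\<dots> = (\<Sum>j\<le>m. a j * (T j - T (Suc j)))"
    proof (intro sum.cong refl arg_cong2[where f="(*)"])
      fix j assume "j \<in> {..m}"
      then have sj: "Suc m - j = Suc (m - j)" by auto
      let ?p = "\<lambda>y. (deriv ^^ j) \<theta> y * \<phi> y"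
      have sp: "smooth ?p" "smooth (\<lambda>y. (deriv ^^ Suc j) \<theta> y * \<phi> y)"
        using s by (auto intro!: smooth_mult smooth_derivs simp del: funpow.simps)
      have e: "(\<lambda>y. (deriv ^^ j) \<theta> y * deriv \<phi> y) = (\<lambda>y. deriv ?p y - (deriv ^^ Suc j) \<theta> y * \<phi> y)"
        using s by (subst deriv_mult_smooth) (auto intro!: smooth_derivs)
      have "(deriv ^^ (m - j)) (\<lambda>y. deriv ?p y - (deriv ^^ Suc j) \<theta> y * \<phi> y) x = (deriv ^^ (m - j)) (deriv ?p) x - (deriv ^^ (m - j)) (\<lambda>y. (deriv ^^ Suc j) \<theta> y * \<phi> y) x"
        by (subst derivs_diff) (use sp smooth_deriv in auto)
      also have "(deriv ^^ (m - j)) (deriv ?p) x = T j"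
        unfolding T_def sj funpow_Suc_right by simp
      finally show "(deriv ^^ (m - j)) (\<lambda>y. (deriv ^^ j) \<theta> y * deriv \<phi> y) x = T j - T (Suc j)"
        by (simp only: e T_def diff_Suc_Suc)
    qed
    also have "\<dots> = (\<Sum>j\<le>m. a j * T j) - (\<Sum>j\<le>m. a j * T (Suc j))"
      by (simp add: right_diff_distrib sum_subtractf)
    also have "(\<Sum>j\<le>m. a j * T (Suc j)) = (\<Sum>j\<le>Suc m. (if j = 0 then 0 else a (j - 1)) * T j)"
      by (subst sum.atMost_Suc_shift) simp
    also have "(\<Sum>j\<le>m. a j * T j) = (\<Sum>j\<le>Suc m. (if j \<le> m then a j else 0) * T j)" by simp
    also have "(\<Sum>j\<le>Suc m. (if j \<le> m then a j else 0) * T j) - (\<Sum>j\<le>Suc m. (if j = 0 then 0 else a (j - 1)) * T j)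
      = (\<Sum>j\<le>Suc m. a' j * T j)"
      unfolding a'_def by (simp only: left_diff_distrib sum_subtractf)
    finally show ?thesis unfolding T_def .
  qed
  then show ?case by blast
qed

subsection \<open>Weak derivatives of the cut-off function\<close>

abbreviation outer :: "real set" where "outer \<equiv> - {-1..1}"

text \<open>The derivatives of the cutoff vanish for |x| < 17/16, so the product is supported away
  from [-1,1] wherever \<psi> lives. This is what admits translates of a mollifier in the weak
  derivatives.\<close>

lemma test_fun_cut:
  assumes "csmooth \<psi>"
  shows "test_fun outer (\<lambda>y. (deriv ^^ j) cutoff y * \<psi> y)"
proof -
  obtain R where "\<And>x. \<bar>x\<bar> > R \<Longrightarrow> \<psi> x = 0" using assms by (auto simp: csmooth_def)
  moreover have "closed {x::real. \<bar>x\<bar> \<ge> 17/16}" by (intro closed_Collect_le continuous_intros)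
  ultimately show ?thesis
    using cutoff_derivs_0 smooth_mult[OF smooth_derivs[OF smooth_cutoff] csmooth_smooth[OF assms]]
    by (intro test_funI[where A="{x. \<bar>x\<bar> \<ge> 17/16}" and R=R]) auto
qed

lemma test_fun_deriv:
  assumes "test_fun \<Omega> \<psi>"
  shows "test_fun \<Omega> (deriv \<psi>)"
proof -
  have s: "smooth \<psi>" using assms by (simp add: test_fun_smooth)
  have z: "\<psi> x = 0" if "x \<in> - closure {x. \<psi> x \<noteq> 0}" for x
    using that closure_subset[of "{x. \<psi> x \<noteq> 0}"] by blast
  have "(deriv ^^ 1) \<psi> x = 0" if "x \<in> - closure {x. \<psi> x \<noteq> 0}" for x
    by (rule derivs_zero_open[OF s open_Compl[OF closed_closure] z that])
  then have "{x. deriv \<psi> x \<noteq> 0} \<subseteq> closure {x. \<psi> x \<noteq> 0}" by auto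
  then have cl: "closure {x. deriv \<psi> x \<noteq> 0} \<subseteq> closure {x. \<psi> x \<noteq> 0}" by (simp add: closure_minimal)
  have c: "compact (closure {x. \<psi> x \<noteq> 0})" "closure {x. \<psi> x \<noteq> 0} \<subseteq> \<Omega>" using assms by (auto simp: test_fun_smooth)
  have "compact (closure {x. deriv \<psi> x \<noteq> 0})"
    using bounded_subset[OF compact_imp_bounded[OF c(1)] cl] by (simp add: compact_eq_bounded_closed)
  then show ?thesis
    unfolding test_fun_smooth using smooth_deriv[OF s] order_trans[OF cl c(2)] by blast
qed

text \<open>The Leibniz terms. Each lives on the whole line and ignores the values of h on [-1,1],
  so that Young's inequality and translations apply to it.\<close>

definition piece :: "nat \<Rightarrow> (real \<Rightarrow> complex) \<Rightarrow> real \<Rightarrow> complex" where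
  "piece j h x = of_real ((deriv ^^ j) cutoff x) * h x"

lemma piece_measurable[measurable]:
  assumes [measurable]: "h \<in> borel_measurable borel"
  shows "piece j h \<in> borel_measurable borel"
  unfolding piece_def by measurable

text \<open>Since the derivatives of the cutoff vanish on [-1,1], integrals over the complement are
  integrals over the line.\<close>

lemma piece_outer: "indicator outer x *\<^sub>R (h x * of_real ((deriv ^^ j) cutoff x * p)) = piece j h x * of_real p"
proof (cases "\<bar>x\<bar> < 17/16")
  case False
  then have "x \<in> outer" by auto
  then show ?thesis by (simp add: piece_def)
qed (simp add: piece_def cutoff_derivs_0)

lemma N2_piece_le:
  "\<exists>c\<ge>0. \<forall>h. h \<in> borel_measurable borel \<longrightarrow> N2 (piece j h) \<le> ennreal c * N2 (\<lambda>x. indicator outer x *\<^sub>R h x)"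
proof -
  obtain c where c: "c \<ge> 1" "\<And>x. \<bar>(deriv ^^ j) cutoff x\<bar> \<le> c" using cutoff_derivs_bounded by blast
  have "N2 (piece j h) \<le> ennreal (c\<^sup>2) * N2 (\<lambda>x. indicator outer x *\<^sub>R h x)" if [measurable]: "h \<in> borel_measurable borel" for h
  proof -
    have "N2 (piece j h) \<le> N2 (\<lambda>x. of_real c * (indicator outer x *\<^sub>R h x))"
    proof (intro N2_mono)
      fix x
      show "cmod (piece j h x) \<le> cmod (of_real c * (indicator outer x *\<^sub>R h x))"
        using c(1) c(2)[of x] cutoff_derivs_0[of x j]
        by (auto simp: piece_def norm_mult indicator_def intro!: mult_right_mono)
    qed
    also have "\<dots> = ennreal (c\<^sup>2) * N2 (\<lambda>x. indicator outer x *\<^sub>R h x)"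
      using c(1) by (subst N2_cmult) auto
    finally show ?thesis .
  qed
  then show ?thesis by (intro exI[of _ "c\<^sup>2"]) auto
qed

text \<open>The Sobolev norm prescribes weak derivatives of orders 1 to m; order 0 is supplied here
  so that all orders can be treated alike. Local integrability is Cauchy-Schwarz against the
  compactly supported test function.\<close>

lemma weak_deriv_0: 
  assumes [measurable]: "f \<in> borel_measurable borel" and fin: "N2 (\<lambda>x. indicator outer x *\<^sub>R f x) < \<infinity>"
  shows "weak_deriv outer 0 f f"
proof -
  have "set_integrable lborel outer (\<lambda>x. f x * of_real (\<phi> x))" if t: "test_fun outer \<phi>" for \<phi>
  proof -
    have s: "smooth \<phi>" and c: "compact (closure {x. \<phi> x \<noteq> 0})" using t by (auto simp: test_fun_smooth)
    obtain R where R: "\<And>x. x \<in> closure {x. \<phi> x \<noteq> 0} \<Longrightarrow> \<bar>x\<bar> \<le> R" using compact_imp_bounded[OF c] by (auto simp: bounded_iff)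
    have "csmooth \<phi>" unfolding csmooth_def using s R closure_subset[of "{x. \<phi> x \<noteq> 0}"]
      by (intro conjI exI[of _ R]) (auto, force)
    then have K: "kernel \<phi>" by (rule csmooth_kernel)
    have [measurable]: "\<phi> \<in> borel_measurable borel" using s by (rule smooth_measurable)
    have "integrable lborel (\<lambda>x. (indicator outer x *\<^sub>R f x) * cnj (of_real (\<phi> x)))"
      by (intro integrable_mult_cnj fin kernel_N2[OF K]) auto
    then show ?thesis by (simp add: set_integrable_def)
  qed
  then show ?thesis unfolding weak_deriv_def by auto
qed

text \<open>An admissible family in the infimum that defines the Sobolev norm on the complement of
  [-1,1], with all its L^2 norms finite; if one of them is infinite, the final bound is
  trivial.\<close>

locale weak_derivs =
  fixes m :: nat and f :: "real \<Rightarrow> complex" and h :: "nat \<Rightarrow> real \<Rightarrow> complex"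
  assumes f_meas[measurable]: "f \<in> borel_measurable borel" and h0: "h 0 = f"
    and wd: "\<And>k. k \<in> {1..m} \<Longrightarrow> weak_deriv outer k f (h k)"
    and fin: "\<And>k. k \<le> m \<Longrightarrow> N2 (\<lambda>x. indicator outer x *\<^sub>R h k x) < \<infinity>"
begin

lemma wd': "k \<le> m \<Longrightarrow> weak_deriv outer k f (h k)"
  using wd[of k] weak_deriv_0[OF f_meas] fin[of 0] h0 by (cases k) auto

lemma h_meas: "k \<le> m \<Longrightarrow> h k \<in> borel_measurable borel"
  using wd'[of k] by (simp add: weak_deriv_def)

lemma piece_meas: "k \<le> m \<Longrightarrow> piece j (h k) \<in> borel_measurable borel"
  by (intro piece_measurable h_meas)

lemma piece_fin: "k \<le> m \<Longrightarrow> N2 (piece j (h k)) < \<infinity>"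
proof -
  assume k: "k \<le> m"
  obtain c where "\<And>h. h \<in> borel_measurable borel \<Longrightarrow> N2 (piece j h) \<le> ennreal c * N2 (\<lambda>x. indicator outer x *\<^sub>R h x)"
    using N2_piece_le by blast
  from this[OF h_meas[OF k]] show ?thesis
    using fin[OF k] by (auto simp: ennreal_mult_less_top elim!: le_less_trans)
qed

lemma weak_cut:
  assumes k: "k \<le> m" and \<psi>: "csmooth \<psi>"
  shows "integrable lborel (\<lambda>x. indicator outer x *\<^sub>R (f x * of_real ((deriv ^^ k) (\<lambda>y. (deriv ^^ j) cutoff y * \<psi> y) x)))"
    and "(\<integral>x. indicator outer x *\<^sub>R (f x * of_real ((deriv ^^ k) (\<lambda>y. (deriv ^^ j) cutoff y * \<psi> y) x)) \<partial>lborel)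
       = (-1) ^ k * (\<integral>x. piece j (h k) x * of_real (\<psi> x) \<partial>lborel)"
proof -
  have t: "test_fun outer (\<lambda>y. (deriv ^^ j) cutoff y * \<psi> y)" by (rule test_fun_cut[OF \<psi>])
  show "integrable lborel (\<lambda>x. indicator outer x *\<^sub>R (f x * of_real ((deriv ^^ k) (\<lambda>y. (deriv ^^ j) cutoff y * \<psi> y) x)))"
    using wd'[OF k] t unfolding weak_deriv_def set_integrable_def by blast
  have "(LINT x:outer|lborel. f x * of_real ((deriv ^^ k) (\<lambda>y. (deriv ^^ j) cutoff y * \<psi> y) x))
     = (-1) ^ k * (LINT x:outer|lborel. h k x * of_real ((deriv ^^ j) cutoff x * \<psi> x))"
    using wd'[OF k] t unfolding weak_deriv_def by blast
  then show "(\<integral>x. indicator outer x *\<^sub>R (f x * of_real ((deriv ^^ k) (\<lambda>y. (deriv ^^ j) cutoff y * \<psi> y) x)) \<partial>lborel)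
       = (-1) ^ k * (\<integral>x. piece j (h k) x * of_real (\<psi> x) \<partial>lborel)"
    unfolding set_lebesgue_integral_def piece_outer .
qed

text \<open>The weak product rule (\<theta>^(j) h_l)' = \<theta>^(j+1) h_l + \<theta>^(j) h_(l+1)
  with l = m - j, where \<theta> is the cutoff. It results from evaluating in two ways the pairing
  of f with the derivative of order l + 1 of \<theta>^(j) \<psi>. The case j = 0 is left out because
  it would call for a weak derivative of order m + 1.\<close>

lemma piece_weak_deriv:
  assumes j: "1 \<le> j" "j \<le> m" and \<psi>: "csmooth \<psi>"
  shows "(\<integral>x. piece j (h (m - j)) x * of_real (deriv \<psi> x) \<partial>lborel)
     = - (\<integral>x. (piece (Suc j) (h (m - j)) x + piece j (h (Suc (m - j))) x) * of_real (\<psi> x) \<partial>lborel)"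
proof -
  define l where "l = m - j"
  have l: "l \<le> m" "Suc l \<le> m" using j by (auto simp: l_def)
  have s: "smooth \<psi>" using \<psi> by (rule csmooth_smooth)
  have i: "integrable lborel (\<lambda>x. piece i (h k) x * of_real (\<phi> x))" if "k \<le> m" "csmooth \<phi>" for i k \<phi>
  proof -
    have [measurable]: "\<phi> \<in> borel_measurable borel" "piece i (h k) \<in> borel_measurable borel"
      using that csmooth_measurable piece_meas by auto
    have "integrable lborel (\<lambda>x. piece i (h k) x * cnj (of_real (\<phi> x)))"
      by (intro integrable_mult_cnj piece_fin kernel_N2 csmooth_kernel that) auto
    then show ?thesis by simp
  qed
  have t: "test_fun outer (\<lambda>y. (deriv ^^ j) cutoff y * \<psi> y)" by (rule test_fun_cut[OF \<psi>])
  then have t': "test_fun outer (deriv (\<lambda>y. (deriv ^^ j) cutoff y * \<psi> y))" by (rule test_fun_deriv)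
  have cancel: "b = - c" if "a = (-1) ^ l * b" "a = (-1) ^ Suc l * c" for a b c :: complex
  proof -
    have "(-1) ^ l * b = (-1) ^ l * (- c)" using that by simp
    then show ?thesis by (simp only: mult_cancel_left power_not_zero) auto
  qed
  have e: "deriv (\<lambda>y. (deriv ^^ j) cutoff y * \<psi> y) x = (deriv ^^ Suc j) cutoff x * \<psi> x + (deriv ^^ j) cutoff x * deriv \<psi> x" for x
    using s by (subst deriv_mult_smooth) (auto intro!: smooth_derivs smooth_cutoff)
  have "(LINT x:outer|lborel. f x * of_real ((deriv ^^ l) (deriv (\<lambda>y. (deriv ^^ j) cutoff y * \<psi> y)) x))
     = (-1) ^ l * (LINT x:outer|lborel. h l x * of_real (deriv (\<lambda>y. (deriv ^^ j) cutoff y * \<psi> y) x))"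
    using wd'[OF l(1)] t' unfolding weak_deriv_def by blast
  moreover have "(LINT x:outer|lborel. f x * of_real ((deriv ^^ Suc l) (\<lambda>y. (deriv ^^ j) cutoff y * \<psi> y) x))
     = (-1) ^ Suc l * (LINT x:outer|lborel. h (Suc l) x * of_real ((deriv ^^ j) cutoff x * \<psi> x))"
    using wd'[OF l(2)] t unfolding weak_deriv_def by blast
  ultimately have "(LINT x:outer|lborel. h l x * of_real (deriv (\<lambda>y. (deriv ^^ j) cutoff y * \<psi> y) x))
     = - (LINT x:outer|lborel. h (Suc l) x * of_real ((deriv ^^ j) cutoff x * \<psi> x))"
    unfolding funpow_Suc_right o_apply by (rule cancel)
  moreover have "(LINT x:outer|lborel. h l x * of_real (deriv (\<lambda>y. (deriv ^^ j) cutoff y * \<psi> y) x))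
     = (\<integral>x. piece (Suc j) (h l) x * of_real (\<psi> x) + piece j (h l) x * of_real (deriv \<psi> x) \<partial>lborel)"
    unfolding set_lebesgue_integral_def
    by (intro Bochner_Integration.integral_cong refl)
       (simp only: e of_real_add ring_distribs scaleR_add_right piece_outer)
  moreover have "\<dots> = (\<integral>x. piece (Suc j) (h l) x * of_real (\<psi> x) \<partial>lborel) + (\<integral>x. piece j (h l) x * of_real (deriv \<psi> x) \<partial>lborel)"
    by (intro Bochner_Integration.integral_add i l \<psi> csmooth_deriv)
  moreover have "(LINT x:outer|lborel. h (Suc l) x * of_real ((deriv ^^ j) cutoff x * \<psi> x)) = (\<integral>x. piece j (h (Suc l)) x * of_real (\<psi> x) \<partial>lborel)"
    unfolding set_lebesgue_integral_def piece_outer ..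
  moreover have "(\<integral>x. (piece (Suc j) (h l) x + piece j (h (Suc l)) x) * of_real (\<psi> x) \<partial>lborel)
     = (\<integral>x. piece (Suc j) (h l) x * of_real (\<psi> x) \<partial>lborel) + (\<integral>x. piece j (h (Suc l)) x * of_real (\<psi> x) \<partial>lborel)"
    unfolding distrib_right by (intro Bochner_Integration.integral_add i l \<psi>)
  ultimately show ?thesis unfolding l_def[symmetric] by (simp add: algebra_simps)
qed

end

text \<open>Fixed by m alone, whatever \<theta>, \<phi> and f are; this keeps the final constant
  dependent on \<open>mu\<close> only.\<close>

definition leib :: "nat \<Rightarrow> nat \<Rightarrow> real" where
  "leib m = (SOME a. (\<forall>\<theta> \<phi> x. smooth \<theta> \<longrightarrow> smooth \<phi> \<longrightarrow>
     \<theta> x * (deriv ^^ m) \<phi> x = (\<Sum>j\<le>m. a j * (deriv ^^ (m - j)) (\<lambda>y. (deriv ^^ j) \<theta> y * \<phi> y) x)))"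

lemma leib:
  "smooth \<theta> \<Longrightarrow> smooth \<phi> \<Longrightarrow>
     \<theta> x * (deriv ^^ m) \<phi> x = (\<Sum>j\<le>m. leib m j * (deriv ^^ (m - j)) (\<lambda>y. (deriv ^^ j) \<theta> y * \<phi> y) x)"
  using someI_ex[OF adjoint_leibniz[of m]] unfolding leib_def[symmetric] by auto

context weak_derivs
begin

text \<open>All m derivatives leave the mollifier: the adjoint Leibniz rule turns the cutoff times
  the derivative of order m into derivatives of the test functions \<theta>^(j) \<psi>, and each of
  these is transferred to f by a weak derivative.\<close>

lemma conv_deriv_cut:
  assumes \<phi>: "csmooth \<phi>"
  shows "conv ((deriv ^^ m) \<phi>) (\<lambda>y. of_real (cutoff y) * f y) \<xi>
     = (\<Sum>j\<le>m. of_real ((-1) ^ j * leib m j) * conv \<phi> (piece j (h (m - j))) \<xi>)"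
proof -
  define \<psi> where "\<psi> = (\<lambda>y. \<phi> ((-1) * y + \<xi>))"
  have \<psi>: "csmooth \<psi>" unfolding \<psi>_def by (rule csmooth_affine[OF \<phi>]) simp
  have d: "(deriv ^^ m) \<phi> (\<xi> - y) = (-1) ^ m * (deriv ^^ m) \<psi> y" for y
  proof -
    have "(deriv ^^ m) \<psi> y = (-1) ^ m * (deriv ^^ m) \<phi> ((-1) * y + \<xi>)"
      unfolding \<psi>_def by (subst derivs_affine[OF csmooth_smooth[OF \<phi>]]) rule
    then show ?thesis by (simp add: mult.assoc[symmetric] power_mult_distrib[symmetric])
  qed
  have cut: "indicator outer y *\<^sub>R (of_real (cutoff y) :: complex) = of_real (cutoff y)" for y
  proof (cases "\<bar>y\<bar> \<le> 17/16")
    case False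
    then have "y \<in> outer" by auto
    then show ?thesis by simp
  qed (simp add: cutoff_0)
  define Q where "Q = (\<lambda>j y. indicator outer y *\<^sub>R (f y * of_real ((deriv ^^ (m - j)) (\<lambda>y. (deriv ^^ j) cutoff y * \<psi> y) y)))"
  have iQ: "integrable lborel (Q j)" for j
    unfolding Q_def by (rule weak_cut(1)[OF diff_le_self \<psi>])
  have Qi: "(\<integral>y. Q j y \<partial>lborel) = (-1) ^ (m - j) * (\<integral>y. piece j (h (m - j)) y * of_real (\<psi> y) \<partial>lborel)" for j
    unfolding Q_def by (rule weak_cut(2)[OF diff_le_self \<psi>])
  have "conv ((deriv ^^ m) \<phi>) (\<lambda>y. of_real (cutoff y) * f y) \<xi>
     = (\<integral>y. (-1) ^ m * (\<Sum>j\<le>m. of_real (leib m j) * Q j y) \<partial>lborel)"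
    unfolding conv_def
  proof (intro Bochner_Integration.integral_cong refl)
    fix y
    have "(of_real (cutoff y) * f y) * of_real ((deriv ^^ m) \<phi> (\<xi> - y))
      = (-1) ^ m * (indicator outer y *\<^sub>R f y * of_real (cutoff y * (deriv ^^ m) \<psi> y))"
    proof -
      have "(of_real (cutoff y) * f y) * of_real ((deriv ^^ m) \<phi> (\<xi> - y))
        = (-1) ^ m * ((of_real (cutoff y)) * f y * of_real ((deriv ^^ m) \<psi> y))"
        unfolding d by simp
      also have "\<dots> = (-1) ^ m * ((indicator outer y *\<^sub>R of_real (cutoff y)) * f y * of_real ((deriv ^^ m) \<psi> y))"
        unfolding cut ..
      finally show ?thesis by (simp add: mult_ac)
    qed
    also have "cutoff y * (deriv ^^ m) \<psi> y = (\<Sum>j\<le>m. leib m j * (deriv ^^ (m - j)) (\<lambda>y. (deriv ^^ j) cutoff y * \<psi> y) y)"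
      by (rule leib[OF smooth_cutoff csmooth_smooth[OF \<psi>]])
    also have "(-1) ^ m * (indicator outer y *\<^sub>R f y * of_real \<dots>)
      = (-1) ^ m * (\<Sum>j\<le>m. of_real (leib m j) * Q j y)"
      unfolding Q_def by (simp add: sum_distrib_left mult_ac)
    finally show "(of_real (cutoff y) * f y) * of_real ((deriv ^^ m) \<phi> (\<xi> - y))
      = (-1) ^ m * (\<Sum>j\<le>m. of_real (leib m j) * Q j y)" .
  qed
  also have "\<dots> = (-1) ^ m * (\<Sum>j\<le>m. of_real (leib m j) * (\<integral>y. Q j y \<partial>lborel))"
    by (subst integral_mult_right_zero, subst Bochner_Integration.integral_sum) (auto intro!: integrable_mult_right iQ)
  also have "\<dots> = (-1) ^ m * (\<Sum>j\<le>m. of_real (leib m j) * ((-1) ^ (m - j) * conv \<phi> (piece j (h (m - j))) \<xi>))"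
    unfolding Qi conv_def \<psi>_def by simp
  also have "\<dots> = (\<Sum>j\<le>m. of_real ((-1) ^ j * leib m j) * conv \<phi> (piece j (h (m - j))) \<xi>)"
    unfolding sum_distrib_left
  proof (intro sum.cong refl)
    fix j assume "j \<in> {..m}"
    then obtain i where "m = j + i" by (auto dest: le_Suc_ex)
    \<comment> \<open>The reflection y \<mapsto> \<xi> - y contributes (-1)^m and the weak
      derivative (-1)^(m-j); together they leave (-1)^j.\<close>
    then have "(-1) ^ m * (-1) ^ (m - j) = ((-1) ^ j :: complex)"
      by (simp add: power_add mult.assoc power_mult_distrib[symmetric])
    then show "(-1) ^ m * (of_real (leib m j) * ((-1) ^ (m - j) * conv \<phi> (piece j (h (m - j))) \<xi>)) = of_real ((-1) ^ j * leib m j) * conv \<phi> (piece j (h (m - j))) \<xi>"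
      by (simp add: mult.assoc[symmetric] mult.commute[of _ "of_real (leib m j)"])
  qed
  finally show ?thesis .
qed

end

section \<open>Translation differences of mollified functions\<close>

lemma nn_integral_difference_kernel:
  assumes P: "\<And>x. (P has_real_derivative \<phi> x) (at x)" and nn: "\<And>x. \<phi> x \<ge> 0"
    and [measurable]: "\<phi> \<in> borel_measurable borel" and k: "k > 0"
    and one: "(\<integral>\<^sup>+ x. ennreal (\<phi> x) \<partial>lborel) = 1"
  shows "(\<integral>\<^sup>+ z. ennreal \<bar>P (z + k) - P z\<bar> \<partial>lborel) = ennreal k"
proof -
  \<comment> \<open>P increases, so the difference is the mass of \<phi> on [z, z+k]; by Tonelli
    each t is counted for z in an interval of length k.\<close>
  have mono: "P z \<le> P (z + k)" for z using DERIV_nonneg_imp_nondecreasing[of z "z + k" P] P nn k by force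
  have "(\<integral>\<^sup>+ z. ennreal \<bar>P (z + k) - P z\<bar> \<partial>lborel) = (\<integral>\<^sup>+ z. \<integral>\<^sup>+ t. ennreal (\<phi> t) * indicator {z..z+k} t \<partial>lborel \<partial>lborel)"
  proof (rule nn_integral_cong)
    fix z
    have "(\<integral>\<^sup>+ t. ennreal (\<phi> t) * indicator {z..z+k} t \<partial>lborel) = ennreal (P (z + k) - P z)"
      by (rule nn_integral_FTC_nonneg[OF P nn]) (use k in auto)
    then show "ennreal \<bar>P (z + k) - P z\<bar> = (\<integral>\<^sup>+ t. ennreal (\<phi> t) * indicator {z..z+k} t \<partial>lborel)"
      using mono[of z] by simp
  qed
  also have "\<dots> = (\<integral>\<^sup>+ z. \<integral>\<^sup>+ t. ennreal (\<phi> t) * (if z \<le> t \<and> t \<le> z + k then 1 else 0) \<partial>lborel \<partial>lborel)"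
    by (simp add: indicator_def of_bool_def)
  also have "\<dots> = (\<integral>\<^sup>+ t. \<integral>\<^sup>+ z. ennreal (\<phi> t) * (if z \<le> t \<and> t \<le> z + k then 1 else 0) \<partial>lborel \<partial>lborel)"
    by (rule lborel_pair.Fubini'[symmetric]) (simp add: split_beta', measurable)
  also have "\<dots> = (\<integral>\<^sup>+ t. ennreal (\<phi> t) * ennreal k \<partial>lborel)"
  proof (rule nn_integral_cong)
    fix t
    have "(\<integral>\<^sup>+ z. ennreal (\<phi> t) * (if z \<le> t \<and> t \<le> z + k then 1 else 0) \<partial>lborel) = (\<integral>\<^sup>+ z. ennreal (\<phi> t) * indicator {t-k..t} z \<partial>lborel)"
      by (intro nn_integral_cong) (auto simp: indicator_def)
    also have "\<dots> = ennreal (\<phi> t) * ennreal k" using k by (subst nn_integral_cmult_indicator) auto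
    finally show "(\<integral>\<^sup>+ z. ennreal (\<phi> t) * (if z \<le> t \<and> t \<le> z + k then 1 else 0) \<partial>lborel) = ennreal (\<phi> t) * ennreal k" .
  qed
  also have "\<dots> = ennreal k" by (subst nn_integral_multc) (auto simp: one)
  finally show ?thesis .
qed

text \<open>The primitive P is carried along because translation differences of \<phi> are
  derivatives of translation differences of P.\<close>

definition moll :: "(real \<Rightarrow> real) \<Rightarrow> (real \<Rightarrow> real) \<Rightarrow> bool" where
  "moll \<phi> P \<longleftrightarrow> smooth \<phi> \<and> (\<forall>x. \<phi> x \<ge> 0) \<and> (\<forall>x. \<bar>x\<bar> \<ge> 1 \<longrightarrow> \<phi> x = 0) \<and> integrable lborel \<phi> \<and> (\<integral>x. \<phi> x \<partial>lborel) = 1 \<and>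
     (\<forall>x. (P has_real_derivative \<phi> x) (at x)) \<and> (\<forall>x\<le>-1. P x = 0) \<and> (\<forall>x\<ge>1. P x = 1)"

lemma moll_exists: "\<exists>\<phi> P. moll \<phi> P"
proof -
  obtain \<phi> where \<phi>: "smooth \<phi>" "\<And>x. \<phi> x \<ge> 0" "\<And>x. \<bar>x\<bar> \<ge> 1 \<Longrightarrow> \<phi> x = 0"
    "integrable lborel \<phi>" "(\<integral>x. \<phi> x \<partial>lborel) = 1" using mollifier_exists by blast
  obtain P where "\<And>x. (P has_real_derivative \<phi> x) (at x)" "\<And>x. x \<le> -1 \<Longrightarrow> P x = 0" "\<And>x. x \<ge> 1 \<Longrightarrow> P x = 1"
    using primitive_exists[OF \<phi>] by metis
  then show ?thesis unfolding moll_def using \<phi> by blast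
qed

lemma moll_csmooth: "moll \<phi> P \<Longrightarrow> csmooth \<phi>"
  unfolding moll_def csmooth_def by (auto intro!: exI[of _ 1])

lemma moll_one: "moll \<phi> P \<Longrightarrow> (\<integral>\<^sup>+ x. ennreal (\<phi> x) \<partial>lborel) = 1"
  unfolding moll_def by (subst nn_integral_eq_integral) auto

text \<open>Shrinking by a factor n + 1 \<ge> 1 keeps the support in [-1,1], so the whole
  approximating sequence satisfies one predicate and inherits the same bounds.\<close>

lemma moll_scale:
  assumes "moll \<phi> P"
  shows "moll (\<lambda>x. real (Suc n) * \<phi> (real (Suc n) * x)) (\<lambda>x. P (real (Suc n) * x))"
proof -
  define c where "c = real (Suc n)"
  have c: "c \<ge> 1" by (simp add: c_def)
  have cx: "\<bar>x\<bar> \<ge> 1 \<Longrightarrow> \<bar>c * x\<bar> \<ge> 1" for x using mult_mono[of 1 c 1 "\<bar>x\<bar>"] c by (simp add: abs_mult)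
  have "smooth (\<lambda>x. c * \<phi> (c * x))" using smooth_affine[of \<phi> c c 0] assms by (simp add: moll_def)
  moreover have "integrable lborel (\<lambda>x. c * \<phi> (c * x))"
    using lborel_integrable_real_affine[of \<phi> c 0] assms c by (simp add: moll_def)
  moreover have "(\<integral>x. c * \<phi> (c * x) \<partial>lborel) = 1"
    using lborel_integral_real_affine[of c \<phi> 0] assms c by (simp add: moll_def)
  moreover have "((\<lambda>x. P (c * x)) has_real_derivative c * \<phi> (c * x)) (at x)" for x
  proof -
    have "((\<lambda>x. P (c * x)) has_real_derivative \<phi> (c * x) * c) (at x)"
      by (rule DERIV_chain2[of P]) (use assms in \<open>auto simp: moll_def intro!: derivative_eq_intros\<close>)
    then show ?thesis by (simp add: mult.commute)
  qed
  moreover have "P (c * x) = 0" if "x \<le> -1" for x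
  proof -
    have "c * x \<le> - 1" using mult_mono[of 1 c 1 "-x"] c that by simp
    then show ?thesis using assms by (simp add: moll_def)
  qed
  moreover have "P (c * x) = 1" if "x \<ge> 1" for x
  proof -
    have "c * x \<ge> 1" using mult_mono[of 1 c 1 "x"] c that by simp
    then show ?thesis using assms by (simp add: moll_def)
  qed
  ultimately show ?thesis using assms cx c unfolding moll_def c_def[symmetric] by auto
qed

lemma conv_shift:
  "conv K G (\<xi> + t) = conv K (\<lambda>y. G (y + t)) \<xi>"
  unfolding conv_def using integral_shift[of "\<lambda>y. G y * of_real (K (\<xi> + t - y))" t] by simp

lemma conv_sum_kernel:
  assumes K: "kernel K" "kernel L" and G: "G \<in> borel_measurable borel" "N2 G < \<infinity>"
  shows "conv (\<lambda>s. K (s + t) - L s) G \<xi> = conv K G (\<xi> + t) - conv L G \<xi>"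
  unfolding conv_def using integrable_conv[OF K(1) G, of "\<xi> + t"] integrable_conv[OF K(2) G, of \<xi>]
  by (subst Bochner_Integration.integral_diff[symmetric]) (auto simp: algebra_simps)

context weak_derivs
begin

text \<open>The L^2 mean value inequality for weak derivatives. Since \<phi>(. + k) - \<phi> is the
  derivative of P(. + k) - P, that derivative passes to the piece, and the kernel left over has L^1
  norm k.\<close>

lemma N2_conv_difference_piece:
  assumes \<phi>: "moll \<phi> P" and j: "1 \<le> j" "j \<le> m" and k: "k > 0"
  shows "N2 (\<lambda>\<xi>. conv \<phi> (piece j (h (m - j))) (\<xi> + k) - conv \<phi> (piece j (h (m - j))) \<xi>)
     \<le> ennreal (k\<^sup>2) * N2 (\<lambda>x. piece (Suc j) (h (m - j)) x + piece j (h (Suc (m - j))) x)"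
proof -
  let ?F = "piece j (h (m - j))" and ?G = "\<lambda>x. piece (Suc j) (h (m - j)) x + piece j (h (Suc (m - j))) x"
  have mj: "m - j \<le> m" "Suc (m - j) \<le> m" using j by auto
  have [measurable]: "piece i (h (m - j)) \<in> borel_measurable borel" "piece i (h (Suc (m - j))) \<in> borel_measurable borel" for i
    using mj piece_meas by auto
  have P: "(P has_real_derivative \<phi> x) (at x)" "\<phi> x \<ge> 0" for x using \<phi> by (auto simp: moll_def)
  have sP: "smooth P" by (rule smooth_antideriv[OF P(1)]) (use \<phi> in \<open>simp add: moll_def\<close>)
  have c\<phi>: "csmooth \<phi>" using \<phi> by (rule moll_csmooth)
  have [measurable]: "\<phi> \<in> borel_measurable borel" "P \<in> borel_measurable borel" using c\<phi> sP csmooth_measurable smooth_measurable by auto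
  define K where "K = (\<lambda>z. P (z + k) - P z)"
  have [measurable]: "K \<in> borel_measurable borel" unfolding K_def by measurable
  have K: "csmooth K"
    unfolding csmooth_def K_def
  proof (intro conjI exI[of _ "1 + k"] allI impI)
    show "smooth (\<lambda>z. P (z + k) - P z)" using smooth_affine[OF sP, of 1 1 k] by (intro smooth_diff sP) simp
    \<comment> \<open>Beyond this radius x and x + k lie on the same plateau of P.\<close>
    fix x assume "1 + k < \<bar>x\<bar>"
    then consider "x \<ge> 1" "x + k \<ge> 1" | "x \<le> -1" "x + k \<le> -1" using k by linarith
    then show "P (x + k) - P x = 0" using \<phi> by cases (auto simp: moll_def)
  qed
  have e: "conv \<phi> ?F (\<xi> + k) - conv \<phi> ?F \<xi> = conv K ?G \<xi>" for \<xi>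
  proof -
    define \<psi> where "\<psi> = (\<lambda>y. K ((-1) * y + \<xi>))"
    have \<psi>: "csmooth \<psi>" unfolding \<psi>_def by (rule csmooth_affine[OF K]) simp
    have "(\<psi> has_real_derivative - (\<phi> (\<xi> + k - y) - \<phi> (\<xi> - y))) (at y)" for y
    proof -
      have "(K has_real_derivative \<phi> (z + k) - \<phi> z) (at z)" for z
        unfolding K_def by (intro derivative_intros P DERIV_shift[THEN iffD1])
      moreover have "((\<lambda>y. (-1) * y + \<xi>) has_real_derivative -1) (at y)"
        by (auto intro!: derivative_eq_intros)
      ultimately have "(\<psi> has_real_derivative (\<phi> ((-1) * y + \<xi> + k) - \<phi> ((-1) * y + \<xi>)) * (-1)) (at y)"
        unfolding \<psi>_def by (rule DERIV_chain2)
      then show ?thesis by (simp add: algebra_simps)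
    qed
    then have d\<psi>: "deriv \<psi> y = - (\<phi> (\<xi> + k - y) - \<phi> (\<xi> - y))" for y by (rule DERIV_imp_deriv)
    have i: "integrable lborel (\<lambda>y. ?F y * of_real (\<phi> (\<xi>' - y)))" for \<xi>'
      by (rule integrable_conv[OF csmooth_kernel[OF c\<phi>]]) (use piece_fin[OF mj(1)] in auto)
    have "conv \<phi> ?F (\<xi> + k) - conv \<phi> ?F \<xi> = (\<integral>y. ?F y * of_real (\<phi> (\<xi> + k - y)) - ?F y * of_real (\<phi> (\<xi> - y)) \<partial>lborel)"
      unfolding conv_def by (rule Bochner_Integration.integral_diff[symmetric, OF i i])
    also have "\<dots> = (\<integral>y. - (?F y * of_real (deriv \<psi> y)) \<partial>lborel)"
      unfolding d\<psi> by (intro Bochner_Integration.integral_cong refl) (simp add: algebra_simps)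
    also have "\<dots> = - (\<integral>y. ?F y * of_real (deriv \<psi> y) \<partial>lborel)"
      by (rule Bochner_Integration.integral_minus)
    also have "\<dots> = (\<integral>y. ?G y * of_real (\<psi> y) \<partial>lborel)"
      unfolding piece_weak_deriv[OF j \<psi>] by simp
    also have "\<dots> = conv K ?G \<xi>" unfolding conv_def \<psi>_def by simp
    finally show ?thesis .
  qed
  have "N2 (conv K ?G) \<le> (\<integral>\<^sup>+ s. ennreal \<bar>K s\<bar> \<partial>lborel)\<^sup>2 * N2 ?G"
    by (rule N2_conv_le) measurable
  also have "(\<integral>\<^sup>+ s. ennreal \<bar>K s\<bar> \<partial>lborel) = ennreal k"
    unfolding K_def by (rule nn_integral_difference_kernel[OF P _ k moll_one[OF \<phi>]]) measurable
  finally show ?thesis using k by (simp add: e ennreal_power)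
qed

end

section \<open>Multipliers of mollifier derivatives\<close>

lemma kt_deriv:
  assumes \<phi>: "csmooth \<phi>"
  shows "kt (deriv \<phi>) x = - (\<i> * of_real x) * kt \<phi> x"
proof -
  obtain R where R: "\<And>s. \<bar>s\<bar> > R \<Longrightarrow> \<phi> s = 0" using \<phi> by (auto simp: csmooth_def)
  define a where "a = \<bar>R\<bar> + 1"
  have z: "\<phi> s = 0" "deriv \<phi> s = 0" if "\<bar>s\<bar> \<ge> a" for s
  proof -
    show "\<phi> s = 0" using R that by (simp add: a_def)
    have "(deriv ^^ 1) \<phi> s = 0"
      by (rule derivs_zero_open[OF csmooth_smooth[OF \<phi>], of "{s. \<bar>s\<bar> > R}"])
         (use R that in \<open>auto simp: a_def intro!: open_Collect_less continuous_intros\<close>)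
    then show "deriv \<phi> s = 0" by simp
  qed
  define e where "e = (\<lambda>s. exp (\<i> * of_real (x * s)))"
  have e': "(e has_vector_derivative (\<i> * of_real x) * e s) (at s within A)" for s A
  proof -
    have "((\<lambda>z. exp ((\<i> * of_real x) * z)) has_field_derivative ((\<i> * of_real x) * e s)) (at (of_real s))"
      by (auto intro!: derivative_eq_intros simp: e_def mult_ac)
    from has_vector_derivative_real_field[OF this]
    show ?thesis by (simp add: e_def mult_ac)
  qed
  \<comment> \<open>The derivative of the product of \<phi> and e; its integral vanishes, which is
    the integration by parts.\<close>
  define f where "f = (\<lambda>s. of_real (deriv \<phi> s) * e s + (\<i> * of_real x) * (of_real (\<phi> s) * e s))"
  have F': "((\<lambda>s. of_real (\<phi> s) * e s) has_vector_derivative f s) (at s within {-a..a})" for s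
  proof -
    have "(\<phi> has_field_derivative deriv \<phi> s) (at s within {-a..a})"
      by (rule has_field_derivative_at_within[OF smooth_DERIV[OF csmooth_smooth[OF \<phi>]]])
    then have "((\<lambda>s. of_real (\<phi> s)) has_vector_derivative (of_real (deriv \<phi> s) :: complex)) (at s within {-a..a})"
      by (rule has_vector_derivative_of_real)
    from has_vector_derivative_mult[OF this e'] show ?thesis
      by (simp add: f_def algebra_simps)
  qed
  have ce: "continuous_on A e" for A unfolding e_def by (intro continuous_intros)
  have cf: "continuous_on {-a..a} f"
    unfolding f_def by (intro continuous_intros ce smooth_continuous smooth_deriv csmooth_smooth \<phi>)
  have "has_bochner_integral lborel (\<lambda>s. indicator {-a..a} s *\<^sub>R f s) (of_real (\<phi> a) * e a - of_real (\<phi> (-a)) * e (-a))"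
    by (rule has_bochner_integral_FTC_Icc[OF _ F' cf]) (auto simp: a_def)
  then have "(\<integral>s. indicator {-a..a} s *\<^sub>R f s \<partial>lborel) = of_real (\<phi> a) * e a - of_real (\<phi> (-a)) * e (-a)"
    by (rule has_bochner_integral_integral_eq)
  also have "\<dots> = 0" using z[of a] z[of "-a"] by simp
  also have "(\<lambda>s. indicator {-a..a} s *\<^sub>R f s) = f"
  proof
    fix s show "indicator {-a..a} s *\<^sub>R f s = f s" using z[of s] by (cases "\<bar>s\<bar> \<ge> a") (auto simp: f_def indicator_def)
  qed
  finally have "(\<integral>s. f s \<partial>lborel) = 0" .
  moreover have "(\<integral>s. f s \<partial>lborel) = kt (deriv \<phi>) x + (\<i> * of_real x) * kt \<phi> x"
    unfolding f_def kt_def e_def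
    by (subst Bochner_Integration.integral_add)
       (use integrable_kt[OF csmooth_kernel[OF \<phi>], of x] integrable_kt[OF csmooth_kernel[OF csmooth_deriv[OF \<phi>]], of x] in auto)
  ultimately show ?thesis by (simp add: add_eq_0_iff2)
qed

lemma norm_kt_derivs:
  assumes "csmooth \<phi>"
  shows "cmod (kt ((deriv ^^ m) \<phi>) x) = \<bar>x\<bar> ^ m * cmod (kt \<phi> x)"
proof (induction m)
  case (Suc m)
  show ?case using Suc by (simp add: kt_deriv csmooth_derivs[OF assms] norm_mult)
qed simp

lemma kt_shift_diff:
  assumes K: "kernel K"
  shows "kt (\<lambda>s. K (s + t) - K s) x = (exp (- (\<i> * of_real (x * t))) - 1) * kt K x"
proof -
  have K': "kernel (\<lambda>s. K (s + t))"
    using K lborel_integrable_real_affine[of K 1 t] by (auto simp: kernel_def add.commute)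
  have "kt (\<lambda>s. K (s + t) - K s) x = kt (\<lambda>s. K (s + t)) x - kt K x"
    unfolding kt_def by (subst Bochner_Integration.integral_diff[symmetric])
      (use integrable_kt[OF K, of x] integrable_kt[OF K', of x] in \<open>auto simp: algebra_simps\<close>)
  also have "kt (\<lambda>s. K (s + t)) x = (\<integral>s. of_real (K (s + t)) * exp (\<i> * of_real (x * ((s + t) - t))) \<partial>lborel)"
    unfolding kt_def by simp
  also have "\<dots> = (\<integral>s. of_real (K s) * exp (\<i> * of_real (x * (s - t))) \<partial>lborel)"
    by (rule integral_shift)
  also have "\<dots> = (\<integral>s. exp (- (\<i> * of_real (x * t))) * (of_real (K s) * exp (\<i> * of_real (x * s))) \<partial>lborel)"
  proof (intro Bochner_Integration.integral_cong refl)
    fix s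
    have "exp (\<i> * of_real (x * (s - t))) = exp (- (\<i> * of_real (x * t))) * exp (\<i> * of_real (x * s))"
      by (simp add: mult_exp_exp algebra_simps)
    then show "of_real (K s) * exp (\<i> * of_real (x * (s - t))) = exp (- (\<i> * of_real (x * t))) * (of_real (K s) * exp (\<i> * of_real (x * s)))"
      by (simp only: mult_ac)
  qed
  also have "\<dots> = exp (- (\<i> * of_real (x * t))) * kt K x" unfolding kt_def by simp
  finally show ?thesis by (simp add: algebra_simps)
qed

lemma kt_moll_scale_tendsto:
  assumes "moll \<phi> P"
  shows "(\<lambda>n. kt (\<lambda>x. real (Suc n) * \<phi> (real (Suc n) * x)) x) \<longlonglongrightarrow> 1"
proof -
  have i: "integrable lborel \<phi>" and nn: "\<And>x. \<phi> x \<ge> 0" and one: "(\<integral>x. \<phi> x \<partial>lborel) = 1" and s: "smooth \<phi>"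
    using assms by (auto simp: moll_def)
  have [measurable]: "\<phi> \<in> borel_measurable borel" using s by (rule smooth_measurable)
  have e: "kt (\<lambda>x. real (Suc n) * \<phi> (real (Suc n) * x)) x = (\<integral>t. of_real (\<phi> t) * exp (\<i> * of_real (x * t / real (Suc n))) \<partial>lborel)" for n
  proof -
    have n0: "real (Suc n) \<noteq> 0" by simp
    have "(\<integral>t. of_real (\<phi> t) * exp (\<i> * of_real (x * t / real (Suc n))) \<partial>lborel) =
       \<bar>real (Suc n)\<bar> *\<^sub>R (\<integral>s. of_real (\<phi> (0 + real (Suc n) * s)) * exp (\<i> * of_real (x * (0 + real (Suc n) * s) / real (Suc n))) \<partial>lborel)"
      by (rule lborel_integral_real_affine[OF n0])
    also have "\<dots> = (\<integral>s. \<bar>real (Suc n)\<bar> *\<^sub>R (of_real (\<phi> (0 + real (Suc n) * s)) * exp (\<i> * of_real (x * (0 + real (Suc n) * s) / real (Suc n)))) \<partial>lborel)"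
      by simp
    also have "\<dots> = kt (\<lambda>x. real (Suc n) * \<phi> (real (Suc n) * x)) x"
      unfolding kt_def
    proof (intro Bochner_Integration.integral_cong refl)
      fix s
      have "x * (0 + real (Suc n) * s) / real (Suc n) = x * s" by simp
      then show "\<bar>real (Suc n)\<bar> *\<^sub>R (of_real (\<phi> (0 + real (Suc n) * s)) * exp (\<i> * of_real (x * (0 + real (Suc n) * s) / real (Suc n))))
        = of_real (real (Suc n) * \<phi> (real (Suc n) * s)) * exp (\<i> * of_real (x * s))"
        by (simp only: add_0 scaleR_conv_of_real of_real_mult abs_of_nat mult.assoc)
    qed
    finally show ?thesis ..
  qed
  have "(\<lambda>n. \<integral>t. of_real (\<phi> t) * exp (\<i> * of_real (x * t / real (Suc n))) \<partial>lborel) \<longlonglongrightarrow> (\<integral>t. of_real (\<phi> t) * exp (\<i> * of_real 0) \<partial>lborel)"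
  proof (rule integral_dominated_convergence[where w=\<phi>])
    show "AE t in lborel. (\<lambda>n. of_real (\<phi> t) * exp (\<i> * of_real (x * t / real (Suc n)))) \<longlonglongrightarrow> of_real (\<phi> t) * exp (\<i> * of_real 0)"
    proof (intro AE_I2)
      fix t
      have "(\<lambda>n. x * t / real (Suc n)) \<longlonglongrightarrow> 0" by real_asymp
      then show "(\<lambda>n. of_real (\<phi> t) * exp (\<i> * of_real (x * t / real (Suc n)))) \<longlonglongrightarrow> of_real (\<phi> t) * exp (\<i> * of_real 0)"
        by (intro tendsto_intros)
    qed
    show "AE t in lborel. norm (of_real (\<phi> t) * exp (\<i> * of_real (x * t / real (Suc n)))) \<le> \<phi> t" for n
      using nn by (auto simp: norm_mult simp del: of_real_mult of_real_divide)
  qed (use i in \<open>auto\<close>)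
  also have "(\<integral>t. of_real (\<phi> t) * exp (\<i> * of_real 0) \<partial>lborel) = (1::complex)"
    using one by simp
  finally show ?thesis unfolding e .
qed

subsection \<open>The Slobodeckij weight\<close>

text \<open>The Slobodeckij kernel for positive shifts only: shifts by k and by -k have the same
  effect in L^2.\<close>

definition sw :: "real \<Rightarrow> real \<Rightarrow> real" where
  "sw \<sigma> k = indicator {0<..} k * k powr (- 1 - 2 * \<sigma>)"

lemma sw_nonneg: "sw \<sigma> k \<ge> 0"
  by (simp add: sw_def)

lemma sw_measurable[measurable]: "sw \<sigma> \<in> borel_measurable borel"
  unfolding sw_def by measurable

text \<open>The minimum softens the singularity at 0 to k^(1 - 2\<sigma>), integrable as \<sigma> <
  1; the tail k^(-1 - 2\<sigma>) is integrable as \<sigma> > 0.\<close>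

lemma sw_min_finite:
  assumes \<sigma>: "0 < \<sigma>" "\<sigma> < 1"
  shows "(\<integral>\<^sup>+ k. ennreal (sw \<sigma> k * min 1 (k\<^sup>2)) \<partial>lborel) < \<infinity>"
proof -
  have 1: "integral\<^sup>N lborel (\<lambda>k. ennreal (indicator {0..1} k * k powr (1 - 2 * \<sigma>))) < \<infinity>"
    using \<sigma> by (subst nn_integral_has_integral_lebesgue[OF _ has_integral_powr_from_0]) auto
  have 2: "integral\<^sup>N lborel (\<lambda>k. ennreal (indicator {1..} k * k powr (- 1 - 2 * \<sigma>))) < \<infinity>"
    using \<sigma> by (subst nn_integral_has_integral_lebesgue[OF _ has_integral_powr_to_inf]) auto
  have "(\<integral>\<^sup>+ k. ennreal (sw \<sigma> k * min 1 (k\<^sup>2)) \<partial>lborel) \<le>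
    (\<integral>\<^sup>+ k. ennreal (indicator {0..1} k * k powr (1 - 2 * \<sigma>)) + ennreal (indicator {1..} k * k powr (- 1 - 2 * \<sigma>)) \<partial>lborel)"
  proof (intro nn_integral_mono)
    fix k :: real
    have "sw \<sigma> k * min 1 (k\<^sup>2) \<le> indicator {0..1} k * k powr (1 - 2 * \<sigma>) + indicator {1..} k * k powr (- 1 - 2 * \<sigma>)"
    proof (cases "k > 0")
      case True
      show ?thesis
      proof (cases "k \<le> 1")
        case k1: True
        have "k powr (- 1 - 2 * \<sigma>) * min 1 (k\<^sup>2) \<le> k powr (- 1 - 2 * \<sigma>) * k powr 2"
          using True by (intro mult_left_mono) auto
        also have "\<dots> = k powr (1 - 2 * \<sigma>)" by (simp add: powr_add[symmetric])
        finally show ?thesis using True k1 by (simp add: sw_def indicator_def)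
      next
        case False
        then have "k powr (- 1 - 2 * \<sigma>) * min 1 (k\<^sup>2) \<le> k powr (- 1 - 2 * \<sigma>) * 1" by (intro mult_left_mono) auto
        then show ?thesis using True False by (simp add: sw_def indicator_def)
      qed
    qed (auto simp: sw_def)
    then have "ennreal (sw \<sigma> k * min 1 (k\<^sup>2)) \<le> ennreal (indicator {0..1} k * k powr (1 - 2 * \<sigma>) + indicator {1..} k * k powr (- 1 - 2 * \<sigma>))"
      by (rule ennreal_leI)
    then show "ennreal (sw \<sigma> k * min 1 (k\<^sup>2)) \<le> ennreal (indicator {0..1} k * k powr (1 - 2 * \<sigma>)) + ennreal (indicator {1..} k * k powr (- 1 - 2 * \<sigma>))"
      by (subst (asm) ennreal_plus) auto
  qed
  also have "\<dots> < \<infinity>" using 1 2 by (subst nn_integral_add) auto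
  finally show ?thesis .
qed

lemma cmod_iexp_diff_sq: "(cmod (exp (- (\<i> * of_real y)) - 1))\<^sup>2 = 2 - 2 * cos y"
proof -
  have "exp (- (\<i> * of_real y)) = cis (- y)" by (simp add: cis_conv_exp)
  then have "(cmod (exp (- (\<i> * of_real y)) - 1))\<^sup>2 = (cos y - 1)\<^sup>2 + (sin y)\<^sup>2"
    by (simp add: cmod_power2)
  also have "\<dots> = 2 - 2 * cos y"
    using sin_cos_squared_add[of y] by (simp add: power2_eq_square algebra_simps)
  finally show ?thesis .
qed

text \<open>By scaling, the integral behaves like |x|^(2\<sigma>). For k between 1/|x| and 2/|x| the
  phase x k has modulus between 1 and 2, where 2 - 2 cos is at least 2 - 2 cos 1; this interval
  alone gives the bound.\<close>

lemma sw_lower_bound: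
  "\<exists>d>0. \<forall>x. ennreal (d * \<bar>x\<bar> powr (2 * \<sigma>)) \<le> (\<integral>\<^sup>+ k. ennreal (sw \<sigma> k) * ennreal ((cmod (exp (- (\<i> * of_real (x * k))) - 1))\<^sup>2) \<partial>lborel)"
  if \<sigma>: "0 \<le> \<sigma>"
proof -
  define d where "d = (2 powr (-1 - 2 * \<sigma>)) * (2 - 2 * cos 1)"
  have c1: "cos 1 < (1::real)" using cos_monotone_0_pi[of 0 1] pi_gt3 by simp
  have d: "d > 0" using c1 by (simp add: d_def)
  have "ennreal (d * \<bar>x\<bar> powr (2 * \<sigma>)) \<le> (\<integral>\<^sup>+ k. ennreal (sw \<sigma> k) * ennreal ((cmod (exp (- (\<i> * of_real (x * k))) - 1))\<^sup>2) \<partial>lborel)" for x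
  proof (cases "x = 0")
    case False
    define r where "r = 1 / \<bar>x\<bar>"
    have r: "r > 0" using False by (simp add: r_def)
    define v where "v = (2 * r) powr (-1 - 2 * \<sigma>) * (2 - 2 * cos 1)"
    have v0: "v \<ge> 0" using c1 by (simp add: v_def)
    have "v * r = d * \<bar>x\<bar> powr (2 * \<sigma>)"
    proof -
      have "(2 * r) powr (-1 - 2 * \<sigma>) * r = 2 powr (-1 - 2 * \<sigma>) * (r powr (-1 - 2 * \<sigma>) * r powr 1)"
        using r by (simp add: powr_mult)
      also have "r powr (-1 - 2 * \<sigma>) * r powr 1 = r powr (-1 - 2 * \<sigma> + 1)" by (rule powr_add[symmetric])
      also have "r powr (-1 - 2 * \<sigma> + 1) = \<bar>x\<bar> powr (2 * \<sigma>)" using False by (simp add: r_def powr_divide powr_minus_divide)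
      finally show ?thesis by (simp add: v_def d_def)
    qed
    then have "ennreal (d * \<bar>x\<bar> powr (2 * \<sigma>)) = ennreal v * ennreal r" using ennreal_mult[of v r] v0 r by simp
    also have "\<dots> = (\<integral>\<^sup>+ k. ennreal v * indicator {r..2*r} k \<partial>lborel)"
      using r by (subst nn_integral_cmult_indicator) auto
    also have "\<dots> \<le> (\<integral>\<^sup>+ k. ennreal (sw \<sigma> k) * ennreal ((cmod (exp (- (\<i> * of_real (x * k))) - 1))\<^sup>2) \<partial>lborel)"
    proof (intro nn_integral_mono)
      fix k
      show "ennreal v * indicator {r..2*r} k \<le> ennreal (sw \<sigma> k) * ennreal ((cmod (exp (- (\<i> * of_real (x * k))) - 1))\<^sup>2)"
      proof (cases "k \<in> {r..2*r}")
        case True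
        then have k: "r \<le> k" "k \<le> 2 * r" by auto
        have "k > 0" using k r by linarith
        then have a: "1 \<le> \<bar>x * k\<bar>" "\<bar>x * k\<bar> \<le> 2"
          using k False by (auto simp: r_def abs_mult field_simps)
        have "cos \<bar>x * k\<bar> \<le> cos 1" using a pi_gt3 by (intro cos_monotone_0_pi_le) auto
        then have 1: "2 - 2 * cos 1 \<le> (cmod (exp (- (\<i> * of_real (x * k))) - 1))\<^sup>2"
          unfolding cmod_iexp_diff_sq by simp
        have "(2 * r) powr (-1 - 2 * \<sigma>) \<le> k powr (-1 - 2 * \<sigma>)"
          using k r \<sigma> by (intro powr_mono2') auto
        then have "(2 * r) powr (-1 - 2 * \<sigma>) \<le> sw \<sigma> k" using k r by (simp add: sw_def)
        then have "v \<le> sw \<sigma> k * (cmod (exp (- (\<i> * of_real (x * k))) - 1))\<^sup>2"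
          unfolding v_def using 1 c1 by (intro mult_mono sw_nonneg) auto
        then show ?thesis using True sw_nonneg by (simp add: ennreal_mult[symmetric] ennreal_leI del: of_real_mult)
      qed auto
    qed
    finally show ?thesis .
  qed auto
  then show ?thesis using d by blast
qed

text \<open>Values in [0,1] for large k, the Lipschitz bound for small k.\<close>

lemma cutoff_diff_sq: "\<exists>L\<ge>0. \<forall>x k. (cutoff (x + k) - cutoff x)\<^sup>2 \<le> L * min 1 (k\<^sup>2)"
proof -
  obtain c where c: "c \<ge> 1" "\<And>x. \<bar>(deriv ^^ 1) cutoff x\<bar> \<le> c" using cutoff_derivs_bounded by blast
  have "(cutoff (x + k) - cutoff x)\<^sup>2 \<le> c\<^sup>2 * min 1 (k\<^sup>2)" for x k
  proof -
    have "\<bar>cutoff (x + k) - cutoff x\<bar> \<le> 1"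
      using cutoff_nonneg[of x] cutoff_le_1[of x] cutoff_nonneg[of "x+k"] cutoff_le_1[of "x+k"] by linarith
    then have "(cutoff (x + k) - cutoff x)\<^sup>2 \<le> 1\<^sup>2" by (simp only: abs_le_square_iff[symmetric] abs_one)
    also have "\<dots> \<le> c\<^sup>2 * 1" using c by (simp add: power_mono[of 1 c 2, simplified])
    finally have 1: "(cutoff (x + k) - cutoff x)\<^sup>2 \<le> c\<^sup>2 * 1" .
    have "norm (cutoff (x + k) - cutoff x) \<le> c * norm (x + k - x)"
      by (rule field_differentiable_bound[of UNIV cutoff "deriv cutoff"])
         (use c(2) smooth_DERIV[OF smooth_cutoff] in \<open>auto\<close>)
    then have "\<bar>cutoff (x + k) - cutoff x\<bar> \<le> \<bar>c * k\<bar>" using c(1) by (simp add: abs_mult)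
    then have 2: "(cutoff (x + k) - cutoff x)\<^sup>2 \<le> c\<^sup>2 * k\<^sup>2"
      by (simp only: abs_le_square_iff power_mult_distrib)
    show ?thesis using 1 2 by (auto simp: min_def)
  qed
  then show ?thesis by (intro exI[of _ "c\<^sup>2"]) auto
qed

text \<open>A product rule for the fractional seminorm: multiplying by the cutoff costs the L^2 norm
  of h times the integral of min(1, k^2) against the weight. The seminorm over the whole line is
  thus reduced to the one over the complement of [-1,1].\<close>

lemma slobodeckij_cut:
  "\<exists>L<\<infinity>. \<forall>h. h \<in> borel_measurable borel \<longrightarrow>
    (\<integral>\<^sup>+ k. ennreal (sw \<sigma> k) * N2 (\<lambda>x. piece 0 h (x + k) - piece 0 h x) \<partial>lborel)
    \<le> L * ((\<integral>\<^sup>+ x \<in> outer. (\<integral>\<^sup>+ y \<in> outer. ennreal ((cmod (h x - h y))\<^sup>2 / \<bar>x - y\<bar> powr (1 + 2 * \<sigma>)) \<partial>lborel) \<partial>lborel)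
      + N2 (\<lambda>x. indicator outer x *\<^sub>R h x))"
  if \<sigma>: "0 < \<sigma>" "\<sigma> < 1"
proof -
  define J where "J = (\<integral>\<^sup>+ k. ennreal (sw \<sigma> k * min 1 (k\<^sup>2)) \<partial>lborel)"
  have J: "J < \<infinity>" unfolding J_def by (rule sw_min_finite[OF \<sigma>])
  obtain L where L: "L \<ge> 0" "\<And>x k. (cutoff (x + k) - cutoff x)\<^sup>2 \<le> L * min 1 (k\<^sup>2)" using cutoff_diff_sq by blast
  have "(\<integral>\<^sup>+ k. ennreal (sw \<sigma> k) * N2 (\<lambda>x. piece 0 h (x + k) - piece 0 h x) \<partial>lborel)
    \<le> (2 + 4 * ennreal L * J) * ((\<integral>\<^sup>+ x \<in> outer. (\<integral>\<^sup>+ y \<in> outer. ennreal ((cmod (h x - h y))\<^sup>2 / \<bar>x - y\<bar> powr (1 + 2 * \<sigma>)) \<partial>lborel) \<partial>lborel)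
      + N2 (\<lambda>x. indicator outer x *\<^sub>R h x))" if [measurable]: "h \<in> borel_measurable borel" for h
  proof -
    define e where "e = (\<lambda>x. indicator outer x *\<^sub>R h x)"
    have [measurable]: "e \<in> borel_measurable borel" unfolding e_def by measurable
    define T where "T = (\<lambda>x y. ennreal (indicator outer x * (indicator outer y * (cmod (h y - h x))\<^sup>2)))"
    have Tm[measurable]: "case_prod T \<in> borel_measurable (lborel \<Otimes>\<^sub>M lborel)"
      unfolding T_def by measurable
    define I where "I = (\<integral>\<^sup>+ x \<in> outer. (\<integral>\<^sup>+ y \<in> outer. ennreal ((cmod (h x - h y))\<^sup>2 / \<bar>x - y\<bar> powr (1 + 2 * \<sigma>)) \<partial>lborel) \<partial>lborel)"
    define Mk where "Mk = (\<lambda>k::real. ennreal (L * min 1 (k\<^sup>2)))"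
    \<comment> \<open>If both points lie outside [-1,1], the difference of the products is split in
      two; if only one does, the cutoff vanishes at the other and only the increment of the cutoff
      remains.\<close>
    have pt: "ennreal ((cmod (piece 0 h (x + k) - piece 0 h x))\<^sup>2) \<le> 2 * T x (x + k) + 2 * (Mk k * (ennreal ((cmod (e x))\<^sup>2) + ennreal ((cmod (e (x + k)))\<^sup>2)))" for x k
    proof -
      define \<theta>1 where "\<theta>1 = cutoff (x + k)"
      define \<theta>2 where "\<theta>2 = cutoff x"
      have \<theta>: "0 \<le> \<theta>1" "\<theta>1 \<le> 1" by (auto simp: \<theta>1_def cutoff_nonneg cutoff_le_1)
      have z: "y \<notin> outer \<Longrightarrow> cutoff y = 0" for y by (rule cutoff_0) auto
      have z1: "x + k \<notin> outer \<Longrightarrow> \<theta>1 = 0" unfolding \<theta>1_def by (rule z)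
      have z2: "x \<notin> outer \<Longrightarrow> \<theta>2 = 0" unfolding \<theta>2_def by (rule z)
      define t1 where "t1 = indicator outer x * (indicator outer (x + k) * (cmod (h (x + k) - h x))\<^sup>2)"
      have t1: "t1 \<ge> 0" by (simp add: t1_def)
      define q where "q = L * min 1 (k\<^sup>2)"
      have q: "(\<theta>1 - \<theta>2)\<^sup>2 \<le> q" unfolding q_def \<theta>1_def \<theta>2_def by (rule L)
      then have q0: "q \<ge> 0" using zero_le_power2[of "\<theta>1 - \<theta>2"] by linarith
      have qe: "(\<theta>1 - \<theta>2)\<^sup>2 * r \<le> q * r" if "r \<ge> 0" for r using q that by (rule mult_right_mono)
      have "(cmod (of_real \<theta>1 * h (x + k) - of_real \<theta>2 * h x))\<^sup>2 \<le> 2 * t1 + 2 * (q * ((cmod (e x))\<^sup>2 + (cmod (e (x + k)))\<^sup>2))"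
      proof (cases "x \<in> outer")
        case x: True
        show ?thesis
        proof (cases "x + k \<in> outer")
          case True
          have "of_real \<theta>1 * h (x + k) - of_real \<theta>2 * h x = of_real \<theta>1 * (h (x + k) - h x) + of_real (\<theta>1 - \<theta>2) * h x"
            by (simp add: algebra_simps)
          then have "(cmod (of_real \<theta>1 * h (x + k) - of_real \<theta>2 * h x))\<^sup>2
            \<le> 2 * (cmod (of_real \<theta>1 * (h (x + k) - h x)))\<^sup>2 + 2 * (cmod (of_real (\<theta>1 - \<theta>2) * h x))\<^sup>2"
            by (simp only: cmod_add_sq)
          also have "\<dots> = 2 * (\<theta>1\<^sup>2 * (cmod (h (x + k) - h x))\<^sup>2) + 2 * ((\<theta>1 - \<theta>2)\<^sup>2 * (cmod (h x))\<^sup>2)"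
            by (simp add: norm_mult power_mult_distrib del: of_real_diff)
          also have "\<dots> \<le> 2 * (1 * (cmod (h (x + k) - h x))\<^sup>2) + 2 * (q * (cmod (h x))\<^sup>2)"
            using \<theta> by (intro add_mono mult_left_mono mult_right_mono qe) (auto simp: power_le_one)
          also have "\<dots> \<le> 2 * t1 + 2 * (q * ((cmod (e x))\<^sup>2 + (cmod (e (x + k)))\<^sup>2))"
            using x True q0 by (simp add: t1_def e_def distrib_left)
          finally show ?thesis .
        next
          case False
          have "(cmod (of_real \<theta>1 * h (x + k) - of_real \<theta>2 * h x))\<^sup>2 = (\<theta>1 - \<theta>2)\<^sup>2 * (cmod (e x))\<^sup>2"
            using z1 False x by (simp add: e_def norm_mult power_mult_distrib)
          also have "\<dots> \<le> q * (cmod (e x))\<^sup>2" by (rule qe) simp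
          also have "\<dots> \<le> 2 * t1 + 2 * (q * ((cmod (e x))\<^sup>2 + (cmod (e (x + k)))\<^sup>2))"
            using t1 q0 by (simp add: distrib_left)
          finally show ?thesis .
        qed
      next
        case x: False
        have "(cmod (of_real \<theta>1 * h (x + k) - of_real \<theta>2 * h x))\<^sup>2 = (\<theta>1 - \<theta>2)\<^sup>2 * (cmod (e (x + k)))\<^sup>2"
          using z1 z2 x by (auto simp: e_def norm_mult power_mult_distrib indicator_def)
        also have "\<dots> \<le> q * (cmod (e (x + k)))\<^sup>2" by (rule qe) simp
        also have "\<dots> \<le> 2 * t1 + 2 * (q * ((cmod (e x))\<^sup>2 + (cmod (e (x + k)))\<^sup>2))"
          using t1 q0 by (simp add: distrib_left)
        finally show ?thesis .
      qed
      then have "ennreal ((cmod (piece 0 h (x + k) - piece 0 h x))\<^sup>2) \<le> ennreal (2 * t1 + 2 * (q * ((cmod (e x))\<^sup>2 + (cmod (e (x + k)))\<^sup>2)))"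
        unfolding \<theta>1_def \<theta>2_def piece_def by (intro ennreal_leI) simp
      also have "\<dots> = 2 * ennreal t1 + 2 * (ennreal q * (ennreal ((cmod (e x))\<^sup>2) + ennreal ((cmod (e (x + k)))\<^sup>2)))"
        using t1 q0 by (simp add: ennreal_plus ennreal_mult)
      finally show ?thesis unfolding T_def Mk_def t1_def q_def .
    qed
    have N: "N2 (\<lambda>x. piece 0 h (x + k) - piece 0 h x) \<le> 2 * (\<integral>\<^sup>+ x. T x (x + k) \<partial>lborel) + 4 * (Mk k * N2 e)" for k
    proof -
      have [measurable]: "(\<lambda>x. T x (x + k)) \<in> borel_measurable lborel" unfolding T_def by measurable
      have "N2 (\<lambda>x. piece 0 h (x + k) - piece 0 h x) \<le> (\<integral>\<^sup>+ x. 2 * T x (x + k) + 2 * (Mk k * (ennreal ((cmod (e x))\<^sup>2) + ennreal ((cmod (e (x + k)))\<^sup>2))) \<partial>lborel)"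
        unfolding N2_def by (intro nn_integral_mono pt)
      also have "\<dots> = 2 * (\<integral>\<^sup>+ x. T x (x + k) \<partial>lborel) + 2 * (Mk k * (N2 e + N2 (\<lambda>x. e (x + k))))"
        unfolding N2_def by (simp add: nn_integral_add nn_integral_cmult)
      also have "N2 (\<lambda>x. e (x + k)) = N2 e" by (rule N2_shift) measurable
      also have "2 * (Mk k * (N2 e + N2 e)) = 4 * (Mk k * N2 e)"
      proof -
        have "Mk k * (N2 e + N2 e) = 2 * (Mk k * N2 e)" by (simp only: distrib_left mult_2)
        then show ?thesis by (simp add: mult.assoc[symmetric])
      qed
      finally show ?thesis .
    qed
    have sT: "(\<integral>\<^sup>+ k. ennreal (sw \<sigma> k) * (\<integral>\<^sup>+ x. T x (x + k) \<partial>lborel) \<partial>lborel) \<le> I"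
    proof -
      have "(\<integral>\<^sup>+ k. ennreal (sw \<sigma> k) * (\<integral>\<^sup>+ x. T x (x + k) \<partial>lborel) \<partial>lborel) = (\<integral>\<^sup>+ k. (\<integral>\<^sup>+ x. ennreal (sw \<sigma> k) * T x (x + k) \<partial>lborel) \<partial>lborel)"
        unfolding T_def by (simp add: nn_integral_cmult)
      also have "\<dots> = (\<integral>\<^sup>+ x. (\<integral>\<^sup>+ k. ennreal (sw \<sigma> k) * T x (x + k) \<partial>lborel) \<partial>lborel)"
        unfolding T_def by (rule lborel_pair.Fubini') (simp add: split_beta', measurable)
      \<comment> \<open>With y = x + k the shifts become pairs with x < y, one half of the
        Slobodeckij integral.\<close>
      also have "\<dots> = (\<integral>\<^sup>+ x. (\<integral>\<^sup>+ y. ennreal (sw \<sigma> (y - x)) * T x y \<partial>lborel) \<partial>lborel)"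
      proof (rule nn_integral_cong)
        fix x
        have "(\<integral>\<^sup>+ k. ennreal (sw \<sigma> ((k + x) - x)) * T x (k + x) \<partial>lborel) = (\<integral>\<^sup>+ y. ennreal (sw \<sigma> (y - x)) * T x y \<partial>lborel)"
          unfolding T_def by (rule nn_integral_shift) measurable
        then show "(\<integral>\<^sup>+ k. ennreal (sw \<sigma> k) * T x (x + k) \<partial>lborel) = (\<integral>\<^sup>+ y. ennreal (sw \<sigma> (y - x)) * T x y \<partial>lborel)"
          by (simp add: add.commute)
      qed
      also have "\<dots> \<le> (\<integral>\<^sup>+ x. (\<integral>\<^sup>+ y. ennreal ((cmod (h x - h y))\<^sup>2 / \<bar>x - y\<bar> powr (1 + 2 * \<sigma>)) * indicator outer y * indicator outer x \<partial>lborel) \<partial>lborel)"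
      proof (intro nn_integral_mono)
        fix x y
        have "sw \<sigma> (y - x) \<le> 1 / \<bar>x - y\<bar> powr (1 + 2 * \<sigma>)"
        proof (cases "x < y")
          case True
          have "sw \<sigma> (y - x) = (y - x) powr (- (1 + 2 * \<sigma>))" using True by (simp add: sw_def algebra_simps)
          also have "\<dots> = 1 / (y - x) powr (1 + 2 * \<sigma>)" by (rule powr_minus_divide)
          finally show ?thesis using True by simp
        qed (auto simp: sw_def)
        then have "sw \<sigma> (y - x) * (cmod (h y - h x))\<^sup>2 \<le> 1 / \<bar>x - y\<bar> powr (1 + 2 * \<sigma>) * (cmod (h y - h x))\<^sup>2"
          by (intro mult_right_mono) auto
        then have "ennreal (sw \<sigma> (y - x) * (cmod (h y - h x))\<^sup>2) \<le> ennreal ((cmod (h x - h y))\<^sup>2 / \<bar>x - y\<bar> powr (1 + 2 * \<sigma>))"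
          by (intro ennreal_leI) (simp add: norm_minus_commute)
        then show "ennreal (sw \<sigma> (y - x)) * T x y \<le> ennreal ((cmod (h x - h y))\<^sup>2 / \<bar>x - y\<bar> powr (1 + 2 * \<sigma>)) * indicator outer y * indicator outer x"
          unfolding T_def by (auto simp: indicator_def ennreal_mult[symmetric] sw_nonneg)
      qed
      also have "\<dots> = I" unfolding I_def by (subst nn_integral_multc) auto
      finally show ?thesis .
    qed
    have sM: "(\<integral>\<^sup>+ k. ennreal (sw \<sigma> k) * (Mk k * N2 e) \<partial>lborel) = ennreal L * J * N2 e"
    proof -
      have "ennreal (sw \<sigma> k) * (Mk k * N2 e) = ennreal L * ennreal (sw \<sigma> k * min 1 (k\<^sup>2)) * N2 e" for k
        using L(1) sw_nonneg[of \<sigma> k] by (simp add: Mk_def ennreal_mult mult_ac)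
      then show ?thesis unfolding J_def by (simp add: nn_integral_multc nn_integral_cmult)
    qed
    have [measurable]: "(\<lambda>k. \<integral>\<^sup>+ x. T x (x + k) \<partial>lborel) \<in> borel_measurable borel" unfolding T_def by measurable
    have [measurable]: "Mk \<in> borel_measurable borel" unfolding Mk_def by measurable
    have "(\<integral>\<^sup>+ k. ennreal (sw \<sigma> k) * N2 (\<lambda>x. piece 0 h (x + k) - piece 0 h x) \<partial>lborel)
      \<le> (\<integral>\<^sup>+ k. 2 * (ennreal (sw \<sigma> k) * (\<integral>\<^sup>+ x. T x (x + k) \<partial>lborel)) + 4 * (ennreal (sw \<sigma> k) * (Mk k * N2 e)) \<partial>lborel)"
    proof (intro nn_integral_mono)
      fix k
      have "ennreal (sw \<sigma> k) * N2 (\<lambda>x. piece 0 h (x + k) - piece 0 h x) \<le> ennreal (sw \<sigma> k) * (2 * (\<integral>\<^sup>+ x. T x (x + k) \<partial>lborel) + 4 * (Mk k * N2 e))"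
        by (intro mult_left_mono N) auto
      then show "ennreal (sw \<sigma> k) * N2 (\<lambda>x. piece 0 h (x + k) - piece 0 h x) \<le> 2 * (ennreal (sw \<sigma> k) * (\<integral>\<^sup>+ x. T x (x + k) \<partial>lborel)) + 4 * (ennreal (sw \<sigma> k) * (Mk k * N2 e))"
        by (simp add: distrib_left mult_ac)
    qed
    also have "\<dots> = 2 * (\<integral>\<^sup>+ k. ennreal (sw \<sigma> k) * (\<integral>\<^sup>+ x. T x (x + k) \<partial>lborel) \<partial>lborel) + 4 * (\<integral>\<^sup>+ k. ennreal (sw \<sigma> k) * (Mk k * N2 e) \<partial>lborel)"
      by (simp add: nn_integral_add nn_integral_cmult)
    also have "\<dots> \<le> 2 * I + 4 * (ennreal L * J * N2 e)"
      unfolding sM by (intro add_mono mult_left_mono sT) auto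
    also have "\<dots> \<le> (2 + 4 * ennreal L * J) * (I + N2 e)"
      by (simp add: distrib_left distrib_right mult_ac add_increasing add_increasing2 add_mono)
    finally show ?thesis unfolding I_def e_def .
  qed
  moreover have "2 + 4 * ennreal L * J < \<infinity>" using J by (auto simp: ennreal_mult_less_top)
  ultimately show ?thesis by blast
qed

subsection \<open>The high-frequency part\<close>

text \<open>The low-frequency part, at unit scale, of the function with transform f; the cutoff is 0
  near [-1,1], hence the factor 1 - \<open>cutoff\<close>.\<close>

definition uin :: "(real \<Rightarrow> complex) \<Rightarrow> real \<Rightarrow> complex" where
  "uin f = ift (\<lambda>\<xi>. of_real (1 - cutoff \<xi>) * f \<xi>)"

text \<open>Compact support of 1 - \<open>cutoff\<close> makes the low frequencies integrable, by
  Cauchy-Schwarz.\<close>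

lemma L12_low:
  assumes [measurable]: "f \<in> borel_measurable borel" and fin: "N2 f < \<infinity>"
  shows "L12 (\<lambda>\<xi>. of_real (1 - cutoff \<xi>) * f \<xi>)"
proof -
  have "integrable lborel (\<lambda>\<xi>. f \<xi> * cnj (of_real (1 - cutoff \<xi>)))"
    by (intro integrable_mult_cnj fin kernel_N2 csmooth_kernel csmooth_1_cutoff) auto
  moreover have "N2 (\<lambda>\<xi>. of_real (1 - cutoff \<xi>) * f \<xi>) \<le> N2 f"
  proof (intro N2_mono)
    fix x
    have "\<bar>1 - cutoff x\<bar> \<le> 1" using cutoff_nonneg[of x] cutoff_le_1[of x] by auto
    then show "cmod (of_real (1 - cutoff x) * f x) \<le> cmod (f x)"
      using mult_right_mono[of "\<bar>1 - cutoff x\<bar>" 1 "cmod (f x)"] by (simp add: norm_mult del: of_real_diff)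
  qed
  ultimately show ?thesis using fin by (auto simp: L12_def mult.commute)
qed

lemma pieces_bound:
  "\<exists>c<\<infinity>. \<forall>i\<le>n. \<forall>h. h \<in> borel_measurable borel \<longrightarrow> N2 (piece i h) \<le> c * N2 (\<lambda>x. indicator outer x *\<^sub>R h x)"
proof -
  have "\<exists>c. \<forall>i. 0 \<le> c i \<and> (\<forall>h. h \<in> borel_measurable borel \<longrightarrow> N2 (piece i h) \<le> ennreal (c i) * N2 (\<lambda>x. indicator outer x *\<^sub>R h x))"
    by (rule choice) (use N2_piece_le in blast)
  then obtain c where c: "\<And>i h. h \<in> borel_measurable borel \<Longrightarrow> N2 (piece i h) \<le> ennreal (c i) * N2 (\<lambda>x. indicator outer x *\<^sub>R h x)"
    by blast
  have "N2 (piece i h) \<le> (\<Sum>i\<le>n. ennreal (c i)) * N2 (\<lambda>x. indicator outer x *\<^sub>R h x)"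
    if "i \<le> n" "h \<in> borel_measurable borel" for i h
  proof -
    have "ennreal (c i) \<le> (\<Sum>i\<le>n. ennreal (c i))" using that by (intro member_le_sum) auto
    then show ?thesis using c[OF that(2), of i] by (meson mult_right_mono order_trans zero_le)
  qed
  moreover have "(\<Sum>i\<le>n. ennreal (c i)) < \<infinity>" by simp
  ultimately show ?thesis by blast
qed

context weak_derivs
begin

definition S where "S = (\<Sum>k\<le>m. N2 (\<lambda>x. indicator outer x *\<^sub>R h k x))"

lemma S_ge: "k \<le> m \<Longrightarrow> N2 (\<lambda>x. indicator outer x *\<^sub>R h k x) \<le> S"
  unfolding S_def by (intro member_le_sum) auto

text \<open>Removing (1 - \<open>cutoff\<close>) f from f leaves \<open>cutoff\<close> f, so
  \<open>ft_pair_conv\<close> applies with the low frequencies as F.\<close>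

lemma high_regularized:
  assumes p: "ft_pair u f" and K: "kernel K"
  shows "N2 (\<lambda>x. kt K x * (u x - uin f x)) \<le> 2 * N2 (conv K (\<lambda>\<xi>. of_real (cutoff \<xi>) * f \<xi>))"
proof -
  have fin: "N2 f < \<infinity>" using p by (rule ft_pair_N2_finite)
  have "N2 (\<lambda>x. kt K x * (u x - ift (\<lambda>\<xi>. of_real (1 - cutoff \<xi>) * f \<xi>) x)) \<le> 2 * N2 (conv K (\<lambda>\<xi>. f \<xi> - of_real (1 - cutoff \<xi>) * f \<xi>))"
    by (rule ft_pair_conv[OF p L12_low[OF f_meas fin] K])
  moreover have "(\<lambda>\<xi>. f \<xi> - of_real (1 - cutoff \<xi>) * f \<xi>) = (\<lambda>\<xi>. of_real (cutoff \<xi>) * f \<xi>)"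
    by (auto simp: algebra_simps)
  ultimately show ?thesis by (simp add: uin_def)
qed

lemma piece_le:
  assumes c: "\<And>i h. i \<le> Suc m \<Longrightarrow> h \<in> borel_measurable borel \<Longrightarrow> N2 (piece i h) \<le> c * N2 (\<lambda>x. indicator outer x *\<^sub>R h x)"
    and i: "i \<le> Suc m" and k: "k \<le> m"
  shows "N2 (piece i (h k)) \<le> c * S"
  by (rule order_trans[OF c[OF i h_meas[OF k]] mult_left_mono[OF S_ge[OF k]]]) simp

lemma N2_conv_moll_le:
  assumes \<phi>: "moll \<phi> P" and "G \<in> borel_measurable borel"
  shows "N2 (conv \<phi> G) \<le> N2 G"
proof -
  have nn: "\<bar>\<phi> x\<bar> = \<phi> x" for x using \<phi> by (simp add: moll_def)
  show ?thesis
    using N2_conv_le[OF csmooth_measurable[OF moll_csmooth[OF \<phi>]] assms(2)] moll_one[OF \<phi>] by (simp add: nn)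
qed

text \<open>After the expansion of \<open>conv_deriv_cut\<close> every term is a convolution with
  the mollifier itself, whose L^1 norm is 1; the bound is therefore the same for all
  mollifiers.\<close>

lemma high_integer_regularized:
  assumes p: "ft_pair u f" and \<phi>: "moll \<phi> P"
    and c: "\<And>i h. i \<le> Suc m \<Longrightarrow> h \<in> borel_measurable borel \<Longrightarrow> N2 (piece i h) \<le> c * N2 (\<lambda>x. indicator outer x *\<^sub>R h x)"
  shows "N2 (\<lambda>x. kt ((deriv ^^ m) \<phi>) x * (u x - uin f x)) \<le> 2 * (2 ^ Suc m * (\<Sum>j\<le>m. ennreal ((leib m j)\<^sup>2) * (c * S)))"
proof -
  have \<phi>c: "csmooth \<phi>" using \<phi> by (rule moll_csmooth)
  have [measurable]: "\<phi> \<in> borel_measurable borel" using \<phi>c by (rule csmooth_measurable)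
  have pm[measurable]: "piece j (h (m - j)) \<in> borel_measurable borel" for j by (intro piece_meas) simp
  have "N2 (\<lambda>x. kt ((deriv ^^ m) \<phi>) x * (u x - uin f x)) \<le> 2 * N2 (conv ((deriv ^^ m) \<phi>) (\<lambda>\<xi>. of_real (cutoff \<xi>) * f \<xi>))"
    by (rule high_regularized[OF p csmooth_kernel[OF csmooth_derivs[OF \<phi>c]]])
  also have "conv ((deriv ^^ m) \<phi>) (\<lambda>\<xi>. of_real (cutoff \<xi>) * f \<xi>) = (\<lambda>\<xi>. \<Sum>j\<le>m. of_real ((-1) ^ j * leib m j) * conv \<phi> (piece j (h (m - j))) \<xi>)"
    using conv_deriv_cut[OF \<phi>c] by auto
  also have "N2 \<dots> \<le> 2 ^ Suc m * (\<Sum>j\<le>m. N2 (\<lambda>\<xi>. of_real ((-1) ^ j * leib m j) * conv \<phi> (piece j (h (m - j))) \<xi>))"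
    by (rule N2_sum) measurable
  also have "\<dots> \<le> 2 ^ Suc m * (\<Sum>j\<le>m. ennreal ((leib m j)\<^sup>2) * (c * S))"
  proof (intro mult_left_mono sum_mono)
    fix j assume j: "j \<in> {..m}"
    have "N2 (\<lambda>\<xi>. of_real ((-1) ^ j * leib m j) * conv \<phi> (piece j (h (m - j))) \<xi>) = ennreal ((leib m j)\<^sup>2) * N2 (conv \<phi> (piece j (h (m - j))))"
      by (subst N2_cmult) (auto simp: norm_mult norm_power)
    also have "\<dots> \<le> ennreal ((leib m j)\<^sup>2) * (c * S)"
      using j by (intro mult_left_mono order_trans[OF N2_conv_moll_le[OF \<phi> pm] piece_le[OF c]]) auto
    finally show "N2 (\<lambda>\<xi>. of_real ((-1) ^ j * leib m j) * conv \<phi> (piece j (h (m - j))) \<xi>) \<le> ennreal ((leib m j)\<^sup>2) * (c * S)" .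
  qed auto
  finally show ?thesis by (simp add: mult_left_mono)
qed

text \<open>The factor exp(-i x k) - 1 corresponds to a translation difference of the kernel. In the
  Leibniz expansion the term j = 0 keeps the translation difference of the top derivative, which
  cannot be differentiated again; each term with j \<ge> 1 gains k^2 from the weak product rule for
  small k and is bounded trivially for large k.\<close>

lemma high_difference_regularized:
  assumes p: "ft_pair u f" and \<phi>: "moll \<phi> P" and k: "k > 0"
    and c: "\<And>i h. i \<le> Suc m \<Longrightarrow> h \<in> borel_measurable borel \<Longrightarrow> N2 (piece i h) \<le> c * N2 (\<lambda>x. indicator outer x *\<^sub>R h x)"
  shows "N2 (\<lambda>x. (exp (- (\<i> * of_real (x * k))) - 1) * (kt ((deriv ^^ m) \<phi>) x * (u x - uin f x)))
    \<le> 2 * (2 ^ Suc m * (\<Sum>j\<le>m. ennreal ((leib m j)\<^sup>2) * (N2 (\<lambda>x. piece 0 (h m) (x + k) - piece 0 (h m) x) + ennreal (min 1 (k\<^sup>2)) * (4 * (c * S)))))"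
proof -
  define D where "D = N2 (\<lambda>x. piece 0 (h m) (x + k) - piece 0 (h m) x) + ennreal (min 1 (k\<^sup>2)) * (4 * (c * S))"
  have \<phi>c: "csmooth \<phi>" using \<phi> by (rule moll_csmooth)
  have [measurable]: "\<phi> \<in> borel_measurable borel" using \<phi>c by (rule csmooth_measurable)
  have pm[measurable]: "piece j (h (m - j)) \<in> borel_measurable borel" for j by (intro piece_meas) simp
  define dm where "dm = (deriv ^^ m) \<phi>"
  have dmc: "csmooth dm" unfolding dm_def by (rule csmooth_derivs[OF \<phi>c])
  have K: "kernel (\<lambda>s. dm (s + k) - dm s)"
    using csmooth_affine[OF dmc, of 1 k] by (intro csmooth_kernel csmooth_diff dmc) simp
  define G where "G = (\<lambda>\<xi>. of_real (cutoff \<xi>) * f \<xi>)"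
  have Gm[measurable]: "G \<in> borel_measurable borel" unfolding G_def by measurable
  have "N2 G \<le> N2 f"
    unfolding G_def using cutoff_nonneg cutoff_le_1
    by (intro N2_mono) (auto simp: norm_mult intro: mult_left_le_one_le)
  then have Gf: "N2 G < \<infinity>" using ft_pair_N2_finite[OF p] by (rule le_less_trans)
  have each: "N2 (\<lambda>\<xi>. conv \<phi> (piece j (h (m - j))) (\<xi> + k) - conv \<phi> (piece j (h (m - j))) \<xi>) \<le> D" if j: "j \<le> m" for j
  proof (cases "j = 0")
    case True
    have [measurable]: "piece 0 (h m) \<in> borel_measurable borel" by (intro piece_meas) simp
    have e: "conv \<phi> (piece 0 (h m)) (\<xi> + k) - conv \<phi> (piece 0 (h m)) \<xi> = conv \<phi> (\<lambda>y. piece 0 (h m) (y + k) - piece 0 (h m) y) \<xi>" for \<xi>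
      unfolding conv_shift using piece_fin[of m 0]
      by (subst conv_diff[OF csmooth_kernel[OF \<phi>c]]) (auto simp: N2_shift)
    have "N2 (\<lambda>\<xi>. conv \<phi> (piece j (h (m - j))) (\<xi> + k) - conv \<phi> (piece j (h (m - j))) \<xi>) \<le> N2 (\<lambda>x. piece 0 (h m) (x + k) - piece 0 (h m) x)"
      unfolding True diff_zero e by (rule N2_conv_moll_le[OF \<phi>]) measurable
    also have "\<dots> \<le> D" unfolding D_def by (rule add_increasing2) auto
    finally show ?thesis .
  next
    case False
    then have j1: "1 \<le> j" by simp
    have mj: "m - j \<le> m" "Suc (m - j) \<le> m" using j j1 by auto
    have [measurable]: "piece i (h (m - j)) \<in> borel_measurable borel" "piece i (h (Suc (m - j))) \<in> borel_measurable borel" for i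
      using mj piece_meas by auto
    have cS: "N2 (piece j (h (m - j))) \<le> c * S" "N2 (piece (Suc j) (h (m - j))) \<le> c * S" "N2 (piece j (h (Suc (m - j)))) \<le> c * S"
      using j mj by (auto intro!: piece_le[OF c])
    have four: "2 * (c * S) + 2 * (c * S) = 4 * (c * S)" by (simp add: distrib_right[symmetric])
    have "N2 (\<lambda>x. piece (Suc j) (h (m - j)) x + piece j (h (Suc (m - j))) x) \<le> 2 * N2 (piece (Suc j) (h (m - j))) + 2 * N2 (piece j (h (Suc (m - j))))"
      by (rule N2_add) measurable
    also have "\<dots> \<le> 2 * (c * S) + 2 * (c * S)" by (intro add_mono mult_left_mono cS) auto
    finally have a: "N2 (\<lambda>\<xi>. conv \<phi> (piece j (h (m - j))) (\<xi> + k) - conv \<phi> (piece j (h (m - j))) \<xi>) \<le> ennreal (k\<^sup>2) * (4 * (c * S))"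
      unfolding four by (intro order_trans[OF N2_conv_difference_piece[OF \<phi> j1 j k]] mult_left_mono) auto
    have "N2 (\<lambda>\<xi>. conv \<phi> (piece j (h (m - j))) (\<xi> + k) - conv \<phi> (piece j (h (m - j))) \<xi>)
      \<le> 2 * N2 (\<lambda>\<xi>. conv \<phi> (piece j (h (m - j))) (\<xi> + k)) + 2 * N2 (conv \<phi> (piece j (h (m - j))))"
      by (rule N2_diff) measurable
    also have "N2 (\<lambda>\<xi>. conv \<phi> (piece j (h (m - j))) (\<xi> + k)) = N2 (conv \<phi> (piece j (h (m - j))))"
      by (rule N2_shift) measurable
    also have "2 * N2 (conv \<phi> (piece j (h (m - j)))) + 2 * N2 (conv \<phi> (piece j (h (m - j)))) \<le> 2 * (c * S) + 2 * (c * S)"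
      by (intro add_mono mult_left_mono order_trans[OF N2_conv_moll_le[OF \<phi>] cS(1)]) auto
    finally have b: "N2 (\<lambda>\<xi>. conv \<phi> (piece j (h (m - j))) (\<xi> + k) - conv \<phi> (piece j (h (m - j))) \<xi>) \<le> 1 * (4 * (c * S))"
      unfolding four by simp
    have "N2 (\<lambda>\<xi>. conv \<phi> (piece j (h (m - j))) (\<xi> + k) - conv \<phi> (piece j (h (m - j))) \<xi>) \<le> ennreal (min 1 (k\<^sup>2)) * (4 * (c * S))"
      using a b by (cases "k\<^sup>2 \<le> 1") (auto simp: min_def)
    also have "\<dots> \<le> D" unfolding D_def by (rule add_increasing) auto
    finally show ?thesis .
  qed
  have "N2 (\<lambda>x. (exp (- (\<i> * of_real (x * k))) - 1) * (kt dm x * (u x - uin f x))) = N2 (\<lambda>x. kt (\<lambda>s. dm (s + k) - dm s) x * (u x - uin f x))"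
    by (simp only: kt_shift_diff[OF csmooth_kernel[OF dmc]] mult.assoc)
  also have "\<dots> \<le> 2 * N2 (conv (\<lambda>s. dm (s + k) - dm s) G)"
    unfolding G_def by (rule high_regularized[OF p K])
  also have "conv (\<lambda>s. dm (s + k) - dm s) G = (\<lambda>\<xi>. conv dm G (\<xi> + k) - conv dm G \<xi>)"
    using conv_sum_kernel[OF csmooth_kernel[OF dmc] csmooth_kernel[OF dmc] Gm Gf] by auto
  also have "\<dots> = (\<lambda>\<xi>. \<Sum>j\<le>m. of_real ((-1) ^ j * leib m j) * (conv \<phi> (piece j (h (m - j))) (\<xi> + k) - conv \<phi> (piece j (h (m - j))) \<xi>))"
    unfolding dm_def G_def conv_deriv_cut[OF \<phi>c] by (simp add: sum_subtractf[symmetric] right_diff_distrib)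
  also have "N2 \<dots> \<le> 2 ^ Suc m * (\<Sum>j\<le>m. N2 (\<lambda>\<xi>. of_real ((-1) ^ j * leib m j) * (conv \<phi> (piece j (h (m - j))) (\<xi> + k) - conv \<phi> (piece j (h (m - j))) \<xi>)))"
    by (rule N2_sum) measurable
  also have "\<dots> \<le> 2 ^ Suc m * (\<Sum>j\<le>m. ennreal ((leib m j)\<^sup>2) * D)"
  proof (intro mult_left_mono sum_mono)
    fix j assume j: "j \<in> {..m}"
    have "N2 (\<lambda>\<xi>. of_real ((-1) ^ j * leib m j) * (conv \<phi> (piece j (h (m - j))) (\<xi> + k) - conv \<phi> (piece j (h (m - j))) \<xi>))
      = ennreal ((leib m j)\<^sup>2) * N2 (\<lambda>\<xi>. conv \<phi> (piece j (h (m - j))) (\<xi> + k) - conv \<phi> (piece j (h (m - j))) \<xi>)"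
      by (subst N2_cmult) (auto simp: norm_mult norm_power)
    also have "\<dots> \<le> ennreal ((leib m j)\<^sup>2) * D"
      using j by (intro mult_left_mono each) auto
    finally show "N2 (\<lambda>\<xi>. of_real ((-1) ^ j * leib m j) * (conv \<phi> (piece j (h (m - j))) (\<xi> + k) - conv \<phi> (piece j (h (m - j))) \<xi>)) \<le> ennreal ((leib m j)\<^sup>2) * D" .
  qed auto
  finally show ?thesis unfolding D_def dm_def by (simp add: mult_left_mono)
qed

text \<open>\<open>high_difference_regularized\<close> integrated over k against \<open>sw\<close>:
  on the left the phases add up to at least d |x|^(2\<sigma>); on the right the term j = 0 becomes a
  Slobodeckij integral, and min(1, k^2) becomes a constant.\<close>

lemma high_fractional_regularized:
  assumes p: "ft_pair u f" and \<phi>: "moll \<phi> P"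
    and c: "\<And>i h. i \<le> Suc m \<Longrightarrow> h \<in> borel_measurable borel \<Longrightarrow> N2 (piece i h) \<le> c * N2 (\<lambda>x. indicator outer x *\<^sub>R h x)"
    and d: "d > 0" "\<And>x. ennreal (d * \<bar>x\<bar> powr (2 * \<sigma>)) \<le> (\<integral>\<^sup>+ k. ennreal (sw \<sigma> k) * ennreal ((cmod (exp (- (\<i> * of_real (x * k))) - 1))\<^sup>2) \<partial>lborel)"
    and L: "(\<integral>\<^sup>+ k. ennreal (sw \<sigma> k) * N2 (\<lambda>x. piece 0 (h m) (x + k) - piece 0 (h m) x) \<partial>lborel) \<le> L * T"
  shows "(\<integral>\<^sup>+ x. ennreal (d * \<bar>x\<bar> powr (2 * \<sigma>)) * ennreal ((cmod (kt ((deriv ^^ m) \<phi>) x * (u x - uin f x)))\<^sup>2) \<partial>lborel)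
    \<le> 2 * (2 ^ Suc m * (\<Sum>j\<le>m. ennreal ((leib m j)\<^sup>2) * (L * T + (\<integral>\<^sup>+ k. ennreal (sw \<sigma> k * min 1 (k\<^sup>2)) \<partial>lborel) * (4 * (c * S)))))"
proof -
  define V where "V = (\<lambda>x. kt ((deriv ^^ m) \<phi>) x * (u x - uin f x))"
  have [measurable]: "u \<in> borel_measurable borel" using p by (simp add: ft_pair_def)
  have [measurable]: "uin f \<in> borel_measurable borel" unfolding uin_def by measurable
  have [measurable]: "(deriv ^^ m) \<phi> \<in> borel_measurable borel" by (rule csmooth_measurable[OF csmooth_derivs[OF moll_csmooth[OF \<phi>]]])
  have [measurable]: "V \<in> borel_measurable borel" unfolding V_def by measurable
  have [measurable]: "piece 0 (h m) \<in> borel_measurable borel" by (intro piece_meas) simp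
  define J where "J = (\<integral>\<^sup>+ k. ennreal (sw \<sigma> k * min 1 (k\<^sup>2)) \<partial>lborel)"
  define N where "N = (\<lambda>k. N2 (\<lambda>x. piece 0 (h m) (x + k) - piece 0 (h m) x))"
  have [measurable]: "N \<in> borel_measurable borel" unfolding N_def N2_def by measurable
  define E where "E = (\<lambda>x k. exp (- (\<i> * of_real (x * k))) - (1::complex))"
  have [measurable]: "case_prod E \<in> borel_measurable (borel \<Otimes>\<^sub>M borel)" unfolding E_def by (simp add: split_beta')
  have "(\<integral>\<^sup>+ x. ennreal (d * \<bar>x\<bar> powr (2 * \<sigma>)) * ennreal ((cmod (V x))\<^sup>2) \<partial>lborel)
    \<le> (\<integral>\<^sup>+ x. (\<integral>\<^sup>+ k. ennreal (sw \<sigma> k) * ennreal ((cmod (E x k))\<^sup>2) \<partial>lborel) * ennreal ((cmod (V x))\<^sup>2) \<partial>lborel)"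
    unfolding E_def by (intro nn_integral_mono mult_right_mono d) auto
  also have "\<dots> = (\<integral>\<^sup>+ x. (\<integral>\<^sup>+ k. ennreal (sw \<sigma> k) * ennreal ((cmod (E x k * V x))\<^sup>2) \<partial>lborel) \<partial>lborel)"
  proof (rule nn_integral_cong)
    fix x
    have "(\<integral>\<^sup>+ k. ennreal (sw \<sigma> k) * ennreal ((cmod (E x k))\<^sup>2) \<partial>lborel) * ennreal ((cmod (V x))\<^sup>2)
      = (\<integral>\<^sup>+ k. ennreal (sw \<sigma> k) * ennreal ((cmod (E x k))\<^sup>2) * ennreal ((cmod (V x))\<^sup>2) \<partial>lborel)"
      unfolding E_def by (rule nn_integral_multc[symmetric]) measurable
    then show "(\<integral>\<^sup>+ k. ennreal (sw \<sigma> k) * ennreal ((cmod (E x k))\<^sup>2) \<partial>lborel) * ennreal ((cmod (V x))\<^sup>2)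
      = (\<integral>\<^sup>+ k. ennreal (sw \<sigma> k) * ennreal ((cmod (E x k * V x))\<^sup>2) \<partial>lborel)"
      by (simp add: norm_mult power_mult_distrib ennreal_mult mult.assoc)
  qed
  also have "\<dots> = (\<integral>\<^sup>+ k. (\<integral>\<^sup>+ x. ennreal (sw \<sigma> k) * ennreal ((cmod (E x k * V x))\<^sup>2) \<partial>lborel) \<partial>lborel)"
    unfolding E_def by (rule lborel_pair.Fubini') (simp add: split_beta', measurable)
  also have "\<dots> = (\<integral>\<^sup>+ k. ennreal (sw \<sigma> k) * N2 (\<lambda>x. E x k * V x) \<partial>lborel)"
    unfolding N2_def E_def by (rule nn_integral_cong) (rule nn_integral_cmult, measurable)
  also have "\<dots> \<le> (\<integral>\<^sup>+ k. 2 * (2 ^ Suc m * (\<Sum>j\<le>m. ennreal ((leib m j)\<^sup>2) * (ennreal (sw \<sigma> k) * N k + ennreal (sw \<sigma> k * min 1 (k\<^sup>2)) * (4 * (c * S))))) \<partial>lborel)"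
  proof (intro nn_integral_mono)
    fix k
    show "ennreal (sw \<sigma> k) * N2 (\<lambda>x. E x k * V x) \<le> 2 * (2 ^ Suc m * (\<Sum>j\<le>m. ennreal ((leib m j)\<^sup>2) * (ennreal (sw \<sigma> k) * N k + ennreal (sw \<sigma> k * min 1 (k\<^sup>2)) * (4 * (c * S)))))"
    proof (cases "k > 0")
      case True
      have "ennreal (sw \<sigma> k) * N2 (\<lambda>x. E x k * V x) \<le> ennreal (sw \<sigma> k) * (2 * (2 ^ Suc m * (\<Sum>j\<le>m. ennreal ((leib m j)\<^sup>2) * (N k + ennreal (min 1 (k\<^sup>2)) * (4 * (c * S))))))"
        unfolding E_def V_def N_def by (intro mult_left_mono high_difference_regularized[OF p \<phi> True c]) auto
      also have "\<dots> = 2 * (2 ^ Suc m * (\<Sum>j\<le>m. ennreal ((leib m j)\<^sup>2) * (ennreal (sw \<sigma> k) * N k + ennreal (sw \<sigma> k * min 1 (k\<^sup>2)) * (4 * (c * S)))))"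
        using sw_nonneg[of \<sigma> k] by (simp add: sum_distrib_left sum_distrib_right distrib_left ennreal_mult mult_ac)
      finally show ?thesis .
    qed (simp add: sw_def)
  qed
  also have "\<dots> = 2 * (2 ^ Suc m * (\<Sum>j\<le>m. ennreal ((leib m j)\<^sup>2) * ((\<integral>\<^sup>+ k. ennreal (sw \<sigma> k) * N k \<partial>lborel) + J * (4 * (c * S)))))"
    unfolding J_def by (simp add: nn_integral_cmult nn_integral_sum nn_integral_add nn_integral_multc)
  also have "\<dots> \<le> 2 * (2 ^ Suc m * (\<Sum>j\<le>m. ennreal ((leib m j)\<^sup>2) * (L * T + J * (4 * (c * S)))))"
    using L unfolding N_def by (intro mult_left_mono sum_mono add_mono order_refl) auto
  finally show ?thesis unfolding V_def J_def .
qed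

text \<open>Fatou along a shrinking mollifier, whose multiplier tends to 1 pointwise, while its m
  derivatives contribute exactly |x|^m. For this the bound \<open>b\<close> has to be uniform over
  all mollifiers.\<close>

lemma moll_limit:
  assumes p: "ft_pair u f" and [measurable]: "w \<in> borel_measurable borel"
    and bd: "\<And>\<phi> P. moll \<phi> P \<Longrightarrow> (\<integral>\<^sup>+ x. ennreal (w x) * ennreal ((cmod (kt ((deriv ^^ m) \<phi>) x * (u x - uin f x)))\<^sup>2) \<partial>lborel) \<le> b"
  shows "(\<integral>\<^sup>+ x. ennreal (w x) * ennreal ((\<bar>x\<bar> ^ m * cmod (u x - uin f x))\<^sup>2) \<partial>lborel) \<le> b"
proof -
  have [measurable]: "u \<in> borel_measurable borel" using p by (simp add: ft_pair_def)
  have [measurable]: "uin f \<in> borel_measurable borel" unfolding uin_def by measurable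
  obtain \<phi> P where \<phi>: "moll \<phi> P" using moll_exists by blast
  define \<psi> where "\<psi> = (\<lambda>n x. real (Suc n) * \<phi> (real (Suc n) * x))"
  have \<psi>: "moll (\<psi> n) (\<lambda>x. P (real (Suc n) * x))" for n unfolding \<psi>_def by (rule moll_scale[OF \<phi>])
  have [measurable]: "(deriv ^^ m) (\<psi> n) \<in> borel_measurable borel" for n
    by (rule csmooth_measurable[OF csmooth_derivs[OF moll_csmooth[OF \<psi>]]])
  show ?thesis
  proof (rule nn_integral_le_LIMSEQ[OF _ _ bd[OF \<psi>] tendsto_const])
    fix x
    have "(\<lambda>n. \<bar>x\<bar> ^ m * cmod (kt (\<psi> n) x) * cmod (u x - uin f x)) \<longlonglongrightarrow> \<bar>x\<bar> ^ m * cmod 1 * cmod (u x - uin f x)"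
      unfolding \<psi>_def by (intro tendsto_intros kt_moll_scale_tendsto[OF \<phi>])
    then have "(\<lambda>n. (\<bar>x\<bar> ^ m * cmod (kt (\<psi> n) x) * cmod (u x - uin f x))\<^sup>2) \<longlonglongrightarrow> (\<bar>x\<bar> ^ m * cmod (u x - uin f x))\<^sup>2"
      by (intro tendsto_power) simp
    then have "(\<lambda>n. ennreal ((cmod (kt ((deriv ^^ m) (\<psi> n)) x * (u x - uin f x)))\<^sup>2)) \<longlonglongrightarrow> ennreal ((\<bar>x\<bar> ^ m * cmod (u x - uin f x))\<^sup>2)"
      by (intro tendsto_ennrealI) (simp add: norm_mult norm_kt_derivs[OF moll_csmooth[OF \<psi>]])
    then show "(\<lambda>n. ennreal (w x) * ennreal ((cmod (kt ((deriv ^^ m) (\<psi> n)) x * (u x - uin f x)))\<^sup>2)) \<longlonglongrightarrow> ennreal (w x) * ennreal ((\<bar>x\<bar> ^ m * cmod (u x - uin f x))\<^sup>2)"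
      by (intro ennreal_tendsto_cmult) auto
  qed measurable
qed

end

section \<open>Integer and fractional orders combined\<close>

lemma N2_indicator:
  "N2 (\<lambda>x. indicator A x *\<^sub>R h x) = (\<integral>\<^sup>+ x \<in> A. ennreal ((cmod (h x))\<^sup>2) \<partial>lborel)"
  unfolding N2_def by (intro nn_integral_cong) (auto simp: indicator_def)

text \<open>The expression under the infimum in \<open>sobolev_sq\<close>, for the complement of
  [-1,1].\<close>

definition sob_of :: "real \<Rightarrow> (nat \<Rightarrow> real \<Rightarrow> complex) \<Rightarrow> ennreal" where
  "sob_of mu h = (let m = nat \<lfloor>mu\<rfloor>; \<sigma> = mu - real m in
        (\<Sum>k\<le>m. \<integral>\<^sup>+ x \<in> outer. ennreal ((cmod (h k x))\<^sup>2) \<partial>lborel) +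
        (if \<sigma> > 0 then
           (\<integral>\<^sup>+ x \<in> outer. (\<integral>\<^sup>+ y \<in> outer.
               ennreal ((cmod (h m x - h m y))\<^sup>2 / \<bar>x - y\<bar> powr (1 + 2 * \<sigma>)) \<partial>lborel) \<partial>lborel)
         else 0))"

text \<open>The case \<sigma> = 0 stands apart because \<open>0 powr 0\<close> is 0, whereas the
  weight of exponent 0 equals 1 at the origin.\<close>

lemma wt_split:
  assumes "mu \<ge> 0" "m = nat \<lfloor>mu\<rfloor>" "\<sigma> = mu - real m"
  shows "\<sigma> = 0 \<Longrightarrow> wt mu x = (\<bar>x\<bar> ^ m)\<^sup>2" and "\<sigma> \<noteq> 0 \<Longrightarrow> wt mu x = \<bar>x\<bar> powr (2 * \<sigma>) * (\<bar>x\<bar> ^ m)\<^sup>2"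
proof -
  assume "\<sigma> = 0"
  then have m: "mu = real m" using assms by simp
  show "wt mu x = (\<bar>x\<bar> ^ m)\<^sup>2"
  proof (cases "m = 0")
    case False
    then have "\<bar>x\<bar> powr (2 * real m) = \<bar>x\<bar> ^ (2 * m)"
      by (cases "x = 0") (auto simp: powr_realpow[symmetric])
    then show ?thesis using False m by (simp add: wt_def power_mult[symmetric] mult.commute)
  qed (simp add: wt_def m)
next
  assume s: "\<sigma> \<noteq> 0"
  have mu: "mu = real m + \<sigma>" using assms by simp
  have "mu \<noteq> 0" using s assms by auto
  show "wt mu x = \<bar>x\<bar> powr (2 * \<sigma>) * (\<bar>x\<bar> ^ m)\<^sup>2"
  proof (cases "x = 0")
    case False
    then have "\<bar>x\<bar> powr (2 * mu) = \<bar>x\<bar> powr (2 * \<sigma>) * \<bar>x\<bar> powr real (m * 2)"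
      unfolding mu by (simp add: powr_add[symmetric] algebra_simps)
    also have "\<bar>x\<bar> powr real (m * 2) = \<bar>x\<bar> ^ (m * 2)" using False by (intro powr_realpow) simp
    finally show ?thesis using \<open>mu \<noteq> 0\<close> by (simp add: wt_def power_mult)
  qed (use \<open>mu \<noteq> 0\<close> in \<open>simp add: wt_def\<close>)
qed

lemma wt_nonneg: "wt mu x \<ge> 0"
  by (simp add: wt_def)

lemma wt_measurable[measurable]: "wt mu \<in> borel_measurable borel"
  unfolding wt_def by measurable

text \<open>The constant is fixed before u, f and h, so it survives the infimum over h in the
  Sobolev norm.\<close>

lemma high_frequency_bound:
  assumes mu: "mu \<ge> 0"
  shows "\<exists>C>0. \<forall>u f h. ft_pair u f \<longrightarrow> h 0 = f \<longrightarrow> (\<forall>k\<in>{1..nat \<lfloor>mu\<rfloor>}. weak_deriv outer k f (h k)) \<longrightarrow>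
    (\<integral>\<^sup>+ x. ennreal ((cmod (u x - uin f x))\<^sup>2 * wt mu x) \<partial>lborel) \<le> ennreal C * sob_of mu h"
proof -
  define m where "m = nat \<lfloor>mu\<rfloor>"
  define \<sigma> where "\<sigma> = mu - real m"
  have \<sigma>: "0 \<le> \<sigma>" "\<sigma> < 1" unfolding \<sigma>_def m_def using mu by linarith+
  obtain c where cf: "c < \<infinity>" and c: "\<And>i h. i \<le> Suc m \<Longrightarrow> h \<in> borel_measurable borel \<Longrightarrow> N2 (piece i h) \<le> c * N2 (\<lambda>x. indicator outer x *\<^sub>R h x)"
    using pieces_bound[of "Suc m"] by blast
  define b :: ennreal where "b = 2 * (2 ^ Suc m * (\<Sum>j\<le>m. ennreal ((leib m j)\<^sup>2)))"
  have two: "(2::ennreal) ^ k < \<infinity>" for k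
    by (induction k) (auto simp: ennreal_mult_less_top)
  have bf: "b < \<infinity>" unfolding b_def using two[of "Suc m"] by (auto simp: ennreal_mult_less_top simp del: power_Suc)
  have bsum: "2 * (2 ^ Suc m * (\<Sum>j\<le>m. ennreal ((leib m j)\<^sup>2) * z)) = b * z" for z
    unfolding b_def by (simp add: sum_distrib_right[symmetric] mult.assoc)
  have S_le: "weak_derivs.S m h \<le> sob_of mu h" if "weak_derivs m f h" for f h
    unfolding weak_derivs.S_def[OF that] sob_of_def N2_indicator Let_def m_def[symmetric] by (rule add_increasing2) auto
  have main: "\<exists>C<\<infinity>. \<forall>u f h. ft_pair u f \<longrightarrow> weak_derivs m f h \<longrightarrow>
    (\<integral>\<^sup>+ x. ennreal ((cmod (u x - uin f x))\<^sup>2 * wt mu x) \<partial>lborel) \<le> C * sob_of mu h"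
  proof (cases "\<sigma> = 0")
    case True
    have "(\<integral>\<^sup>+ x. ennreal ((cmod (u x - uin f x))\<^sup>2 * wt mu x) \<partial>lborel) \<le> (b * c) * sob_of mu h"
      if p: "ft_pair u f" and w: "weak_derivs m f h" for u f h
    proof -
      interpret weak_derivs m f h by (rule w)
      have "(\<integral>\<^sup>+ x. ennreal 1 * ennreal ((\<bar>x\<bar> ^ m * cmod (u x - uin f x))\<^sup>2) \<partial>lborel) \<le> b * (c * S)"
      proof (rule moll_limit[OF p])
        fix \<phi> P assume \<phi>: "moll \<phi> P"
        have "N2 (\<lambda>x. kt ((deriv ^^ m) \<phi>) x * (u x - uin f x)) \<le> b * (c * S)"
          unfolding bsum[symmetric] by (rule high_integer_regularized[OF p \<phi> c])
        then show "(\<integral>\<^sup>+ x. ennreal 1 * ennreal ((cmod (kt ((deriv ^^ m) \<phi>) x * (u x - uin f x)))\<^sup>2) \<partial>lborel) \<le> b * (c * S)"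
          by (simp only: N2_def ennreal_1 mult_1)
      qed simp
      moreover have "(\<bar>x\<bar> ^ m * cmod (u x - uin f x))\<^sup>2 = (cmod (u x - uin f x))\<^sup>2 * wt mu x" for x
        by (simp add: wt_split(1)[OF mu m_def \<sigma>_def True] power_mult_distrib)
      ultimately have "(\<integral>\<^sup>+ x. ennreal ((cmod (u x - uin f x))\<^sup>2 * wt mu x) \<partial>lborel) \<le> b * c * S" by (simp add: mult.assoc)
      also have "\<dots> \<le> b * c * sob_of mu h" by (intro mult_left_mono S_le[OF w]) auto
      finally show ?thesis .
    qed
    then show ?thesis using bf cf by (intro exI[of _ "b * c"]) (auto simp: ennreal_mult_less_top)
  next
    case False
    then have \<sigma>0: "0 < \<sigma>" using \<sigma> by simp
    obtain d where d: "d > 0" "\<And>x. ennreal (d * \<bar>x\<bar> powr (2 * \<sigma>)) \<le> (\<integral>\<^sup>+ k. ennreal (sw \<sigma> k) * ennreal ((cmod (exp (- (\<i> * of_real (x * k))) - 1))\<^sup>2) \<partial>lborel)"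
      using sw_lower_bound[OF \<sigma>(1)] by blast
    obtain L where Lf: "L < \<infinity>" and L': "\<forall>h. h \<in> borel_measurable borel \<longrightarrow>
      (\<integral>\<^sup>+ k. ennreal (sw \<sigma> k) * N2 (\<lambda>x. piece 0 h (x + k) - piece 0 h x) \<partial>lborel)
      \<le> L * ((\<integral>\<^sup>+ x \<in> outer. (\<integral>\<^sup>+ y \<in> outer. ennreal ((cmod (h x - h y))\<^sup>2 / \<bar>x - y\<bar> powr (1 + 2 * \<sigma>)) \<partial>lborel) \<partial>lborel)
        + N2 (\<lambda>x. indicator outer x *\<^sub>R h x))"
      using slobodeckij_cut[OF \<sigma>0 \<sigma>(2)] by (elim exE conjE)
    note L = L'[rule_format]
    define J where "J = (\<integral>\<^sup>+ k. ennreal (sw \<sigma> k * min 1 (k\<^sup>2)) \<partial>lborel)"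
    have Jf: "J < \<infinity>" unfolding J_def by (rule sw_min_finite[OF \<sigma>0 \<sigma>(2)])
    define C where "C = ennreal (1 / d) * (b * (L + J * (4 * c)))"
    have "(\<integral>\<^sup>+ x. ennreal ((cmod (u x - uin f x))\<^sup>2 * wt mu x) \<partial>lborel) \<le> C * sob_of mu h"
      if p: "ft_pair u f" and w: "weak_derivs m f h" for u f h
    proof -
      interpret weak_derivs m f h by (rule w)
      define T where "T = (\<integral>\<^sup>+ x \<in> outer. (\<integral>\<^sup>+ y \<in> outer. ennreal ((cmod (h m x - h m y))\<^sup>2 / \<bar>x - y\<bar> powr (1 + 2 * \<sigma>)) \<partial>lborel) \<partial>lborel)
        + N2 (\<lambda>x. indicator outer x *\<^sub>R h m x)"
      have T: "T \<le> sob_of mu h"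
      proof -
        have "T \<le> (\<integral>\<^sup>+ x \<in> outer. (\<integral>\<^sup>+ y \<in> outer. ennreal ((cmod (h m x - h m y))\<^sup>2 / \<bar>x - y\<bar> powr (1 + 2 * \<sigma>)) \<partial>lborel) \<partial>lborel) + S"
          unfolding T_def by (intro add_left_mono S_ge) simp
        also have "\<dots> = sob_of mu h"
          unfolding S_def sob_of_def N2_indicator Let_def m_def[symmetric] \<sigma>_def[symmetric] using \<sigma>0 by (simp add: add.commute)
        finally show ?thesis .
      qed
      have [measurable]: "u \<in> borel_measurable borel" using p by (simp add: ft_pair_def)
      have [measurable]: "uin f \<in> borel_measurable borel" unfolding uin_def by measurable
      have LT: "(\<integral>\<^sup>+ k. ennreal (sw \<sigma> k) * N2 (\<lambda>x. piece 0 (h m) (x + k) - piece 0 (h m) x) \<partial>lborel) \<le> L * T"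
        unfolding T_def by (intro L h_meas) simp
      have 1: "(\<integral>\<^sup>+ x. ennreal (d * \<bar>x\<bar> powr (2 * \<sigma>)) * ennreal ((\<bar>x\<bar> ^ m * cmod (u x - uin f x))\<^sup>2) \<partial>lborel) \<le> b * (L * T + J * (4 * (c * S)))"
        unfolding bsum[symmetric] J_def
        by (rule moll_limit[OF p _ high_fractional_regularized[OF p _ c d LT]]) measurable
      have "(\<integral>\<^sup>+ x. ennreal ((cmod (u x - uin f x))\<^sup>2 * wt mu x) \<partial>lborel)
        = (\<integral>\<^sup>+ x. ennreal (1 / d) * (ennreal (d * \<bar>x\<bar> powr (2 * \<sigma>)) * ennreal ((\<bar>x\<bar> ^ m * cmod (u x - uin f x))\<^sup>2)) \<partial>lborel)"
      proof (intro nn_integral_cong)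
        fix x
        have "(1 / d) * ((d * \<bar>x\<bar> powr (2 * \<sigma>)) * (\<bar>x\<bar> ^ m * cmod (u x - uin f x))\<^sup>2) = (cmod (u x - uin f x))\<^sup>2 * wt mu x"
          using d(1) by (simp add: wt_split(2)[OF mu m_def \<sigma>_def False] power_mult_distrib)
        then show "ennreal ((cmod (u x - uin f x))\<^sup>2 * wt mu x) = ennreal (1 / d) * (ennreal (d * \<bar>x\<bar> powr (2 * \<sigma>)) * ennreal ((\<bar>x\<bar> ^ m * cmod (u x - uin f x))\<^sup>2))"
          using d(1) by (simp add: ennreal_mult[symmetric])
      qed
      also have "\<dots> = ennreal (1 / d) * (\<integral>\<^sup>+ x. (ennreal (d * \<bar>x\<bar> powr (2 * \<sigma>)) * ennreal ((\<bar>x\<bar> ^ m * cmod (u x - uin f x))\<^sup>2)) \<partial>lborel)"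
        by (rule nn_integral_cmult) measurable
      also have "\<dots> \<le> ennreal (1 / d) * (b * (L * T + J * (4 * (c * S))))"
        by (intro mult_left_mono 1) auto
      also have "\<dots> \<le> ennreal (1 / d) * (b * (L * sob_of mu h + J * (4 * (c * sob_of mu h))))"
        by (intro mult_left_mono add_mono T S_le[OF w]) auto
      also have "\<dots> = C * sob_of mu h" unfolding C_def by (simp add: distrib_left distrib_right mult.assoc)
      finally show ?thesis .
    qed
    moreover have "C < \<infinity>" unfolding C_def using bf Lf Jf cf by (auto simp: ennreal_mult_less_top)
    ultimately show ?thesis by blast
  qed
  then obtain C where Cf: "C < \<infinity>" and C: "\<And>u f h. ft_pair u f \<Longrightarrow> weak_derivs m f h \<Longrightarrow>
    (\<integral>\<^sup>+ x. ennreal ((cmod (u x - uin f x))\<^sup>2 * wt mu x) \<partial>lborel) \<le> C * sob_of mu h" by blast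
  \<comment> \<open>Adding 1 turns an extended constant that may be 0 into a positive real
    one.\<close>
  define C' where "C' = enn2real C + 1"
  have C': "C' > 0" "C \<le> ennreal C'" using Cf unfolding C'_def
    by (cases C; auto simp: add_nonneg_pos intro!: ennreal_leI)+
  have "(\<integral>\<^sup>+ x. ennreal ((cmod (u x - uin f x))\<^sup>2 * wt mu x) \<partial>lborel) \<le> ennreal C' * sob_of mu h"
    if p: "ft_pair u f" and h0: "h 0 = f" and wd: "\<forall>k\<in>{1..nat \<lfloor>mu\<rfloor>}. weak_deriv outer k f (h k)" for u f h
  proof (cases "\<forall>k\<le>m. N2 (\<lambda>x. indicator outer x *\<^sub>R h k x) < \<infinity>")
    case True
    have "weak_derivs m f h"
      by unfold_locales (use p h0 wd True in \<open>auto simp: ft_pair_def m_def\<close>)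
    from C[OF p this] show ?thesis using C'(2) by (meson mult_right_mono order_trans zero_le)
  next
    case False
    then obtain k where k: "k \<le> m" "N2 (\<lambda>x. indicator outer x *\<^sub>R h k x) = \<infinity>"
      using top.not_eq_extremum by auto
    have "N2 (\<lambda>x. indicator outer x *\<^sub>R h k x) \<le> (\<Sum>k\<le>m. N2 (\<lambda>x. indicator outer x *\<^sub>R h k x))"
      using k(1) by (intro member_le_sum) auto
    also have "\<dots> \<le> sob_of mu h"
      unfolding sob_of_def N2_indicator Let_def m_def[symmetric] by (rule add_increasing2) auto
    finally have "sob_of mu h = \<infinity>" using k(2) by (simp add: top_unique)
    then show ?thesis using C'(1) by (simp add: ennreal_mult_top)
  qed
  then show ?thesis using C'(1) by blast
qed

lemma sobolev_sq_eq:
  "sobolev_sq mu outer f = (INF h \<in> {h. f \<in> borel_measurable lborel \<and> h 0 = f \<and> (\<forall>k\<in>{1..nat \<lfloor>mu\<rfloor>}. weak_deriv outer k f (h k))}. sob_of mu h)"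
  unfolding sobolev_sq_def sob_of_def Let_def by simp

lemma high_frequency_sobolev:
  assumes mu: "mu \<ge> 0"
  shows "\<exists>C>0. \<forall>u f. ft_pair u f \<longrightarrow>
    (\<integral>\<^sup>+ x. ennreal ((cmod (u x - uin f x))\<^sup>2 * wt mu x) \<partial>lborel) \<le> ennreal C * sobolev_sq mu outer f"
proof -
  obtain C where C0: "C > 0" and C: "\<And>u f h. ft_pair u f \<Longrightarrow> h 0 = f \<Longrightarrow> (\<forall>k\<in>{1..nat \<lfloor>mu\<rfloor>}. weak_deriv outer k f (h k)) \<Longrightarrow>
    (\<integral>\<^sup>+ x. ennreal ((cmod (u x - uin f x))\<^sup>2 * wt mu x) \<partial>lborel) \<le> ennreal C * sob_of mu h"
    using high_frequency_bound[OF mu] by blast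
  have "(\<integral>\<^sup>+ x. ennreal ((cmod (u x - uin f x))\<^sup>2 * wt mu x) \<partial>lborel) \<le> ennreal C * sobolev_sq mu outer f" if p: "ft_pair u f" for u f
  proof -
    define X where "X = (\<integral>\<^sup>+ x. ennreal ((cmod (u x - uin f x))\<^sup>2 * wt mu x) \<partial>lborel)"
    have inv: "ennreal (1 / C) * (ennreal C * z) = z" "ennreal C * (ennreal (1 / C) * z) = z" for z
      using C0 by (simp_all add: mult.assoc[symmetric] ennreal_mult[symmetric])
    \<comment> \<open>Dividing by C first lets the infimum be taken on its own, also over an empty
      family, where it is infinite.\<close>
    have "ennreal (1 / C) * X \<le> sobolev_sq mu outer f"
      unfolding sobolev_sq_eq
    proof (rule INF_greatest)
      fix h assume "h \<in> {h. f \<in> borel_measurable lborel \<and> h 0 = f \<and> (\<forall>k\<in>{1..nat \<lfloor>mu\<rfloor>}. weak_deriv outer k f (h k))}"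
      then have "X \<le> ennreal C * sob_of mu h" unfolding X_def by (intro C[OF p]) auto
      then have "ennreal (1 / C) * X \<le> ennreal (1 / C) * (ennreal C * sob_of mu h)" by (rule mult_left_mono) simp
      then show "ennreal (1 / C) * X \<le> sob_of mu h" by (simp only: inv)
    qed
    then have "ennreal C * (ennreal (1 / C) * X) \<le> ennreal C * sobolev_sq mu outer f" by (rule mult_left_mono) simp
    then show ?thesis by (simp only: inv X_def)
  qed
  then show ?thesis using C0 by blast
qed

subsection \<open>Scaling\<close>

text \<open>The dilation rule for the mean-square limit: substitution changes the truncation radius
  R into R/B, which still tends to infinity.\<close>

lemma fourier_L2_scale:
  assumes [measurable]: "u \<in> borel_measurable borel" and F: "fourier_L2 u g" and B: "B > 0"
  shows "fourier_L2 (\<lambda>x. of_real (1 / B) * u (x / B)) (\<lambda>\<xi>. g (B * \<xi>))"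
proof -
  have [measurable]: "g \<in> borel_measurable borel" using F by (simp add: fourier_L2_def)
  define \<Phi> where "\<Phi> = (\<lambda>R \<xi>. g \<xi> - of_real (1 / sqrt (2 * pi)) *
          (\<integral>x. indicator {-R..R} x *\<^sub>R (exp (- \<i> * of_real (\<xi> * x)) * u x) \<partial>lborel))"
  have m[measurable]: "\<Phi> R \<in> borel_measurable borel" for R unfolding \<Phi>_def by measurable
  have lim: "((\<lambda>R. N2 (\<Phi> R)) \<longlongrightarrow> 0) at_top" using F unfolding fourier_L2_def N2_def \<Phi>_def by blast
  have "filterlim (\<lambda>R. R / B) at_top at_top" using B by real_asymp
  from filterlim_compose[OF lim this] have lim2: "((\<lambda>R. N2 (\<Phi> (R / B))) \<longlongrightarrow> 0) at_top" .
  have e: "g (B * \<xi>) - of_real (1 / sqrt (2 * pi)) *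
          (\<integral>x. indicator {-R..R} x *\<^sub>R (exp (- \<i> * of_real (\<xi> * x)) * (of_real (1 / B) * u (x / B))) \<partial>lborel) = \<Phi> (R / B) (B * \<xi>)" for R \<xi>
  proof -
    have "(\<integral>x. indicator {-R..R} x *\<^sub>R (exp (- \<i> * of_real (\<xi> * x)) * (of_real (1 / B) * u (x / B))) \<partial>lborel)
      = \<bar>B\<bar> *\<^sub>R (\<integral>x. indicator {-R..R} (0 + B * x) *\<^sub>R (exp (- \<i> * of_real (\<xi> * (0 + B * x))) * (of_real (1 / B) * u ((0 + B * x) / B))) \<partial>lborel)"
      using B by (intro lborel_integral_real_affine) simp
    also have "\<dots> = (\<integral>x. \<bar>B\<bar> *\<^sub>R (indicator {-R..R} (0 + B * x) *\<^sub>R (exp (- \<i> * of_real (\<xi> * (0 + B * x))) * (of_real (1 / B) * u ((0 + B * x) / B)))) \<partial>lborel)"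
      by (rule integral_scaleR_right[symmetric])
    also have "\<dots> = (\<integral>x. indicator {-(R/B)..R/B} x *\<^sub>R (exp (- \<i> * of_real ((B * \<xi>) * x)) * u x) \<partial>lborel)"
    proof (intro Bochner_Integration.integral_cong refl)
      fix x
      have i: "(indicator {-R..R} (0 + B * x) :: real) = indicator {-(R/B)..R/B} x"
        using B by (auto simp: indicator_def field_simps)
      show "\<bar>B\<bar> *\<^sub>R (indicator {-R..R} (0 + B * x) *\<^sub>R (exp (- \<i> * of_real (\<xi> * (0 + B * x))) * (of_real (1 / B) * u ((0 + B * x) / B))))
        = indicator {-(R/B)..R/B} x *\<^sub>R (exp (- \<i> * of_real ((B * \<xi>) * x)) * u x)"
        unfolding i using B by (simp add: scaleR_conv_of_real mult_ac)
    qed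
    finally show ?thesis unfolding \<Phi>_def by simp
  qed
  have N: "N2 (\<lambda>\<xi>. \<Phi> (R / B) (B * \<xi>)) = ennreal (1 / B) * N2 (\<Phi> (R / B))" for R
    using N2_affine[OF m, of B "R / B" 0] B by (simp add: mult.assoc[symmetric] ennreal_mult[symmetric])
  have "((\<lambda>R. ennreal (1 / B) * N2 (\<Phi> (R / B))) \<longlongrightarrow> ennreal (1 / B) * 0) at_top"
    by (intro ennreal_tendsto_cmult lim2) simp
  then have "((\<lambda>R. N2 (\<lambda>\<xi>. \<Phi> (R / B) (B * \<xi>))) \<longlongrightarrow> 0) at_top" by (simp add: N)
  then show ?thesis unfolding fourier_L2_def e N2_def by simp
qed

text \<open>The low-frequency part at scale B, with frequencies up to 9B/8.\<close>

definition ulow :: "real \<Rightarrow> (real \<Rightarrow> complex) \<Rightarrow> real \<Rightarrow> complex" where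
  "ulow B g = ift (\<lambda>b. of_real (1 - cutoff (b / B)) * g b)"

lemma ulow_scale:
  assumes B: "B > 0"
  shows "of_real B * uin (\<lambda>\<xi>. g (B * \<xi>)) (B * y) = ulow B g y"
proof -
  let ?f = "\<lambda>b. exp (- \<i> * of_real (- y * b)) * (of_real (1 - cutoff (b / B)) * g b)"
  have "(\<integral>b. ?f b \<partial>lborel) = \<bar>B\<bar> *\<^sub>R (\<integral>\<xi>. ?f (0 + B * \<xi>) \<partial>lborel)"
    using B by (intro lborel_integral_real_affine) simp
  also have "\<dots> = of_real B * (\<integral>\<xi>. exp (- \<i> * of_real (- (B * y) * \<xi>)) * (of_real (1 - cutoff \<xi>) * g (B * \<xi>)) \<partial>lborel)"
    using B by (simp add: scaleR_conv_of_real mult_ac)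
  finally show ?thesis unfolding ulow_def uin_def ift_def ft_def by (simp add: mult_ac)
qed

text \<open>Substituting x = B y in the unit-scale estimate produces B from dx, B^(-2) from the
  normalisation and B^(2 mu) from the weight; hence B^(1 - 2 mu) on the other side, and B^(1/2 - mu)
  after the square root.\<close>

lemma high_frequency_scaled:
  assumes mu: "mu \<ge> 0"
  shows "\<exists>C>0. \<forall>u g B. B > 0 \<longrightarrow> u \<in> borel_measurable borel \<longrightarrow> N2 u < \<infinity> \<longrightarrow> fourier_L2 u g \<longrightarrow>
    (\<integral>\<^sup>+ x. ennreal ((cmod (u x - ulow B g x))\<^sup>2 * wt mu x) \<partial>lborel) \<le> ennreal (C * B powr (1 - 2 * mu)) * sobolev_sq mu outer (\<lambda>\<xi>. g (B * \<xi>))"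
proof -
  obtain C where C0: "C > 0" and C: "\<And>u f. ft_pair u f \<Longrightarrow>
    (\<integral>\<^sup>+ x. ennreal ((cmod (u x - uin f x))\<^sup>2 * wt mu x) \<partial>lborel) \<le> ennreal C * sobolev_sq mu outer f"
    using high_frequency_sobolev[OF mu] by blast
  have "(\<integral>\<^sup>+ x. ennreal ((cmod (u x - ulow B g x))\<^sup>2 * wt mu x) \<partial>lborel) \<le> ennreal (C * B powr (1 - 2 * mu)) * sobolev_sq mu outer (\<lambda>\<xi>. g (B * \<xi>))"
    if B: "B > 0" and um[measurable]: "u \<in> borel_measurable borel" and fin: "N2 u < \<infinity>" and F: "fourier_L2 u g" for u g B
  proof -
    define v where "v = (\<lambda>x. of_real (1 / B) * u (x / B))"
    define f where "f = (\<lambda>\<xi>. g (B * \<xi>))"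
    have [measurable]: "v \<in> borel_measurable borel" unfolding v_def by measurable
    have [measurable]: "g \<in> borel_measurable borel" using F by (simp add: fourier_L2_def)
    have [measurable]: "f \<in> borel_measurable borel" "uin f \<in> borel_measurable borel" unfolding f_def uin_def by measurable
    have "N2 (\<lambda>x. u (x / B)) = ennreal \<bar>B\<bar> * N2 u"
      using N2_affine[of "\<lambda>x. u (x / B)" B 0] B by simp
    then have "N2 v < \<infinity>"
      unfolding v_def using fin by (subst N2_cmult) (auto simp: ennreal_mult_less_top)
    then have p: "ft_pair v f"
      unfolding f_def using fourier_L2_scale[OF um F B] by (intro fourier_L2_ft_pair) (auto simp: v_def)
    define X where "X = (\<integral>\<^sup>+ x. ennreal ((cmod (u x - ulow B g x))\<^sup>2 * wt mu x) \<partial>lborel)"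
    have wB: "wt mu (B * y) = B powr (2 * mu) * wt mu y" for y
      using B by (auto simp: wt_def abs_mult powr_mult)
    have "(\<integral>\<^sup>+ x. ennreal ((cmod (v x - uin f x))\<^sup>2 * wt mu x) \<partial>lborel)
      = ennreal \<bar>B\<bar> * (\<integral>\<^sup>+ y. ennreal ((cmod (v (0 + B * y) - uin f (0 + B * y)))\<^sup>2 * wt mu (0 + B * y)) \<partial>lborel)"
      using B by (intro nn_integral_real_affine) auto
    also have "(\<integral>\<^sup>+ y. ennreal ((cmod (v (0 + B * y) - uin f (0 + B * y)))\<^sup>2 * wt mu (0 + B * y)) \<partial>lborel)
      = (\<integral>\<^sup>+ y. ennreal (B powr (2 * mu - 2)) * ennreal ((cmod (u y - ulow B g y))\<^sup>2 * wt mu y) \<partial>lborel)"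
    proof (intro nn_integral_cong)
      fix y
      have "v (B * y) - uin f (B * y) = of_real (1 / B) * (u y - ulow B g y)"
        unfolding ulow_scale[OF B, of g y, symmetric] f_def[symmetric] using B
        by (simp add: v_def right_diff_distrib)
      then have "(cmod (v (B * y) - uin f (B * y)))\<^sup>2 = (1 / B)\<^sup>2 * (cmod (u y - ulow B g y))\<^sup>2"
        by (simp add: norm_mult norm_divide power_mult_distrib power_divide)
      moreover have "(1 / B)\<^sup>2 * B powr (2 * mu) = B powr (2 * mu - 2)"
        using B by (simp add: powr_diff power_divide)
      ultimately show "ennreal ((cmod (v (0 + B * y) - uin f (0 + B * y)))\<^sup>2 * wt mu (0 + B * y)) = ennreal (B powr (2 * mu - 2)) * ennreal ((cmod (u y - ulow B g y))\<^sup>2 * wt mu y)"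
        by (simp add: wB ennreal_mult[symmetric] wt_nonneg mult_ac)
    qed
    also have "\<dots> = ennreal (B powr (2 * mu - 2)) * X"
      unfolding X_def ulow_def by (rule nn_integral_cmult) measurable
    finally have "ennreal \<bar>B\<bar> * (ennreal (B powr (2 * mu - 2)) * X) \<le> ennreal C * sobolev_sq mu outer f"
      using C[OF p] by simp
    then have "ennreal (B powr (1 - 2 * mu)) * (ennreal \<bar>B\<bar> * (ennreal (B powr (2 * mu - 2)) * X)) \<le> ennreal (B powr (1 - 2 * mu)) * (ennreal C * sobolev_sq mu outer f)"
      by (rule mult_left_mono) simp
    moreover have "ennreal (B powr (1 - 2 * mu)) * (ennreal \<bar>B\<bar> * (ennreal (B powr (2 * mu - 2)) * X)) = X"
    proof -
      have "B powr (1 - 2 * mu) * (\<bar>B\<bar> * B powr (2 * mu - 2)) = B powr (1 - 2 * mu) * (B powr 1 * B powr (2 * mu - 2))" using B by simp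
      also have "\<dots> = B powr ((1 - 2 * mu) + (1 + (2 * mu - 2)))" by (simp only: powr_add)
      also have "\<dots> = 1" using B by simp
      finally show ?thesis by (simp add: mult.assoc[symmetric] ennreal_mult[symmetric])
    qed
    ultimately show ?thesis using C0 unfolding X_def f_def by (simp add: ennreal_mult mult_ac)
  qed
  then show ?thesis using C0 by blast
qed

subsection \<open>Gaussian approximation of band-limited functions\<close>

text \<open>Every index n of the tail exceeds N, so a factor \<rho>^(n - N) may be inserted; the
  series then sums to at most \<rho>^(-N) exp(\<rho> |w|). The parameter \<rho> trades decay in N
  against growth in |w|.\<close>

lemma exp_tail_bound:
  fixes w :: complex and \<rho> :: real
  assumes \<rho>: "\<rho> \<ge> 1"
  shows "cmod (exp w - (\<Sum>n\<le>N. w ^ n / fact n)) \<le> (1 / \<rho>) ^ N * exp (\<rho> * cmod w)"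
proof -
  have s: "summable (\<lambda>n. w ^ n / fact n)" "(\<Sum>n. w ^ n / fact n) = exp w"
    using exp_converges[of w] by (auto simp: sums_iff scaleR_conv_of_real divide_inverse mult.commute)
  have sr: "summable (\<lambda>n. (\<rho> * cmod w) ^ n / fact n)" "(\<Sum>n. (\<rho> * cmod w) ^ n / fact n) = exp (\<rho> * cmod w)"
    using exp_converges[of "\<rho> * cmod w"] by (auto simp: sums_iff scaleR_conv_of_real divide_inverse mult.commute)
  have sn: "summable (\<lambda>n. cmod (w ^ (n + Suc N) / fact (n + Suc N)))"
  proof -
    have "summable (\<lambda>n. cmod (w ^ n / fact n))"
      using exp_converges[of "cmod w"] by (simp add: sums_iff norm_divide norm_mult norm_inverse norm_power divide_inverse mult.commute)
    then show ?thesis by (rule summable_ignore_initial_segment)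
  qed
  have "exp w - (\<Sum>n\<le>N. w ^ n / fact n) = (\<Sum>n. w ^ (n + Suc N) / fact (n + Suc N))"
    using suminf_minus_initial_segment[OF s(1), of "Suc N"] s(2) by (simp add: lessThan_Suc_atMost)
  also have "cmod \<dots> \<le> (\<Sum>n. cmod (w ^ (n + Suc N) / fact (n + Suc N)))" by (rule summable_norm[OF sn])
  also have "\<dots> \<le> (\<Sum>n. (1 / \<rho>) ^ N * ((\<rho> * cmod w) ^ (n + Suc N) / fact (n + Suc N)))"
  proof (rule suminf_le[OF _ sn])
    show "summable (\<lambda>n. (1 / \<rho>) ^ N * ((\<rho> * cmod w) ^ (n + Suc N) / fact (n + Suc N)))"
      using summable_ignore_initial_segment[OF sr(1), of "Suc N"] by (rule summable_mult)
    fix n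
    have "1 \<le> \<rho> ^ (n + 1)" using \<rho> by (rule one_le_power)
    \<comment> \<open>The tail starts at N + 1, so one factor \<rho> is given away.\<close>
    moreover have e: "(1 / \<rho>) ^ N * \<rho> ^ (n + Suc N) = \<rho> ^ (n + 1)"
      using \<rho> by (simp add: power_add power_divide)
    ultimately have "1 * (cmod w ^ (n + Suc N) / fact (n + Suc N)) \<le> ((1 / \<rho>) ^ N * \<rho> ^ (n + Suc N)) * (cmod w ^ (n + Suc N) / fact (n + Suc N))"
      unfolding e by (intro mult_right_mono) auto
    then show "cmod (w ^ (n + Suc N) / fact (n + Suc N)) \<le> (1 / \<rho>) ^ N * ((\<rho> * cmod w) ^ (n + Suc N) / fact (n + Suc N))"
      by (simp add: norm_divide norm_power power_mult_distrib mult_ac del: power_Suc fact_Suc add_Suc_right)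
  qed
  also have "\<dots> = (1 / \<rho>) ^ N * (\<Sum>n. (\<rho> * cmod w) ^ (n + Suc N) / fact (n + Suc N))"
    by (rule suminf_mult[OF summable_ignore_initial_segment[OF sr(1)]])
  also have "\<dots> \<le> (1 / \<rho>) ^ N * exp (\<rho> * cmod w)"
  proof (intro mult_left_mono)
    have "(\<Sum>n. (\<rho> * cmod w) ^ (n + Suc N) / fact (n + Suc N)) = exp (\<rho> * cmod w) - (\<Sum>n<Suc N. (\<rho> * cmod w) ^ n / fact n)"
      using suminf_minus_initial_segment[OF sr(1), of "Suc N"] sr(2) by simp
    moreover have "(\<Sum>n<Suc N. (\<rho> * cmod w) ^ n / fact n) \<ge> 0" using \<rho> by (intro sum_nonneg) auto
    ultimately show "(\<Sum>n. (\<rho> * cmod w) ^ (n + Suc N) / fact (n + Suc N)) \<le> exp (\<rho> * cmod w)" by linarith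
  qed (use \<rho> in auto)
  finally show ?thesis .
qed

text \<open>17/42 lies just below ln(3/2); this is certified by e < 2.72 and 2.72^17 \<le> (3/2)^42,
  a comparison of rationals.\<close>

lemma two_thirds_power_le: "(2/3::real) ^ N \<le> exp (- (17/42 * real N))"
proof -
  have "exp (17::real) = exp 1 ^ 17" by (simp flip: exp_of_nat_mult)
  also have "\<dots> \<le> (272/100) ^ 17" using e_less_272 by (intro power_mono) auto
  also have "\<dots> \<le> (3/2) ^ 42" by (simp add: power_divide)
  finally have "exp (17/42) ^ 42 \<le> (3/2::real) ^ 42" by (simp flip: exp_of_nat_mult)
  then have "exp (17/42) \<le> (3/2::real)" by (rule power_le_imp_le_base[of _ 41, simplified]) simp
  then have "exp (17/42) ^ N \<le> (3/2::real) ^ N" by (intro power_mono) auto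
  then have "inverse ((3/2::real) ^ N) \<le> inverse (exp (17/42) ^ N)" by (intro le_imp_inverse_le) auto
  then show ?thesis by (simp add: exp_minus exp_of_nat_mult[symmetric] power_divide mult.commute flip: power_inverse)
qed

text \<open>The choice \<open>\<rho> = 3/2\<close> in the tail bound. Since \<open>17/42 < ln (3/2)\<close>, there is room for the factor
  \<open>exp (- N / 400)\<close>, which absorbs powers of \<open>N\<close> later. The square completed here is \<open>15/32 (\<beta> x - 8/5 \<bar>z\<bar> / \<beta>)\<^sup>2\<close>.\<close>

lemma gauss_exponent_bound:
  fixes a b x \<beta> :: real and N :: nat
  assumes \<beta>: "\<beta> > 0" and a: "\<beta>\<^sup>2 * a\<^sup>2 \<le> real N / 3" and b: "b\<^sup>2 / \<beta>\<^sup>2 \<le> 81/64 * (real N / 12)"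
  shows "exp (- (\<beta>\<^sup>2 * a\<^sup>2) / 2) * exp (- (\<beta>\<^sup>2 * x\<^sup>2) / 2) * ((2/3) ^ N * exp (3/2 * cmod (of_real x * (of_real (\<beta>\<^sup>2 * a) + \<i> * of_real b))))
    \<le> exp (- (real N / 24) - real N / 400) * exp (- (\<beta>\<^sup>2 * x\<^sup>2) / 32)"
proof -
  \<comment> \<open>Division by \<beta> makes \<beta> x and s dimensionless: the product x z has
    modulus \<beta> |x| s, and s^2 is the sum of the two quantities bounded by \<open>a\<close> and
    \<open>b\<close>.\<close>
  define s where "s = cmod (of_real (\<beta>\<^sup>2 * a) + \<i> * of_real b) / \<beta>"
  have s2: "s\<^sup>2 = \<beta>\<^sup>2 * a\<^sup>2 + b\<^sup>2 / \<beta>\<^sup>2"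
  proof -
    have "(cmod (of_real (\<beta>\<^sup>2 * a) + \<i> * of_real b))\<^sup>2 = (\<beta>\<^sup>2 * a)\<^sup>2 + b\<^sup>2"
      by (simp only: cmod_power2) simp
    then have "s\<^sup>2 = ((\<beta>\<^sup>2 * a)\<^sup>2 + b\<^sup>2) / \<beta>\<^sup>2" by (simp only: s_def power_divide)
    also have "\<dots> = \<beta>\<^sup>2 * a\<^sup>2 + b\<^sup>2 / \<beta>\<^sup>2" using \<beta> by (simp add: field_simps power2_eq_square)
    finally show ?thesis .
  qed
  have cm: "cmod (of_real x * (of_real (\<beta>\<^sup>2 * a) + \<i> * of_real b)) = (\<beta> * \<bar>x\<bar>) * s"
    using \<beta> by (simp add: s_def norm_mult)
  have "0 \<le> 15/32 * (\<beta> * \<bar>x\<bar> - 8/5 * s)\<^sup>2" by simp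
  then have k: "3/2 * ((\<beta> * \<bar>x\<bar>) * s) \<le> 15/32 * (\<beta>\<^sup>2 * x\<^sup>2) + 6/5 * s\<^sup>2"
    by (simp add: power2_diff power_mult_distrib power_divide algebra_simps)
  have "exp (- (\<beta>\<^sup>2 * a\<^sup>2) / 2) * exp (- (\<beta>\<^sup>2 * x\<^sup>2) / 2) * ((2/3) ^ N * exp (3/2 * ((\<beta> * \<bar>x\<bar>) * s)))
    \<le> exp (- (\<beta>\<^sup>2 * a\<^sup>2) / 2) * exp (- (\<beta>\<^sup>2 * x\<^sup>2) / 2) * (exp (- (17/42 * real N)) * exp (15/32 * (\<beta>\<^sup>2 * x\<^sup>2) + 6/5 * s\<^sup>2))"
    using two_thirds_power_le[of N] k by (intro mult_mono) auto
  also have "\<dots> = exp (- (\<beta>\<^sup>2 * a\<^sup>2) / 2 + - (\<beta>\<^sup>2 * x\<^sup>2) / 2 + (- (17/42 * real N) + (15/32 * (\<beta>\<^sup>2 * x\<^sup>2) + 6/5 * s\<^sup>2)))"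
    by (simp only: exp_add)
  also have "\<dots> \<le> exp (- (real N / 24) - real N / 400 + - (\<beta>\<^sup>2 * x\<^sup>2) / 32)"
  proof -
    \<comment> \<open>X retains -1/2 + 15/32 = -1/32. A and Q contribute at most (7/10)(1/3) and
      (6/5)(81/64)(1/12), in sum 7/30 + 81/640, which is less than 17/42 - 1/24 - 1/400.\<close>
    have gen: "- A / 2 + - X / 2 + (- (17/42 * n) + (15/32 * X + 6/5 * (A + Q))) \<le> - (n / 24) - n / 400 + - X / 32"
      if "A \<le> n / 3" "Q \<le> 81/64 * (n / 12)" "0 \<le> n" for A Q X n :: real
      using that by (simp add: field_simps)
    have "- (\<beta>\<^sup>2 * a\<^sup>2) / 2 + - (\<beta>\<^sup>2 * x\<^sup>2) / 2 + (- (17/42 * real N) + (15/32 * (\<beta>\<^sup>2 * x\<^sup>2) + 6/5 * s\<^sup>2))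
      \<le> - (real N / 24) - real N / 400 + - (\<beta>\<^sup>2 * x\<^sup>2) / 32"
      unfolding s2 by (rule gen[OF a b]) simp
    then show ?thesis by simp
  qed
  also have "\<dots> = exp (- (real N / 24) - real N / 400) * exp (- (\<beta>\<^sup>2 * x\<^sup>2) / 32)"
    by (simp only: exp_add)
  finally show ?thesis unfolding cm .
qed

text \<open>The probability that a normal variable with mean x and variance \<beta>^(-2) falls in
  [-2M,2M]; as a function of x, the convolution of the indicator with the Gaussian.\<close>

definition window :: "real \<Rightarrow> real \<Rightarrow> real \<Rightarrow> real" where
  "window M \<beta> x = (\<integral>a. indicator {-(2*M)..2*M} a * normal_density x (1 / \<beta>) a \<partial>lborel)"

lemma integrable_window: "\<beta> > 0 \<Longrightarrow> integrable lborel (\<lambda>a. indicator {-(2*M)..2*M} a * normal_density x (1 / \<beta>) a)"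
  by (rule Bochner_Integration.integrable_bound[where f="normal_density x (1 / \<beta>)"]) (auto simp: indicator_def)

lemma window_measurable[measurable]: "window M \<beta> \<in> borel_measurable borel"
  unfolding window_def normal_density_def by measurable

lemma window_bounds:
  assumes \<beta>: "\<beta> > 0"
  shows "0 \<le> window M \<beta> x" "window M \<beta> x \<le> 1"
proof -
  show "0 \<le> window M \<beta> x" unfolding window_def by (intro integral_nonneg_AE) auto
  have "window M \<beta> x \<le> (\<integral>a. normal_density x (1 / \<beta>) a \<partial>lborel)"
    unfolding window_def using \<beta> by (intro integral_mono integrable_window) (auto simp: indicator_def)
  then show "window M \<beta> x \<le> 1" using \<beta> by simp
qed

text \<open>Seen from |x| \<le> M, the complement of [-2M,2M] begins at distance at least M. There
  the density is at most exp(-\<beta>^2 M^2 / 2) times the density recentred at x + M or x - M, so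
  each of the two tails costs at most that factor.\<close>

lemma window_inside:
  assumes \<beta>: "\<beta> > 0" and x: "\<bar>x\<bar> \<le> M"
  shows "1 - window M \<beta> x \<le> 2 * exp (- (\<beta>\<^sup>2 * M\<^sup>2) / 2)"
proof -
  have nd: "normal_density y (1 / \<beta>) a = \<beta> / sqrt (2 * pi) * exp (- (\<beta>\<^sup>2 * (a - y)\<^sup>2) / 2)" for y a
    using \<beta> by (simp add: normal_density_def real_sqrt_mult real_sqrt_divide power_one_over field_simps)
  have M: "M \<ge> 0" using x by linarith
  have half: "normal_density x (1 / \<beta>) a \<le> exp (- (\<beta>\<^sup>2 * M\<^sup>2) / 2) * normal_density y (1 / \<beta>) a"
    if "(a - y)\<^sup>2 + M\<^sup>2 \<le> (a - x)\<^sup>2" for a y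
  proof -
    have "exp (- (\<beta>\<^sup>2 * (a - x)\<^sup>2) / 2) \<le> exp (- (\<beta>\<^sup>2 * M\<^sup>2) / 2 + - (\<beta>\<^sup>2 * (a - y)\<^sup>2) / 2)"
      using mult_left_mono[OF that, of "\<beta>\<^sup>2"] by (simp add: algebra_simps)
    also have "\<dots> = exp (- (\<beta>\<^sup>2 * M\<^sup>2) / 2) * exp (- (\<beta>\<^sup>2 * (a - y)\<^sup>2) / 2)" by (simp only: exp_add)
    finally have "\<beta> / sqrt (2 * pi) * exp (- (\<beta>\<^sup>2 * (a - x)\<^sup>2) / 2) \<le> \<beta> / sqrt (2 * pi) * (exp (- (\<beta>\<^sup>2 * M\<^sup>2) / 2) * exp (- (\<beta>\<^sup>2 * (a - y)\<^sup>2) / 2))"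
      using \<beta> by (intro mult_left_mono) auto
    then show ?thesis unfolding nd by (simp only: mult_ac)
  qed
  have pt: "normal_density x (1 / \<beta>) a - indicator {-(2*M)..2*M} a * normal_density x (1 / \<beta>) a
    \<le> exp (- (\<beta>\<^sup>2 * M\<^sup>2) / 2) * normal_density (x + M) (1 / \<beta>) a + exp (- (\<beta>\<^sup>2 * M\<^sup>2) / 2) * normal_density (x - M) (1 / \<beta>) a" for a
  proof -
    consider "a > 2 * M" | "a < - (2 * M)" | "a \<in> {-(2*M)..2*M}" by force
    then show ?thesis
    proof cases
      case 1
      have "0 \<le> M * (a - x - M)" using M 1 x by (intro mult_nonneg_nonneg) auto
      then have "(a - (x + M))\<^sup>2 + M\<^sup>2 \<le> (a - x)\<^sup>2" by (simp add: power2_eq_square algebra_simps)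
      from half[OF this] show ?thesis using 1 by (simp add: add_increasing2)
    next
      case 2
      have "0 \<le> M * (x - M - a)" using M 2 x by (intro mult_nonneg_nonneg) auto
      then have "(a - (x - M))\<^sup>2 + M\<^sup>2 \<le> (a - x)\<^sup>2" by (simp add: power2_eq_square algebra_simps)
      from half[OF this] show ?thesis using 2 by (simp add: add_increasing)
    qed auto
  qed
  have "1 - window M \<beta> x = (\<integral>a. normal_density x (1 / \<beta>) a - indicator {-(2*M)..2*M} a * normal_density x (1 / \<beta>) a \<partial>lborel)"
    unfolding window_def using \<beta> integrable_window[OF \<beta>] by (subst Bochner_Integration.integral_diff) auto
  also have "\<dots> \<le> (\<integral>a. exp (- (\<beta>\<^sup>2 * M\<^sup>2) / 2) * normal_density (x + M) (1 / \<beta>) a + exp (- (\<beta>\<^sup>2 * M\<^sup>2) / 2) * normal_density (x - M) (1 / \<beta>) a \<partial>lborel)"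
    using \<beta> integrable_window[OF \<beta>] pt by (intro integral_mono Bochner_Integration.integrable_diff Bochner_Integration.integrable_add integrable_mult_right) auto
  also have "\<dots> = 2 * exp (- (\<beta>\<^sup>2 * M\<^sup>2) / 2)"
    using \<beta> by (subst Bochner_Integration.integral_add) auto
  finally show ?thesis .
qed

lemma L12_bounded_support:
  assumes [measurable]: "q \<in> borel_measurable borel" and fin: "N2 q < \<infinity>" and z: "\<And>b. \<bar>b\<bar> > L \<Longrightarrow> q b = 0"
  shows "L12 q"
proof -
  obtain n :: nat where n: "L \<le> real n" using real_arch_simple by blast
  have "trunc n q = q"
  proof
    fix x show "trunc n q x = q x" using z[of x] n by (cases "\<bar>x\<bar> > L") (auto simp: indicator_def)
  qed
  then show ?thesis using L12_trunc[OF _ fin, of n] by simp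
qed

lemma L1_le_L2_bounded_support:
  assumes [measurable]: "q \<in> borel_measurable borel" and fin: "N2 q < \<infinity>" and z: "\<And>b. \<bar>b\<bar> > L \<Longrightarrow> q b = 0" and L: "L \<ge> 0"
  shows "ennreal ((\<integral>b. cmod (q b) \<partial>lborel)\<^sup>2) \<le> ennreal (2 * L) * N2 q"
proof -
  have i: "integrable lborel q" using L12_bounded_support[OF assms(1-3)] by (simp add: L12_def)
  have "ennreal ((\<integral>b. cmod (q b) \<partial>lborel)\<^sup>2) = (ennreal (\<integral>b. cmod (q b) \<partial>lborel))\<^sup>2"
    by (simp add: ennreal_power)
  also have "ennreal (\<integral>b. cmod (q b) \<partial>lborel) = (\<integral>\<^sup>+ b. ennreal (cmod (q b)) \<partial>lborel)"
    using i by (intro nn_integral_eq_integral[symmetric]) auto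
  also have "\<dots> = (\<integral>\<^sup>+ b. ennreal (cmod (q b)) * indicator {-L..L} b \<partial>lborel)"
  proof (intro nn_integral_cong)
    fix b show "ennreal (cmod (q b)) = ennreal (cmod (q b)) * indicator {-L..L} b"
      using z[of b] by (cases "\<bar>b\<bar> > L") (auto simp: indicator_def)
  qed
  also have "\<dots>\<^sup>2 \<le> (\<integral>\<^sup>+ b. (ennreal (cmod (q b)))\<^sup>2 \<partial>lborel) * (\<integral>\<^sup>+ b. (indicator {-L..L} b)\<^sup>2 \<partial>lborel)"
    by (rule Cauchy_Schwarz_nn_integral) auto
  also have "(\<integral>\<^sup>+ b. (indicator {-L..L} b)\<^sup>2 \<partial>lborel) = (\<integral>\<^sup>+ b. indicator {-L..L} b \<partial>lborel)"
    by (intro nn_integral_cong) (auto simp: indicator_def)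
  also have "\<dots> = ennreal (2 * L)" using L by simp
  finally show ?thesis by (simp add: N2_def ennreal_power mult.commute)
qed

text \<open>The window is an integral over a and \<open>ift q\<close> one over b, so their product
  is exp(-\<beta>^2 x^2 / 2) times a plane integral of exp(x (\<beta>^2 a + i b)). Truncating this
  exponential at degree N turns the integral into a polynomial in x, and the remainder is estimated
  under the integral sign.\<close>

lemma band_limited_approx:
  assumes \<beta>: "\<beta> > 0" and [measurable]: "q \<in> borel_measurable borel" and fin: "N2 q < \<infinity>"
    and z: "\<And>b. \<bar>b\<bar> > L \<Longrightarrow> q b = 0" and M: "M \<ge> 0" and L: "L \<ge> 0"
    and M2: "\<beta>\<^sup>2 * (2 * M)\<^sup>2 \<le> real N / 3" and L2: "L\<^sup>2 / \<beta>\<^sup>2 \<le> 81/64 * (real N / 12)"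
  shows "\<exists>v\<in>gauss_poly_space \<beta> N. \<forall>x. cmod (of_real (window M \<beta> x) * ift q x - v x)
     \<le> \<beta> / (2 * pi) * (4 * M) * (\<integral>b. cmod (q b) \<partial>lborel) * (exp (- (real N / 24) - real N / 400) * exp (- (\<beta>\<^sup>2 * x\<^sup>2) / 32))"
proof -
  define I where "I = (indicator {-(2*M)..2*M} :: real \<Rightarrow> real)"
  have [measurable]: "I \<in> borel_measurable borel" unfolding I_def by measurable
  have I01: "0 \<le> I a" for a by (simp add: I_def)
  have I0: "I a = 0 \<or> \<beta>\<^sup>2 * a\<^sup>2 \<le> real N / 3" for a
  proof (cases "a \<in> {-(2*M)..2*M}")
    case True
    then have "\<bar>a\<bar> \<le> \<bar>2 * M\<bar>" by auto
    then have "a\<^sup>2 \<le> (2 * M)\<^sup>2" by (simp only: abs_le_square_iff)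
    then show ?thesis using M2 mult_left_mono[of "a\<^sup>2" "(2*M)\<^sup>2" "\<beta>\<^sup>2"] by auto
  qed (simp add: I_def)
  have q0: "q b = 0 \<or> b\<^sup>2 / \<beta>\<^sup>2 \<le> 81/64 * (real N / 12)" for b
  proof (cases "\<bar>b\<bar> > L")
    case False
    then have "\<bar>b\<bar> \<le> \<bar>L\<bar>" by auto
    then have "b\<^sup>2 \<le> L\<^sup>2" by (simp only: abs_le_square_iff)
    then have "b\<^sup>2 / \<beta>\<^sup>2 \<le> L\<^sup>2 / \<beta>\<^sup>2" by (intro divide_right_mono) auto
    from order_trans[OF this L2] show ?thesis by simp
  qed (use z in auto)
  have qi: "integrable lborel q" using L12_bounded_support[OF assms(2) fin z] by (simp add: L12_def)
  have Ii: "integrable lborel I" unfolding I_def by (rule integrable_real_indicator) (auto simp: emeasure_lborel_Icc_eq)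
  \<comment> \<open>W collects what does not depend on x, and \<zeta> is the complex frequency of
    the coherent state; \<beta> / (2 pi) is the product of the normalisations of the normal density
    and of the transform.\<close>
  define W where "W = (\<lambda>p. of_real (\<beta> / (2 * pi) * (I (fst p) * exp (- (\<beta>\<^sup>2 * (fst p)\<^sup>2) / 2))) * q (snd p))"
  define \<zeta> where "\<zeta> = (\<lambda>p::real \<times> real. of_real (\<beta>\<^sup>2 * fst p) + \<i> * complex_of_real (snd p))"
  have [measurable]: "W \<in> borel_measurable borel" "\<zeta> \<in> borel_measurable borel" unfolding W_def \<zeta>_def by measurable
  have Wb: "cmod (W (a, b)) \<le> (\<beta> / (2 * pi) * I a) * cmod (q b)" for a b
  proof -
    have "cmod (W (a, b)) = (\<beta> / (2 * pi) * (I a * exp (- (\<beta>\<^sup>2 * a\<^sup>2) / 2))) * cmod (q b)"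
      using \<beta> I01[of a] by (simp add: W_def norm_mult abs_mult del: of_real_mult of_real_divide)
    also have "\<dots> \<le> (\<beta> / (2 * pi) * (I a * 1)) * cmod (q b)"
      using \<beta> I01 by (intro mult_right_mono mult_left_mono) auto
    finally show ?thesis by simp
  qed
  \<comment> \<open>A bound for |\<zeta>| on the support of W; it makes all powers and the
    exponential of x \<zeta> integrable against W.\<close>
  define Z where "Z = \<beta>\<^sup>2 * (2 * M) + L"
  have Zb: "W p = 0 \<or> cmod (\<zeta> p) \<le> Z" for p
  proof (cases "fst p \<in> {-(2*M)..2*M} \<and> \<not> \<bar>snd p\<bar> > L")
    case True
    have "cmod (\<zeta> p) \<le> cmod (of_real (\<beta>\<^sup>2 * fst p)) + cmod (\<i> * complex_of_real (snd p))"
      unfolding \<zeta>_def by (rule norm_triangle_ineq)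
    also have "\<dots> = \<beta>\<^sup>2 * \<bar>fst p\<bar> + \<bar>snd p\<bar>" by (simp add: norm_mult abs_mult del: of_real_mult)
    also have "\<dots> \<le> Z" unfolding Z_def using True by (intro add_mono mult_left_mono) auto
    finally show ?thesis by simp
  qed (use z[of "snd p"] in \<open>auto simp: W_def I_def\<close>)
  have Wi': "integrable (lborel \<Otimes>\<^sub>M lborel) W"
    by (rule integrable_pair_bound[where a="\<lambda>a. \<beta> / (2 * pi) * I a" and b="\<lambda>b. cmod (q b)", OF _ _ _ Wb])
       (use qi Ii in \<open>auto simp: lborel_prod\<close>)
  then have Wi: "integrable lborel W" by (simp add: lborel_prod)
  have Wk: "integrable lborel (\<lambda>p. W p * k p)" if [measurable]: "k \<in> borel_measurable borel" and kb: "\<And>p. W p = 0 \<or> cmod (k p) \<le> c" for k :: "real \<times> real \<Rightarrow> complex" and c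
  proof (rule Bochner_Integration.integrable_bound[where f="\<lambda>p. of_real c * W p"])
    show "AE p in lborel. norm (W p * k p) \<le> norm (of_real c * W p)"
    proof (intro AE_I2)
      fix p show "norm (W p * k p) \<le> norm (of_real c * W p)"
      proof (cases "W p = 0")
        case False
        then have "cmod (W p) * cmod (k p) \<le> cmod (W p) * \<bar>c\<bar>" using kb[of p] by (intro mult_left_mono) auto
        then show ?thesis by (simp add: norm_mult mult.commute)
      qed simp
    qed
  qed (use Wi in auto)
  have Wn: "integrable lborel (\<lambda>p. W p * (of_real x * \<zeta> p) ^ n)" for x n
  proof (rule Wk[where c="(\<bar>x\<bar> * Z) ^ n"])
    fix p show "W p = 0 \<or> cmod ((of_real x * \<zeta> p) ^ n) \<le> (\<bar>x\<bar> * Z) ^ n"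
      using Zb[of p] by (auto simp: norm_power norm_mult intro!: power_mono mult_left_mono)
  qed measurable
  have We: "integrable lborel (\<lambda>p. W p * exp (of_real x * \<zeta> p))" for x
  proof (rule Wk[where c="exp (\<bar>x\<bar> * Z)"])
    fix p
    have "cmod (exp (of_real x * \<zeta> p)) \<le> exp (cmod (of_real x * \<zeta> p))" by (rule norm_exp)
    moreover have "W p = 0 \<or> exp (cmod (of_real x * \<zeta> p)) \<le> exp (\<bar>x\<bar> * Z)"
      using Zb[of p] by (auto simp: norm_mult intro!: mult_left_mono)
    ultimately show "W p = 0 \<or> cmod (exp (of_real x * \<zeta> p)) \<le> exp (\<bar>x\<bar> * Z)"
      by linarith
  qed measurable
  have rep: "of_real (window M \<beta> x) * ift q x = of_real (exp (- (\<beta>\<^sup>2 * x\<^sup>2) / 2)) * (\<integral>p. W p * exp (of_real x * \<zeta> p) \<partial>lborel)" for x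
  proof -
    define ea where "ea = (\<lambda>a. complex_of_real (\<beta> / sqrt (2 * pi)) * of_real (I a * exp (- (\<beta>\<^sup>2 * a\<^sup>2) / 2) * exp (\<beta>\<^sup>2 * a * x)))"
    define eb where "eb = (\<lambda>b. complex_of_real (1 / sqrt (2 * pi)) * (exp (- \<i> * of_real (- x * b)) * q b))"
    have spl: "W p * exp (of_real x * \<zeta> p) = ea (fst p) * eb (snd p)" for p
    proof -
      have e1: "exp (of_real x * \<zeta> p) = of_real (exp (\<beta>\<^sup>2 * fst p * x)) * exp (- \<i> * of_real (- x * snd p))"
        unfolding \<zeta>_def exp_of_real[symmetric] mult_exp_exp by (simp add: algebra_simps)
      have e2: "complex_of_real (\<beta> / (2 * pi)) = of_real (\<beta> / sqrt (2 * pi)) * of_real (1 / sqrt (2 * pi))"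
        unfolding of_real_mult[symmetric] by simp
      show ?thesis
        unfolding W_def ea_def eb_def e1 of_real_mult[of "\<beta> / (2 * pi)"] e2
          of_real_mult[of "I (fst p) * exp (- (\<beta>\<^sup>2 * (fst p)\<^sup>2) / 2)"] by (simp only: mult_ac)
    qed
    have "(\<integral>p. W p * exp (of_real x * \<zeta> p) \<partial>lborel) = (\<integral>a. (\<integral>b. W (a, b) * exp (of_real x * \<zeta> (a, b)) \<partial>lborel) \<partial>lborel)"
      using lborel_pair.integral_fst'[of "\<lambda>p. W p * exp (of_real x * \<zeta> p)"] We[of x] by (simp add: lborel_prod)
    also have "\<dots> = (\<integral>a. ea a \<partial>lborel) * (\<integral>b. eb b \<partial>lborel)"
      unfolding spl by simp
    also have "(\<integral>b. eb b \<partial>lborel) = ift q x" unfolding eb_def ift_def ft_def by simp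
    also have "of_real (exp (- (\<beta>\<^sup>2 * x\<^sup>2) / 2)) * ((\<integral>a. ea a \<partial>lborel) * ift q x) = (\<integral>a. of_real (exp (- (\<beta>\<^sup>2 * x\<^sup>2) / 2)) * ea a \<partial>lborel) * ift q x"
      by simp
    also have "(\<integral>a. of_real (exp (- (\<beta>\<^sup>2 * x\<^sup>2) / 2)) * ea a \<partial>lborel) = (\<integral>a. of_real (I a * normal_density x (1 / \<beta>) a) \<partial>lborel)"
    proof (intro Bochner_Integration.integral_cong refl)
      fix a
      \<comment> \<open>Expanding (a - x)^2 splits the Gaussian into its part in x, its part in a
        and the cross term exp(\<beta>^2 a x).\<close>
      have "exp (- (\<beta>\<^sup>2 * x\<^sup>2) / 2) * (exp (- (\<beta>\<^sup>2 * a\<^sup>2) / 2) * exp (\<beta>\<^sup>2 * a * x)) = exp (- (\<beta>\<^sup>2 * (a - x)\<^sup>2) / 2)"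
        unfolding mult_exp_exp by (simp add: power2_eq_square algebra_simps add_divide_distrib diff_divide_distrib)
      moreover have "normal_density x (1 / \<beta>) a = \<beta> / sqrt (2 * pi) * exp (- (\<beta>\<^sup>2 * (a - x)\<^sup>2) / 2)"
        using \<beta> by (simp add: normal_density_def real_sqrt_mult real_sqrt_divide power_one_over field_simps)
      ultimately have "I a * normal_density x (1 / \<beta>) a = exp (- (\<beta>\<^sup>2 * x\<^sup>2) / 2) * (\<beta> / sqrt (2 * pi) * (I a * exp (- (\<beta>\<^sup>2 * a\<^sup>2) / 2) * exp (\<beta>\<^sup>2 * a * x)))"
        by (metis (no_types, lifting) mult.assoc mult.left_commute)
      then show "of_real (exp (- (\<beta>\<^sup>2 * x\<^sup>2) / 2)) * ea a = of_real (I a * normal_density x (1 / \<beta>) a)"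
        unfolding ea_def by (simp only: of_real_mult)
    qed
    also have "\<dots> = of_real (window M \<beta> x)"
      unfolding window_def I_def by (rule integral_complex_of_real)
    finally show ?thesis ..
  qed
  \<comment> \<open>The moments of \<zeta> under W, that is, the Taylor coefficients of the plane
    integral as a function of x.\<close>
  define co where "co = (\<lambda>n. (\<integral>p. W p * (\<zeta> p) ^ n \<partial>lborel) / fact n)"
  define pl where "pl = (\<Sum>n\<le>N. monom (co n) n)"
  define v where "v = (\<lambda>x. of_real (exp (- (\<beta>\<^sup>2 * x\<^sup>2) / 2)) * poly pl (of_real x))"
  have "degree pl \<le> N" unfolding pl_def by (intro degree_sum_le) (auto intro: order_trans[OF degree_monom_le])
  then have v: "v \<in> gauss_poly_space \<beta> N" unfolding gauss_poly_space_def v_def by blast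
  have pv: "poly pl (of_real x) = (\<integral>p. W p * (\<Sum>n\<le>N. (of_real x * \<zeta> p) ^ n / fact n) \<partial>lborel)" for x
  proof -
    have "(\<integral>p. W p * (\<Sum>n\<le>N. (of_real x * \<zeta> p) ^ n / fact n) \<partial>lborel) = (\<integral>p. (\<Sum>n\<le>N. (W p * (of_real x * \<zeta> p) ^ n) / fact n) \<partial>lborel)"
      by (simp add: sum_distrib_left)
    also have "\<dots> = (\<Sum>n\<le>N. (\<integral>p. (W p * (of_real x * \<zeta> p) ^ n) / fact n \<partial>lborel))"
      by (intro Bochner_Integration.integral_sum integrable_divide_zero Wn)
    also have "\<dots> = (\<Sum>n\<le>N. co n * of_real x ^ n)"
    proof (intro sum.cong refl)
      fix n
      have "(\<integral>p. (W p * (of_real x * \<zeta> p) ^ n) / fact n \<partial>lborel) = (\<integral>p. of_real x ^ n / fact n * (W p * \<zeta> p ^ n) \<partial>lborel)"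
        by (intro Bochner_Integration.integral_cong refl) (simp add: power_mult_distrib mult_ac)
      then show "(\<integral>p. (W p * (of_real x * \<zeta> p) ^ n) / fact n \<partial>lborel) = co n * of_real x ^ n"
        by (simp add: co_def)
    qed
    finally show ?thesis unfolding pl_def by (simp add: poly_sum poly_monom)
  qed
  have "cmod (of_real (window M \<beta> x) * ift q x - v x)
     \<le> \<beta> / (2 * pi) * (4 * M) * (\<integral>b. cmod (q b) \<partial>lborel) * (exp (- (real N / 24) - real N / 400) * exp (- (\<beta>\<^sup>2 * x\<^sup>2) / 32))" for x
  proof -
    define E where "E = exp (- (real N / 24) - real N / 400) * exp (- (\<beta>\<^sup>2 * x\<^sup>2) / 32)"
    define g where "g = exp (- (\<beta>\<^sup>2 * x\<^sup>2) / 2)"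
    define t where "t = (\<lambda>p. exp (of_real x * \<zeta> p) - (\<Sum>n\<le>N. (of_real x * \<zeta> p) ^ n / fact n))"
    have ti: "integrable lborel (\<lambda>p. W p * t p)"
    proof -
      have "integrable lborel (\<lambda>p. W p * exp (of_real x * \<zeta> p) - (\<Sum>n\<le>N. (W p * (of_real x * \<zeta> p) ^ n) / fact n))"
        by (intro Bochner_Integration.integrable_diff We Bochner_Integration.integrable_sum integrable_divide_zero Wn) 
      then show ?thesis unfolding t_def by (simp add: right_diff_distrib sum_distrib_left)
    qed
    have si: "integrable lborel (\<lambda>p. W p * (\<Sum>n\<le>N. (of_real x * \<zeta> p) ^ n / fact n))"
      unfolding sum_distrib_left times_divide_eq_right
      by (intro Bochner_Integration.integrable_sum integrable_divide_zero Wn)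
    have "of_real (window M \<beta> x) * ift q x - v x = of_real g * ((\<integral>p. W p * exp (of_real x * \<zeta> p) \<partial>lborel) - (\<integral>p. W p * (\<Sum>n\<le>N. (of_real x * \<zeta> p) ^ n / fact n) \<partial>lborel))"
      unfolding rep v_def pv g_def by (simp only: right_diff_distrib)
    also have "(\<integral>p. W p * exp (of_real x * \<zeta> p) \<partial>lborel) - (\<integral>p. W p * (\<Sum>n\<le>N. (of_real x * \<zeta> p) ^ n / fact n) \<partial>lborel) = (\<integral>p. W p * t p \<partial>lborel)"
      unfolding t_def right_diff_distrib by (rule Bochner_Integration.integral_diff[OF We si, symmetric])
    finally have "cmod (of_real (window M \<beta> x) * ift q x - v x) = g * cmod (\<integral>p. W p * t p \<partial>lborel)"
      by (simp add: norm_mult g_def)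
    also have "\<dots> \<le> g * (\<integral>p. cmod (W p * t p) \<partial>lborel)"
      by (intro mult_left_mono integral_norm_bound) (simp add: g_def)
    also have "\<dots> = (\<integral>p. g * cmod (W p * t p) \<partial>lborel)" by simp
    also have "\<dots> \<le> (\<integral>p. (\<beta> / (2 * pi) * E) * (I (fst p) * cmod (q (snd p))) \<partial>lborel)"
    proof (rule integral_mono)
      show "integrable lborel (\<lambda>p. g * cmod (W p * t p))" using ti by (intro integrable_mult_right integrable_norm)
      \<comment> \<open>The domination lemma speaks of complex integrands, so the real one is
        embedded and recovered by \<open>Re\<close>.\<close>
      have "integrable (lborel \<Otimes>\<^sub>M lborel) (\<lambda>p. complex_of_real (I (fst p) * cmod (q (snd p))))"
        by (rule integrable_pair_bound[where a=I and b="\<lambda>b. cmod (q b)"])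
           (use qi Ii I01 in \<open>auto simp: lborel_prod norm_mult\<close>)
      then have "integrable lborel (\<lambda>p. Re (complex_of_real (I (fst p) * cmod (q (snd p)))))"
        by (simp only: lborel_prod integrable_Re)
      then show "integrable lborel (\<lambda>p. (\<beta> / (2 * pi) * E) * (I (fst p) * cmod (q (snd p))))"
        by (intro integrable_mult_right) (simp only: Re_complex_of_real)
      fix p :: "real \<times> real"
      obtain a b where p: "p = (a, b)" by (cases p)
      show "g * cmod (W p * t p) \<le> (\<beta> / (2 * pi) * E) * (I (fst p) * cmod (q (snd p)))"
      \<comment> \<open>The exponent estimate is valid on the rectangle only; off it W
        vanishes.\<close>
      proof (cases "I a = 0 \<or> q b = 0")
        case True
        then show ?thesis by (auto simp: p W_def)
      next
        case False
        have tb: "cmod (t p) \<le> (2/3) ^ N * exp (3/2 * cmod (of_real x * \<zeta> p))"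
          unfolding t_def using exp_tail_bound[of "3/2" "of_real x * \<zeta> p" N] by simp
        have "g * cmod (W p * t p) = (\<beta> / (2 * pi) * (I a * cmod (q b))) * (exp (- (\<beta>\<^sup>2 * a\<^sup>2) / 2) * g * cmod (t p))"
          using \<beta> I01[of a] by (simp add: p W_def norm_mult abs_mult del: of_real_mult of_real_divide)
        also have "\<dots> \<le> (\<beta> / (2 * pi) * (I a * cmod (q b))) * (exp (- (\<beta>\<^sup>2 * a\<^sup>2) / 2) * g * ((2/3) ^ N * exp (3/2 * cmod (of_real x * \<zeta> p))))"
          using \<beta> I01[of a] tb by (intro mult_left_mono) (auto simp: g_def)
        also have "\<dots> \<le> (\<beta> / (2 * pi) * (I a * cmod (q b))) * E"
        proof (intro mult_left_mono)
          show "exp (- (\<beta>\<^sup>2 * a\<^sup>2) / 2) * g * ((2/3) ^ N * exp (3/2 * cmod (of_real x * \<zeta> p))) \<le> E"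
            unfolding E_def g_def p \<zeta>_def fst_conv snd_conv
            using I0[of a] q0[of b] False by (intro gauss_exponent_bound \<beta>) auto
        qed (use \<beta> I01[of a] in auto)
        finally show ?thesis by (simp add: p mult_ac)
      qed
    qed
    also have "\<dots> = (\<beta> / (2 * pi) * E) * (\<integral>p. I (fst p) * cmod (q (snd p)) \<partial>lborel)" by simp
    also have "(\<integral>p. I (fst p) * cmod (q (snd p)) \<partial>lborel) = (4 * M) * (\<integral>b. cmod (q b) \<partial>lborel)"
    proof -
      have "integrable (lborel \<Otimes>\<^sub>M lborel) (\<lambda>p. complex_of_real (I (fst p) * cmod (q (snd p))))"
        by (rule integrable_pair_bound[where a=I and b="\<lambda>b. cmod (q b)"])
           (use qi Ii I01 in \<open>auto simp: lborel_prod norm_mult\<close>)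
      then have "integrable (lborel \<Otimes>\<^sub>M lborel) (\<lambda>p. Re (complex_of_real (I (fst p) * cmod (q (snd p)))))"
        by (rule integrable_Re)
      then have "integrable (lborel \<Otimes>\<^sub>M lborel) (\<lambda>p. I (fst p) * cmod (q (snd p)))" by (simp only: Re_complex_of_real)
      from lborel_pair.integral_fst'[OF this]
      have "(\<integral>p. I (fst p) * cmod (q (snd p)) \<partial>lborel) = (\<integral>a. (\<integral>b. I a * cmod (q b) \<partial>lborel) \<partial>lborel)"
        by (simp add: lborel_prod)
      also have "\<dots> = (\<integral>a. I a \<partial>lborel) * (\<integral>b. cmod (q b) \<partial>lborel)" by simp
      also have "(\<integral>a. I a \<partial>lborel) = 4 * M" unfolding I_def using M by simp
      finally show ?thesis .
    qed
    finally show ?thesis unfolding E_def by (simp add: mult_ac)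
  qed
  then show ?thesis using v by blast
qed

subsection \<open>Orthogonal projection\<close>

text \<open>Functions rather than classes modulo null functions, since \<open>hproj\<close> selects
  an actual function.\<close>

definition sqi :: "'a measure \<Rightarrow> ('a \<Rightarrow> complex) \<Rightarrow> bool" where
  "sqi M f \<longleftrightarrow> f \<in> borel_measurable M \<and> integrable M (\<lambda>x. (cmod (f x))\<^sup>2)"

definition ip :: "'a measure \<Rightarrow> ('a \<Rightarrow> complex) \<Rightarrow> ('a \<Rightarrow> complex) \<Rightarrow> complex" where
  "ip M f g = (\<integral>x. f x * cnj (g x) \<partial>M)"

lemma sqi_mult: "sqi M f \<Longrightarrow> sqi M g \<Longrightarrow> integrable M (\<lambda>x. f x * cnj (g x))"
  unfolding sqi_def by (intro integrable_mult_cnj_of_squares) auto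

lemma sqi_add:
  assumes f: "sqi M f" and g: "sqi M g"
  shows "sqi M (\<lambda>x. f x + g x)"
proof -
  have [measurable]: "f \<in> borel_measurable M" "g \<in> borel_measurable M" using f g by (auto simp: sqi_def)
  have "integrable M (\<lambda>x. (cmod (f x + g x))\<^sup>2)"
  proof (rule Bochner_Integration.integrable_bound)
  show "integrable M (\<lambda>x. 2 * (cmod (f x))\<^sup>2 + 2 * (cmod (g x))\<^sup>2)" using f g by (auto simp: sqi_def)
  show "AE x in M. norm ((cmod (f x + g x))\<^sup>2) \<le> norm (2 * (cmod (f x))\<^sup>2 + 2 * (cmod (g x))\<^sup>2)"
    using cmod_add_sq by (auto simp: abs_of_nonneg)
  qed measurable
  then show ?thesis by (simp add: sqi_def)
qed

lemma sqi_cmult: "sqi M f \<Longrightarrow> sqi M (\<lambda>x. c * f x)"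
  unfolding sqi_def by (auto simp: norm_mult power_mult_distrib)

lemma sqi_diff: "sqi M f \<Longrightarrow> sqi M g \<Longrightarrow> sqi M (\<lambda>x. f x - g x)"
  using sqi_add[of M f "\<lambda>x. (-1) * g x"] sqi_cmult[of M g "-1"] by simp

lemma sqi_zero: "sqi M (\<lambda>x. 0)"
  by (simp add: sqi_def)

lemma sqi_sum: "(\<And>i. i \<in> A \<Longrightarrow> sqi M (f i)) \<Longrightarrow> sqi M (\<lambda>x. \<Sum>i\<in>A. f i x)"
  by (induction A rule: infinite_finite_induct) (auto intro: sqi_zero sqi_add)

lemma ip_diff_left:
  "sqi M f \<Longrightarrow> sqi M g \<Longrightarrow> sqi M h \<Longrightarrow> ip M (\<lambda>x. f x - g x) h = ip M f h - ip M g h"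
  unfolding ip_def left_diff_distrib by (intro Bochner_Integration.integral_diff sqi_mult)

lemma ip_cmult_left: "ip M (\<lambda>x. c * f x) g = c * ip M f g"
  unfolding ip_def by (simp add: mult.assoc)

lemma ip_add_right:
  "sqi M f \<Longrightarrow> sqi M g \<Longrightarrow> sqi M h \<Longrightarrow> ip M h (\<lambda>x. f x + g x) = ip M h f + ip M h g"
  unfolding ip_def complex_cnj_add distrib_left by (intro Bochner_Integration.integral_add sqi_mult)

lemma ip_cmult_right: "ip M f (\<lambda>x. c * g x) = cnj c * ip M f g"
  unfolding ip_def by (simp add: mult.left_commute)

lemma ip_sum_right:
  assumes "finite A" "sqi M f" "\<And>i. i \<in> A \<Longrightarrow> sqi M (g i)" "\<And>i. i \<in> A \<Longrightarrow> ip M f (g i) = 0"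
  shows "ip M f (\<lambda>x. \<Sum>i\<in>A. c i * g i x) = 0"
  using assms
proof (induction A rule: finite_induct)
  case empty
  show ?case by (simp add: ip_def)
next
  case (insert a A)
  have "ip M f (\<lambda>x. \<Sum>i\<in>insert a A. c i * g i x) = ip M f (\<lambda>x. c a * g a x + (\<Sum>i\<in>A. c i * g i x))"
    using insert by simp
  also have "\<dots> = ip M f (\<lambda>x. c a * g a x) + ip M f (\<lambda>x. \<Sum>i\<in>A. c i * g i x)"
    by (intro ip_add_right sqi_sum sqi_cmult) (use insert in auto)
  finally show ?case using insert by (simp add: ip_cmult_right)
qed

text \<open>A vector of norm 0 vanishes almost everywhere. This covers the degenerate Gram-Schmidt
  step, in which the quotient is 0 by convention.\<close>

lemma ip_self_eq_0:
  assumes f: "sqi M f" and g: "sqi M g" and z: "ip M g g = 0"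
  shows "ip M f g = 0"
proof -
  have "of_real (\<integral>x. (cmod (g x))\<^sup>2 \<partial>M) = ip M g g"
    unfolding ip_def by (simp only: integral_complex_of_real[symmetric] complex_norm_square)
  then have "(\<integral>x. (cmod (g x))\<^sup>2 \<partial>M) = 0" using z by simp
  then have "AE x in M. (cmod (g x))\<^sup>2 = 0"
    using g by (subst (asm) integral_nonneg_eq_0_iff_AE) (auto simp: sqi_def)
  then have "AE x in M. f x * cnj (g x) = 0" by eventually_elim simp
  then show ?thesis unfolding ip_def by (rule integral_eq_zero_AE)
qed

text \<open>Gram--Schmidt; no linear independence is needed, since \<open>c / 0 = 0\<close>.\<close>

lemma projection_exists:
  assumes e: "\<And>i. sqi M (e i)"
  shows "sqi M u \<Longrightarrow> \<exists>c. \<forall>i<(n::nat). ip M (\<lambda>x. u x - (\<Sum>j<n. c j * e j x)) (e i) = 0"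
proof (induction n arbitrary: u)
  case 0
  then show ?case by simp
next
  case (Suc n)
  obtain c0 where c0: "\<And>i. i < n \<Longrightarrow> ip M (\<lambda>x. u x - (\<Sum>j<n. c0 j * e j x)) (e i) = 0"
    using Suc.IH[OF Suc.prems] by blast
  obtain d where d: "\<And>i. i < n \<Longrightarrow> ip M (\<lambda>x. e n x - (\<Sum>j<n. d j * e j x)) (e i) = 0"
    using Suc.IH[OF e] by blast
  define v0 where "v0 = (\<lambda>x. u x - (\<Sum>j<n. c0 j * e j x))"
  define w where "w = (\<lambda>x. e n x - (\<Sum>j<n. d j * e j x))"
  have s: "sqi M v0" "sqi M w" unfolding v0_def w_def
    by (intro sqi_diff Suc.prems e sqi_sum sqi_cmult)+
  define \<alpha> where "\<alpha> = ip M v0 w / ip M w w"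
  define c where "c = (\<lambda>j. if j = n then \<alpha> else c0 j - \<alpha> * d j)"
  have r: "u x - (\<Sum>j<Suc n. c j * e j x) = v0 x - \<alpha> * w x" for x
    by (simp add: c_def v0_def w_def sum_subtractf left_diff_distrib right_diff_distrib sum_distrib_left mult.assoc)
  have sr: "sqi M (\<lambda>x. v0 x - \<alpha> * w x)" by (intro sqi_diff s sqi_cmult)
  have lin: "ip M (\<lambda>x. v0 x - \<alpha> * w x) g = ip M v0 g - \<alpha> * ip M w g" if "sqi M g" for g
    using ip_diff_left[OF s(1) sqi_cmult[OF s(2)] that] by (simp add: ip_cmult_left)
  have low: "ip M (\<lambda>x. v0 x - \<alpha> * w x) (e i) = 0" if "i < n" for i
    using lin[OF e, of i] c0[OF that, folded v0_def] d[OF that, folded w_def] by simp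
  have "ip M (\<lambda>x. v0 x - \<alpha> * w x) w = 0"
    using ip_self_eq_0[OF s] lin[OF s(2)] by (cases "ip M w w = 0") (simp_all add: \<alpha>_def)
  moreover have "ip M (\<lambda>x. v0 x - \<alpha> * w x) (\<lambda>x. \<Sum>j<n. d j * e j x) = 0"
    by (rule ip_sum_right) (use sr e low in auto)
  moreover have "ip M (\<lambda>x. v0 x - \<alpha> * w x) (\<lambda>x. w x + (\<Sum>j<n. d j * e j x)) =
    ip M (\<lambda>x. v0 x - \<alpha> * w x) w + ip M (\<lambda>x. v0 x - \<alpha> * w x) (\<lambda>x. \<Sum>j<n. d j * e j x)"
    by (intro ip_add_right s sqi_sum sqi_cmult e sr)
  moreover have "(\<lambda>x. w x + (\<Sum>j<n. d j * e j x)) = e n" by (auto simp: w_def)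
  ultimately have "ip M (\<lambda>x. v0 x - \<alpha> * w x) (e n) = 0" by simp
  then have "\<forall>i<Suc n. ip M (\<lambda>x. u x - (\<Sum>j<Suc n. c j * e j x)) (e i) = 0"
    unfolding r using low by (auto simp: less_Suc_eq)
  then show ?case by blast
qed

lemma pythagoras_le:
  assumes u: "sqi M u" and v: "sqi M v" and w: "sqi M w" and o: "ip M (\<lambda>x. u x - v x) (\<lambda>x. v x - w x) = 0"
  shows "(\<integral>x. (cmod (u x - v x))\<^sup>2 \<partial>M) \<le> (\<integral>x. (cmod (u x - w x))\<^sup>2 \<partial>M)"
proof -
  have s: "sqi M (\<lambda>x. u x - v x)" "sqi M (\<lambda>x. v x - w x)" "sqi M (\<lambda>x. u x - w x)" by (intro sqi_diff u v w)+
  have e: "(cmod (u x - w x))\<^sup>2 = (cmod (u x - v x))\<^sup>2 + (cmod (v x - w x))\<^sup>2 + 2 * Re ((u x - v x) * cnj (v x - w x))" for x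
  proof -
    have "(u x - v x) * cnj (w x - v x) = - ((u x - v x) * cnj (v x - w x))" by (simp add: algebra_simps)
    then have "Re ((u x - v x) * cnj (w x - v x)) = - Re ((u x - v x) * cnj (v x - w x))" by (simp only: uminus_complex.sel)
    moreover have "(cmod (w x - v x))\<^sup>2 = (cmod (v x - w x))\<^sup>2" by (simp only: norm_minus_commute)
    moreover have "u x - w x = (u x - v x) - (w x - v x)" by simp
    ultimately show ?thesis by (simp only: cmod_diff_sq[of "u x - v x" "w x - v x"])
  qed
  have i: "integrable M (\<lambda>x. Re ((u x - v x) * cnj (v x - w x)))" by (rule integrable_Re[OF sqi_mult[OF s(1,2)]])
  have "(\<integral>x. (cmod (u x - w x))\<^sup>2 \<partial>M) = (\<integral>x. (cmod (u x - v x))\<^sup>2 \<partial>M) + (\<integral>x. (cmod (v x - w x))\<^sup>2 \<partial>M) + 2 * (\<integral>x. Re ((u x - v x) * cnj (v x - w x)) \<partial>M)"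
    unfolding e using s i by (simp add: sqi_def del: times_complex.sel)
  also have "(\<integral>x. Re ((u x - v x) * cnj (v x - w x)) \<partial>M) = 0"
    using o unfolding ip_def by (subst integral_Re[OF sqi_mult[OF s(1,2)]]) simp
  finally show ?thesis by (simp add: integral_nonneg_AE)
qed

section \<open>Gaussian polynomials in the weighted space\<close>

lemma wt_le: "wt mu x \<le> 1 + \<bar>x\<bar> ^ (nat \<lceil>2 * mu\<rceil>)" if "mu \<ge> 0"
proof (cases "\<bar>x\<bar> \<le> 1")
  case True
  have "wt mu x \<le> 1" using True that powr_mono2[of "2 * mu" "\<bar>x\<bar>" 1] by (auto simp: wt_def)
  then show ?thesis by (simp add: add_increasing2)
next
  case False
  have "\<bar>x\<bar> powr (2 * mu) \<le> \<bar>x\<bar> powr real (nat \<lceil>2 * mu\<rceil>)"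
    using False that by (intro powr_mono) linarith+
  also have "\<dots> = \<bar>x\<bar> ^ (nat \<lceil>2 * mu\<rceil>)" using False by (intro powr_realpow) auto
  finally show ?thesis using False by (auto simp: wt_def)
qed

text \<open>The weight is at most 1 plus an integer power, so absolute moments of a normal law bound
  the integral.\<close>

lemma gauss_moment_finite:
  assumes c: "c > 0" and mu: "mu \<ge> 0"
  shows "(\<integral>\<^sup>+ x. ennreal (exp (- (c * x\<^sup>2)) * \<bar>x\<bar> ^ k * wt mu x) \<partial>lborel) < \<infinity>"
proof -
  define s where "s = 1 / sqrt (2 * c)"
  have s: "s > 0" "s\<^sup>2 = 1 / (2 * c)" using c by (auto simp: s_def power_divide)
  define K where "K = sqrt (2 * pi * s\<^sup>2)"
  have e: "exp (- (c * x\<^sup>2)) = K * normal_density 0 s x" for x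
    using s c by (simp add: normal_density_def K_def)
  have i: "integrable lborel (\<lambda>x. K * (normal_density 0 s x * \<bar>x\<bar> ^ j))" for j
    using integrable_normal_moment_abs[OF s(1), of 0 j] by (intro integrable_mult_right) simp
  have i2: "integrable lborel (\<lambda>x. K * (normal_density 0 s x * \<bar>x\<bar> ^ k) + K * (normal_density 0 s x * \<bar>x\<bar> ^ (k + nat \<lceil>2 * mu\<rceil>)))"
    by (intro Bochner_Integration.integrable_add i)
  have "(\<integral>\<^sup>+ x. ennreal (exp (- (c * x\<^sup>2)) * \<bar>x\<bar> ^ k * wt mu x) \<partial>lborel)
    \<le> (\<integral>\<^sup>+ x. ennreal (norm (K * (normal_density 0 s x * \<bar>x\<bar> ^ k) + K * (normal_density 0 s x * \<bar>x\<bar> ^ (k + nat \<lceil>2 * mu\<rceil>)))) \<partial>lborel)"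
  proof (intro nn_integral_mono ennreal_leI)
    fix x
    have "exp (- (c * x\<^sup>2)) * \<bar>x\<bar> ^ k * wt mu x \<le> exp (- (c * x\<^sup>2)) * \<bar>x\<bar> ^ k * (1 + \<bar>x\<bar> ^ (nat \<lceil>2 * mu\<rceil>))"
      by (intro mult_left_mono wt_le mu) auto
    also have "\<dots> = K * (normal_density 0 s x * \<bar>x\<bar> ^ k) + K * (normal_density 0 s x * \<bar>x\<bar> ^ (k + nat \<lceil>2 * mu\<rceil>))"
      unfolding e by (simp add: algebra_simps power_add)
    finally show "exp (- (c * x\<^sup>2)) * \<bar>x\<bar> ^ k * wt mu x \<le> norm (K * (normal_density 0 s x * \<bar>x\<bar> ^ k) + K * (normal_density 0 s x * \<bar>x\<bar> ^ (k + nat \<lceil>2 * mu\<rceil>)))"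
      by simp
  qed
  also have "\<dots> < \<infinity>" using i2 by (simp add: integrable_iff_bounded)
  finally show ?thesis .
qed

abbreviation wm :: "real \<Rightarrow> real measure" where
  "wm mu \<equiv> density lborel (\<lambda>x. ennreal (wt mu x))"

lemma nn_integral_wm:
  assumes [measurable]: "f \<in> borel_measurable borel"
  shows "(\<integral>\<^sup>+ x. ennreal ((cmod (f x))\<^sup>2) \<partial>wm mu) = (\<integral>\<^sup>+ x. ennreal ((cmod (f x))\<^sup>2 * wt mu x) \<partial>lborel)"
  by (subst nn_integral_density) (auto simp: ennreal_mult wt_nonneg mult.commute)

lemma sqi_wm:
  assumes [measurable]: "f \<in> borel_measurable borel" and fin: "(\<integral>\<^sup>+ x. ennreal ((cmod (f x))\<^sup>2 * wt mu x) \<partial>lborel) < \<infinity>"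
  shows "sqi (wm mu) f"
  unfolding sqi_def
proof (intro conjI integrableI_bounded)
  show "(\<integral>\<^sup>+ x. ennreal (norm ((cmod (f x))\<^sup>2)) \<partial>wm mu) < \<infinity>"
    using fin nn_integral_wm[of f mu] by simp
qed auto

lemma sqi_gauss_monomial:
  assumes \<beta>: "\<beta> > 0" and mu: "mu \<ge> 0"
  shows "sqi (wm mu) (\<lambda>x. of_real (exp (- (\<beta>\<^sup>2 * x\<^sup>2) / 2)) * of_real x ^ i)"
proof (rule sqi_wm)
  have "(cmod (of_real (exp (- (\<beta>\<^sup>2 * x\<^sup>2) / 2)) * of_real x ^ i))\<^sup>2 = exp (- (\<beta>\<^sup>2 * x\<^sup>2)) * \<bar>x\<bar> ^ (2 * i)" for x
  proof -
    have "(exp (- (\<beta>\<^sup>2 * x\<^sup>2) / 2))\<^sup>2 = exp (- (\<beta>\<^sup>2 * x\<^sup>2))"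
      by (simp add: power2_eq_square mult_exp_exp)
    moreover have "(\<bar>x\<bar> ^ i)\<^sup>2 = \<bar>x\<bar> ^ (2 * i)" by (simp only: power_mult[symmetric] mult.commute)
    ultimately show ?thesis by (simp only: norm_mult norm_power norm_of_real power_mult_distrib abs_exp_cancel)
  qed
  then show "(\<integral>\<^sup>+ x. ennreal ((cmod (of_real (exp (- (\<beta>\<^sup>2 * x\<^sup>2) / 2)) * of_real x ^ i))\<^sup>2 * wt mu x) \<partial>lborel) < \<infinity>"
    using gauss_moment_finite[of "\<beta>\<^sup>2" mu "2 * i"] \<beta> mu by simp
qed measurable

text \<open>Padding to the fixed length N + 1 lets all elements of the space share one list of
  generators.\<close>

lemma gauss_poly_sum:
  assumes "degree p \<le> N"
  shows "of_real g * poly p (of_real x) = (\<Sum>j<Suc N. coeff p j * (of_real g * of_real x ^ j :: complex))"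
proof -
  have "poly p (of_real x) = (\<Sum>j\<le>degree p. coeff p j * of_real x ^ j)" by (rule poly_altdef)
  also have "\<dots> = (\<Sum>j<Suc N. coeff p j * of_real x ^ j)"
    using assms by (intro sum.mono_neutral_left) (auto simp: coeff_eq_0)
  finally show ?thesis by (simp only: sum_distrib_left mult.left_commute)
qed

lemma gauss_poly_space_diff:
  assumes "v \<in> gauss_poly_space \<beta> N" "w \<in> gauss_poly_space \<beta> N"
  shows "(\<lambda>x. v x - w x) \<in> gauss_poly_space \<beta> N"
proof -
  obtain p q where "degree p \<le> N" "degree q \<le> N" and
    "v = (\<lambda>x. of_real (exp (- (\<beta>\<^sup>2 * x\<^sup>2) / 2)) * poly p (of_real x))"
    "w = (\<lambda>x. of_real (exp (- (\<beta>\<^sup>2 * x\<^sup>2) / 2)) * poly q (of_real x))"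
    using assms by (auto simp: gauss_poly_space_def)
  then show ?thesis unfolding gauss_poly_space_def
    by (intro CollectI exI[of _ "p - q"]) (auto simp: right_diff_distrib degree_diff_le)
qed

lemma gauss_poly_space_sqi:
  assumes \<beta>: "\<beta> > 0" and mu: "mu \<ge> 0" and v: "v \<in> gauss_poly_space \<beta> N"
  shows "sqi (wm mu) v"
proof -
  obtain p where p: "degree p \<le> N" "v = (\<lambda>x. of_real (exp (- (\<beta>\<^sup>2 * x\<^sup>2) / 2)) * poly p (of_real x))"
    using v by (auto simp: gauss_poly_space_def)
  show ?thesis unfolding p(2) gauss_poly_sum[OF p(1)]
    by (intro sqi_sum sqi_cmult sqi_gauss_monomial \<beta> mu)
qed

lemma gauss_poly_space_measurable:
  assumes "v \<in> gauss_poly_space \<beta> N"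
  shows "v \<in> borel_measurable borel"
proof -
  obtain p where p: "v = (\<lambda>x. of_real (exp (- (\<beta>\<^sup>2 * x\<^sup>2) / 2)) * poly p (of_real x))"
    using assms by (auto simp: gauss_poly_space_def)
  show ?thesis unfolding p by (intro borel_measurable_continuous_onI continuous_intros)  simp
qed

text \<open>Square integrability makes the integrability clause of \<open>is_hproj\<close> automatic
  and leaves pure orthogonality in the weighted measure.\<close>

lemma is_hproj_iff:
  assumes [measurable]: "u \<in> borel_measurable borel" and fin: "(\<integral>\<^sup>+ x. ennreal ((cmod (u x))\<^sup>2 * wt mu x) \<partial>lborel) < \<infinity>"
    and \<beta>: "\<beta> > 0" and mu: "mu \<ge> 0"
  shows "is_hproj mu \<beta> N u v \<longleftrightarrow> v \<in> gauss_poly_space \<beta> N \<and> (\<forall>q\<in>gauss_poly_space \<beta> N. ip (wm mu) (\<lambda>x. u x - v x) q = 0)"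
proof -
  have su: "sqi (wm mu) u" by (rule sqi_wm) (use fin in auto)
  have "integrable lborel (\<lambda>x. (u x - v x) * cnj (q x) * of_real (wt mu x))"
    "(\<integral>x. (u x - v x) * cnj (q x) * of_real (wt mu x) \<partial>lborel) = ip (wm mu) (\<lambda>x. u x - v x) q"
    if v: "v \<in> gauss_poly_space \<beta> N" and q: "q \<in> gauss_poly_space \<beta> N" for q
  proof -
    have [measurable]: "v \<in> borel_measurable borel" "q \<in> borel_measurable borel"
      using gauss_poly_space_measurable[OF v] gauss_poly_space_measurable[OF q] by auto
    have "integrable (wm mu) (\<lambda>x. (u x - v x) * cnj (q x))"
      by (rule sqi_mult[OF sqi_diff[OF su gauss_poly_space_sqi[OF \<beta> mu v]] gauss_poly_space_sqi[OF \<beta> mu q]])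
    then show "integrable lborel (\<lambda>x. (u x - v x) * cnj (q x) * of_real (wt mu x))"
      by (subst (asm) integrable_density) (auto simp: wt_nonneg scaleR_conv_of_real mult.commute)
    show "(\<integral>x. (u x - v x) * cnj (q x) * of_real (wt mu x) \<partial>lborel) = ip (wm mu) (\<lambda>x. u x - v x) q"
      unfolding ip_def by (subst integral_density) (auto simp: wt_nonneg scaleR_conv_of_real mult.commute)
  qed
  then show ?thesis unfolding is_hproj_def by auto
qed

text \<open>Gives uniqueness of the projection as a function, beyond equality almost everywhere: a
  nonzero polynomial has only finitely many zeros. The origin is set aside because the weight may
  vanish there.\<close>

lemma gauss_poly_self_orthogonal:
  assumes \<beta>: "\<beta> > 0" and mu: "mu \<ge> 0" and d: "d \<in> gauss_poly_space \<beta> N" and z: "ip (wm mu) d d = 0"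
  shows "d = (\<lambda>x. 0)"
proof -
  have sd: "sqi (wm mu) d" by (rule gauss_poly_space_sqi[OF \<beta> mu d])
  have [measurable]: "d \<in> borel_measurable borel" using d by (rule gauss_poly_space_measurable)
  obtain p where p: "d = (\<lambda>x. of_real (exp (- (\<beta>\<^sup>2 * x\<^sup>2) / 2)) * poly p (of_real x))"
    using d by (auto simp: gauss_poly_space_def)
  have "of_real (\<integral>x. (cmod (d x))\<^sup>2 \<partial>wm mu) = ip (wm mu) d d"
    unfolding ip_def by (simp only: integral_complex_of_real[symmetric] complex_norm_square)
  then have "(\<integral>x. (cmod (d x))\<^sup>2 \<partial>wm mu) = 0" using z by simp
  then have "AE x in wm mu. (cmod (d x))\<^sup>2 = 0"
    using sd by (subst (asm) integral_nonneg_eq_0_iff_AE) (auto simp: sqi_def)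
  then have ae: "AE x in lborel. 0 < ennreal (wt mu x) \<longrightarrow> (cmod (d x))\<^sup>2 = 0"
    by (subst (asm) AE_density) auto
  have "p = 0"
  proof (rule ccontr)
    assume "p \<noteq> 0"
    then have "finite {z. poly p z = 0}" by (rule poly_roots_finite)
    then have "finite (complex_of_real -` {z. poly p z = 0})" by (rule finite_vimageI) (rule inj_of_real)
    then have "finite (insert 0 (complex_of_real -` {z. poly p z = 0}))" by simp
    then have n: "insert 0 (complex_of_real -` {z. poly p z = 0}) \<in> null_sets lborel" by (rule finite_imp_null_set_lborel)
    have "AE x in lborel. x \<notin> insert 0 (complex_of_real -` {z. poly p z = 0})"
      using AE_not_in[OF n] .
    with ae have "AE (x::real) in lborel. False"
    proof eventually_elim
      case (elim x)
      then have "wt mu x > 0" by (auto simp: wt_def)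
      then have "d x = 0" using elim by simp
      then show False using elim by (simp add: p)
    qed
    then show False using AE_iff_null_sets[of "UNIV::real set" lborel] by (auto dest!: null_setsD1)
  qed
  then show ?thesis by (simp add: p)
qed

text \<open>The definite description in \<open>hproj\<close> is resolved by Gram-Schmidt for
  existence and by \<open>gauss_poly_self_orthogonal\<close> for uniqueness; minimality is then
  Pythagoras.\<close>

lemma hproj_best:
  assumes um[measurable]: "u \<in> borel_measurable borel" and fin: "(\<integral>\<^sup>+ x. ennreal ((cmod (u x))\<^sup>2 * wt mu x) \<partial>lborel) < \<infinity>"
    and \<beta>: "\<beta> > 0" and mu: "mu \<ge> 0" and w: "w \<in> gauss_poly_space \<beta> N"
  shows "(\<integral>\<^sup>+ x. ennreal ((cmod (u x - hproj mu \<beta> N u x))\<^sup>2 * wt mu x) \<partial>lborel)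
    \<le> (\<integral>\<^sup>+ x. ennreal ((cmod (u x - w x))\<^sup>2 * wt mu x) \<partial>lborel)"
proof -
  note iff = is_hproj_iff[OF um fin \<beta> mu, of N]
  have su: "sqi (wm mu) u" by (rule sqi_wm) (use fin in auto)
  define e where "e = (\<lambda>i x. complex_of_real (exp (- (\<beta>\<^sup>2 * x\<^sup>2) / 2)) * of_real x ^ i)"
  have se: "sqi (wm mu) (e i)" for i unfolding e_def by (rule sqi_gauss_monomial[OF \<beta> mu])
  obtain c where c: "\<And>i. i < Suc N \<Longrightarrow> ip (wm mu) (\<lambda>x. u x - (\<Sum>j<Suc N. c j * e j x)) (e i) = 0"
    using projection_exists[where e=e and M="wm mu" and n="Suc N", OF se su] by blast
  define v where "v = (\<lambda>x. \<Sum>j<Suc N. c j * e j x)"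
  have v: "v \<in> gauss_poly_space \<beta> N"
  proof -
    have "degree (\<Sum>j\<le>N. monom (c j) j) \<le> N" by (intro degree_sum_le) (auto intro: order_trans[OF degree_monom_le])
    moreover have "v = (\<lambda>x. of_real (exp (- (\<beta>\<^sup>2 * x\<^sup>2) / 2)) * poly (\<Sum>j\<le>N. monom (c j) j) (of_real x))"
      unfolding v_def e_def lessThan_Suc_atMost poly_sum poly_monom sum_distrib_left by (simp only: mult.left_commute)
    ultimately show ?thesis unfolding gauss_poly_space_def by blast
  qed
  have sv: "sqi (wm mu) v" by (rule gauss_poly_space_sqi[OF \<beta> mu v])
  have orth: "ip (wm mu) (\<lambda>x. u x - v x) q = 0" if q: "q \<in> gauss_poly_space \<beta> N" for q
  proof -
    obtain p where p: "degree p \<le> N" "q = (\<lambda>x. of_real (exp (- (\<beta>\<^sup>2 * x\<^sup>2) / 2)) * poly p (of_real x))"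
      using q by (auto simp: gauss_poly_space_def)
    have q': "q = (\<lambda>x. \<Sum>j<Suc N. coeff p j * e j x)" unfolding p(2) e_def gauss_poly_sum[OF p(1)] ..
    have "ip (wm mu) (\<lambda>x. u x - v x) (e i) = 0" if "i \<in> {..<Suc N}" for i
      using c[of i] that by (simp only: v_def lessThan_iff)
    then show ?thesis unfolding q' by (intro ip_sum_right sqi_diff su sv se) auto
  qed
  have pv: "is_hproj mu \<beta> N u v" using v orth by (simp add: iff)
  have "hproj mu \<beta> N u = v"
    unfolding hproj_def
  proof (rule the_equality)
    show "is_hproj mu \<beta> N u v" by (rule pv)
    fix v' assume "is_hproj mu \<beta> N u v'"
    then have v': "v' \<in> gauss_poly_space \<beta> N" and o': "\<And>q. q \<in> gauss_poly_space \<beta> N \<Longrightarrow> ip (wm mu) (\<lambda>x. u x - v' x) q = 0"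
      by (auto simp: iff)
    \<comment> \<open>The difference of two projections lies in the space and is orthogonal to it,
      hence to itself.\<close>
    define d where "d = (\<lambda>x. v' x - v x)"
    have d: "d \<in> gauss_poly_space \<beta> N" unfolding d_def by (rule gauss_poly_space_diff[OF v' v])
    have sd: "sqi (wm mu) d" "sqi (wm mu) v'" using gauss_poly_space_sqi[OF \<beta> mu] d v' by auto
    have "ip (wm mu) (\<lambda>x. (u x - v x) - (u x - v' x)) d = ip (wm mu) (\<lambda>x. u x - v x) d - ip (wm mu) (\<lambda>x. u x - v' x) d"
      by (intro ip_diff_left sqi_diff su sv sd)
    then have "ip (wm mu) d d = 0" using orth[OF d] o'[OF d] by (simp add: d_def)
    then have "d = (\<lambda>x. 0)" by (rule gauss_poly_self_orthogonal[OF \<beta> mu d])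
    then show "v' = v" unfolding d_def fun_eq_iff by simp
  qed
  moreover have "(\<integral>\<^sup>+ x. ennreal ((cmod (u x - v x))\<^sup>2 * wt mu x) \<partial>lborel) \<le> (\<integral>\<^sup>+ x. ennreal ((cmod (u x - w x))\<^sup>2 * wt mu x) \<partial>lborel)"
  proof -
    have [measurable]: "v \<in> borel_measurable borel" "w \<in> borel_measurable borel" using v w gauss_poly_space_measurable by auto
    have sw: "sqi (wm mu) w" by (rule gauss_poly_space_sqi[OF \<beta> mu w])
    have "(\<integral>x. (cmod (u x - v x))\<^sup>2 \<partial>wm mu) \<le> (\<integral>x. (cmod (u x - w x))\<^sup>2 \<partial>wm mu)"
      by (intro pythagoras_le su sv sw orth gauss_poly_space_diff v w)
    then have "ennreal (\<integral>x. (cmod (u x - v x))\<^sup>2 \<partial>wm mu) \<le> ennreal (\<integral>x. (cmod (u x - w x))\<^sup>2 \<partial>wm mu)" by (rule ennreal_leI)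
    moreover have "(\<integral>\<^sup>+ x. ennreal ((cmod (u x - y x))\<^sup>2) \<partial>wm mu) = ennreal (\<integral>x. (cmod (u x - y x))\<^sup>2 \<partial>wm mu)" if "sqi (wm mu) y" for y
      using sqi_diff[OF su that] by (intro nn_integral_eq_integral) (auto simp: sqi_def)
    ultimately have "(\<integral>\<^sup>+ x. ennreal ((cmod (u x - v x))\<^sup>2) \<partial>wm mu) \<le> (\<integral>\<^sup>+ x. ennreal ((cmod (u x - w x))\<^sup>2) \<partial>wm mu)"
      using sv sw by simp
    then show ?thesis by (subst (asm) (1 2) nn_integral_wm) auto
  qed
  ultimately show ?thesis by simp
qed

section \<open>Size of the low-frequency error\<close>

lemma square_exp_bound: "(x::real)\<^sup>2 * exp (- (x / 200)) \<le> 80000" if "x \<ge> 0"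
proof -
  \<comment> \<open>The quadratic term of the series is (x/200)^2 / 2 = x^2 / 80000.\<close>
  have "1 + x/200 + (x/200)\<^sup>2 / 2 \<le> exp (x/200)" by (rule exp_lower_Taylor_quadratic) (use that in auto)
  then have "x\<^sup>2 / 80000 \<le> exp (x/200)" using that by (simp add: power_divide)
  then have "x\<^sup>2 * exp (- (x / 200)) \<le> (80000 * exp (x/200)) * exp (- (x / 200))"
    by (intro mult_right_mono) auto
  also have "\<dots> = 80000" by (simp add: mult.assoc mult_exp_exp)
  finally show ?thesis .
qed

lemma gauss_weight_scale:
  assumes \<beta>: "\<beta> > 0"
  shows "(\<integral>\<^sup>+ x. ennreal (exp (- (\<beta>\<^sup>2 * x\<^sup>2) / 16) * wt mu x) \<partial>lborel)
    = ennreal (1 / \<beta> * \<beta> powr (- 2 * mu)) * (\<integral>\<^sup>+ x. ennreal (exp (- (1/16 * x\<^sup>2)) * wt mu x) \<partial>lborel)"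
proof -
  have w: "wt mu (1 / \<beta> * y) = \<beta> powr (- 2 * mu) * wt mu y" for y
    using \<beta> by (auto simp: wt_def abs_mult powr_mult powr_divide powr_minus_divide)
  have "(\<integral>\<^sup>+ x. ennreal (exp (- (\<beta>\<^sup>2 * x\<^sup>2) / 16) * wt mu x) \<partial>lborel)
    = ennreal \<bar>1 / \<beta>\<bar> * (\<integral>\<^sup>+ y. ennreal (exp (- (\<beta>\<^sup>2 * (0 + 1 / \<beta> * y)\<^sup>2) / 16) * wt mu (0 + 1 / \<beta> * y)) \<partial>lborel)"
    using \<beta> by (intro nn_integral_real_affine) auto
  also have "(\<integral>\<^sup>+ y. ennreal (exp (- (\<beta>\<^sup>2 * (0 + 1 / \<beta> * y)\<^sup>2) / 16) * wt mu (0 + 1 / \<beta> * y)) \<partial>lborel)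
    = (\<integral>\<^sup>+ y. ennreal (\<beta> powr (- 2 * mu)) * ennreal (exp (- (1/16 * y\<^sup>2)) * wt mu y) \<partial>lborel)"
  proof (intro nn_integral_cong)
    fix y
    have "\<beta>\<^sup>2 * (0 + 1 / \<beta> * y)\<^sup>2 = y\<^sup>2" using \<beta> by (simp add: power_divide)
    then show "ennreal (exp (- (\<beta>\<^sup>2 * (0 + 1 / \<beta> * y)\<^sup>2) / 16) * wt mu (0 + 1 / \<beta> * y)) = ennreal (\<beta> powr (- 2 * mu)) * ennreal (exp (- (1/16 * y\<^sup>2)) * wt mu y)"
      unfolding add_0 w by (simp add: ennreal_mult[symmetric] wt_nonneg mult_ac)
  qed
  also have "\<dots> = ennreal (\<beta> powr (- 2 * mu)) * (\<integral>\<^sup>+ y. ennreal (exp (- (1/16 * y\<^sup>2)) * wt mu y) \<partial>lborel)"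
    by (rule nn_integral_cmult) measurable
  also have "ennreal \<bar>1 / \<beta>\<bar> * (ennreal (\<beta> powr (- 2 * mu)) * z) = ennreal (1 / \<beta> * \<beta> powr (- 2 * mu)) * z" for z
  proof -
    have "ennreal (1 / \<beta> * \<beta> powr (- 2 * mu)) = ennreal (1 / \<beta>) * ennreal (\<beta> powr (- 2 * mu))"
      using \<beta> by (intro ennreal_mult) auto
    moreover have "\<bar>1 / \<beta>\<bar> = 1 / \<beta>" using \<beta> by simp
    ultimately show ?thesis by (simp only: mult.assoc)
  qed
  finally show ?thesis .
qed

text \<open>The dimensionless k = \<beta> M = sqrt(N/12) collects the polynomial dependence on N.
  The squared prefactor and the bandwidth give 9 k^3 / pi^2; here k^3 \<le> N^2 is absorbed by
  exp(-N/200), and \<beta>^(-2 mu) = M^(2 mu) k^(-2 mu) with k^(-2 mu) \<le> 12^mu because N \<ge>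
  1.\<close>

lemma low_frequency_error:
  assumes mu: "mu \<ge> 0"
  shows "\<exists>C>0. \<forall>\<beta> N q. \<beta> > 0 \<longrightarrow> N \<ge> 1 \<longrightarrow> q \<in> borel_measurable borel \<longrightarrow> N2 q < \<infinity> \<longrightarrow>
    (\<forall>b. \<bar>b\<bar> > 9/8 * (sqrt (real N) * \<beta> / (2 * sqrt 3)) \<longrightarrow> q b = 0) \<longrightarrow>
    (\<exists>v\<in>gauss_poly_space \<beta> N. (\<integral>\<^sup>+ x. ennreal ((cmod (of_real (window (sqrt (real N) / (2 * sqrt 3 * \<beta>)) \<beta> x) * ift q x - v x))\<^sup>2 * wt mu x) \<partial>lborel)
       \<le> ennreal (C * exp (- real N / 12) * (sqrt (real N) / (2 * sqrt 3 * \<beta>)) powr (2 * mu)) * N2 q)"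
proof -
  obtain G where G0: "G \<ge> 0" and G: "(\<integral>\<^sup>+ x. ennreal (exp (- (1/16 * x\<^sup>2)) * wt mu x) \<partial>lborel) = ennreal G"
    using gauss_moment_finite[of "1/16" mu 0] mu by (cases "(\<integral>\<^sup>+ x. ennreal (exp (- (1/16 * x\<^sup>2)) * wt mu x) \<partial>lborel)") auto
  \<comment> \<open>G is known here only to be nonnegative; the summand 1 makes C positive.\<close>
  define C where "C = 9 / pi\<^sup>2 * 80000 * G * 12 powr mu + 1"
  have C: "C > 0" unfolding C_def using G0 by (intro add_nonneg_pos mult_nonneg_nonneg) auto
  have "\<exists>v\<in>gauss_poly_space \<beta> N. (\<integral>\<^sup>+ x. ennreal ((cmod (of_real (window (sqrt (real N) / (2 * sqrt 3 * \<beta>)) \<beta> x) * ift q x - v x))\<^sup>2 * wt mu x) \<partial>lborel)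
       \<le> ennreal (C * exp (- real N / 12) * (sqrt (real N) / (2 * sqrt 3 * \<beta>)) powr (2 * mu)) * N2 q"
    if \<beta>: "\<beta> > 0" and N: "N \<ge> 1" and [measurable]: "q \<in> borel_measurable borel" and fin: "N2 q < \<infinity>"
      and z: "\<And>b. \<bar>b\<bar> > 9/8 * (sqrt (real N) * \<beta> / (2 * sqrt 3)) \<Longrightarrow> q b = 0" for \<beta> N q
  proof -
    define k where "k = sqrt (real N) / (2 * sqrt 3)"
    define M where "M = sqrt (real N) / (2 * sqrt 3 * \<beta>)"
    define L where "L = 9/8 * (sqrt (real N) * \<beta> / (2 * sqrt 3))"
    have k0: "k > 0" using N by (simp add: k_def)
    have k2: "k\<^sup>2 = real N / 12" by (simp add: k_def power_divide power_mult_distrib)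
    have Mk: "M = k / \<beta>" by (simp add: M_def k_def)
    have Lk: "L = 9/8 * (k * \<beta>)" by (simp add: L_def k_def)
    have M0: "M > 0" using k0 \<beta> by (simp add: Mk)
    have M2: "\<beta>\<^sup>2 * (2 * M)\<^sup>2 \<le> real N / 3" using \<beta> k2 by (simp add: Mk power_mult_distrib power_divide)
    have L2: "L\<^sup>2 / \<beta>\<^sup>2 \<le> 81/64 * (real N / 12)" using \<beta> k2 by (simp add: Lk power_mult_distrib power_divide)
    have L0: "L \<ge> 0" using k0 \<beta> by (simp add: Lk)
    define r where "r = (\<integral>b. cmod (q b) \<partial>lborel)"
    define A where "A = \<beta> / (2 * pi) * (4 * M) * r * exp (- (real N / 24) - real N / 400)"
    obtain v where v: "v \<in> gauss_poly_space \<beta> N" and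
      vb: "\<And>x. cmod (of_real (window M \<beta> x) * ift q x - v x) \<le> \<beta> / (2 * pi) * (4 * M) * r * (exp (- (real N / 24) - real N / 400) * exp (- (\<beta>\<^sup>2 * x\<^sup>2) / 32))"
      using band_limited_approx[OF \<beta> _ fin z[folded L_def] less_imp_le[OF M0] L0 M2 L2] unfolding r_def by auto
    have vb2: "(cmod (of_real (window M \<beta> x) * ift q x - v x))\<^sup>2 \<le> A\<^sup>2 * exp (- (\<beta>\<^sup>2 * x\<^sup>2) / 16)" for x
    proof -
      have "(cmod (of_real (window M \<beta> x) * ift q x - v x))\<^sup>2 \<le> (A * exp (- (\<beta>\<^sup>2 * x\<^sup>2) / 32))\<^sup>2"
        using vb[of x] by (intro power_mono) (auto simp: A_def mult.assoc)
      also have "\<dots> = A\<^sup>2 * exp (- (\<beta>\<^sup>2 * x\<^sup>2) / 16)"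
        by (simp add: power_mult_distrib power2_eq_square[of "exp _"] mult_exp_exp)
      finally show ?thesis .
    qed
    have A2: "A\<^sup>2 = (\<beta> / (2 * pi) * (4 * M))\<^sup>2 * (exp (- real N / 12) * exp (- (real N / 200))) * r\<^sup>2"
    proof -
      have "(exp (- (real N / 24) - real N / 400))\<^sup>2 = exp (- real N / 12) * exp (- (real N / 200))"
        by (simp add: power2_eq_square mult_exp_exp)
      then show ?thesis unfolding A_def by (simp only: power_mult_distrib mult_ac)
    qed
    define D where "D = (\<beta> / (2 * pi) * (4 * M))\<^sup>2 * (exp (- real N / 12) * exp (- (real N / 200)))"
    have D0: "D \<ge> 0" by (simp add: D_def)
    have "(\<integral>\<^sup>+ x. ennreal ((cmod (of_real (window M \<beta> x) * ift q x - v x))\<^sup>2 * wt mu x) \<partial>lborel)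
      \<le> (\<integral>\<^sup>+ x. ennreal (A\<^sup>2) * ennreal (exp (- (\<beta>\<^sup>2 * x\<^sup>2) / 16) * wt mu x) \<partial>lborel)"
    proof (intro nn_integral_mono)
      fix x
      have "(cmod (of_real (window M \<beta> x) * ift q x - v x))\<^sup>2 * wt mu x \<le> A\<^sup>2 * exp (- (\<beta>\<^sup>2 * x\<^sup>2) / 16) * wt mu x"
        by (intro mult_right_mono vb2 wt_nonneg)
      then show "ennreal ((cmod (of_real (window M \<beta> x) * ift q x - v x))\<^sup>2 * wt mu x) \<le> ennreal (A\<^sup>2) * ennreal (exp (- (\<beta>\<^sup>2 * x\<^sup>2) / 16) * wt mu x)"
        by (simp add: ennreal_mult[symmetric] wt_nonneg mult.assoc ennreal_leI)
    qed
    also have "\<dots> = ennreal (A\<^sup>2) * (ennreal (1 / \<beta> * \<beta> powr (- 2 * mu)) * ennreal G)"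
    proof -
      have "(\<integral>\<^sup>+ x. ennreal (A\<^sup>2) * ennreal (exp (- (\<beta>\<^sup>2 * x\<^sup>2) / 16) * wt mu x) \<partial>lborel)
        = ennreal (A\<^sup>2) * (\<integral>\<^sup>+ x. ennreal (exp (- (\<beta>\<^sup>2 * x\<^sup>2) / 16) * wt mu x) \<partial>lborel)"
        by (rule nn_integral_cmult) measurable
      then show ?thesis by (simp only: gauss_weight_scale[OF \<beta>] G)
    qed
    also have "ennreal (A\<^sup>2) = ennreal D * ennreal (r\<^sup>2)"
      unfolding A2 D_def[symmetric] using D0 by (simp add: ennreal_mult)
    also have "ennreal D * ennreal (r\<^sup>2) * (ennreal (1 / \<beta> * \<beta> powr (- 2 * mu)) * ennreal G)
      \<le> ennreal D * (ennreal (2 * L) * N2 q) * (ennreal (1 / \<beta> * \<beta> powr (- 2 * mu)) * ennreal G)"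
      unfolding r_def by (intro mult_right_mono mult_left_mono L1_le_L2_bounded_support fin L0 z[folded L_def]) auto
    also have "\<dots> = ennreal (D * (2 * L) * (1 / \<beta> * \<beta> powr (- 2 * mu) * G)) * N2 q"
    proof -
      have "ennreal D * (ennreal L' * z) * (ennreal p * ennreal G) = ennreal (D * L' * (p * G)) * z"
        if "L' \<ge> 0" "p \<ge> 0" for L' p z
        using that D0 G0 by (simp add: ennreal_mult mult_ac)
      from this[of "2 * L" "1 / \<beta> * \<beta> powr (- 2 * mu)" "N2 q"] show ?thesis using L0 \<beta> by (simp only: mult.assoc) simp
    qed
    also have "\<dots> \<le> ennreal (C * exp (- real N / 12) * M powr (2 * mu)) * N2 q"
    proof (intro mult_right_mono ennreal_leI)
      have b2: "(\<beta> / (2 * pi) * (4 * M))\<^sup>2 = 4 / pi\<^sup>2 * k\<^sup>2"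
        using \<beta> by (simp add: Mk power_mult_distrib power_divide)
      have bM: "\<beta> powr (- 2 * mu) = M powr (2 * mu) * k powr (- 2 * mu)"
        unfolding Mk using \<beta> k0 by (simp add: powr_divide powr_minus_divide)
      have "k powr (- 2 * mu) \<le> 12 powr mu"
      proof -
        have "k powr (- 2 * mu) = (k\<^sup>2) powr (- mu)" using k0 powr_powr[of k 2 "- mu"] by simp
        also have "\<dots> = (real N / 12) powr (- mu)" by (simp add: k2)
        also have "\<dots> \<le> (1 / 12) powr (- mu)" using N mu by (intro powr_mono2') auto
        also have "\<dots> = 12 powr mu" by (simp add: powr_divide powr_minus_divide)
        finally show ?thesis .
      qed
      moreover have "k\<^sup>2 * k * exp (- (real N / 200)) \<le> 80000"
      proof -
        have "k \<le> real N"
        proof (rule power2_le_imp_le)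
          have "real N * 1 \<le> real N * real N" using N by (intro mult_left_mono) auto
          then show "k\<^sup>2 \<le> (real N)\<^sup>2" unfolding k2 by (simp add: power2_eq_square)
        qed simp
        then have "k\<^sup>2 * k \<le> real N * real N" unfolding k2 using k0 by (intro mult_mono) auto
        then have "k\<^sup>2 * k * exp (- (real N / 200)) \<le> (real N)\<^sup>2 * exp (- (real N / 200))"
          by (intro mult_right_mono) (auto simp: power2_eq_square)
        also have "\<dots> \<le> 80000" by (rule square_exp_bound) simp
        finally show ?thesis .
      qed
      ultimately have "(9 / pi\<^sup>2 * G * exp (- real N / 12) * M powr (2 * mu)) * ((k\<^sup>2 * k * exp (- (real N / 200))) * k powr (- 2 * mu))
        \<le> (9 / pi\<^sup>2 * G * exp (- real N / 12) * M powr (2 * mu)) * (80000 * 12 powr mu)"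
        using G0 k0 by (intro mult_left_mono mult_mono) auto
      also have "\<dots> \<le> C * exp (- real N / 12) * M powr (2 * mu)"
        unfolding C_def by (simp add: algebra_simps)
      finally show "D * (2 * L) * (1 / \<beta> * \<beta> powr (- 2 * mu) * G) \<le> C * exp (- real N / 12) * M powr (2 * mu)"
        unfolding D_def b2 bM Lk using \<beta> by (simp add: field_simps)
    qed auto
    finally show ?thesis using v unfolding M_def by blast
  qed
  then show ?thesis using C by blast
qed

subsection \<open>Square roots of extended nonnegative reals\<close>

lemma enn_sqrt_ennreal: "r \<ge> 0 \<Longrightarrow> enn_sqrt (ennreal r) = ennreal (sqrt r)"
  by (simp add: enn_sqrt_def)

lemma enn_sqrt_top: "enn_sqrt top = top"
  by (simp add: enn_sqrt_def)

lemma enn_sqrt_mono: "a \<le> b \<Longrightarrow> enn_sqrt a \<le> enn_sqrt b"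
  by (cases a; cases b) (auto simp: enn_sqrt_ennreal enn_sqrt_top top_unique intro: ennreal_leI)

lemma enn_sqrt_add_le: "enn_sqrt (a + b) \<le> enn_sqrt a + enn_sqrt b"
proof (cases a; cases b)
  fix r s assume "a = ennreal r" "0 \<le> r" "b = ennreal s" "0 \<le> s"
  then show ?thesis
    using sqrt_add_le_add_sqrt[of r s] by (simp add: enn_sqrt_ennreal ennreal_leI flip: ennreal_plus)
qed (auto simp: enn_sqrt_top)

lemma enn_sqrt_cmult: "c > 0 \<Longrightarrow> enn_sqrt (ennreal c * a) = ennreal (sqrt c) * enn_sqrt a"
  by (cases a) (auto simp: enn_sqrt_ennreal enn_sqrt_top ennreal_mult_top real_sqrt_mult simp flip: ennreal_mult)

text \<open>The transform is determined only almost everywhere, so the bound is stated for every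
  representative \<open>g\<close>. The growth hypothesis puts u both in L^2 and in the weighted
  space, so that Plancherel and the projection apply.\<close>

theorem mainTheorem3:
  fixes mu :: real
  assumes "mu \<ge> 0"
  shows "\<exists>C::real. \<forall>(u :: real \<Rightarrow> complex) (beta::real) (N::nat) (g :: real \<Rightarrow> complex).
    beta > 0 \<longrightarrow> N \<ge> 1 \<longrightarrow> u \<in> borel_measurable lborel \<longrightarrow>
    (\<integral>\<^sup>+ x. ennreal ((cmod (u x * of_real ((1 + x\<^sup>2) powr (mu / 2))))\<^sup>2) \<partial>lborel) < \<infinity> \<longrightarrow>
    fourier_L2 u g \<longrightarrow>
    (let M = sqrt (real N) / (2 * sqrt 3 * beta);
         B = sqrt (real N) * beta / (2 * sqrt 3)
     in wnorm (wt mu) (\<lambda>x. u x - hproj mu beta N u x)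
        \<le> ennreal C *
          ( wnorm (wt mu) (\<lambda>x. u x * of_real (indicator {x. \<bar>x\<bar> > M} x))
          + ennreal (B powr (- mu + 1 / 2)) * sobolev_norm mu (- {-1..1}) (\<lambda>\<xi>. g (B * \<xi>))
          + ennreal (exp (- real N / 24)) * (wnorm (wt mu) u + l2norm u * ennreal (M powr mu))))"
proof -
  note mu = assms
  obtain C1 where C1: "C1 > 0" "\<And>u g B. B > 0 \<Longrightarrow> u \<in> borel_measurable borel \<Longrightarrow> N2 u < \<infinity> \<Longrightarrow> fourier_L2 u g \<Longrightarrow>
    (\<integral>\<^sup>+ x. ennreal ((cmod (u x - ulow B g x))\<^sup>2 * wt mu x) \<partial>lborel) \<le> ennreal (C1 * B powr (1 - 2 * mu)) * sobolev_sq mu outer (\<lambda>\<xi>. g (B * \<xi>))"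
    using high_frequency_scaled[OF mu] by blast
  obtain C2 where C2: "C2 > 0" and C2b: "\<And>\<beta> N q. \<beta> > 0 \<Longrightarrow> N \<ge> 1 \<Longrightarrow> q \<in> borel_measurable borel \<Longrightarrow> N2 q < \<infinity> \<Longrightarrow>
    (\<forall>b. \<bar>b\<bar> > 9/8 * (sqrt (real N) * \<beta> / (2 * sqrt 3)) \<longrightarrow> q b = 0) \<Longrightarrow>
    (\<exists>v\<in>gauss_poly_space \<beta> N. (\<integral>\<^sup>+ x. ennreal ((cmod (of_real (window (sqrt (real N) / (2 * sqrt 3 * \<beta>)) \<beta> x) * ift q x - v x))\<^sup>2 * wt mu x) \<partial>lborel)
       \<le> ennreal (C2 * exp (- real N / 12) * (sqrt (real N) / (2 * sqrt 3 * \<beta>)) powr (2 * mu)) * N2 q)"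
    using low_frequency_error[OF mu] by blast
  \<comment> \<open>42, 8, 32 and 4 are the weights in \<open>pt\<close> below; the last meets a
    factor 2 from \<open>N2 q \<le> 2 * N2 u\<close>, hence 8 times \<open>C2\<close>. The weight 8
    of the term outside [-M,M] is covered by 32.\<close>
  define K where "K = 42 * C1 + 8 * C2 + 32"
  have K: "K > 0" using C1(1) C2 by (simp add: K_def)
  show ?thesis
  proof (intro exI[of _ "sqrt K"] allI impI)
    fix u g :: "real \<Rightarrow> complex" and beta :: real and N :: nat
    assume \<beta>: "beta > 0" and N: "N \<ge> 1" and "u \<in> borel_measurable lborel"
      and fin: "(\<integral>\<^sup>+ x. ennreal ((cmod (u x * of_real ((1 + x\<^sup>2) powr (mu / 2))))\<^sup>2) \<partial>lborel) < \<infinity>"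
      and F: "fourier_L2 u g"
    then have um[measurable]: "u \<in> borel_measurable borel" by simp
    have gm[measurable]: "g \<in> borel_measurable borel" using F by (simp add: fourier_L2_def)
    define M where "M = sqrt (real N) / (2 * sqrt 3 * beta)"
    define B where "B = sqrt (real N) * beta / (2 * sqrt 3)"
    have B: "B > 0" and M: "M > 0" using \<beta> N by (simp_all add: B_def M_def)
    have \<beta>M: "beta\<^sup>2 * M\<^sup>2 = real N / 12" using \<beta> by (simp add: M_def power_divide power_mult_distrib)
    have pw: "(cmod (u x * of_real ((1 + x\<^sup>2) powr (mu / 2))))\<^sup>2 = (cmod (u x))\<^sup>2 * (1 + x\<^sup>2) powr mu" for x
    proof -
      have "((1 + x\<^sup>2) powr (mu / 2))\<^sup>2 = (1 + x\<^sup>2) powr mu"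
        by (simp add: power2_eq_square powr_add[symmetric])
      then show ?thesis by (simp add: norm_mult power_mult_distrib)
    qed
    \<comment> \<open>This norm and the weighted one \<open>T2\<close> are dominated by the
      hypothesis, because 1 and |x|^(2 mu) are at most (1 + x^2)^mu.\<close>
    have N2u: "N2 u < \<infinity>"
    proof (rule le_less_trans[OF _ fin], unfold N2_def pw, intro nn_integral_mono ennreal_leI)
      fix x
      have "1 \<le> (1 + x\<^sup>2) powr mu" using mu by (intro ge_one_powr_ge_zero) auto
      from mult_left_mono[OF this, of "(cmod (u x))\<^sup>2"]
      show "(cmod (u x))\<^sup>2 \<le> (cmod (u x))\<^sup>2 * (1 + x\<^sup>2) powr mu" by simp
    qed
    define T2 where "T2 = (\<integral>\<^sup>+ x. ennreal ((cmod (u x))\<^sup>2 * wt mu x) \<partial>lborel)"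
    have T2f: "T2 < \<infinity>"
    proof (rule le_less_trans[OF _ fin], unfold T2_def pw, intro nn_integral_mono ennreal_leI mult_left_mono)
      fix x :: real
      show "wt mu x \<le> (1 + x\<^sup>2) powr mu"
      proof (cases "mu = 0 \<or> x = 0")
        case True
        moreover have "1 + x\<^sup>2 > 0" by (simp add: add_pos_nonneg)
        ultimately show ?thesis by (auto simp: wt_def)
      next
        case False
        have "\<bar>x\<bar> powr 2 = x\<^sup>2" using False by simp
        then have "\<bar>x\<bar> powr (2 * mu) = (x\<^sup>2) powr mu" by (simp only: powr_powr[symmetric])
        also have "\<dots> \<le> (1 + x\<^sup>2) powr mu" using mu by (intro powr_mono2) auto
        finally show ?thesis using False by (simp add: wt_def)
      qed
    qed simp
    define T1 where "T1 = (\<integral>\<^sup>+ x. ennreal ((cmod (u x * of_real (indicator {x. \<bar>x\<bar> > M} x)))\<^sup>2 * wt mu x) \<partial>lborel)"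
    define q where "q = (\<lambda>b. of_real (1 - cutoff (b / B)) * g b)"
    have qm[measurable]: "q \<in> borel_measurable borel" unfolding q_def by measurable
    have N2g: "N2 g \<le> 2 * N2 u"
      by (rule ft_pair_N2_le[OF fourier_L2_ft_pair[OF _ N2u F]]) simp
    have N2q: "N2 q \<le> N2 g"
    proof (intro N2_mono)
      fix x
      have "\<bar>1 - cutoff (x / B)\<bar> \<le> 1" using cutoff_nonneg[of "x / B"] cutoff_le_1[of "x / B"] by auto
      then show "cmod (q x) \<le> cmod (g x)"
        using mult_right_mono[of "\<bar>1 - cutoff (x / B)\<bar>" 1 "cmod (g x)"] by (simp add: q_def norm_mult del: of_real_diff)
    qed
    have qu: "N2 q \<le> 2 * N2 u" using N2q N2g by (rule order_trans)
    have qf: "N2 q < \<infinity>" using N2u by (intro le_less_trans[OF qu]) (simp add: ennreal_mult_less_top)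
    have qz: "q b = 0" if "\<bar>b\<bar> > 9/8 * B" for b
    proof -
      have "\<bar>b / B\<bar> \<ge> 9/8" using that B by (simp add: abs_divide pos_le_divide_eq)
      then show ?thesis by (simp add: q_def cutoff_1)
    qed
    define l where "l = ulow B g"
    have lq: "l = ift q" unfolding l_def ulow_def q_def ..
    have [measurable]: "l \<in> borel_measurable borel" unfolding lq by measurable
    obtain v where v: "v \<in> gauss_poly_space beta N" and
      vb: "(\<integral>\<^sup>+ x. ennreal ((cmod (of_real (window M beta x) * l x - v x))\<^sup>2 * wt mu x) \<partial>lborel) \<le> ennreal (C2 * exp (- real N / 12) * M powr (2 * mu)) * N2 q"
      using C2b[OF \<beta> N qm qf] qz unfolding lq M_def B_def by blast
    have [measurable]: "v \<in> borel_measurable borel" using v by (rule gauss_poly_space_measurable)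
    \<comment> \<open>Squared norms are being estimated, so E is the square of exp(-N/24).\<close>
    define E where "E = exp (- real N / 12)"
    have E: "0 < E" "E \<le> 1" by (simp_all add: E_def)
    define c where "c = window M beta"
    have [measurable]: "c \<in> borel_measurable borel" unfolding c_def by measurable
    have c01: "0 \<le> c x" "c x \<le> 1" for x unfolding c_def by (rule window_bounds[OF \<beta>])+
    define X where "X = (\<integral>\<^sup>+ x. ennreal ((cmod (u x - l x))\<^sup>2 * wt mu x) \<partial>lborel)"
    define Y where "Y = (\<integral>\<^sup>+ x. ennreal ((cmod (of_real (c x) * l x - v x))\<^sup>2 * wt mu x) \<partial>lborel)"
    define i where "i = (\<lambda>x. cmod (u x * of_real (indicator {x. \<bar>x\<bar> > M} x)))"
    have [measurable]: "i \<in> borel_measurable borel" unfolding i_def by measurable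
    have T1_i: "T1 = (\<integral>\<^sup>+ x. ennreal ((i x)\<^sup>2 * wt mu x) \<partial>lborel)" unfolding T1_def i_def ..
    \<comment> \<open>Split u - v into u - l, (1 - c) l and c l - v. Outside [-M,M] the middle term
      is bounded by |l|, which is u up to u - l; inside, the window makes it of order sqrt E. The
      weights are 2 + 4 * 10, 4 * 2, 4 * 8 and 4.\<close>
    have pt: "(cmod (u x - v x))\<^sup>2 \<le> 42 * (cmod (u x - l x))\<^sup>2 + 8 * (i x)\<^sup>2 + 32 * E * (cmod (u x))\<^sup>2 + 4 * (cmod (of_real (c x) * l x - v x))\<^sup>2" for x
    proof -
      have l2: "(cmod (l x))\<^sup>2 \<le> 2 * (cmod (u x))\<^sup>2 + 2 * (cmod (u x - l x))\<^sup>2"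
        using cmod_add_sq[of "u x" "- (u x - l x)"] by (simp add: norm_minus_commute)
      have mid: "(cmod (of_real (1 - c x) * l x))\<^sup>2 \<le> 2 * (i x)\<^sup>2 + 8 * E * (cmod (u x))\<^sup>2 + 10 * (cmod (u x - l x))\<^sup>2"
      proof -
        have e: "(cmod (of_real (1 - c x) * l x))\<^sup>2 = (1 - c x)\<^sup>2 * (cmod (l x))\<^sup>2"
          by (simp add: norm_mult power_mult_distrib del: of_real_diff)
        show ?thesis
        proof (cases "\<bar>x\<bar> > M")
          case True
          have "(1 - c x)\<^sup>2 * (cmod (l x))\<^sup>2 \<le> 1 * (cmod (l x))\<^sup>2"
            using c01[of x] by (intro mult_right_mono) (auto simp: power_le_one)
          moreover have "(i x)\<^sup>2 = (cmod (u x))\<^sup>2" using True by (simp add: i_def)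
          moreover have "0 \<le> 8 * E * (cmod (u x))\<^sup>2" using E by simp
          moreover have "0 \<le> (cmod (u x - l x))\<^sup>2" by simp
          ultimately show ?thesis using l2 unfolding e by linarith
        next
          case False
          have "1 - c x \<le> 2 * exp (- (beta\<^sup>2 * M\<^sup>2) / 2)" unfolding c_def using False by (intro window_inside \<beta>) simp
          then have "(1 - c x)\<^sup>2 \<le> (2 * exp (- (beta\<^sup>2 * M\<^sup>2) / 2))\<^sup>2" using c01[of x] by (intro power_mono) auto
          also have "\<dots> = 4 * E"
            unfolding \<beta>M E_def by (simp add: power_mult_distrib power2_eq_square[of "exp _"] mult_exp_exp)
          finally have "(1 - c x)\<^sup>2 * (cmod (l x))\<^sup>2 \<le> (4 * E) * (2 * (cmod (u x))\<^sup>2 + 2 * (cmod (u x - l x))\<^sup>2)"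
            using l2 E by (intro mult_mono) auto
          moreover have "E * (cmod (u x - l x))\<^sup>2 \<le> 1 * (cmod (u x - l x))\<^sup>2" using E by (intro mult_right_mono) auto
          moreover have "0 \<le> (i x)\<^sup>2" "0 \<le> (cmod (u x - l x))\<^sup>2" by simp_all
          moreover have "(4 * E) * (2 * (cmod (u x))\<^sup>2 + 2 * (cmod (u x - l x))\<^sup>2) = 8 * E * (cmod (u x))\<^sup>2 + 8 * (E * (cmod (u x - l x))\<^sup>2)"
            by (simp add: algebra_simps)
          ultimately show ?thesis unfolding e by linarith
        qed
      qed
      have "u x - v x = (u x - l x) + (of_real (1 - c x) * l x + (of_real (c x) * l x - v x))"
        by (simp add: algebra_simps)
      then have h1: "(cmod (u x - v x))\<^sup>2 \<le> 2 * (cmod (u x - l x))\<^sup>2 + 2 * (cmod (of_real (1 - c x) * l x + (of_real (c x) * l x - v x)))\<^sup>2"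
        by (simp only: cmod_add_sq)
      have h2: "(cmod (of_real (1 - c x) * l x + (of_real (c x) * l x - v x)))\<^sup>2 \<le> 2 * (cmod (of_real (1 - c x) * l x))\<^sup>2 + 2 * (cmod (of_real (c x) * l x - v x))\<^sup>2"
        by (rule cmod_add_sq)
      show ?thesis using h1 h2 mid by linarith
    qed
    have "(\<integral>\<^sup>+ x. ennreal ((cmod (u x - hproj mu beta N u x))\<^sup>2 * wt mu x) \<partial>lborel)
      \<le> (\<integral>\<^sup>+ x. ennreal ((cmod (u x - v x))\<^sup>2 * wt mu x) \<partial>lborel)"
      by (rule hproj_best[OF um T2f[unfolded T2_def] \<beta> mu v])
    also have "\<dots> \<le> (\<integral>\<^sup>+ x. ennreal 42 * ennreal ((cmod (u x - l x))\<^sup>2 * wt mu x) + ennreal 8 * ennreal ((i x)\<^sup>2 * wt mu x)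
        + ennreal (32 * E) * ennreal ((cmod (u x))\<^sup>2 * wt mu x) + ennreal 4 * ennreal ((cmod (of_real (c x) * l x - v x))\<^sup>2 * wt mu x) \<partial>lborel)"
    proof (intro nn_integral_mono)
      fix x
      have "(cmod (u x - v x))\<^sup>2 * wt mu x \<le> (42 * (cmod (u x - l x))\<^sup>2 + 8 * (i x)\<^sup>2 + 32 * E * (cmod (u x))\<^sup>2 + 4 * (cmod (of_real (c x) * l x - v x))\<^sup>2) * wt mu x"
        by (intro mult_right_mono pt wt_nonneg)
      also have "\<dots> = 42 * ((cmod (u x - l x))\<^sup>2 * wt mu x) + 8 * ((i x)\<^sup>2 * wt mu x) + (32 * E) * ((cmod (u x))\<^sup>2 * wt mu x) + 4 * ((cmod (of_real (c x) * l x - v x))\<^sup>2 * wt mu x)"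
        by (simp add: algebra_simps)
      finally have "ennreal ((cmod (u x - v x))\<^sup>2 * wt mu x) \<le> ennreal \<dots>" by (rule ennreal_leI)
      then show "ennreal ((cmod (u x - v x))\<^sup>2 * wt mu x) \<le> ennreal 42 * ennreal ((cmod (u x - l x))\<^sup>2 * wt mu x) + ennreal 8 * ennreal ((i x)\<^sup>2 * wt mu x)
        + ennreal (32 * E) * ennreal ((cmod (u x))\<^sup>2 * wt mu x) + ennreal 4 * ennreal ((cmod (of_real (c x) * l x - v x))\<^sup>2 * wt mu x)"
        using E(1) wt_nonneg[of mu x]
        by (simp only: ennreal_plus ennreal_mult mult_nonneg_nonneg add_nonneg_nonneg zero_le_power2 zero_le_numeral less_imp_le)
    qed
    also have "\<dots> = ennreal 42 * X + ennreal 8 * T1 + ennreal (32 * E) * T2 + ennreal 4 * Y"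
      unfolding X_def T1_i T2_def Y_def by (simp add: nn_integral_add nn_integral_cmult del: ennreal_numeral)
    finally have tot: "(\<integral>\<^sup>+ x. ennreal ((cmod (u x - hproj mu beta N u x))\<^sup>2 * wt mu x) \<partial>lborel) \<le> ennreal 42 * X + ennreal 8 * T1 + ennreal (32 * E) * T2 + ennreal 4 * Y" .
    define S where "S = sobolev_sq mu outer (\<lambda>\<xi>. g (B * \<xi>))"
    have X: "X \<le> ennreal (C1 * B powr (1 - 2 * mu)) * S"
      unfolding X_def l_def S_def by (rule C1(2)[OF B um N2u F])
    have Y: "Y \<le> ennreal (C2 * E * M powr (2 * mu)) * (2 * N2 u)"
      unfolding Y_def c_def E_def by (rule order_trans[OF vb mult_left_mono[OF qu]]) simp
    define a where "a = ennreal (B powr (1 - 2 * mu)) * S"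
    define b where "b = ennreal E * T2"
    define d where "d = ennreal (E * M powr (2 * mu)) * N2 u"
    have "ennreal 42 * X + ennreal 8 * T1 + ennreal (32 * E) * T2 + ennreal 4 * Y
      \<le> ennreal K * a + ennreal K * T1 + ennreal K * b + ennreal K * d"
    proof (intro add_mono)
      have "ennreal 42 * X \<le> ennreal 42 * (ennreal (C1 * B powr (1 - 2 * mu)) * S)" by (intro mult_left_mono X) simp
      also have "\<dots> = ennreal (42 * C1) * a"
        unfolding a_def using C1(1) by (simp add: ennreal_mult mult.assoc del: ennreal_numeral)
      also have "\<dots> \<le> ennreal K * a" unfolding K_def using C2 by (intro mult_right_mono ennreal_leI) auto
      finally show "ennreal 42 * X \<le> ennreal K * a" .
      show "ennreal 8 * T1 \<le> ennreal K * T1" unfolding K_def using C1(1) C2 by (intro mult_right_mono ennreal_leI) auto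
      have "ennreal (32 * E) * T2 = ennreal 32 * b"
        unfolding b_def using E by (simp add: ennreal_mult mult.assoc del: ennreal_numeral)
      also have "\<dots> \<le> ennreal K * b" unfolding K_def using C1(1) C2 by (intro mult_right_mono ennreal_leI) auto
      finally show "ennreal (32 * E) * T2 \<le> ennreal K * b" .
      have "ennreal 4 * Y \<le> ennreal 4 * (ennreal (C2 * E * M powr (2 * mu)) * (ennreal 2 * N2 u))" using Y by (intro mult_left_mono) auto
      also have "\<dots> = ennreal (4 * (C2 * (E * M powr (2 * mu))) * 2) * N2 u"
      proof -
        have p: "0 \<le> C2 * E * M powr (2 * mu)" using C2 E by simp
        have "ennreal (4 * (C2 * E * M powr (2 * mu)) * 2) = ennreal 4 * ennreal (C2 * E * M powr (2 * mu)) * ennreal 2"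
          using p by (simp only: ennreal_mult zero_le_numeral mult_nonneg_nonneg)
        then show ?thesis by (simp only: mult_ac)
      qed
      also have "\<dots> = ennreal (8 * C2) * d"
      proof -
        have "4 * (C2 * (E * M powr (2 * mu))) * 2 = (8 * C2) * (E * M powr (2 * mu))" by simp
        moreover have "ennreal ((8 * C2) * (E * M powr (2 * mu))) = ennreal (8 * C2) * ennreal (E * M powr (2 * mu))"
          using C2 E by (intro ennreal_mult) auto
        ultimately show ?thesis unfolding d_def by (simp only: mult.assoc)
      qed
      also have "\<dots> \<le> ennreal K * d" unfolding K_def using C1(1) by (intro mult_right_mono ennreal_leI) auto
      finally show "ennreal 4 * Y \<le> ennreal K * d" .
    qed
    also have "\<dots> = ennreal K * (a + T1 + b + d)" by (simp add: distrib_left)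
    finally have "wnorm (wt mu) (\<lambda>x. u x - hproj mu beta N u x) \<le> enn_sqrt (ennreal K * (a + T1 + b + d))"
      unfolding wnorm_def using tot by (intro enn_sqrt_mono) (rule order_trans)
    also have "\<dots> = ennreal (sqrt K) * enn_sqrt (a + T1 + b + d)" by (rule enn_sqrt_cmult[OF K])
    also have "\<dots> \<le> ennreal (sqrt K) * (enn_sqrt a + enn_sqrt T1 + enn_sqrt b + enn_sqrt d)"
      by (intro mult_left_mono order_trans[OF enn_sqrt_add_le] add_mono order_refl) auto
    finally have total: "wnorm (wt mu) (\<lambda>x. u x - hproj mu beta N u x) \<le> ennreal (sqrt K) * (enn_sqrt a + enn_sqrt T1 + enn_sqrt b + enn_sqrt d)" .
    have ea: "enn_sqrt a = ennreal (B powr (- mu + 1 / 2)) * sobolev_norm mu (- {-1..1}) (\<lambda>\<xi>. g (B * \<xi>))"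
    proof -
      have "B powr (1 - 2 * mu) = (B powr (- mu + 1 / 2))\<^sup>2"
        by (simp add: power2_eq_square powr_add[symmetric])
      then have "sqrt (B powr (1 - 2 * mu)) = B powr (- mu + 1 / 2)" by simp
      then show ?thesis
        unfolding a_def S_def sobolev_norm_def using B by (subst enn_sqrt_cmult) auto
    qed
    have eT: "enn_sqrt T1 = wnorm (wt mu) (\<lambda>x. u x * of_real (indicator {x. \<bar>x\<bar> > M} x))"
      unfolding T1_def wnorm_def ..
    have sE: "sqrt E = exp (- real N / 24)"
    proof -
      have "E = (exp (- real N / 24))\<^sup>2" by (simp add: E_def power2_eq_square mult_exp_exp)
      then show ?thesis by simp
    qed
    have eb: "enn_sqrt b = ennreal (exp (- real N / 24)) * wnorm (wt mu) u"
      unfolding b_def enn_sqrt_cmult[OF E(1)] sE T2_def wnorm_def ..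
    have ed: "enn_sqrt d = ennreal (exp (- real N / 24)) * (l2norm u * ennreal (M powr mu))"
    proof -
      have "M powr (2 * mu) = (M powr mu)\<^sup>2" by (simp add: power2_eq_square powr_add[symmetric])
      then have "sqrt (M powr (2 * mu)) = M powr mu" by simp
      moreover have "E * M powr (2 * mu) > 0" using E M by simp
      ultimately have "enn_sqrt d = ennreal (exp (- real N / 24) * M powr mu) * enn_sqrt (N2 u)"
        unfolding d_def by (subst enn_sqrt_cmult) (auto simp: real_sqrt_mult sE)
      then show ?thesis by (simp add: l2norm_def wnorm_def N2_def ennreal_mult mult_ac)
    qed
    show "let M = sqrt (real N) / (2 * sqrt 3 * beta);
         B = sqrt (real N) * beta / (2 * sqrt 3)
     in wnorm (wt mu) (\<lambda>x. u x - hproj mu beta N u x)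
        \<le> ennreal (sqrt K) *
          ( wnorm (wt mu) (\<lambda>x. u x * of_real (indicator {x. \<bar>x\<bar> > M} x))
          + ennreal (B powr (- mu + 1 / 2)) * sobolev_norm mu (- {-1..1}) (\<lambda>\<xi>. g (B * \<xi>))
          + ennreal (exp (- real N / 24)) * (wnorm (wt mu) u + l2norm u * ennreal (M powr mu)))"
      using total unfolding Let_def M_def[symmetric] B_def[symmetric] ea eT eb ed by (simp only: distrib_left ac_simps)
  qed
qed

end
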